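(* Let $\varepsilon>0$ and let $\mathcal{U}$ be a (possibly infinite) family of pairwise fractionally isomorphic graphons. Then there exists $n_0\in\mathbb{N}$ such that for each integer $n\ge n_0$ there exists a family $\{H_U\}_{U\in\mathcal{U}}$ of pairwise fractionally isomorphic graphs, each on vertex set $[n]=\{1,\dots,n\}$, such that $\delta_\square(U,H_U)\le\varepsilon$ for every $U\in\mathcal{U}$.
   Context: Graphons: $(\Omega,\mathcal{B})$ is a standard Borel space with a Borel probability measure $\pi$ (atoms allowed). A graphon on $\Omega$ is a symmetric measurable $W\colon\Omega^2\to[0,1]$ (functions equal a.e. are identified). For a measure-preserving map $\phi\colon\Lambda\to\Omega$, $W^\phi(x,y)=W(\phi(x),\phi(y))$. Graphons $W$ on $\Omega$ and $U$ on $\Lambda$ are isomorphic if there is a measure-preserving bijection $\phi\colon\Lambda\to\Omega$ with $W^\phi=U$. Cut norm and cut distance: $\|W\|_\square=\sup_{S,T}\left|\int_{S\times T}W\,\mathrm{d}\pi^2\right|$ over measurable $S,T\subseteq\Omega$; for graphons $W$ on $\Omega$ and $U$ on $\Lambda$, $\delta_\square(U,W)=\inf_\phi\|U^\phi-W\|_\square$ over measure-preserving bijections $\phi\colon\Omega\to\Lambda$. For a graph $F$ on vertex set $V$, its graphon representation $W_F$ on an atomless probability space is obtained by partitioning the space into sets $(\Omega_v)_{v\in V}$ of measure $1/|V|$ each and letting $W_F=1$ on $\Omega_u\times\Omega_v$ if $uv\in E(F)$ and $0$ otherwise (unique up to isomorphism); $\delta_\square(U,F):=\delta_\square(U,W_F)$.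 Fractional isomorphism of graphons: A sub-sigma-algebra $\mathcal{C}\subseteq\mathcal{B}$ is $\pi$-relatively complete if $\pi(S\triangle T)>0$ for all $S\in\mathcal{B}\setminus\mathcal{C}$, $T\in\mathcal{C}$. A graphon $W$ defines the operator $T_W$ on $L^2(\Omega)$, $(T_Wf)(x)=\int W(x,y)f(y)\,\mathrm{d}\pi(y)$; a relatively complete $\mathcal{C}$ is $W$-invariant if $T_W$ maps $\mathcal{C}$-measurable $L^2$ functions to $\mathcal{C}$-measurable ones. $\mathcal{C}(W)$ denotes the minimum $W$-invariant $\pi$-relatively complete sub-sigma-algebra (it exists). For such $\mathcal{C}$ there is a standard Borel probability space $(\Omega/\mathcal{C},\pi/\mathcal{C})$ and a measurable surjection $q_\mathcal{C}\colon\Omega\to\Omega/\mathcal{C}$ pushing $\pi$ to $\pi/\mathcal{C}$, through which exactly the $\mathcal{C}$-measurable functions factor; the quotient graphon $W/\mathcal{C}$ on $\Omega/\mathcal{C}$ is defined by $W/\mathcal{C}(q_\mathcal{C}(x),q_\mathcal{C}(y))=\mathbb{E}[W\mid\mathcal{C}\times\mathcal{C}](x,y)$ for a.e. $(x,y)$. Graphons $W$ and $U$ are fractionally isomorphic if $W/\mathcal{C}(W)$ and $U/\mathcal{C}(U)$ are isomorphic. Fractional isomorphism of graphs: an equitable partition of a graph $G$ is a partition $\{P_i\}_{i\in[k]}$ of $V(G)$ into nonempty parts such that for all $i,j$ the number $\deg_G(u;P_j)$ of neighbours of $u$ in $P_j$ is the same for all $u\in P_i$; its parameters are $((|P_i|)_{i\in[k]},(D_{i,j})_{i,j\in[k]})$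 with $D_{i,j}=\deg_G(u;P_j)$ for $u\in P_i$. Graphs $G,H$ are fractionally isomorphic if they have equitable partitions which can be indexed so as to have the same parameters.
   Formalization: If the space of U has atoms, no measure-preserving bijection to an atomless space exists and the cut distance to a graph as defined is an infimum over the empty set; there U is first pulled back to the product of its space with [0,1), the usual convention. *)

theory Defs
  imports "HOL-Probability.Probability"
begin

section \<open>Graphons\<close>

definition standard_borel :: "'a measure \<Rightarrow> bool" where
  "standard_borel M \<longleftrightarrow>
     (\<exists>X. completely_metrizable_space X \<and> second_countable X \<and> topspace X = space M \<and>
          sets M = sigma_sets (topspace X) {U. openin X U})"

definition standard_probability_space :: "'a measure \<Rightarrow> bool" where
  "standard_probability_space M \<longleftrightarrow> prob_space M \<and> standard_borel M"

text \<open>The kernel is a genuine function rather than an a.e.-class; identities between kernels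
  are therefore stated almost everywhere below.\<close>

record 'a graphon =
  base :: "'a measure"
  kernel :: "'a \<times> 'a \<Rightarrow> real"

definition is_graphon :: "'a graphon \<Rightarrow> bool" where
  "is_graphon W \<longleftrightarrow>
     standard_probability_space (base W) \<and>
     kernel W \<in> borel_measurable (base W \<Otimes>\<^sub>M base W) \<and>
     (\<forall>x\<in>space (base W). \<forall>y\<in>space (base W).
        kernel W (x, y) = kernel W (y, x) \<and> 0 \<le> kernel W (x, y) \<and> kernel W (x, y) \<le> 1)"

definition measure_preserving_map :: "'a measure \<Rightarrow> 'b measure \<Rightarrow> ('a \<Rightarrow> 'b) \<Rightarrow> bool" where
  "measure_preserving_map M N f \<longleftrightarrow> f \<in> M \<rightarrow>\<^sub>M N \<and> distr M N f = N"

text \<open>Between standard Borel spaces the inverse of a measurable bijection is automatically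
  measurable.\<close>

definition measure_preserving_bij :: "'a measure \<Rightarrow> 'b measure \<Rightarrow> ('a \<Rightarrow> 'b) \<Rightarrow> bool" where
  "measure_preserving_bij M N f \<longleftrightarrow>
     measure_preserving_map M N f \<and> bij_betw f (space M) (space N)"

definition pull_back :: "('a \<times> 'a \<Rightarrow> real) \<Rightarrow> ('b \<Rightarrow> 'a) \<Rightarrow> 'b \<times> 'b \<Rightarrow> real" where
  "pull_back W f = (\<lambda>(x, y). W (f x, f y))"

definition isomorphic_graphons :: "'a graphon \<Rightarrow> 'b graphon \<Rightarrow> bool" where
  "isomorphic_graphons W U \<longleftrightarrow>
     (\<exists>f. measure_preserving_bij (base U) (base W) f \<and>
          (AE z in base U \<Otimes>\<^sub>M base U. pull_back (kernel W) f z = kernel U z))"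


section \<open>Fractional isomorphism of graphons\<close>

definition sub_sigma_algebra :: "'a measure \<Rightarrow> 'a set set \<Rightarrow> bool" where
  "sub_sigma_algebra M C \<longleftrightarrow> sigma_algebra (space M) C \<and> C \<subseteq> sets M"

definition relatively_complete :: "'a measure \<Rightarrow> 'a set set \<Rightarrow> bool" where
  "relatively_complete M C \<longleftrightarrow> (\<forall>S\<in>sets M - C. \<forall>T\<in>C. emeasure M (sym_diff S T) > 0)"

definition graphon_operator :: "'a graphon \<Rightarrow> ('a \<Rightarrow> real) \<Rightarrow> 'a \<Rightarrow> real" where
  "graphon_operator W f = (\<lambda>x. \<integral>y. kernel W (x, y) * f y \<partial>base W)"

text \<open>Since a relatively complete \<open>C\<close> contains every measurable set that differs from a member
  of \<open>C\<close> by a null set, \<open>C\<close>-measurability does not depend on the representative of an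
  \<open>L\<^sup>2\<close>-class.\<close>

definition invariant_algebra :: "'a graphon \<Rightarrow> 'a set set \<Rightarrow> bool" where
  "invariant_algebra W C \<longleftrightarrow>
     (\<forall>f\<in>borel_measurable (sigma (space (base W)) C).
        integrable (base W) (\<lambda>x. (f x)\<^sup>2) \<longrightarrow>
        graphon_operator W f \<in> borel_measurable (sigma (space (base W)) C))"

definition invariant_complete_subalgebra :: "'a graphon \<Rightarrow> 'a set set \<Rightarrow> bool" where
  "invariant_complete_subalgebra W C \<longleftrightarrow>
     sub_sigma_algebra (base W) C \<and> relatively_complete (base W) C \<and> invariant_algebra W C"

text \<open>\<open>C\<close> is the algebra written \<open>C(W)\<close>.\<close>

definition minimum_invariant_subalgebra :: "'a graphon \<Rightarrow> 'a set set \<Rightarrow> bool" where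
  "minimum_invariant_subalgebra W C \<longleftrightarrow>
     invariant_complete_subalgebra W C \<and>
     (\<forall>D. invariant_complete_subalgebra W D \<longrightarrow> C \<subseteq> D)"

text \<open>\<open>N\<close> and \<open>q\<close> are a model of the quotient space and of the quotient map. The factorisation
  has to be read almost everywhere: \<open>C\<close> contains all measurable null sets, whereas the algebra
  generated by \<open>q\<close> is countably generated.\<close>

definition quotient_space :: "'a measure \<Rightarrow> 'a set set \<Rightarrow> 'b measure \<Rightarrow> ('a \<Rightarrow> 'b) \<Rightarrow> bool" where
  "quotient_space M C N q \<longleftrightarrow>
     standard_probability_space N \<and>
     measure_preserving_map M N q \<and>
     q ` space M = space N \<and>
     (\<forall>f\<in>borel_measurable M.
        f \<in> borel_measurable (sigma (space M) C) \<longleftrightarrow>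
        (\<exists>g\<in>(borel_measurable N :: ('b \<Rightarrow> real) set). AE x in M. f x = g (q x)))"

definition quotient_graphon :: "'a graphon \<Rightarrow> 'a set set \<Rightarrow> 'b graphon \<Rightarrow> bool" where
  "quotient_graphon W C V \<longleftrightarrow>
     is_graphon V \<and>
     (\<exists>q. quotient_space (base W) C (base V) q \<and>
          (AE z in base W \<Otimes>\<^sub>M base W.
             pull_back (kernel V) q z =
             real_cond_exp (base W \<Otimes>\<^sub>M base W)
               (sigma (space (base W)) C \<Otimes>\<^sub>M sigma (space (base W)) C) (kernel W) z))"

text \<open>Quotients are determined up to isomorphism modulo null sets. Every standard Borel space is
  Borel isomorphic to a Borel subset of the real line, so it is no restriction to take the
  quotients on subsets of \<open>real\<close>. Two models that agree only modulo null sets can be replaced by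
  strictly isomorphic ones, by redefining the quotient maps on null sets; choosing the
  models existentially therefore matches the usual reading up to null sets.\<close>

definition fractionally_isomorphic :: "'a graphon \<Rightarrow> 'b graphon \<Rightarrow> bool" where
  "fractionally_isomorphic W U \<longleftrightarrow>
     (\<exists>C D (V :: real graphon) (V' :: real graphon).
        minimum_invariant_subalgebra W C \<and> quotient_graphon W C V \<and>
        minimum_invariant_subalgebra U D \<and> quotient_graphon U D V' \<and>
        isomorphic_graphons V V')"


section \<open>Fractional isomorphism of graphs\<close>

definition simple_graph :: "'v set \<Rightarrow> 'v set set \<Rightarrow> bool" where
  "simple_graph V E \<longleftrightarrow> finite V \<and> (\<forall>e\<in>E. e \<subseteq> V \<and> card e = 2)"

definition degree_into :: "'v set set \<Rightarrow> 'v \<Rightarrow> 'v set \<Rightarrow> nat" where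
  "degree_into E u P = card {v\<in>P. {u, v} \<in> E}"

definition indexed_partition :: "'v set \<Rightarrow> nat \<Rightarrow> (nat \<Rightarrow> 'v set) \<Rightarrow> bool" where
  "indexed_partition V k P \<longleftrightarrow>
     (\<Union>i\<in>{1..k}. P i) = V \<and> disjoint_family_on P {1..k} \<and> (\<forall>i\<in>{1..k}. P i \<noteq> {})"

definition equitable_partition ::
    "'v set \<Rightarrow> 'v set set \<Rightarrow> nat \<Rightarrow> (nat \<Rightarrow> 'v set) \<Rightarrow> bool" where
  "equitable_partition V E k P \<longleftrightarrow>
     indexed_partition V k P \<and>
     (\<forall>i\<in>{1..k}. \<forall>j\<in>{1..k}. \<forall>u\<in>P i. \<forall>u'\<in>P i.
        degree_into E u (P j) = degree_into E u' (P j))"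

definition equitable_parameters ::
    "'v set set \<Rightarrow> nat \<Rightarrow> (nat \<Rightarrow> 'v set) \<Rightarrow> (nat \<Rightarrow> nat) \<Rightarrow> (nat \<Rightarrow> nat \<Rightarrow> nat) \<Rightarrow> bool" where
  "equitable_parameters E k P a D \<longleftrightarrow>
     (\<forall>i\<in>{1..k}. a i = card (P i)) \<and>
     (\<forall>i\<in>{1..k}. \<forall>j\<in>{1..k}. \<forall>u\<in>P i. D i j = degree_into E u (P j))"

definition fractionally_isomorphic_graphs ::
    "'v set \<Rightarrow> 'v set set \<Rightarrow> 'w set \<Rightarrow> 'w set set \<Rightarrow> bool" where
  "fractionally_isomorphic_graphs V E V' E' \<longleftrightarrow>
     (\<exists>k P P' a D.
        equitable_partition V E k P \<and> equitable_parameters E k P a D \<and>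
        equitable_partition V' E' k P' \<and> equitable_parameters E' k P' a D)"


section \<open>Cut distance\<close>

definition cut_norm :: "'a measure \<Rightarrow> ('a \<times> 'a \<Rightarrow> real) \<Rightarrow> ereal" where
  "cut_norm M W =
     (SUP (S, T)\<in>sets M \<times> sets M. ereal \<bar>set_lebesgue_integral (M \<Otimes>\<^sub>M M) (S \<times> T) W\<bar>)"

text \<open>Extended reals make the infimum infinite when there is no measure-preserving bijection.
  Between atomless standard Borel probability spaces there always is one.\<close>

definition cut_distance :: "'b graphon \<Rightarrow> 'a graphon \<Rightarrow> ereal" where
  "cut_distance U W =
     (INF f\<in>{f. measure_preserving_bij (base W) (base U) f}.
        cut_norm (base W) (\<lambda>z. pull_back (kernel U) f z - kernel W z))"

abbreviation unit_space :: "real measure" where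
  "unit_space \<equiv> restrict_space lborel {0..<1}"

definition vertex_part :: "nat \<Rightarrow> nat \<Rightarrow> real set" where
  "vertex_part n v = {(real v - 1) / real n ..< real v / real n}"

text \<open>The representation of a graph on the vertex set \<open>{1..n}\<close> is unique up to isomorphism; it is
  realised on the unit interval, with consecutive intervals as parts.\<close>

definition graph_representation :: "nat \<Rightarrow> nat set set \<Rightarrow> real graphon" where
  "graph_representation n E =
     \<lparr>base = unit_space,
      kernel = (\<lambda>(x, y).
        if \<exists>u\<in>{1..n}. \<exists>v\<in>{1..n}. {u, v} \<in> E \<and> x \<in> vertex_part n u \<and> y \<in> vertex_part n v
        then 1 else 0)\<rparr>"

text \<open>In a standard Borel probability space, every atom is a point mass up to a null set.\<close>

definition atomless :: "'a measure \<Rightarrow> bool" where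
  "atomless M \<longleftrightarrow> (\<forall>x\<in>space M. emeasure M {x} = 0)"

definition blow_up :: "'a graphon \<Rightarrow> ('a \<times> real) graphon" where
  "blow_up U = \<lparr>base = base U \<Otimes>\<^sub>M unit_space, kernel = pull_back (kernel U) fst\<rparr>"

text \<open>There is no measure-preserving bijection between a space with atoms and an atomless one.
  As usual, a graphon on a space with atoms is compared with graphs after pulling it back to an
  atomless space along a measure-preserving map, here the projection from the product with the
  unit interval.\<close>

definition cut_distance_to_graph :: "'a graphon \<Rightarrow> nat \<Rightarrow> nat set set \<Rightarrow> ereal" where
  "cut_distance_to_graph U n E =
     (if atomless (base U) then cut_distance U (graph_representation n E)
      else cut_distance (blow_up U) (graph_representation n E))"

end

theory Submission
  imports Defs
begin

text \<open>A partition of a graphon is nearly regular if almost all degrees into a class depend only on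
  the class. An invariant algebra contains arbitrarily fine nearly regular partitions, because the
  degrees into its members are measurable with respect to it. Since these degrees can be read off
  the quotient graphon, fractionally isomorphic graphons have nearly regular partitions with the same
  class sizes and densities; these finitely many numbers determine \<open>n\<^sub>0\<close> and a common degree
  matrix. For a single graphon, each class is cut into cells of equal size on which weak regularity
  applies, the matrix of the rounded cell densities is perturbed so that its block row sums are
  exactly those prescribed, and every pair of cells is joined by a quasirandom bipartite graph in
  which all degrees are exact. The vertices left over are isolated.\<close>

section \<open>Measure-preserving maps from the unit interval\<close>

text \<open>The family may be infinite, so every bound has to be uniform in the graphon. Three facts
  achieve this: the number of rectangles in weak regularity depends only on the accuracy, so a
  bounded number of cells is cut by the sorting order; the prescribed degrees are computed from the
  class densities alone; and all perturbed matrix entries share one denominator, so a single modulus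
  turns them into integer thresholds. The tolerance of near regularity depends only on
  \<open>\<epsilon>\<close>, since the number of classes is an outcome of the partition and can be
  used only for the constants fixed after it. Contraction towards 1/2 has a second purpose besides
  keeping entries legal: it leaves room below 1 for the higher density that makes up for missing
  edges. The cut distance is an infimum over bijections defined everywhere, whereas distribution and
  quantile functions are mutually inverse only almost everywhere; Cantor sets of measure zero and a
  measurable Schroeder-Bernstein argument close this gap. Atoms disappear by pulling back to the
  unit interval.\<close>

definition encode_bits :: "(nat \<Rightarrow> bool) \<Rightarrow> real" where
  "encode_bits b = (\<Sum>i. of_bool (b i) / 3 ^ Suc i)"

definition ternary_bit :: "real \<Rightarrow> nat \<Rightarrow> bool" where
  "ternary_bit r i \<longleftrightarrow> \<lfloor>3 ^ Suc i * r\<rfloor> mod 3 = 1"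

definition binary_value :: "(nat \<Rightarrow> bool) \<Rightarrow> real" where
  "binary_value b = (\<Sum>i. of_bool (b i) / 2 ^ Suc i)"

definition binary_bit :: "real \<Rightarrow> nat \<Rightarrow> bool" where
  "binary_bit r i \<longleftrightarrow> odd \<lfloor>2 ^ Suc i * r\<rfloor>"

lemma geometric_third_sums: "(\<lambda>i. 1 / 3 ^ Suc i :: real) sums (1 / 2)"
proof -
  have "(\<lambda>i. (1/3) * (1/3) ^ i :: real) sums ((1/3) * (1 / (1 - 1/3)))"
    by (intro sums_mult geometric_sums) auto
  moreover have "(\<lambda>i. (1/3) * (1/3) ^ i :: real) = (\<lambda>i. 1 / 3 ^ Suc i)"
    by (auto simp: fun_eq_iff power_divide)
  ultimately show ?thesis by simp
qed

lemma summable_encode: "summable (\<lambda>i. of_bool (b i) / 3 ^ Suc i :: real)"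
  by (rule summable_comparison_test'[of "\<lambda>i. 1 / 3 ^ Suc i" 0])
     (use geometric_third_sums in \<open>auto simp: sums_iff\<close>)

lemma encode_bits_bounds: "0 \<le> encode_bits b" "encode_bits b \<le> 1 / 2"
proof -
  show "0 \<le> encode_bits b"
    unfolding encode_bits_def by (intro suminf_nonneg summable_encode) auto
  have "encode_bits b \<le> (\<Sum>i. 1 / 3 ^ Suc i)"
    unfolding encode_bits_def
    by (intro suminf_le summable_encode) (use geometric_third_sums in \<open>auto simp: sums_iff\<close>)
  then show "encode_bits b \<le> 1 / 2" using geometric_third_sums by (simp add: sums_iff)
qed

lemma encode_bits_rec: "encode_bits b = (of_bool (b 0) + encode_bits (\<lambda>i. b (Suc i))) / 3"
proof -
  have "encode_bits b = of_bool (b 0) / 3 + (\<Sum>i. of_bool (b (Suc i)) / 3 ^ Suc (Suc i))"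
    unfolding encode_bits_def using suminf_split_head[OF summable_encode[of b]] by simp
  also have "(\<Sum>i. of_bool (b (Suc i)) / 3 ^ Suc (Suc i) :: real) = (\<Sum>i. (of_bool (b (Suc i)) / 3 ^ Suc i) * (1/3))"
    by (simp add: field_simps)
  also have "\<dots> = encode_bits (\<lambda>i. b (Suc i)) * (1/3)"
    unfolding encode_bits_def by (rule suminf_mult2[symmetric]) (rule summable_encode)
  finally show ?thesis by (simp add: field_simps)
qed

text \<open>Dropping the first digit multiplies the code by 3 up to an integer, and since codes
  never exceed 1/2 no floor ever carries. Digits 0 and 1 in base 3 are therefore unambiguous,
  whereas binary digits are not at dyadic rationals.\<close>

lemma ternary_bit_encode: "ternary_bit (encode_bits b) i = b i"
proof (induction i arbitrary: b)
  case 0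
  have "3 * encode_bits b = of_bool (b 0) + encode_bits (\<lambda>i. b (Suc i))"
    using encode_bits_rec[of b] by simp
  moreover have "\<lfloor>real (of_bool (b 0)) + encode_bits (\<lambda>i. b (Suc i))\<rfloor> = of_bool (b 0)"
    using encode_bits_bounds[of "\<lambda>i. b (Suc i)"] by (intro floor_unique) auto
  ultimately show ?case unfolding ternary_bit_def by (auto split: if_splits simp: of_bool_def)
next
  case (Suc i)
  let ?e = "encode_bits (\<lambda>i. b (Suc i))"
  have "3 ^ Suc (Suc i) * encode_bits b = 3 ^ Suc i * (of_bool (b 0) + ?e)"
    using encode_bits_rec[of b] by simp
  also have "\<dots> = real_of_int (3 ^ Suc i * of_bool (b 0)) + 3 ^ Suc i * ?e"
    by (simp add: algebra_simps)
  finally have "\<lfloor>3 ^ Suc (Suc i) * encode_bits b\<rfloor> = 3 ^ Suc i * of_bool (b 0) + \<lfloor>3 ^ Suc i * ?e\<rfloor>"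
    by (metis int_add_floor)
  then have "ternary_bit (encode_bits b) (Suc i) = ternary_bit ?e i"
    unfolding ternary_bit_def by (simp add: mod_add_eq[symmetric] del: mod_add_eq)
  then show ?case using Suc[of "\<lambda>i. b (Suc i)"] by simp
qed

text \<open>The partial sums are the dyadic roundings of \<open>s\<close> from below. Going from
  numbers to bits and back avoids the ambiguity of binary expansions.\<close>

lemma binary_value_binary_bit:
  assumes "0 \<le> s" "s < 1"
  shows "binary_value (binary_bit s) = s"
proof -
  have part: "(\<Sum>i<n. of_bool (binary_bit s i) / 2 ^ Suc i) = \<lfloor>2 ^ n * s\<rfloor> / 2 ^ n" for n
  proof (induction n)
    case 0
    have "\<lfloor>s\<rfloor> = 0" using assms by (simp add: floor_eq_iff)
    then show ?case by simp
  next
    case (Suc n)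
    let ?x = "2 ^ n * s"
    have "\<lfloor>2 ^ Suc n * s\<rfloor> = 2 * \<lfloor>?x\<rfloor> + of_bool (odd \<lfloor>2 ^ Suc n * s\<rfloor>)"
    proof -
      have "2 * \<lfloor>?x\<rfloor> \<le> \<lfloor>2 ^ Suc n * s\<rfloor>" "\<lfloor>2 ^ Suc n * s\<rfloor> \<le> 2 * \<lfloor>?x\<rfloor> + 1"
        by (simp_all) linarith+
      then show ?thesis by (auto simp: of_bool_def elim!: oddE)
    qed
    then have "real_of_int \<lfloor>2 ^ Suc n * s\<rfloor> = 2 * \<lfloor>?x\<rfloor> + of_bool (binary_bit s n)"
      unfolding binary_bit_def by (metis of_int_add of_int_mult of_int_numeral of_int_of_bool)
    then show ?case using Suc by (simp add: field_simps)
  qed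
  have "(\<lambda>n. \<lfloor>2 ^ n * s\<rfloor> / 2 ^ n) \<longlonglongrightarrow> s"
  proof (rule tendsto_sandwich[where f="\<lambda>n. s - (1/2)^n" and h="\<lambda>n. s"])
    have "s - (1/2)^n \<le> \<lfloor>2 ^ n * s\<rfloor> / 2 ^ n" for n
    proof -
      have "2 ^ n * s - 1 \<le> \<lfloor>2 ^ n * s\<rfloor>" by linarith
      then have "(2 ^ n * s - 1) / 2 ^ n \<le> \<lfloor>2 ^ n * s\<rfloor> / 2 ^ n" by (intro divide_right_mono) auto
      then show ?thesis by (simp add: field_simps)
    qed
    then show "\<forall>\<^sub>F n in sequentially. s - (1/2)^n \<le> \<lfloor>2 ^ n * s\<rfloor> / 2 ^ n" by simp
    have "\<lfloor>2 ^ n * s\<rfloor> / 2 ^ n \<le> s" for n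
      using of_int_floor_le[of "2 ^ n * s"] by (simp add: field_simps)
    then show "\<forall>\<^sub>F n in sequentially. \<lfloor>2 ^ n * s\<rfloor> / 2 ^ n \<le> s" by simp
    show "(\<lambda>n. s - (1/2)^n) \<longlonglongrightarrow> s"
      using tendsto_diff[OF tendsto_const LIMSEQ_realpow_zero[of "1/2"], of s] by simp
  qed simp
  then have "(\<lambda>i. of_bool (binary_bit s i) / 2 ^ Suc i) sums s"
    unfolding sums_def part .
  then show ?thesis unfolding binary_value_def by (simp add: sums_iff)
qed

lemma measurable_encode_bits [measurable (raw)]:
  assumes "\<And>i. Measurable.pred M (\<lambda>x. b x i)"
  shows "(\<lambda>x. encode_bits (b x)) \<in> borel_measurable M"
  unfolding encode_bits_def of_bool_def using assms by measurable

lemma measurable_binary_value [measurable (raw)]: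
  assumes "\<And>i. Measurable.pred M (\<lambda>x. b x i)"
  shows "(\<lambda>x. binary_value (b x)) \<in> borel_measurable M"
  unfolding binary_value_def of_bool_def using assms by measurable

lemma measurable_ternary_bit [measurable (raw)]:
  assumes "f \<in> borel_measurable M"
  shows "Measurable.pred M (\<lambda>x. ternary_bit (f x) i)"
  unfolding ternary_bit_def using assms by measurable

lemma measurable_binary_bit [measurable (raw)]:
  assumes "f \<in> borel_measurable M"
  shows "Measurable.pred M (\<lambda>x. binary_bit (f x) i)"
  unfolding binary_bit_def using assms by measurable

text \<open>The middle-thirds set scaled by 1/2, as digits 0 and 1 stand in for 0 and 2. An
  uncountable Borel null set can host an injective copy of a whole space without affecting any
  measure.\<close>

definition cantor :: "real set" where
  "cantor = range encode_bits"

text \<open>Written as the fixed points of a Borel map, the set is visibly Borel; as a mere range it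
  would not be.\<close>

lemma cantor_iff: "r \<in> cantor \<longleftrightarrow> encode_bits (ternary_bit r) = r"
proof
  assume "r \<in> cantor"
  then obtain b where r: "r = encode_bits b" unfolding cantor_def by auto
  have "ternary_bit r = b" unfolding r by (simp add: fun_eq_iff ternary_bit_encode)
  then show "encode_bits (ternary_bit r) = r" using r by simp
qed (metis cantor_def rangeI)

lemma cantor_measurable [measurable]: "cantor \<in> sets borel"
proof -
  have "cantor = {r \<in> space borel. encode_bits (ternary_bit r) = r}" using cantor_iff by auto
  also have "\<dots> \<in> sets borel" by measurable
  finally show ?thesis .
qed

text \<open>The set is the union of two translates of its image under \<open>\<lambda>x. x / 3\<close>.\<close>

lemma cantor_null: "emeasure lborel cantor = 0"
proof -
  have sub: "cantor \<subseteq> ((+) 0 \<circ> (*\<^sub>R) (1/3)) ` cantor \<union> ((+) (1/3) \<circ> (*\<^sub>R) (1/3)) ` cantor"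
  proof
    fix r assume "r \<in> cantor"
    then obtain b where b: "r = encode_bits b" unfolding cantor_def by auto
    have "encode_bits (\<lambda>i. b (Suc i)) \<in> cantor" unfolding cantor_def by auto
    moreover have "r = (of_bool (b 0) + encode_bits (\<lambda>i. b (Suc i))) / 3"
      unfolding b by (rule encode_bits_rec)
    ultimately show "r \<in> ((+) 0 \<circ> (*\<^sub>R) (1/3)) ` cantor \<union> ((+) (1/3) \<circ> (*\<^sub>R) (1/3)) ` cantor"
      by (cases "b 0") (auto simp: image_iff add_divide_distrib)
  qed
  have leb: "cantor \<in> sets lebesgue" by simp
  have sc: "emeasure lebesgue (((+) a \<circ> (*\<^sub>R) (1/3)) ` cantor) = ennreal (1/3) * emeasure lebesgue cantor" for a :: real
    using emeasure_lebesgue_affine[of "1/3" a cantor] leb by (simp add: o_def add.commute)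
  have im: "((+) a \<circ> (*\<^sub>R) (1/3)) ` cantor \<in> sets lebesgue" for a :: real
  proof -
    have "((+) a \<circ> (*\<^sub>R) (1/3)) ` cantor = (\<lambda>x. 3 * (x - a)) -` cantor \<inter> space borel"
    proof (intro equalityI subsetI)
      fix x assume "x \<in> (\<lambda>x. 3 * (x - a)) -` cantor \<inter> space borel"
      then have "3 * (x - a) \<in> cantor" "x = ((+) a \<circ> (*\<^sub>R) (1/3)) (3 * (x - a))"
        by (auto simp: field_simps)
      then show "x \<in> ((+) a \<circ> (*\<^sub>R) (1/3)) ` cantor" by (rule rev_image_eqI)
    qed auto
    also have "\<dots> \<in> sets borel" by measurable
    finally show ?thesis by simp
  qed
  have "emeasure lebesgue cantor \<le> emeasure lebesgue (((+) 0 \<circ> (*\<^sub>R) (1/3)) ` cantor) + emeasure lebesgue (((+) (1/3) \<circ> (*\<^sub>R) (1/3)) ` cantor)"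
    by (rule order_trans[OF emeasure_mono[OF sub] emeasure_subadditive]) (intro sets.Un im)+
  then have le: "emeasure lebesgue cantor \<le> ennreal (1/3) * emeasure lebesgue cantor + ennreal (1/3) * emeasure lebesgue cantor"
    by (simp only: sc)
  \<comment> \<open>Boundedness makes the measure a finite number \<open>c\<close>; only then does
    self-similarity, in the form of \<open>c\<close> being at most two thirds of \<open>c\<close>,
    force \<open>c = 0\<close>.\<close>
  have "emeasure lebesgue cantor \<le> emeasure lebesgue {0..1::real}"
  proof (rule emeasure_mono)
    have "encode_bits b \<in> {0..1}" for b using encode_bits_bounds[of b] by simp
    then show "cantor \<subseteq> {0..1}" unfolding cantor_def by blast
  qed simp
  also have "\<dots> < \<infinity>" by simp
  finally have "emeasure lebesgue cantor \<noteq> \<infinity>" by simp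
  then obtain c where c: "emeasure lebesgue cantor = ennreal c" "c \<ge> 0"
    by (metis ennreal_cases infinity_ennreal_def)
  have "ennreal (1/3) * ennreal c = ennreal (1/3 * c)" using c by (intro ennreal_mult[symmetric]) auto
  then have "ennreal c \<le> ennreal (1/3 * c + 1/3 * c)"
    using le c by (subst ennreal_plus) auto
  then have "c \<le> 1/3 * c + 1/3 * c" using c by (subst (asm) ennreal_le_iff) auto
  then have "c = 0" using c by simp
  then show ?thesis using c by simp
qed

text \<open>The measurable content of being standard Borel: \<open>\<phi>\<close> identifies
  \<open>M\<close> with the Borel set of all \<open>r\<close> with
  \<open>\<phi> (\<psi> r) = r\<close>. In this form the property passes easily to products and
  Borel subsets.\<close>

definition borel_retract :: "'a measure \<Rightarrow> bool" where
  "borel_retract M \<longleftrightarrow>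
     (\<exists>\<phi> \<psi>. \<phi> \<in> borel_measurable M \<and> \<psi> \<in> (borel :: real measure) \<rightarrow>\<^sub>M M \<and> (\<forall>x\<in>space M. \<psi> (\<phi> x) = x))"

text \<open>The left inverse is measurable on all of \<open>N\<close> rather than on the range of
  \<open>f\<close>. The range carries the whole measure of \<open>N\<close> but may omit points,
  which is the defect that two opposite embeddings repair.\<close>

definition mp_embedding :: "'a measure \<Rightarrow> 'b measure \<Rightarrow> ('a \<Rightarrow> 'b) \<Rightarrow> ('b \<Rightarrow> 'a) \<Rightarrow> bool" where
  "mp_embedding M N f g \<longleftrightarrow>
     f \<in> M \<rightarrow>\<^sub>M N \<and> g \<in> N \<rightarrow>\<^sub>M M \<and> (\<forall>x\<in>space M. g (f x) = x) \<and> distr M N f = N"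

definition mp_iso :: "'a measure \<Rightarrow> 'b measure \<Rightarrow> ('a \<Rightarrow> 'b) \<Rightarrow> ('b \<Rightarrow> 'a) \<Rightarrow> bool" where
  "mp_iso M N f g \<longleftrightarrow> mp_embedding M N f g \<and> (\<forall>y\<in>space N. f (g y) = y)"

lemma mp_isoD:
  assumes "mp_iso M N f g"
  shows "f \<in> M \<rightarrow>\<^sub>M N" "g \<in> N \<rightarrow>\<^sub>M M" "\<And>x. x \<in> space M \<Longrightarrow> g (f x) = x"
    "\<And>y. y \<in> space N \<Longrightarrow> f (g y) = y" "distr M N f = N"
  using assms unfolding mp_iso_def mp_embedding_def by auto

text \<open>The image consists of the \<open>y\<close> with \<open>g y \<in> A\<close> and
  \<open>f (g y) = y\<close>; testing the equation after the injection \<open>\<phi>\<close> into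
  the reals makes it a measurable condition.\<close>

lemma mp_embedding_image:
  assumes "mp_embedding M N f g" "borel_retract N" "A \<in> sets M"
  shows "f ` A \<in> sets N"
proof -
  obtain \<phi> :: "_ \<Rightarrow> real" and \<psi> where [measurable]: "\<phi> \<in> borel_measurable N"
    and inv: "\<And>x. x \<in> space N \<Longrightarrow> \<psi> (\<phi> x) = x"
    using assms(2) unfolding borel_retract_def by blast
  have [measurable]: "f \<in> M \<rightarrow>\<^sub>M N" "g \<in> N \<rightarrow>\<^sub>M M" "A \<in> sets M"
    and gf: "\<And>x. x \<in> space M \<Longrightarrow> g (f x) = x"
    using assms unfolding mp_embedding_def by auto
  have "f ` A = {y \<in> space N. g y \<in> A \<and> \<phi> (f (g y)) = \<phi> y}"
  proof (intro equalityI subsetI)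
    fix y assume "y \<in> f ` A"
    then obtain x where x: "x \<in> A" "y = f x" by auto
    then have "x \<in> space M" using sets.sets_into_space[OF assms(3)] by auto
    then show "y \<in> {y \<in> space N. g y \<in> A \<and> \<phi> (f (g y)) = \<phi> y}"
      using x gf measurable_space[OF \<open>f \<in> M \<rightarrow>\<^sub>M N\<close>] by auto
  next
    fix y assume y: "y \<in> {y \<in> space N. g y \<in> A \<and> \<phi> (f (g y)) = \<phi> y}"
    then have "f (g y) \<in> space N" using measurable_space[OF \<open>f \<in> M \<rightarrow>\<^sub>M N\<close>] measurable_space[OF \<open>g \<in> N \<rightarrow>\<^sub>M M\<close>] by auto
    then have "f (g y) = y" using y inv[of "f (g y)"] inv[of y] by simp
    then show "y \<in> f ` A" using y by (intro image_eqI[of _ _ "g y"]) auto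
  qed
  also have "\<dots> \<in> sets N" by measurable
  finally show ?thesis .
qed

text \<open>The classical bijection, equal to \<open>f\<close> on a set \<open>F\<close> and to the
  inverse of \<open>g\<close> off it. Images under embeddings are measurable, so \<open>F\<close> is
  measurable, and each of the two pieces preserves measure because \<open>f\<close> and
  \<open>g\<close> do.\<close>

lemma mp_schroeder_bernstein:
  assumes f: "mp_embedding M N f f'" and g: "mp_embedding N M g g'"
    and rM: "borel_retract M" and rN: "borel_retract N"
  shows "\<exists>h h'. mp_iso M N h h'"
proof -
  have [measurable]: "f \<in> M \<rightarrow>\<^sub>M N" "f' \<in> N \<rightarrow>\<^sub>M M" "g \<in> N \<rightarrow>\<^sub>M M" "g' \<in> M \<rightarrow>\<^sub>M N"
    and ff: "\<And>x. x \<in> space M \<Longrightarrow> f' (f x) = x" and gg: "\<And>y. y \<in> space N \<Longrightarrow> g' (g y) = y"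
    and df: "distr M N f = N" and dg: "distr N M g = M"
    using f g unfolding mp_embedding_def by auto
  note sp = measurable_space[OF \<open>f \<in> M \<rightarrow>\<^sub>M N\<close>] measurable_space[OF \<open>g \<in> N \<rightarrow>\<^sub>M M\<close>]
    measurable_space[OF \<open>f' \<in> N \<rightarrow>\<^sub>M M\<close>] measurable_space[OF \<open>g' \<in> M \<rightarrow>\<^sub>M N\<close>]
  \<comment> \<open>The union \<open>F\<close> collects the points whose backward orbit, under
    alternating preimages by \<open>g\<close> and \<open>f\<close>, stops at a point of
    \<open>M\<close> outside the range of \<open>g\<close>.\<close>
  define E where "E = rec_nat (space M - g ` space N) (\<lambda>_ X. g ` (f ` X))"
  have E0: "E 0 = space M - g ` space N" and ES: "E (Suc n) = g ` (f ` E n)" for n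
    by (simp_all add: E_def)
  have Em: "E n \<in> sets M" for n
  proof (induction n)
    case 0
    show ?case unfolding E0 by (intro sets.Diff mp_embedding_image[OF g rM]) auto
  next
    case (Suc n)
    show ?case unfolding ES by (intro mp_embedding_image[OF g rM] mp_embedding_image[OF f rN] Suc)
  qed
  define F where "F = (\<Union>n. E n)"
  have Fm [measurable]: "F \<in> sets M" unfolding F_def using Em by auto
  have fFm [measurable]: "f ` F \<in> sets N" by (rule mp_embedding_image[OF f rN Fm])
  have Fsp: "x \<in> F \<Longrightarrow> x \<in> space M" for x using sets.sets_into_space[OF Fm] by auto
  have F1: "g (f x) \<in> F" if xF: "x \<in> F" for x
  proof -
    obtain n where "x \<in> E n" using xF unfolding F_def by blast
    then have "g (f x) \<in> E (Suc n)" unfolding ES by auto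
    then show ?thesis unfolding F_def by blast
  qed
  have F2: "g (g' x) = x" if x: "x \<in> space M" "x \<notin> F" for x
  proof -
    have "x \<notin> E 0" using x unfolding F_def by blast
    then obtain y where "y \<in> space N" "x = g y" using x E0 by auto
    then show ?thesis using gg by simp
  qed
  \<comment> \<open>This separates the ranges of the two pieces of \<open>h\<close>: what
    \<open>f\<close> reaches from \<open>F\<close> is exactly what \<open>g\<close> sends into
    \<open>F\<close>.\<close>
  have F3: "g y \<in> F \<longleftrightarrow> y \<in> f ` F" if y: "y \<in> space N" for y
  proof
    assume "g y \<in> F"
    then obtain n where n: "g y \<in> E n" unfolding F_def by blast
    show "y \<in> f ` F"
    proof (cases n)
      case 0
      then show ?thesis using n y E0 by auto
    next
      case (Suc k)
      then obtain e where e: "e \<in> E k" "g y = g (f e)" using n ES by auto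
      have "e \<in> F" using e unfolding F_def by blast
      then have "y = f e" using gg[OF y] gg[of "f e"] e(2) sp(1)[OF Fsp] by metis
      then show ?thesis using \<open>e \<in> F\<close> by auto
    qed
  qed (use F1 in auto)
  define h where "h x = (if x \<in> F then f x else g' x)" for x
  define h' where "h' y = (if y \<in> f ` F then f' y else g y)" for y
  have hm [measurable]: "h \<in> M \<rightarrow>\<^sub>M N"
    unfolding h_def by (rule measurable_If_set) auto
  have h'm [measurable]: "h' \<in> N \<rightarrow>\<^sub>M M"
    unfolding h'_def by (rule measurable_If_set) auto
  have "h' (h x) = x" if x: "x \<in> space M" for x
  proof (cases "x \<in> F")
    case False
    have "g' x \<notin> f ` F"
    proof
      assume "g' x \<in> f ` F"
      then obtain e where "e \<in> F" "g' x = f e" by auto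
      then show False using F1[of e] F2[OF x False] False by simp
    qed
    then show ?thesis using False F2[OF x False] by (simp add: h_def h'_def)
  qed (use x ff in \<open>simp add: h_def h'_def\<close>)
  moreover have "h (h' y) = y" if y: "y \<in> space N" for y
  proof (cases "y \<in> f ` F")
    case True
    then obtain e where "e \<in> F" "y = f e" by auto
    then show ?thesis using ff[OF Fsp] by (simp add: h_def h'_def)
  next
    case False
    then show ?thesis using F3[OF y] gg[OF y] by (simp add: h_def h'_def)
  qed
  moreover have "distr M N h = N"
  proof (rule measure_eqI)
    fix A assume "A \<in> sets (distr M N h)"
    then have A [measurable]: "A \<in> sets N" by simp
    have Asp: "y \<in> A \<Longrightarrow> y \<in> space N" for y using sets.sets_into_space[OF A] by auto
    have inj: "inj_on f (space M)" using ff by (rule inj_on_inverseI)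
    have eq: "f x \<in> f ` F \<longleftrightarrow> x \<in> F" if "x \<in> space M" for x
      using inj_on_image_mem_iff[OF inj that] sets.sets_into_space[OF Fm] by simp
    have "h x \<in> A \<longleftrightarrow> (f x \<in> A \<and> f x \<in> f ` F) \<or> (g' x \<in> A \<and> x \<notin> F)" if "x \<in> space M" for x
      unfolding eq[OF that] h_def by simp
    then have split: "h -` A \<inter> space M = (f -` (A \<inter> f ` F) \<inter> space M) \<union> (g' -` A \<inter> (space M - F))"
      by blast
    have e1: "emeasure M (f -` (A \<inter> f ` F) \<inter> space M) = emeasure N (A \<inter> f ` F)"
      using emeasure_distr[of f M N "A \<inter> f ` F"] by (simp add: df)
    \<comment> \<open>The mass off \<open>F\<close> is computed by pulling it back along the
      measure-preserving map \<open>g\<close>.\<close>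
    have "emeasure M (g' -` A \<inter> (space M - F)) = emeasure N (g -` (g' -` A \<inter> (space M - F)) \<inter> space N)"
    proof -
      have "g' -` A \<inter> (space M - F) = (g' -` A \<inter> space M) - F" by auto
      then have "g' -` A \<inter> (space M - F) \<in> sets M" by simp
      then show ?thesis using emeasure_distr[of g N M "g' -` A \<inter> (space M - F)"] by (simp add: dg)
    qed
    also have "g -` (g' -` A \<inter> (space M - F)) \<inter> space N = A - f ` F"
    proof (intro equalityI subsetI)
      fix y assume "y \<in> A - f ` F"
      then show "y \<in> g -` (g' -` A \<inter> (space M - F)) \<inter> space N"
        using Asp[of y] F3[of y] gg[of y] sp(2)[of y] by simp
    next
      fix y assume "y \<in> g -` (g' -` A \<inter> (space M - F)) \<inter> space N"
      then show "y \<in> A - f ` F" using F3[of y] gg[of y] by simp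
    qed
    finally have e2: "emeasure M (g' -` A \<inter> (space M - F)) = emeasure N (A - f ` F)" .
    have m1: "f -` (A \<inter> f ` F) \<inter> space M \<in> sets M" by measurable
    have m2: "g' -` A \<inter> (space M - F) \<in> sets M"
    proof -
      have "g' -` A \<inter> (space M - F) = (g' -` A \<inter> space M) - F" by auto
      then show ?thesis by simp
    qed
    have "f -` (A \<inter> f ` F) \<inter> space M \<inter> (g' -` A \<inter> (space M - F)) = {}"
      using eq by blast
    then have "emeasure M (h -` A \<inter> space M) =
        emeasure M (f -` (A \<inter> f ` F) \<inter> space M) + emeasure M (g' -` A \<inter> (space M - F))"
      unfolding split by (rule plus_emeasure[symmetric, OF m1 m2])
    also have "\<dots> = emeasure N (A \<inter> f ` F) + emeasure N (A - f ` F)"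
      unfolding e1 e2 ..
    also have "\<dots> = emeasure N ((A \<inter> f ` F) \<union> (A - f ` F))"
      by (rule plus_emeasure) auto
    also have "(A \<inter> f ` F) \<union> (A - f ` F) = A" by auto
    finally show "emeasure (distr M N h) A = emeasure N A" by (simp add: emeasure_distr)
  qed simp
  ultimately have "mp_iso M N h h'" unfolding mp_iso_def mp_embedding_def using hm h'm by simp
  then show ?thesis by blast
qed

section \<open>Distribution and quantile functions of atomless laws on the line\<close>

context cdf_distribution
begin

text \<open>Without atoms the distribution function is continuous, so it cannot jump over the level
  \<open>u\<close> at the quantile of \<open>u\<close>.\<close>

lemma cdf_I:
  assumes u: "0 < u" "u < 1" and atomless: "\<And>x. measure M {x} = 0"
  shows "cdf M (I u) = u"
proof (rule antisym)
  show "u \<le> cdf M (I u)" by (rule iffD2[OF pseudoinverse[OF u] order_refl])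
  show "cdf M (I u) \<le> u"
  proof (rule ccontr)
    assume "\<not> cdf M (I u) \<le> u"
    then have gt: "u < cdf M (I u)" by simp
    have "isCont (cdf M) (I u)" using isCont_cdf atomless by auto
    then have "(cdf M \<longlongrightarrow> cdf M (I u)) (at_left (I u))"
      unfolding isCont_def by (rule tendsto_within_subset) simp
    then have "eventually (\<lambda>x. u < cdf M x) (at_left (I u))"
      using gt by (rule order_tendstoD)
    then obtain b where "b < I u" "\<And>x. b < x \<Longrightarrow> x < I u \<Longrightarrow> u < cdf M x"
      by (auto simp: eventually_at_left_field)
    then have "u < cdf M ((b + I u) / 2)" "(b + I u) / 2 < I u" by auto
    then have "I u \<le> (b + I u) / 2" by (intro iffD1[OF pseudoinverse[OF u]] less_imp_le)
    then show False using \<open>(b + I u) / 2 < I u\<close> by (rule leD[THEN notE])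
  qed
qed

text \<open>The probability integral transform: \<open>M\<close> is the law of the quantile function
  \<open>I\<close>, and \<open>cdf M\<close> undoes \<open>I\<close> when there are no
  atoms.\<close>

lemma distr_cdf:
  assumes atomless: "\<And>x. measure M {x} = 0"
  shows "distr M borel (cdf M) = distr (restrict_space lborel {0<..<1}) borel (\<lambda>u. u)"
proof -
  have "distr M borel (cdf M) = distr (distr (restrict_space lborel {0<..<1}) borel I) borel (cdf M)"
    by (simp add: distr_I_eq_M)
  also have "\<dots> = distr (restrict_space lborel {0<..<1}) borel (cdf M \<circ> I)"
  proof (rule distr_distr)
    show "I \<in> restrict_space lborel {0<..<1} \<rightarrow>\<^sub>M borel"
      using measurable_CI by (simp add: measurable_def sets_restrict_space space_restrict_space)
  qed simp
  also have "\<dots> = distr (restrict_space lborel {0<..<1}) borel (\<lambda>u. u)"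
    by (rule distr_cong) (auto simp: space_restrict_space cdf_I[OF _ _ atomless])
  finally show ?thesis .
qed

text \<open>A quantile outside \<open>K\<close> would have an interval of measure zero immediately
  to its left, contradicting its minimality. The gain is a statement about every quantile, not
  almost every one.\<close>

lemma I_in_closed:
  assumes u: "0 < u" "u < 1" and K: "closed K" "measure M K = 1"
  shows "I u \<in> K"
proof (rule ccontr)
  assume n: "I u \<notin> K"
  have "open (- K)" using K by auto
  then obtain e where e: "e > 0" "ball (I u) e \<subseteq> - K" using n by (auto elim: openE)
  have "{I u - e/2<..I u} \<subseteq> - K"
    using e by (force simp: dist_real_def)
  then have "measure M {I u - e/2<..I u} \<le> measure M (- K)"
    using K by (intro finite_measure_mono) auto
  also have "\<dots> = 0" using K prob_compl[of K] by (simp add: borel_UNIV Compl_eq_Diff_UNIV)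
  finally have "measure M {I u - e/2<..I u} = 0" using measure_nonneg[of M] by (intro antisym) auto
  then have "cdf M (I u) = cdf M (I u - e/2)"
    using cdf_diff_eq[of "I u - e/2" "I u"] e by simp
  moreover have "u \<le> cdf M (I u)" by (rule iffD2[OF pseudoinverse[OF u] order_refl])
  ultimately have "u \<le> cdf M (I u - e/2)" by (simp only:)
  then have "I u \<le> I u - e/2" by (rule iffD1[OF pseudoinverse[OF u]])
  then show False using e by simp
qed

end

section \<open>The half-open unit interval as a probability space\<close>

lemma space_unit [simp]: "space unit_space = {0..<1}"
  by (simp add: space_restrict_space)

lemma sets_unit: "sets unit_space = sets (restrict_space borel {0..<1})"
  by (simp add: sets_restrict_space)

lemma prob_space_unit: "prob_space unit_space"
  by (rule prob_spaceI) (simp add: emeasure_restrict_space)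

lemma measurable_unit_eq: "unit_space \<rightarrow>\<^sub>M N = restrict_space borel {0..<1} \<rightarrow>\<^sub>M N"
  by (rule measurable_cong_sets) (simp_all add: sets_unit)

lemma measurable_unitI: "f \<in> borel \<rightarrow>\<^sub>M N \<Longrightarrow> f \<in> unit_space \<rightarrow>\<^sub>M N"
  unfolding measurable_unit_eq by (rule measurable_restrict_space1)

lemma measurable_to_unitI:
  assumes "f \<in> borel_measurable M" "\<And>x. x \<in> space M \<Longrightarrow> f x \<in> {0..<1}"
  shows "f \<in> M \<rightarrow>\<^sub>M unit_space"
  by (rule measurable_restrict_space2) (use assms in auto)

lemma measurable_from_unit: "f \<in> M \<rightarrow>\<^sub>M unit_space \<Longrightarrow> f \<in> borel_measurable M"
  by (drule measurable_restrict_space2_iff[THEN iffD1]) simp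

lemma AE_unit_iff: "(AE x in unit_space. P x) \<longleftrightarrow> (AE x in lborel. x \<in> {0..<1} \<longrightarrow> P x)"
  by (rule AE_restrict_space_iff) simp

text \<open>Quantile functions live on the open interval and graph representations on the half-open
  one; the two differ by a null point.\<close>

lemma distr_unit_Ioo:
  "distr unit_space borel (\<lambda>u. u) = distr (restrict_space lborel {0<..<1}) borel (\<lambda>u. u)"
proof (rule measure_eqI)
  fix A :: "real set" assume "A \<in> sets (distr unit_space borel (\<lambda>u. u))"
  then have A [measurable]: "A \<in> sets borel" by simp
  have "emeasure lborel (A \<inter> {0..<1}) = emeasure lborel (A \<inter> {0<..<1})"
  proof (rule emeasure_eq_AE)
    show "AE x in lborel. x \<in> A \<inter> {0..<1} \<longleftrightarrow> x \<in> A \<inter> {0<..<1}"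
      using AE_lborel_singleton[of "0::real"] by eventually_elim auto
  qed auto
  then show "emeasure (distr unit_space borel (\<lambda>u. u)) A = emeasure (distr (restrict_space lborel {0<..<1}) borel (\<lambda>u. u)) A"
    by (simp add: emeasure_distr measurable_restrict_space1 emeasure_restrict_space space_restrict_space)
qed simp

lemma borel_retract_unit: "borel_retract unit_space"
proof -
  have "(\<lambda>u. u) \<in> borel_measurable unit_space" by (rule measurable_unitI) simp
  moreover have "(\<lambda>u::real. if u \<in> {0..<1} then u else 0) \<in> borel \<rightarrow>\<^sub>M unit_space"
    by (rule measurable_to_unitI) auto
  ultimately show ?thesis unfolding borel_retract_def by fastforce
qed

text \<open>Binary digits rewritten in base 3: a right inverse of the Cantor staircase, injecting
  \<open>[0,1)\<close> into a null set. \<open>cantor_unembed\<close> is the staircase on that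
  set.\<close>

definition cantor_embed :: "real \<Rightarrow> real" where
  "cantor_embed s = encode_bits (binary_bit s)"

definition cantor_unembed :: "real \<Rightarrow> real" where
  "cantor_unembed r = binary_value (ternary_bit r)"

lemma cantor_embed_measurable [measurable]: "cantor_embed \<in> borel_measurable borel"
  unfolding cantor_embed_def by measurable

lemma cantor_unembed_measurable [measurable]: "cantor_unembed \<in> borel_measurable borel"
  unfolding cantor_unembed_def by measurable

lemma ternary_bit_encode_bits: "ternary_bit (encode_bits b) = b"
  by (simp add: fun_eq_iff ternary_bit_encode)

lemma cantor_embed_props:
  "cantor_embed s \<in> cantor" "0 \<le> cantor_embed s" "cantor_embed s \<le> 1/2"
  "s \<in> {0..<1} \<Longrightarrow> cantor_unembed (cantor_embed s) = s"
  unfolding cantor_embed_def cantor_unembed_def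
  using encode_bits_bounds by (auto simp: cantor_def ternary_bit_encode_bits binary_value_binary_bit)

lemma real_distribution_distr:
  "prob_space M \<Longrightarrow> f \<in> borel_measurable M \<Longrightarrow> real_distribution (distr M borel f)"
  unfolding real_distribution_def real_distribution_axioms_def by (auto intro: prob_space.prob_space_distr)

text \<open>Translates of the Cantor measure: by Fubini some translate gives full measure to \<open>A\<close>, and
  the quantile function of its restriction to a compact subset of \<open>A\<close> is the injection.\<close>

lemma null_borel_injection:
  fixes A :: "real set"
  assumes A [measurable]: "A \<in> sets borel" and sub: "A \<subseteq> {0..<1}" and full: "emeasure lborel ({0..<1} - A) = 0"
  shows "\<exists>Z J J'. Z \<in> sets borel \<and> emeasure lborel Z = 0 \<and> J \<in> borel_measurable borel \<and>
           J' \<in> borel_measurable borel \<and> (\<forall>u\<in>{0..<1::real}. J u \<in> A \<inter> Z \<and> J' (J u) = u)"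
proof -
  interpret U: prob_space unit_space by (rule prob_space_unit)
  \<comment> \<open>Codes are at most 1/2, so a translation by less than 1/2 keeps them inside
    \<open>[0,1)\<close>, where \<open>A\<close> has full measure.\<close>
  let ?Q = "\<lambda>s t :: real. t \<in> {0..<1/2} \<longrightarrow> t + cantor_embed s \<in> A"
  have "AE t in lborel. ?Q s t" for s
  proof -
    have "AE x in lborel. x \<notin> {0..<1} - A" by (rule AE_not_in) (simp add: null_sets_def full)
    then have "AE x in distr lborel borel ((+) (cantor_embed s)). x \<notin> {0..<1} - A"
      by (simp only: lborel_distr_plus)
    then have "AE t in lborel. cantor_embed s + t \<notin> {0..<1} - A" by (subst (asm) AE_distr_iff) auto
    then show ?thesis
    proof eventually_elim
      case (elim t)
      then show ?case using cantor_embed_props(2,3)[of s] by (auto simp: add.commute)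
    qed
  qed
  then have "AE s in lborel. AE t in lborel. ?Q s t" by simp
  moreover have "{x \<in> space (lborel \<Otimes>\<^sub>M lborel). ?Q (fst x) (snd x)} \<in> sets (lborel \<Otimes>\<^sub>M lborel)"
    by measurable
  ultimately have "AE t in lborel. AE s in lborel. ?Q s t"
    by (simp only: lborel_pair.AE_commute)
  moreover have "\<not> (AE t in lborel. t \<notin> {0..<1/2::real})"
    using AE_iff_null_sets[of "{0..<1/2::real}" lborel] by (simp add: null_sets_def)
  ultimately obtain t where t: "t \<in> {0..<1/2::real}" "AE s in lborel. t + cantor_embed s \<in> A"
    by (metis (mono_tags, lifting) AE_mp AE_I2)
  \<comment> \<open>The Cantor set translated by \<open>t\<close>: a null set on which the
    translated Cantor measure is concentrated.\<close>
  define Z where "Z = ((+) (- t)) -` cantor \<inter> space borel"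
  have Zm [measurable]: "Z \<in> sets borel" unfolding Z_def by measurable
  have Z0: "emeasure lborel Z = 0"
  proof -
    have "emeasure lborel Z = emeasure (distr lborel borel ((+) (- t))) cantor"
      unfolding Z_def by (subst emeasure_distr) auto
    then show ?thesis by (simp only: lborel_distr_plus cantor_null)
  qed
  define \<kappa> where "\<kappa> = distr unit_space borel (\<lambda>s. t + cantor_embed s)"
  have fm: "(\<lambda>s. t + cantor_embed s) \<in> borel_measurable unit_space"
    by (rule measurable_unitI) measurable
  interpret \<kappa>: real_distribution \<kappa>
    unfolding \<kappa>_def by (rule real_distribution_distr[OF prob_space_unit fm])
  have \<kappa>0: "emeasure \<kappa> {y} = 0" for y
  proof -
    have "(\<lambda>s. t + cantor_embed s) -` {y} \<inter> {0..<1} \<subseteq> {cantor_unembed (y - t)}"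
      using cantor_embed_props(4) by auto
    then have "emeasure lborel ((\<lambda>s. t + cantor_embed s) -` {y} \<inter> {0..<1}) \<le> emeasure lborel {cantor_unembed (y - t)}"
      by (intro emeasure_mono) auto
    then have "emeasure lborel ((\<lambda>s. t + cantor_embed s) -` {y} \<inter> {0..<1}) = 0" by simp
    then have "emeasure unit_space ((\<lambda>s. t + cantor_embed s) -` {y} \<inter> {0..<1}) = 0"
      by (subst emeasure_restrict_space) auto
    then show ?thesis unfolding \<kappa>_def using fm by (simp add: emeasure_distr)
  qed
  have kA: "emeasure \<kappa> (A \<inter> Z) = 1"
  proof -
    have "AE y in \<kappa>. y \<in> A \<inter> Z" unfolding \<kappa>_def
      by (subst AE_distr_iff[OF fm]) (use t(2) cantor_embed_props(1) in \<open>auto simp: AE_unit_iff Z_def\<close>)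
    then show ?thesis using \<kappa>.emeasure_eq_1_AE[of "A \<inter> Z"] by simp
  qed
  \<comment> \<open>A compact subset is needed because only for a closed set of full measure does
    every quantile lie in the set.\<close>
  have "emeasure \<kappa> (A \<inter> Z) = (SUP K \<in> {K. K \<subseteq> A \<inter> Z \<and> compact K}. emeasure \<kappa> K)"
    by (rule inner_regular) (use \<kappa>.emeasure_space_1 in auto)
  then have "0 < (SUP K \<in> {K. K \<subseteq> A \<inter> Z \<and> compact K}. emeasure \<kappa> K)" using kA by simp
  then obtain K where K: "K \<subseteq> A \<inter> Z" "compact K" "0 < emeasure \<kappa> K" by (auto simp: less_SUP_iff)
  have Km [measurable]: "K \<in> sets borel" using K(2) by (simp add: borel_compact)
  define \<nu> where "\<nu> = uniform_measure \<kappa> K"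
  have Kfin: "emeasure \<kappa> K \<noteq> \<infinity>" "emeasure \<kappa> K \<noteq> 0" using K(3) \<kappa>.emeasure_finite by auto
  have "real_distribution \<nu>"
    unfolding \<nu>_def real_distribution_def real_distribution_axioms_def
    using prob_space_uniform_measure[OF Kfin(2,1)] by simp
  then interpret \<nu>: cdf_distribution \<nu> unfolding cdf_distribution_def .
  have "emeasure \<nu> {y} \<le> 0" for y
  proof -
    have "emeasure \<kappa> (K \<inter> {y}) \<le> emeasure \<kappa> {y}" by (intro emeasure_mono) auto
    then show ?thesis unfolding \<nu>_def using \<kappa>0[of y] by (simp add: emeasure_uniform_measure)
  qed
  then have \<nu>0: "measure \<nu> {y} = 0" for y by (simp add: measure_def)
  have \<nu>K: "measure \<nu> K = 1"
    unfolding \<nu>_def using Kfin by (simp add: measure_uniform_measure \<kappa>.emeasure_eq_measure)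
  \<comment> \<open>The levels \<open>(u + 1) / 3\<close> stay in \<open>[1/3, 2/3)\<close>, away
    from 0 and 1, where quantiles need not be finite.\<close>
  define J where "J u = (if u \<in> {0..<1} then \<nu>.I ((u + 1) / 3) else 0)" for u :: real
  define J' where "J' y = 3 * cdf \<nu> y - 1" for y
  have c: "closed K" using K(2) by (rule compact_imp_closed)
  have inK: "J u \<in> K" if "u \<in> {0..<1}" for u
    using \<nu>.I_in_closed[OF _ _ c \<nu>K, of "(u + 1) / 3"] that by (simp add: J_def)
  have inv: "J' (J u) = u" if "u \<in> {0..<1}" for u
    using \<nu>.cdf_I[OF _ _ \<nu>0, of "(u + 1) / 3"] that by (simp add: J_def J'_def)
  have Jm: "J \<in> borel_measurable borel"
  proof -
    have "(\<lambda>u. (u + 1) / 3) \<in> restrict_space borel {0..<1} \<rightarrow>\<^sub>M restrict_space borel {0<..<1::real}"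
      by (rule measurable_restrict_space2) (auto simp: space_restrict_space intro!: measurable_restrict_space1)
    then have "(\<lambda>u. \<nu>.I ((u + 1) / 3)) \<in> borel_measurable (restrict_space borel {0..<1})"
      by (rule measurable_compose) (rule \<nu>.measurable_CI)
    then show ?thesis unfolding J_def
      by (intro measurable_If_restrict_space_iff[THEN iffD2] conjI) (simp_all only: Collect_mem_eq, simp_all)
  qed
  have J'm: "J' \<in> borel_measurable borel" unfolding J'_def by measurable
  show ?thesis
    using Zm Z0 Jm J'm inK K(1) inv by (intro exI[of _ Z] exI[of _ J] exI[of _ J']) auto
qed


section \<open>Isomorphism of atomless standard spaces with the unit interval\<close>

lemma distr_cong_AE':
  assumes "f \<in> M \<rightarrow>\<^sub>M N" "g \<in> M \<rightarrow>\<^sub>M N" "AE x in M. f x = g x"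
  shows "distr M N f = distr M N g"
  by (rule measure_eqI)
     (use assms in \<open>auto simp: emeasure_distr intro!: emeasure_eq_AE\<close>)

text \<open>The logistic function and its inverse, which bring arbitrary reals into the range where
  binary digits can be read off and reassembled.\<close>

lemma squash_real:
  obtains s s' :: "real \<Rightarrow> real" where "s \<in> borel_measurable borel" "s' \<in> borel_measurable borel"
    "\<And>r. s r \<in> {0..<1}" "\<And>r. s' (s r) = r"
proof
  show "(\<lambda>r::real. 1 / (1 + exp (- r))) \<in> borel_measurable borel" by measurable
  show "(\<lambda>y::real. - ln (1 / y - 1)) \<in> borel_measurable borel" by measurable
  show "1 / (1 + exp (- r)) \<in> {0..<1}" for r :: real by (auto simp: field_simps add_pos_pos)
  show "- ln (1 / (1 / (1 + exp (- r))) - 1) = r" for r :: real by simp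
qed

text \<open>The distribution and quantile functions of the code \<open>\<phi>\<close> are inverse up
  to null sets only. In each direction the exceptional points are rerouted injectively into a null
  set disjoint from the other values, which yields two genuine embeddings for the
  Schroeder-Bernstein argument.\<close>

lemma mp_iso_unit_exists:
  assumes prob: "prob_space M" and ret: "borel_retract M"
    and atomless: "\<And>x. x \<in> space M \<Longrightarrow> emeasure M {x} = 0"
  shows "\<exists>h h'. mp_iso unit_space M h h'"
proof -
  interpret M: prob_space M by (rule prob)
  interpret U: prob_space unit_space by (rule prob_space_unit)
  obtain \<phi> :: "_ \<Rightarrow> real" and \<psi> where [measurable]: "\<phi> \<in> borel_measurable M" "\<psi> \<in> borel \<rightarrow>\<^sub>M M"
    and inv: "\<And>x. x \<in> space M \<Longrightarrow> \<psi> (\<phi> x) = x"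
    using ret unfolding borel_retract_def by blast
  have \<psi>sp: "\<psi> r \<in> space M" for r using measurable_space[OF \<open>\<psi> \<in> borel \<rightarrow>\<^sub>M M\<close>] by simp
  define \<mu> where "\<mu> = distr M borel \<phi>"
  have "real_distribution \<mu>" unfolding \<mu>_def by (rule real_distribution_distr[OF prob]) simp
  then interpret \<mu>: cdf_distribution \<mu> unfolding cdf_distribution_def .
  have "emeasure \<mu> {r} = 0" for r
  proof -
    have "emeasure \<mu> {r} = emeasure M (\<phi> -` {r} \<inter> space M)" unfolding \<mu>_def by (simp add: emeasure_distr)
    also have "\<dots> = 0"
    proof (cases "\<phi> -` {r} \<inter> space M = {}")
      case False
      then obtain x where "x \<in> space M" "\<phi> x = r" by auto
      have "y = x" if "y \<in> space M" "\<phi> y = r" for y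
        using inv[OF \<open>x \<in> space M\<close>] inv[OF that(1)] that(2) \<open>\<phi> x = r\<close> by simp
      then have "\<phi> -` {r} \<inter> space M = {x}" using \<open>x \<in> space M\<close> \<open>\<phi> x = r\<close> by blast
      then show ?thesis using atomless[OF \<open>x \<in> space M\<close>] by simp
    qed simp
    finally show ?thesis .
  qed
  then have \<mu>0: "measure \<mu> {r} = 0" for r by (simp add: measure_def)
  define C where "C = cdf \<mu>"
  have Cm [measurable]: "C \<in> borel_measurable borel" unfolding C_def by measurable
  define I where "I u = (if u \<in> {0<..<1} then \<mu>.I u else 0)" for u :: real
  have Im [measurable]: "I \<in> borel_measurable borel"
    unfolding I_def using \<mu>.measurable_CI
    by (intro measurable_If_restrict_space_iff[THEN iffD2] conjI) (simp_all only: Collect_mem_eq, simp_all)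
  have CI: "C (I u) = u" if "u \<in> {0<..<1}" for u
    using \<mu>.cdf_I[OF _ _ \<mu>0, of u] that by (simp add: C_def I_def)
  have dI: "distr unit_space borel I = \<mu>"
  proof -
    have "distr unit_space borel I = distr (distr unit_space borel (\<lambda>u. u)) borel I"
      by (subst distr_distr) (auto simp: o_def intro: measurable_unitI)
    also have "\<dots> = distr (restrict_space lborel {0<..<1}) borel I"
      unfolding distr_unit_Ioo by (subst distr_distr) (auto simp: o_def intro: measurable_restrict_space1)
    also have "\<dots> = distr (restrict_space lborel {0<..<1}) borel \<mu>.I"
      by (rule distr_cong) (auto simp: space_restrict_space I_def)
    finally show ?thesis by (simp add: \<mu>.distr_I_eq_M)
  qed
  have Im': "I \<in> borel_measurable unit_space" by (rule measurable_unitI) simp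
  have AE0: "AE u in unit_space. u \<noteq> 0"
    unfolding AE_unit_iff using AE_lborel_singleton[of "0::real"] by eventually_elim simp
  \<comment> \<open>The levels whose quantile is the code of a point of \<open>M\<close>. On
    \<open>A\<close> the map \<open>\<psi> (I u)\<close> is injective with inverse given by the
    distribution function.\<close>
  define A where "A = {u \<in> space borel. 0 < u \<and> u < 1 \<and> \<phi> (\<psi> (I u)) = I u}"
  have Am [measurable]: "A \<in> sets borel" unfolding A_def by measurable
  have Asub: "A \<subseteq> {0..<1}" and Ain: "u \<in> A \<Longrightarrow> u \<in> {0<..<1}" for u unfolding A_def by auto
  have AEA: "AE u in unit_space. u \<in> A"
  proof -
    have "AE r in \<mu>. \<phi> (\<psi> r) = r"
      unfolding \<mu>_def by (subst AE_distr_iff) (auto simp: inv)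
    then have "AE u in unit_space. \<phi> (\<psi> (I u)) = I u"
      unfolding dI[symmetric] by (subst (asm) AE_distr_iff[OF Im']) auto
    then show ?thesis using AE0 AE_space
      by eventually_elim (auto simp: A_def)
  qed
  have "emeasure lborel ({0..<1} - A) = 0"
  proof -
    have "AE u in lborel. u \<notin> {0..<1} - A" using AEA unfolding AE_unit_iff by eventually_elim auto
    then have "{0..<1} - A \<in> null_sets lborel" by (subst AE_iff_null_sets) auto
    then show ?thesis by auto
  qed
  then obtain Z J J' where [measurable]: "Z \<in> sets borel" "J \<in> borel_measurable borel" "J' \<in> borel_measurable borel"
    and Z0: "emeasure lborel Z = 0" and J: "\<And>u. u \<in> {0..<1::real} \<Longrightarrow> J u \<in> A \<inter> Z \<and> J' (J u) = u"
    using null_borel_injection[OF Am Asub] by (auto simp: Bex_def)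
  define clamp where "clamp v = (if v \<in> {0..<1} then v else 0)" for v :: real
  have clm: "clamp \<in> borel_measurable borel" unfolding clamp_def by measurable
  have clt: "(\<lambda>x. clamp (f x)) \<in> M \<rightarrow>\<^sub>M unit_space" if "f \<in> borel_measurable M" for f
    by (rule measurable_to_unitI) (use measurable_compose[OF that clm] in \<open>auto simp: clamp_def\<close>)
  \<comment> \<open>Points outside \<open>A - Z\<close> pass through \<open>J\<close> into
    \<open>A \<inter> Z\<close>. Whether the level \<open>C (\<phi> x)\<close> lies in
    \<open>Z\<close> tells the two kinds of values apart, so \<open>f'\<close> can undo
    both.\<close>
  define f where "f u = (if u \<in> A - Z then \<psi> (I u) else \<psi> (I (J u)))" for u
  define f' where "f' x = clamp (if C (\<phi> x) \<in> Z then J' (C (\<phi> x)) else C (\<phi> x))" for x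
  have fm: "f \<in> unit_space \<rightarrow>\<^sub>M M" unfolding f_def by (rule measurable_unitI) measurable
  have f'm: "f' \<in> M \<rightarrow>\<^sub>M unit_space" unfolding f'_def by (rule clt) measurable
  have 1: "mp_embedding unit_space M f f'"
  proof -
    have "C (\<phi> (\<psi> (I u))) = u" if "u \<in> A" for u
    proof -
      have "\<phi> (\<psi> (I u)) = I u" using that unfolding A_def by simp
      then show ?thesis using CI[OF Ain[OF that]] by simp
    qed
    then have "f' (f u) = u" if "u \<in> space unit_space" for u
      using J[of u] that Asub unfolding f_def f'_def by (auto simp: clamp_def)
    moreover have "distr unit_space M f = M"
    proof -
      have "AE u in lborel. u \<notin> Z" using Z0 by (intro AE_not_in) auto
      then have "AE u in unit_space. u \<notin> Z" unfolding AE_unit_iff by eventually_elim simp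
      then have "AE u in unit_space. f u = \<psi> (I u)" using AEA
        by eventually_elim (simp add: f_def)
      then have "distr unit_space M f = distr unit_space M (\<lambda>u. \<psi> (I u))"
        using fm by (intro distr_cong_AE') (auto intro!: measurable_unitI)
      also have "\<dots> = distr (distr unit_space borel I) M \<psi>"
        by (subst distr_distr) (auto simp: o_def Im')
      also have "\<dots> = distr M M (\<psi> \<circ> \<phi>)" unfolding dI \<mu>_def by (subst distr_distr) auto
      also have "\<dots> = distr M M (\<lambda>x. x)" by (rule distr_cong) (auto simp: inv)
      finally show ?thesis by (simp add: distr_id2)
    qed
    ultimately show ?thesis unfolding mp_embedding_def using fm f'm by simp
  qed
  obtain sq sq' :: "real \<Rightarrow> real" where [measurable]: "sq \<in> borel_measurable borel" "sq' \<in> borel_measurable borel"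
    and sq01: "\<And>r. sq r \<in> {0..<1}" and sq': "\<And>r. sq' (sq r) = r"
    using squash_real by blast
  \<comment> \<open>Good points avoid \<open>cantor\<close>; all others are encoded inside it by
    their own code \<open>\<phi> x\<close>. Membership in \<open>cantor\<close> then decides which
    branch \<open>g'\<close> has to invert.\<close>
  let ?good = "\<lambda>x. C (\<phi> x) \<in> {0<..<1} \<and> I (C (\<phi> x)) = \<phi> x \<and> C (\<phi> x) \<notin> cantor"
  define g where "g x = (if ?good x then C (\<phi> x) else cantor_embed (sq (\<phi> x)))" for x
  define g' where "g' u = (if u \<in> cantor then \<psi> (sq' (cantor_unembed u)) else \<psi> (I u))" for u
  have gm: "g \<in> M \<rightarrow>\<^sub>M unit_space"
  proof (rule measurable_to_unitI)
    show "g \<in> borel_measurable M" unfolding g_def by measurable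
    show "g x \<in> {0..<1}" for x
      using cantor_embed_props(2,3)[of "sq (\<phi> x)"] unfolding g_def by auto
  qed
  have g'm: "g' \<in> unit_space \<rightarrow>\<^sub>M M" unfolding g'_def by (rule measurable_unitI) measurable
  have 2: "mp_embedding M unit_space g g'"
  proof -
    have "g' (g x) = x" if "x \<in> space M" for x
      using cantor_embed_props(1,4)[of "sq (\<phi> x)"] sq01[of "\<phi> x"] inv[OF that]
      unfolding g_def g'_def by (auto simp: sq')
    moreover have "distr M unit_space g = unit_space"
    proof -
      have "AE u in lborel. u \<notin> cantor" using cantor_null by (intro AE_not_in) auto
      then have "AE u in unit_space. u \<notin> cantor" unfolding AE_unit_iff by eventually_elim simp
      then have "AE u in unit_space. C (I u) \<in> {0<..<1} \<and> I (C (I u)) = I u \<and> C (I u) \<notin> cantor"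
        using AE0 AE_space by eventually_elim (auto simp: CI)
      then have "AE r in distr unit_space borel I. C r \<in> {0<..<1} \<and> I (C r) = r \<and> C r \<notin> cantor"
        by (subst AE_distr_iff[OF Im']) auto
      then have "AE x in M. ?good x" unfolding dI \<mu>_def by (subst (asm) AE_distr_iff) auto
      then have AEg: "AE x in M. g x = clamp (C (\<phi> x))" by eventually_elim (simp add: g_def clamp_def)
      have cm: "clamp \<in> borel \<rightarrow>\<^sub>M unit_space" by (rule measurable_to_unitI[OF clm]) (auto simp: clamp_def)
      have "distr M unit_space g = distr M unit_space (\<lambda>x. clamp (C (\<phi> x)))"
        by (intro distr_cong_AE' gm clt AEg) measurable
      also have "\<dots> = distr \<mu> unit_space (\<lambda>r. clamp (C r))"
        unfolding \<mu>_def by (subst distr_distr) (auto simp: o_def intro!: measurable_compose[OF Cm cm])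
      also have "\<dots> = distr (distr unit_space borel I) unit_space (\<lambda>r. clamp (C r))" unfolding dI ..
      also have "\<dots> = distr unit_space unit_space (\<lambda>u. clamp (C (I u)))"
        by (subst distr_distr) (auto simp: o_def Im' intro!: measurable_compose[OF Cm cm])
      also have "\<dots> = distr unit_space unit_space (\<lambda>u. u)"
      proof (rule distr_cong_AE')
        show "AE u in unit_space. clamp (C (I u)) = u"
          using AE0 AE_space by eventually_elim (simp add: CI clamp_def)
      qed (auto intro!: measurable_unitI measurable_compose[OF _ cm])
      finally show ?thesis by (simp add: distr_id2)
    qed
    ultimately show ?thesis unfolding mp_embedding_def using gm g'm by simp
  qed
  show ?thesis by (rule mp_schroeder_bernstein[OF 1 2 borel_retract_unit ret])
qed

text \<open>The code of \<open>x\<close> records which basic open sets contain \<open>x\<close>. To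
  decode, one picks for each \<open>m\<close> a point from a recorded basic set of diameter about
  \<open>1 / (m + 1)\<close> and passes to the limit, which exists by completeness whenever the
  chosen points form a Cauchy sequence.\<close>

lemma standard_borel_imp_retract:
  assumes sb: "standard_borel M" and ne: "space M \<noteq> {}"
  shows "borel_retract M"
proof -
  obtain X where X: "completely_metrizable_space X" "second_countable X" "topspace X = space M"
      "sets M = sigma_sets (topspace X) {U. openin X U}"
    using sb unfolding standard_borel_def by blast
  obtain S d where "Metric_space S d" and mc: "Metric_space.mcomplete S d"
      and Xd: "X = Metric_space.mtopology S d"
    using X(1) unfolding completely_metrizable_space_def by blast
  then interpret Metric_space S d by simp
  have S: "space M = S" using X(3) Xd by simp
  obtain \<B> where \<B>: "countable \<B>" "\<And>V. V \<in> \<B> \<Longrightarrow> openin X V"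
      "\<And>U x. openin X U \<Longrightarrow> x \<in> U \<Longrightarrow> \<exists>V\<in>\<B>. x \<in> V \<and> V \<subseteq> U"
    using X(2) unfolding second_countable_def by metis
  obtain x0 where x0: "x0 \<in> S" using ne S by auto
  define B where "B = from_nat_into \<B>"
  have "\<B> \<noteq> {}" using \<B>(3)[of "topspace X" x0] x0 X(3) S by auto
  then have Bopen: "openin X (B i)" for i unfolding B_def by (intro \<B>(2) from_nat_into)
  have Bbase: "\<exists>i. x \<in> B i \<and> B i \<subseteq> U" if "openin X U" "x \<in> U" for U x
  proof -
    obtain V where "V \<in> \<B>" "x \<in> V" "V \<subseteq> U" using \<B>(3) \<open>openin X U\<close> \<open>x \<in> U\<close> by blast
    moreover obtain i where "B i = V" unfolding B_def using from_nat_into_surj[OF \<B>(1) \<open>V \<in> \<B>\<close>] by blast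
    ultimately show ?thesis by blast
  qed
  have Bm [measurable]: "B i \<in> sets M" for i unfolding X(4) using Bopen by auto
  have BS: "B i \<subseteq> S" for i using openin_subset[OF Bopen] X(3) S by auto
  define \<phi> where "\<phi> x = encode_bits (\<lambda>i. x \<in> B i)" for x
  have \<phi>m: "\<phi> \<in> borel_measurable M" unfolding \<phi>_def by measurable
  define small where "small m i \<longleftrightarrow> (\<forall>u\<in>B i. \<forall>v\<in>B i. d u v < 1 / real (Suc m)) \<and> B i \<noteq> {}" for m i :: nat
  define p where "p i = (case i of 0 \<Rightarrow> x0 | Suc j \<Rightarrow> if B j = {} then x0 else (SOME x. x \<in> B j))" for i
  have pS: "p i \<in> S" for i
    unfolding p_def using x0 BS some_in_eq[of "B _"] by (auto split: nat.split)
  \<comment> \<open>Indices are shifted by one: the value 0 means that \<open>r\<close> records no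
    small basic set and selects the default point \<open>x0\<close> through
    \<open>p 0\<close>.\<close>
  define sel where "sel m r = (if \<exists>i. ternary_bit r i \<and> small m i then Suc (LEAST i. ternary_bit r i \<and> small m i) else 0)" for m :: nat and r :: real
  have selm [measurable]: "sel m \<in> borel \<rightarrow>\<^sub>M count_space UNIV" for m
    unfolding sel_def by measurable
  define y where "y r m = p (sel m r)" for r m
  have yS: "y r m \<in> S" for r m unfolding y_def by (rule pS)
  have sel_\<phi>: "d (y (\<phi> x) m) x < 1 / real (Suc m)" if x: "x \<in> S" for x m
  proof -
    let ?e = "1 / real (Suc m) / 2"
    have "openin X (mball x ?e)" "x \<in> mball x ?e" unfolding Xd using x by auto
    then obtain i where i: "x \<in> B i" "B i \<subseteq> mball x ?e" using Bbase by blast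
    have "small m i" unfolding small_def
    proof (intro conjI ballI)
      fix u v assume uv: "u \<in> B i" "v \<in> B i"
      then have "d x u < ?e" "d x v < ?e" "u \<in> S" "v \<in> S" using i by auto
      then have "d u v < ?e + ?e"
        using triangle[of u x v] x commute[of u x] by linarith
      then show "d u v < 1 / real (Suc m)" by (simp only: field_sum_of_halves)
    qed (use i in auto)
    have bit: "ternary_bit (\<phi> x) j \<longleftrightarrow> x \<in> B j" for j unfolding \<phi>_def by (rule ternary_bit_encode)
    then have ex: "\<exists>i. ternary_bit (\<phi> x) i \<and> small m i" using i \<open>small m i\<close> by blast
    define j where "j = (LEAST i. ternary_bit (\<phi> x) i \<and> small m i)"
    have j: "x \<in> B j" "small m j" using LeastI_ex[OF ex] bit unfolding j_def by auto
    have "y (\<phi> x) m = (SOME z. z \<in> B j)"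
      unfolding y_def sel_def p_def using ex j by (auto simp: j_def[symmetric])
    then have "y (\<phi> x) m \<in> B j" using j(1) by (metis someI)
    then show ?thesis using j unfolding small_def by blast
  qed
  \<comment> \<open>The Cauchy property in countably many quantifiers, so that the domain on which
    the limit is taken is a Borel set.\<close>
  define cv where "cv r \<longleftrightarrow> (\<forall>k. \<exists>N. \<forall>m\<ge>N. \<forall>n\<ge>N. d (y r m) (y r n) < 1 / real (Suc k))" for r
  have cvm [measurable]: "Measurable.pred borel cv"
  proof -
    have [measurable]: "Measurable.pred borel (\<lambda>r. d (p (sel m r)) (p (sel n r)) < c)" for m n c
      by measurable
    show ?thesis unfolding cv_def y_def by measurable
  qed
  have cvl: "\<exists>l. limitin mtopology (y r) l sequentially" if c: "cv r" for r
  proof -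
    have "MCauchy (y r)" unfolding MCauchy_def
    proof (intro conjI allI impI)
      show "range (y r) \<subseteq> S" using yS by auto
      fix e :: real assume "0 < e"
      then obtain k where k: "1 / real (Suc k) < e" using nat_approx_posE by blast
      then show "\<exists>N. \<forall>n n'. N \<le> n \<longrightarrow> N \<le> n' \<longrightarrow> d (y r n) (y r n') < e"
        using c unfolding cv_def by (meson less_trans)
    qed
    then show ?thesis using mc unfolding mcomplete_def by blast
  qed
  define \<psi> where "\<psi> r = (if cv r then (SOME l. limitin mtopology (y r) l sequentially) else x0)" for r
  have lim\<psi>: "limitin mtopology (y r) (\<psi> r) sequentially" if "cv r" for r
    using someI_ex[OF cvl[OF that]] that unfolding \<psi>_def by simp
  have \<psi>S: "\<psi> r \<in> S" for r
    using lim\<psi>[of r] x0 by (cases "cv r") (auto simp: limitin_metric \<psi>_def)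
  have \<psi>m: "\<psi> \<in> borel \<rightarrow>\<^sub>M M"
  proof (rule measurable_sigma_sets[OF X(4)])
    show "{U. openin X U} \<subseteq> Pow (topspace X)" using openin_subset by auto
    show "\<psi> \<in> space borel \<rightarrow> topspace X" using \<psi>S X(3) S by auto
    fix U assume "U \<in> {U. openin X U}"
    then have U: "openin mtopology U" using Xd by simp
    \<comment> \<open>The limit lies in the open set \<open>U\<close> iff, for some fixed radius,
      the sequence eventually stays where the ball of that radius fits inside \<open>U\<close>. This
      is a countable combination of conditions on the selected indices.\<close>
    define Uk where "Uk k = {x \<in> S. mball x (1 / real (Suc k)) \<subseteq> U}" for k
    have iff: "\<psi> r \<in> U \<longleftrightarrow> (\<exists>k N. \<forall>m\<ge>N. y r m \<in> Uk k)" if "cv r" for r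
    proof
      assume "\<psi> r \<in> U"
      then obtain e where e: "e > 0" "mball (\<psi> r) e \<subseteq> U" using U unfolding openin_mtopology by blast
      then obtain k where k: "1 / real (Suc k) < e / 2" using nat_approx_posE[of "e/2"] by auto
      have "\<forall>\<^sub>F m in sequentially. y r m \<in> S \<and> d (y r m) (\<psi> r) < e / 2"
        using lim\<psi>[OF that] e(1) unfolding limitin_metric by (meson half_gt_zero)
      then obtain N where N: "\<And>m. m \<ge> N \<Longrightarrow> d (y r m) (\<psi> r) < e / 2"
        unfolding eventually_sequentially by blast
      have "y r m \<in> Uk k" if "m \<ge> N" for m
      proof -
        have "mball (y r m) (1 / real (Suc k)) \<subseteq> mball (\<psi> r) e"
        proof
          fix z assume z: "z \<in> mball (y r m) (1 / real (Suc k))"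
          then have "d (\<psi> r) z \<le> d (\<psi> r) (y r m) + d (y r m) z" using triangle[of "\<psi> r" "y r m" z] yS \<psi>S by auto
          also have "\<dots> < e" using N[OF that] k z commute[of "y r m" "\<psi> r"] by auto
          finally show "z \<in> mball (\<psi> r) e" using z \<psi>S by auto
        qed
        then show ?thesis unfolding Uk_def using yS e by auto
      qed
      then show "\<exists>k N. \<forall>m\<ge>N. y r m \<in> Uk k" by blast
    next
      assume "\<exists>k N. \<forall>m\<ge>N. y r m \<in> Uk k"
      then obtain k N where N: "\<And>m. m \<ge> N \<Longrightarrow> y r m \<in> Uk k" by blast
      have "\<forall>\<^sub>F m in sequentially. y r m \<in> S \<and> d (y r m) (\<psi> r) < 1 / real (Suc k)"
        using lim\<psi>[OF that] unfolding limitin_metric by simp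
      then obtain N' where N': "\<And>m. m \<ge> N' \<Longrightarrow> d (y r m) (\<psi> r) < 1 / real (Suc k)"
        unfolding eventually_sequentially by blast
      let ?m = "max N N'"
      have "\<psi> r \<in> mball (y r ?m) (1 / real (Suc k))" using N'[of ?m] yS \<psi>S by auto
      then show "\<psi> r \<in> U" using N[of ?m] unfolding Uk_def by auto
    qed
    have "\<psi> -` U \<inter> space borel = {r \<in> space borel. if cv r then (\<exists>k N. \<forall>m\<ge>N. p (sel m r) \<in> Uk k) else x0 \<in> U}"
    proof (intro set_eqI)
      fix r
      show "r \<in> \<psi> -` U \<inter> space borel \<longleftrightarrow> r \<in> {r \<in> space borel. if cv r then (\<exists>k N. \<forall>m\<ge>N. p (sel m r) \<in> Uk k) else x0 \<in> U}"
        using iff[of r] by (cases "cv r") (simp_all add: y_def \<psi>_def)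
    qed
    also have "\<dots> \<in> sets borel"
    proof -
      have [measurable]: "Measurable.pred borel (\<lambda>r. p (sel m r) \<in> Uk k)" for m k
        by (rule measurable_compose[OF selm]) simp
      show ?thesis by measurable
    qed
    finally show "\<psi> -` U \<inter> space borel \<in> sets borel" .
  qed
  have "\<psi> (\<phi> x) = x" if "x \<in> space M" for x
  proof -
    have x: "x \<in> S" using that S by simp
    have lim: "limitin mtopology (y (\<phi> x)) x sequentially"
      unfolding limitin_metric
    proof (intro conjI x allI impI)
      fix e :: real assume "0 < e"
      then obtain k where k: "1 / real (Suc k) < e" using nat_approx_posE by blast
      have "d (y (\<phi> x) m) x < e" if "m \<ge> k" for m
      proof -
        have "1 / real (Suc m) \<le> 1 / real (Suc k)" using that by (simp add: field_simps)
        then show ?thesis using sel_\<phi>[OF x, of m] k by linarith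
      qed
      then show "\<forall>\<^sub>F m in sequentially. y (\<phi> x) m \<in> S \<and> d (y (\<phi> x) m) x < e"
        using yS unfolding eventually_sequentially by blast
    qed
    have "MCauchy (y (\<phi> x))" using lim yS by (intro convergent_imp_MCauchy) auto
    then have "cv (\<phi> x)" unfolding cv_def MCauchy_def by simp
    then show ?thesis using limitin_metric_unique[OF lim\<psi> lim] by simp
  qed
  then show ?thesis unfolding borel_retract_def
    by (intro exI[of _ \<phi>] exI[of _ \<psi>] conjI \<phi>m \<psi>m) simp
qed

text \<open>The binary digits of the two squashed codes are interleaved at even and odd
  positions.\<close>

lemma borel_retract_pair:
  assumes "borel_retract M" "borel_retract N"
  shows "borel_retract (M \<Otimes>\<^sub>M N)"
proof -
  obtain \<phi>1 :: "_ \<Rightarrow> real" and \<psi>1 where [measurable]: "\<phi>1 \<in> borel_measurable M" "\<psi>1 \<in> borel \<rightarrow>\<^sub>M M"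
    and 1: "\<And>x. x \<in> space M \<Longrightarrow> \<psi>1 (\<phi>1 x) = x"
    using assms(1) unfolding borel_retract_def by blast
  obtain \<phi>2 :: "_ \<Rightarrow> real" and \<psi>2 where [measurable]: "\<phi>2 \<in> borel_measurable N" "\<psi>2 \<in> borel \<rightarrow>\<^sub>M N"
    and 2: "\<And>x. x \<in> space N \<Longrightarrow> \<psi>2 (\<phi>2 x) = x"
    using assms(2) unfolding borel_retract_def by blast
  obtain s s' :: "real \<Rightarrow> real" where [measurable]: "s \<in> borel_measurable borel" "s' \<in> borel_measurable borel"
    and s01: "\<And>r. s r \<in> {0..<1}" and s's: "\<And>r. s' (s r) = r"
    using squash_real by blast
  define \<phi> where "\<phi> z = encode_bits (\<lambda>i. if even i then binary_bit (s (\<phi>1 (fst z))) (i div 2)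
     else binary_bit (s (\<phi>2 (snd z))) (i div 2))" for z
  define \<psi> where "\<psi> r = (\<psi>1 (s' (binary_value (\<lambda>i. ternary_bit r (2 * i)))), \<psi>2 (s' (binary_value (\<lambda>i. ternary_bit r (2 * i + 1)))))" for r
  have "\<phi> \<in> borel_measurable (M \<Otimes>\<^sub>M N)" unfolding \<phi>_def
  proof (rule measurable_encode_bits)
    show "Measurable.pred (M \<Otimes>\<^sub>M N) (\<lambda>z. if even i then binary_bit (s (\<phi>1 (fst z))) (i div 2) else binary_bit (s (\<phi>2 (snd z))) (i div 2))" for i :: nat
      by (cases "even i") simp_all
  qed
  moreover have "\<psi> \<in> borel \<rightarrow>\<^sub>M M \<Otimes>\<^sub>M N" unfolding \<psi>_def by measurable
  moreover have "\<psi> (\<phi> z) = z" if "z \<in> space (M \<Otimes>\<^sub>M N)" for z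
  proof -
    have "(\<lambda>i. ternary_bit (\<phi> z) (2 * i)) = binary_bit (s (\<phi>1 (fst z)))"
      "(\<lambda>i. ternary_bit (\<phi> z) (2 * i + 1)) = binary_bit (s (\<phi>2 (snd z)))"
      unfolding \<phi>_def ternary_bit_encode by (auto simp: fun_eq_iff)
    then show ?thesis using that s01[of "\<phi>1 (fst z)"] s01[of "\<phi>2 (snd z)"]
      by (auto simp: \<psi>_def binary_value_binary_bit s's 1 2 space_pair_measure)
  qed
  ultimately show ?thesis unfolding borel_retract_def by blast
qed


section \<open>Cut distance to a graph\<close>

lemma vertex_part_iff:
  assumes "n > 0" "v \<ge> 1"
  shows "x \<in> vertex_part n v \<longleftrightarrow> real n * x - (real v - 1) \<in> {0..<1}"
  using assms by (auto simp: vertex_part_def field_simps)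

lemma vertex_part_unit: "v \<in> {1..n} \<Longrightarrow> vertex_part n v \<subseteq> {0..<1}"
  by (auto simp: vertex_part_def divide_simps)

lemma vertex_part_disjoint:
  assumes "v \<in> {1..n}" "w \<in> {1..n}" "x \<in> vertex_part n v" "x \<in> vertex_part n w"
  shows "v = w"
  using assms by (auto simp: vertex_part_iff)

lemma vertex_part_cover:
  assumes "x \<in> {0..<1::real}" "n > 0"
  shows "\<exists>v\<in>{1..n}. x \<in> vertex_part n v"
proof -
  define v where "v = nat \<lfloor>real n * x\<rfloor> + 1"
  have 0: "0 \<le> real n * x" "real n * x < real n" using assms by auto
  then have "\<lfloor>real n * x\<rfloor> < int n" by linarith
  then have "nat \<lfloor>real n * x\<rfloor> < n" using assms(2) by linarith
  then have "v \<in> {1..n}" unfolding v_def by auto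
  moreover have "x \<in> vertex_part n v"
  proof -
    have rv: "real v - 1 = of_int \<lfloor>real n * x\<rfloor>" using 0 by (simp add: v_def)
    have "v \<ge> 1" by (simp add: v_def)
    moreover have "0 \<le> real n * x - of_int \<lfloor>real n * x\<rfloor>" "real n * x - of_int \<lfloor>real n * x\<rfloor> < 1" by linarith+
    ultimately show ?thesis by (subst vertex_part_iff[OF assms(2)]) (auto simp: rv)
  qed
  ultimately show ?thesis by blast
qed

lemma emeasure_affine_preimage:
  assumes T [measurable]: "T \<in> sets borel" and c: "c > 0"
  shows "emeasure lborel ((\<lambda>x. t + c * x) -` T) = emeasure lborel T / ennreal c"
proof -
  have "emeasure lborel T = emeasure (density (distr lborel borel (\<lambda>x. t + c * x)) (\<lambda>_. ennreal \<bar>c\<bar>)) T"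
    using lborel_real_affine[of c t] c by simp
  also have "\<dots> = ennreal c * emeasure lborel ((\<lambda>x. t + c * x) -` T)"
    using c by (subst emeasure_density_const) (auto simp: emeasure_distr)
  finally show ?thesis
    using c by (simp add: ennreal_mult_divide_eq mult.commute[of "ennreal c"] ennreal_zero_less_divide)
qed

text \<open>Each \<open>A v\<close> with normalised Lebesgue measure is itself an atomless Borel
  retract, hence isomorphic to the unit interval; these maps, rescaled to the consecutive intervals
  of length \<open>1 / n\<close>, are pasted together. Any partition into \<open>n\<close> Borel
  sets of equal measure can thus serve as the vertex parts of a graph.\<close>

lemma mp_iso_glue:
  fixes A :: "nat \<Rightarrow> real set"
  assumes n: "n > 0" and A [measurable]: "\<And>v. A v \<in> sets borel" and sub: "\<And>v. A v \<subseteq> {0..<1}"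
    and cover: "(\<Union>v\<in>{1..n}. A v) = {0..<1}" and disj: "disjoint_family_on A {1..n}"
    and meas: "\<And>v. v \<in> {1..n} \<Longrightarrow> emeasure lborel (A v) = ennreal (1 / n)"
  shows "\<exists>g g'. mp_iso unit_space unit_space g g' \<and> (\<forall>v\<in>{1..n}. \<forall>x\<in>vertex_part n v. g x \<in> A v)"
proof -
  have cov: "\<exists>v\<in>{1..n}. y \<in> A v" if "y \<in> {0..<1}" for y
    using that unfolding cover[symmetric] by blast
  define N where "N v = restrict_space (uniform_measure lborel (A v)) (A v)" for v
  have spN: "space (N v) = A v" for v unfolding N_def by (auto simp: space_restrict_space)
  have emN: "emeasure (N v) S = emeasure lborel S * ennreal n" if "S \<in> sets borel" "S \<subseteq> A v" "v \<in> {1..n}" for v S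
  proof -
    have "emeasure (N v) S = emeasure lborel (A v \<inter> S) / emeasure lborel (A v)"
      unfolding N_def using that by (simp add: emeasure_restrict_space)
    also have "A v \<inter> S = S" using that by auto
    also have "emeasure lborel S / emeasure lborel (A v) = emeasure lborel S * ennreal n"
      unfolding meas[OF that(3)] using n by (simp add: divide_ennreal_def inverse_ennreal)
    finally show ?thesis .
  qed
  have "\<exists>h h'. mp_iso unit_space (N v) h h'" if v: "v \<in> {1..n}" for v
  proof (rule mp_iso_unit_exists)
    show "prob_space (N v)"
    proof (rule prob_spaceI)
      show "emeasure (N v) (space (N v)) = 1" unfolding spN
        using emN[OF A order_refl v] meas[OF v] n by (simp add: ennreal_mult'[symmetric])
    qed
    have "A v \<noteq> {}" using meas[OF v] n by auto
    then obtain a where a: "a \<in> A v" by auto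
    have "(\<lambda>x. x) \<in> borel_measurable (N v)"
      unfolding N_def by (rule measurable_restrict_space1) simp
    moreover have "(\<lambda>x. if x \<in> A v then x else a) \<in> borel \<rightarrow>\<^sub>M N v"
      unfolding N_def using a by (intro measurable_restrict_space2) auto
    ultimately show "borel_retract (N v)"
      unfolding borel_retract_def using spN by fastforce
    fix x assume "x \<in> space (N v)"
    then show "emeasure (N v) {x} = 0" using emN[OF _ _ v, of "{x}"] spN by simp
  qed
  then obtain h h' where h: "\<And>v. v \<in> {1..n} \<Longrightarrow> mp_iso unit_space (N v) (h v) (h' v)" by metis
  have hA: "h v z \<in> A v" if "v \<in> {1..n}" "z \<in> {0..<1}" for v z
    using measurable_space[OF mp_isoD(1)[OF h[OF that(1)]], of z] that spN by simp
  have h'A: "h' v z \<in> {0..<1}" if "v \<in> {1..n}" "z \<in> A v" for v z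
    using measurable_space[OF mp_isoD(2)[OF h[OF that(1)]], of z] that spN by simp
  define H where "H v z = (if z \<in> {0..<1} then h v z else 0)" for v z
  define H' where "H' v z = (if z \<in> A v then h' v z else 0)" for v z
  have Hm: "H v \<in> borel_measurable borel" if v: "v \<in> {1..n}" for v
  proof -
    have "h v \<in> borel_measurable (restrict_space borel {0..<1})"
      using mp_isoD(1)[OF h[OF v]] unfolding measurable_unit_eq N_def
      by (auto dest!: measurable_restrict_space2_iff[THEN iffD1] simp: measurable_cong_sets[OF refl sets_uniform_measure])
    then show ?thesis unfolding H_def
      by (intro measurable_If_restrict_space_iff[THEN iffD2] conjI) (simp_all only: Collect_mem_eq, simp_all)
  qed
  have H'm: "H' v \<in> borel_measurable borel" if v: "v \<in> {1..n}" for v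
  proof -
    have "h' v \<in> borel_measurable (N v)"
      using mp_isoD(2)[OF h[OF v]] by (rule measurable_from_unit)
    then have "h' v \<in> borel_measurable (restrict_space borel (A v))"
      unfolding N_def by (subst (asm) measurable_cong_sets[OF _ refl, of _ "restrict_space borel (A v)"]) (auto simp: sets_restrict_space)
    then show ?thesis unfolding H'_def
      by (intro measurable_If_restrict_space_iff[THEN iffD2] conjI) (simp_all only: Collect_mem_eq, simp_all)
  qed
  define g where "g x = (\<Sum>v\<in>{1..n}. indicator (vertex_part n v) x * H v (real n * x - (real v - 1)))" for x
  define g' where "g' y = (\<Sum>v\<in>{1..n}. indicator (A v) y * ((real v - 1 + H' v y) / real n))" for y
  have g: "g x = h v (real n * x - (real v - 1))" if "v \<in> {1..n}" "x \<in> vertex_part n v" for x v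
  proof -
    have 0: "x \<notin> vertex_part n w" if "w \<in> {1..n} - {v}" for w
      using vertex_part_disjoint[of w n v x] that \<open>v \<in> {1..n}\<close> \<open>x \<in> vertex_part n v\<close> by blast
    have "g x = (\<Sum>w\<in>{v}. indicator (vertex_part n w) x * H w (real n * x - (real w - 1)))"
      unfolding g_def using that(1)
      by (intro sum.mono_neutral_right ballI) (simp_all add: 0)
    then show ?thesis using that vertex_part_iff[OF n, of v x] by (simp add: H_def)
  qed
  have g': "g' y = (real v - 1 + h' v y) / real n" if "v \<in> {1..n}" "y \<in> A v" for y v
  proof -
    have 0: "y \<notin> A w" if "w \<in> {1..n} - {v}" for w
      using disj \<open>v \<in> {1..n}\<close> \<open>y \<in> A v\<close> that unfolding disjoint_family_on_def by blast
    have "g' y = (\<Sum>w\<in>{v}. indicator (A w) y * ((real w - 1 + H' w y) / real n))"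
      unfolding g'_def using that(1)
      by (intro sum.mono_neutral_right ballI) (simp_all add: 0)
    then show ?thesis using that by (simp add: H'_def)
  qed
  have gA: "g x \<in> A v" if "v \<in> {1..n}" "x \<in> vertex_part n v" for x v
    using g[OF that] hA[OF that(1)] vertex_part_iff[OF n, of v x] that by simp
  have g'V: "g' y \<in> vertex_part n v" if "v \<in> {1..n}" "y \<in> A v" for y v
    using g'[OF that] h'A[OF that] n that by (subst vertex_part_iff) auto
  have gm: "g \<in> borel_measurable borel"
  proof -
    have [measurable]: "vertex_part n v \<in> sets borel" for v unfolding vertex_part_def by simp
    have "(\<lambda>x. H v (real n * x - (real v - 1))) \<in> borel_measurable borel" if "v \<in> {1..n}" for v
      by (rule measurable_compose[OF _ Hm[OF that]]) measurable
    then show ?thesis unfolding g_def by (intro borel_measurable_sum borel_measurable_times) auto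
  qed
  have g'm: "g' \<in> borel_measurable borel"
    unfolding g'_def using H'm
    by (intro borel_measurable_sum borel_measurable_times borel_measurable_divide borel_measurable_add) auto
  have gM: "g \<in> unit_space \<rightarrow>\<^sub>M unit_space"
  proof (rule measurable_to_unitI)
    fix x assume "x \<in> space unit_space"
    then show "g x \<in> {0..<1}" using vertex_part_cover[OF _ n, of x] gA sub by fastforce
  qed (rule measurable_unitI[OF gm])
  have g'M: "g' \<in> unit_space \<rightarrow>\<^sub>M unit_space"
  proof (rule measurable_to_unitI)
    fix y assume "y \<in> space unit_space"
    then obtain v where v: "v \<in> {1..n}" "y \<in> A v" using cov[of y] by auto
    then show "g' y \<in> {0..<1}" using g'V[OF v] vertex_part_unit[OF v(1)] by blast
  qed (rule measurable_unitI[OF g'm])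
  have "g' (g x) = x" if "x \<in> space unit_space" for x
  proof -
    obtain v where v: "v \<in> {1..n}" "x \<in> vertex_part n v" using vertex_part_cover[OF _ n, of x] \<open>x \<in> space unit_space\<close> by auto
    have "real n * x - (real v - 1) \<in> {0..<1}" using vertex_part_iff[OF n, of v x] v by simp
    then have "h' v (h v (real n * x - (real v - 1))) = real n * x - (real v - 1)"
      using mp_isoD(3)[OF h[OF v(1)]] by simp
    then show ?thesis using g'[OF v(1) gA[OF v]] g[OF v] n by simp
  qed
  moreover have "g (g' y) = y" if "y \<in> space unit_space" for y
  proof -
    obtain v where v: "v \<in> {1..n}" "y \<in> A v" using cov[of y] \<open>y \<in> space unit_space\<close> by auto
    have "h v (h' v y) = y" using mp_isoD(4)[OF h[OF v(1)]] v(2) spN by simp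
    then show ?thesis using g[OF v(1) g'V[OF v]] g'[OF v] n by simp
  qed
  moreover have "distr unit_space unit_space g = unit_space"
  proof (rule measure_eqI)
    fix S assume "S \<in> sets (distr unit_space unit_space g)"
    then have S: "S \<in> sets unit_space" by simp
    then have Sb [measurable]: "S \<in> sets borel" and S01: "S \<subseteq> {0..<1}"
      by (auto simp: sets_restrict_space_iff)
    let ?P = "\<lambda>v. (\<lambda>x. - (real v - 1) + real n * x) -` ((\<lambda>z. h v z) -` (S \<inter> A v) \<inter> space unit_space)"
    have Ym: "h v -` (S \<inter> A v) \<inter> space unit_space \<in> sets borel" if v: "v \<in> {1..n}" for v
    proof -
      have "h v -` (S \<inter> A v) \<inter> space unit_space \<in> sets unit_space"
        by (rule measurable_sets[OF mp_isoD(1)[OF h[OF v]]]) (auto simp: N_def sets_restrict_space)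
      then show ?thesis by (auto simp: sets_restrict_space_iff)
    qed
    have eq: "g -` S \<inter> {0..<1} = (\<Union>v\<in>{1..n}. ?P v)"
    proof (intro equalityI subsetI)
      fix x assume x: "x \<in> g -` S \<inter> {0..<1}"
      then obtain v where v: "v \<in> {1..n}" "x \<in> vertex_part n v" using vertex_part_cover[OF _ n, of x] by auto
      have "real n * x - (real v - 1) \<in> {0..<1}" using vertex_part_iff[OF n, of v x] v by simp
      then have "x \<in> ?P v" using g[OF v] gA[OF v] x by (simp add: add.commute[of "- _"] algebra_simps)
      then show "x \<in> (\<Union>v\<in>{1..n}. ?P v)" using v by blast
    next
      fix x assume "x \<in> (\<Union>v\<in>{1..n}. ?P v)"
      then obtain v where v: "v \<in> {1..n}" "x \<in> ?P v" by blast
      then have "x \<in> vertex_part n v" using vertex_part_iff[OF n, of v x] by (auto simp: algebra_simps)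
      then show "x \<in> g -` S \<inter> {0..<1}" using g[OF v(1)] v vertex_part_unit[OF v(1)]
        by (auto simp: algebra_simps)
    qed
    have Pm: "?P v \<in> sets lborel" if "v \<in> {1..n}" for v
    proof -
      have "(\<lambda>x. - (real v - 1) + real n * x) \<in> borel_measurable borel" by measurable
      from measurable_sets[OF this Ym[OF that]] show ?thesis by simp
    qed
    have disjP: "disjoint_family_on ?P {1..n}" unfolding disjoint_family_on_def
    proof (intro ballI impI)
      fix v w assume vw: "v \<in> {1..n}" "w \<in> {1..n}" "v \<noteq> w"
      have "x \<in> vertex_part n v" if "x \<in> ?P v" "v \<in> {1..n}" for x v
        using vertex_part_iff[OF n, of v x] that by (auto simp: algebra_simps)
      then show "?P v \<inter> ?P w = {}" using vertex_part_disjoint[OF vw(1,2)] vw by blast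
    qed
    have eP: "emeasure lborel (?P v) = emeasure lborel (S \<inter> A v)" if v: "v \<in> {1..n}" for v
    proof -
      have "emeasure lborel (?P v) = emeasure lborel (h v -` (S \<inter> A v) \<inter> space unit_space) / ennreal (real n)"
        using n by (intro emeasure_affine_preimage[OF Ym[OF v]]) auto
      also have "emeasure lborel (h v -` (S \<inter> A v) \<inter> space unit_space) = emeasure unit_space (h v -` (S \<inter> A v) \<inter> space unit_space)"
        by (subst emeasure_restrict_space) auto
      also have "\<dots> = emeasure (distr unit_space (N v) (h v)) (S \<inter> A v)"
        using mp_isoD(1)[OF h[OF v]] by (subst emeasure_distr) (auto simp: N_def sets_restrict_space)
      also have "\<dots> = emeasure lborel (S \<inter> A v) * ennreal n"
        unfolding mp_isoD(5)[OF h[OF v]] by (rule emN[OF _ _ v]) auto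
      also have "emeasure lborel (S \<inter> A v) * ennreal n / ennreal n = emeasure lborel (S \<inter> A v)"
        using n by (intro ennreal_mult_divide_eq) auto
      finally show ?thesis .
    qed
    have "emeasure (distr unit_space unit_space g) S = emeasure unit_space (g -` S \<inter> {0..<1})"
      using gM S by (simp add: emeasure_distr)
    also have "\<dots> = emeasure lborel (g -` S \<inter> {0..<1})"
      by (rule emeasure_restrict_space) auto
    also have "\<dots> = (\<Sum>v\<in>{1..n}. emeasure lborel (?P v))"
      unfolding eq by (rule sum_emeasure[symmetric]) (use Pm disjP in auto)
    also have "\<dots> = (\<Sum>v\<in>{1..n}. emeasure lborel (S \<inter> A v))" using eP by simp
    also have "\<dots> = emeasure lborel (\<Union>v\<in>{1..n}. S \<inter> A v)"
      by (rule sum_emeasure) (use disj in \<open>auto simp: disjoint_family_on_def\<close>)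
    also have "(\<Union>v\<in>{1..n}. S \<inter> A v) = S" using cover S01 by blast
    also have "emeasure lborel S = emeasure unit_space S"
      using S01 by (intro emeasure_restrict_space[symmetric]) auto
    finally show "emeasure (distr unit_space unit_space g) S = emeasure unit_space S" .
  qed simp
  ultimately have "mp_iso unit_space unit_space g g'"
    unfolding mp_iso_def mp_embedding_def using gM g'M by simp
  then show ?thesis using gA by blast
qed

section \<open>Bounding the cut distance on the unit interval\<close>

lemma mp_iso_measure_preserving_bij:
  assumes "mp_iso M N h h'"
  shows "measure_preserving_bij M N h"
proof -
  note h = mp_isoD[OF assms]
  have "bij_betw h (space M) (space N)"
    by (rule bij_betw_byWitness[of _ h'])
       (use h(3,4) measurable_space[OF h(1)] measurable_space[OF h(2)] in auto)
  then show ?thesis unfolding measure_preserving_bij_def measure_preserving_map_def using h by simp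
qed

lemma mp_iso_trans:
  assumes "mp_iso M N f f'" "mp_iso N K g g'"
  shows "mp_iso M K (g \<circ> f) (f' \<circ> g')"
proof -
  note f = mp_isoD[OF assms(1)] and g = mp_isoD[OF assms(2)]
  have "distr M K (g \<circ> f) = distr (distr M N f) K g"
    using f(1) g(1) by (intro distr_distr[symmetric])
  then have "distr M K (g \<circ> f) = K" unfolding f(5) g(5) .
  then show ?thesis unfolding mp_iso_def mp_embedding_def
    using f g measurable_space[OF f(1)] measurable_space[OF g(2)]
    by (auto intro!: measurable_comp[OF f(1) g(1)] measurable_comp[OF g(2) f(2)])
qed

lemma cut_distance_le:
  assumes "mp_iso (base W) (base U) f f'"
  shows "cut_distance U W \<le> cut_norm (base W) (\<lambda>z. pull_back (kernel U) f z - kernel W z)"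
  unfolding cut_distance_def
  by (rule INF_lower) (simp add: mp_iso_measure_preserving_bij[OF assms])

text \<open>One map \<open>p\<close> treats both cases of the distance: an isomorphism for an
  atomless space, and otherwise the first coordinate of an isomorphism onto the product with the
  unit interval, which has no atoms. It depends on the graphon alone, so all later work takes place
  on the unit interval with only the rearrangement \<open>g\<close> left to choose.\<close>

lemma cut_distance_to_graph_le:
  fixes U :: "'a graphon"
  assumes U: "is_graphon U"
  shows "\<exists>p. measure_preserving_map unit_space (base U) p \<and>
    (\<forall>n E g g'. mp_iso unit_space unit_space g g' \<longrightarrow> cut_distance_to_graph U n E \<le>
       cut_norm unit_space (\<lambda>z. pull_back (kernel U) (\<lambda>x. p (g x)) z - kernel (graph_representation n E) z))"
proof -
  have pU: "prob_space (base U)" and sb: "standard_borel (base U)"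
    using U unfolding is_graphon_def standard_probability_space_def by auto
  interpret pU: prob_space "base U" by (rule pU)
  interpret U1: prob_space unit_space by (rule prob_space_unit)
  have ret: "borel_retract (base U)" by (rule standard_borel_imp_retract[OF sb pU.not_empty])
  show ?thesis
  proof (cases "atomless (base U)")
    case True
    then obtain h h' where h: "mp_iso unit_space (base U) h h'"
      using mp_iso_unit_exists[OF pU ret] unfolding atomless_def by blast
    have "cut_distance_to_graph U n E \<le>
       cut_norm unit_space (\<lambda>z. pull_back (kernel U) (\<lambda>x. h (g x)) z - kernel (graph_representation n E) z)"
      if g: "mp_iso unit_space unit_space g g'" for n E g g'
      using cut_distance_le[of "graph_representation n E" U "h \<circ> g"] mp_iso_trans[OF g h] True
      by (simp add: cut_distance_to_graph_def graph_representation_def o_def)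
    moreover have "measure_preserving_map unit_space (base U) h"
      using mp_isoD[OF h] by (simp add: measure_preserving_map_def)
    ultimately show ?thesis by blast
  next
    case False
    let ?B = "base U \<Otimes>\<^sub>M unit_space"
    interpret P: pair_prob_space "base U" unit_space ..
    have "emeasure ?B {z} = 0" if "z \<in> space ?B" for z
    proof -
      obtain x u where z: "z = (x, u)" by (cases z)
      have u: "u \<in> {0..<1}" "x \<in> space (base U)" using that by (auto simp: z space_pair_measure)
      have us: "{u} \<in> sets unit_space" using u by (simp add: sets_restrict_space_iff)
      have "emeasure ?B {z} \<le> emeasure ?B (space (base U) \<times> {u})"
        using u us by (intro emeasure_mono) (auto simp: z)
      also have "\<dots> = emeasure (base U) (space (base U)) * emeasure unit_space {u}"
        by (rule U1.emeasure_pair_measure_Times) (use us in auto)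
      also have "emeasure unit_space {u} = 0" using u by (subst emeasure_restrict_space) auto
      finally show ?thesis by simp
    qed
    then obtain h h' where h: "mp_iso unit_space ?B h h'"
      using mp_iso_unit_exists[of ?B] borel_retract_pair[OF ret borel_retract_unit] P.prob_space_axioms by blast
    have "cut_distance_to_graph U n E \<le>
       cut_norm unit_space (\<lambda>z. pull_back (kernel U) (\<lambda>x. fst (h (g x))) z - kernel (graph_representation n E) z)"
      if g: "mp_iso unit_space unit_space g g'" for n E g g'
    proof -
      have "pull_back (kernel (blow_up U)) (h \<circ> g) z = pull_back (kernel U) (\<lambda>x. fst (h (g x))) z" for z
        by (simp add: blow_up_def pull_back_def split_beta)
      then show ?thesis
        using cut_distance_le[of "graph_representation n E" "blow_up U" "h \<circ> g"] mp_iso_trans[OF g h] False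
        by (simp add: cut_distance_to_graph_def graph_representation_def blow_up_def)
    qed
    moreover have "measure_preserving_map unit_space (base U) (\<lambda>x. fst (h x))"
    proof -
      note hh = mp_isoD[OF h]
      have "distr unit_space (base U) (\<lambda>x. fst (h x)) = distr (distr unit_space ?B h) (base U) fst"
        by (subst distr_distr) (auto simp: o_def hh(1))
      also have "\<dots> = base U" unfolding hh(5) by (rule U1.distr_pair_fst)
      finally show ?thesis unfolding measure_preserving_map_def
        using measurable_compose[OF hh(1) measurable_fst] by simp
    qed
    ultimately show ?thesis by (intro exI[of _ "\<lambda>x. fst (h x)"]) simp
  qed
qed

section \<open>Matrices with prescribed row and column sums\<close>

text \<open>A linear form in the weights is extremal at weights 0 and 1: keep all nonnegative or all
  negative coefficients.\<close>

lemma weights_extreme_single: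
  fixes w c :: "'a \<Rightarrow> real"
  assumes "finite A" "\<And>a. a \<in> A \<Longrightarrow> 0 \<le> w a \<and> w a \<le> 1"
  shows "\<exists>I\<subseteq>A. \<bar>\<Sum>a\<in>A. w a * c a\<bar> \<le> \<bar>\<Sum>a\<in>I. c a\<bar>"
proof -
  let ?P = "{a \<in> A. c a \<ge> 0}" and ?N = "{a \<in> A. c a < 0}"
  have "(\<Sum>a\<in>A. w a * c a) \<le> (\<Sum>a\<in>A. if c a \<ge> 0 then c a else 0)"
    using assms(2) by (intro sum_mono) (auto simp: mult_left_le_one_le mult_nonneg_nonpos)
  then have up: "(\<Sum>a\<in>A. w a * c a) \<le> sum c ?P" using assms(1) by (simp add: sum.inter_filter)
  have "(\<Sum>a\<in>A. if c a < 0 then c a else 0) \<le> (\<Sum>a\<in>A. w a * c a)"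
  proof (intro sum_mono)
    fix a assume a: "a \<in> A"
    have "c a \<le> w a * c a" if "c a < 0"
      using assms(2)[OF a] that mult_right_mono_neg[of "w a" 1 "c a"] by simp
    then show "(if c a < 0 then c a else 0) \<le> w a * c a" using assms(2)[OF a] by auto
  qed
  then have lo: "sum c ?N \<le> (\<Sum>a\<in>A. w a * c a)" using assms(1) by (simp add: sum.inter_filter)
  show ?thesis
  proof (cases "(\<Sum>a\<in>A. w a * c a) \<ge> 0")
    case True
    then show ?thesis using up by (intro exI[of _ ?P]) auto
  next
    case False
    then show ?thesis using lo by (intro exI[of _ ?N]) auto
  qed
qed

text \<open>A bilinear form is linear in each family of weights, so the two families can be rounded
  one after the other. Bounds over whole blocks therefore extend to sets that meet blocks only
  partially.\<close>

lemma weights_extreme: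
  fixes w :: "'a \<Rightarrow> real" and z :: "'b \<Rightarrow> real" and m :: "'a \<Rightarrow> 'b \<Rightarrow> real"
  assumes A: "finite A" "\<And>a. a \<in> A \<Longrightarrow> 0 \<le> w a \<and> w a \<le> 1"
    and B: "finite B" "\<And>b. b \<in> B \<Longrightarrow> 0 \<le> z b \<and> z b \<le> 1"
    and bound: "\<And>I J. I \<subseteq> A \<Longrightarrow> J \<subseteq> B \<Longrightarrow> \<bar>\<Sum>a\<in>I. \<Sum>b\<in>J. m a b\<bar> \<le> \<epsilon>"
  shows "\<bar>\<Sum>a\<in>A. \<Sum>b\<in>B. w a * z b * m a b\<bar> \<le> \<epsilon>"
proof -
  obtain I where I: "I \<subseteq> A" "\<bar>\<Sum>a\<in>A. w a * (\<Sum>b\<in>B. z b * m a b)\<bar> \<le> \<bar>\<Sum>a\<in>I. \<Sum>b\<in>B. z b * m a b\<bar>"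
    using weights_extreme_single[of A w "\<lambda>a. \<Sum>b\<in>B. z b * m a b", OF A] by auto
  have "(\<Sum>a\<in>I. \<Sum>b\<in>B. z b * m a b) = (\<Sum>b\<in>B. z b * (\<Sum>a\<in>I. m a b))"
    by (subst sum.swap) (simp add: sum_distrib_left)
  moreover obtain J where J: "J \<subseteq> B" "\<bar>\<Sum>b\<in>B. z b * (\<Sum>a\<in>I. m a b)\<bar> \<le> \<bar>\<Sum>b\<in>J. \<Sum>a\<in>I. m a b\<bar>"
    using weights_extreme_single[of B z "\<lambda>b. \<Sum>a\<in>I. m a b", OF B] by auto
  moreover have "(\<Sum>b\<in>J. \<Sum>a\<in>I. m a b) = (\<Sum>a\<in>I. \<Sum>b\<in>J. m a b)" by (rule sum.swap)
  moreover have "(\<Sum>a\<in>A. \<Sum>b\<in>B. w a * z b * m a b) = (\<Sum>a\<in>A. w a * (\<Sum>b\<in>B. z b * m a b))"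
    by (simp add: sum_distrib_left mult.assoc)
  ultimately show ?thesis using I(2) bound[OF I(1) J(1)] by linarith
qed

section \<open>Moments of uniformly random words\<close>

abbreviation words :: "nat \<Rightarrow> nat \<Rightarrow> (nat \<Rightarrow> nat) set" where
  "words K T \<equiv> PiE {..<K} (\<lambda>_. {..<T})"

text \<open>Independence of two coordinates of a uniform word, multiplied out so that neither
  divisions nor subtracted exponents occur.\<close>

lemma sum_words_two:
  fixes f g :: "nat \<Rightarrow> real"
  assumes "a < K" "a' < K" "a \<noteq> a'"
  shows "real T ^ 2 * (\<Sum>x\<in>words K T. f (x a) * g (x a')) = real T ^ K * (\<Sum>z<T. f z) * (\<Sum>z<T. g z)"
proof -
  define \<phi> where "\<phi> j = (if j = a then f else if j = a' then g else (\<lambda>_. 1))" for j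
  have P: "(\<Prod>j<K. \<psi> j) = \<psi> a * \<psi> a' * (\<Prod>j\<in>{..<K} - {a, a'}. \<psi> j)" for \<psi> :: "nat \<Rightarrow> real"
  proof -
    have "{..<K} = insert a (insert a' ({..<K} - {a, a'}))" using assms by auto
    then have "(\<Prod>j<K. \<psi> j) = (\<Prod>j\<in>insert a (insert a' ({..<K} - {a, a'})). \<psi> j)" by simp
    also have "\<dots> = \<psi> a * (\<psi> a' * (\<Prod>j\<in>{..<K} - {a, a'}. \<psi> j))"
      using assms(3) by (subst prod.insert, simp, simp, subst prod.insert) auto
    finally show ?thesis by (simp add: mult.assoc)
  qed
  have "(\<Sum>x\<in>words K T. f (x a) * g (x a')) = (\<Sum>x\<in>words K T. \<Prod>j<K. \<phi> j (x j))"
    using assms(3) by (subst P) (simp add: \<phi>_def)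
  also have "\<dots> = (\<Prod>j<K. \<Sum>z<T. \<phi> j z)" by (rule prod_sum_PiE[symmetric]) auto
  also have "\<dots> = (\<Sum>z<T. f z) * (\<Sum>z<T. g z) * real T ^ (K - 2)"
    using assms by (subst P) (simp add: \<phi>_def card_Diff_subset numeral_2_eq_2)
  finally have "real T ^ 2 * (\<Sum>x\<in>words K T. f (x a) * g (x a')) =
      (real T ^ 2 * real T ^ (K - 2)) * (\<Sum>z<T. f z) * (\<Sum>z<T. g z)" by simp
  also have "real T ^ 2 * real T ^ (K - 2) = real T ^ K"
    using assms by (subst power_add[symmetric]) (rule arg_cong[of _ _ "\<lambda>i. real T ^ i"], linarith)
  finally show ?thesis .
qed

lemma sum_words_one:
  fixes f :: "nat \<Rightarrow> real"
  assumes "a < K"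
  shows "real T * (\<Sum>x\<in>words K T. f (x a)) = real T ^ K * (\<Sum>z<T. f z)"
proof -
  define \<phi> where "\<phi> j = (if j = a then f else (\<lambda>_. 1))" for j
  have P: "(\<Prod>j<K. \<psi> j) = \<psi> a * (\<Prod>j\<in>{..<K} - {a}. \<psi> j)" for \<psi> :: "nat \<Rightarrow> real"
    using assms prod.remove[of "{..<K}" a \<psi>] by simp
  have "(\<Sum>x\<in>words K T. f (x a)) = (\<Sum>x\<in>words K T. \<Prod>j<K. \<phi> j (x j))"
    by (subst P) (simp add: \<phi>_def)
  also have "\<dots> = (\<Prod>j<K. \<Sum>z<T. \<phi> j z)" by (rule prod_sum_PiE[symmetric]) auto
  also have "\<dots> = (\<Sum>z<T. f z) * real T ^ (K - 1)"
    using assms by (subst P) (simp add: \<phi>_def)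
  finally have "real T * (\<Sum>x\<in>words K T. f (x a)) = (real T * real T ^ (K - 1)) * (\<Sum>z<T. f z)" by simp
  also have "real T * real T ^ (K - 1) = real T ^ K"
    using assms by (cases K) auto
  finally show ?thesis .
qed

lemma card_words: "card (words K T) = T ^ K" by (simp add: card_PiE)

text \<open>The deviation of a cyclic shift pattern from its density \<open>p / T\<close>; it sums
  to zero over a complete residue system, which plays the role of mean zero.\<close>

definition shift_dev :: "nat \<Rightarrow> nat \<Rightarrow> nat \<Rightarrow> real" where
  "shift_dev T p z = of_bool (z mod T < p) - real p / real T"

lemma sum_shift:
  fixes f :: "nat \<Rightarrow> 'a::comm_monoid_add" and T :: nat
  assumes "T > 0"
  shows "(\<Sum>z<T. f ((z + b) mod T)) = (\<Sum>z<T. f z)"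
proof (rule sum.reindex_bij_betw)
  have inj: "inj_on (\<lambda>z. (z + b) mod T) {..<T}"
  proof (rule inj_onI)
    have le: "x \<le> y" if "x < T" "(x + b) mod T = (y + b) mod T" for x y :: nat
    proof (rule ccontr)
      assume "\<not> x \<le> y"
      then have "T dvd (x + b) - (y + b)" using that(2) by (intro mod_eq_dvd_iff_nat[THEN iffD1]) auto
      then show False using \<open>\<not> x \<le> y\<close> that(1) by (auto dest!: dvd_imp_le)
    qed
    fix x y assume "x \<in> {..<T}" "y \<in> {..<T}" "(x + b) mod T = (y + b) mod T"
    then show "x = y" using le[of x y] le[of y x] by simp
  qed
  moreover have "(\<lambda>z. (z + b) mod T) ` {..<T} = {..<T}"
    by (rule endo_inj_surj) (use assms inj in auto)
  ultimately show "bij_betw (\<lambda>z. (z + b) mod T) {..<T} {..<T}" by (simp add: bij_betw_def)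
qed

lemma sum_of_bool_less: "p \<le> T \<Longrightarrow> (\<Sum>z<T. of_bool (z < p)) = real p"
proof -
  assume "p \<le> T"
  have "(\<Sum>z<T. of_bool (z < p) :: real) = (\<Sum>z\<in>{..<p}. of_bool (z < p))"
    using \<open>p \<le> T\<close> by (intro sum.mono_neutral_right) auto
  then show ?thesis by simp
qed

lemma sum_shift_dev:
  assumes "T > 0" "p \<le> T"
  shows "(\<Sum>z<T. shift_dev T p (z + b)) = 0"
proof -
  have "(\<Sum>z<T. shift_dev T p (z + b)) = (\<Sum>z<T. of_bool ((z + b) mod T < p)) - real p"
    using assms by (simp add: shift_dev_def sum_subtractf)
  also have "(\<Sum>z<T. of_bool ((z + b) mod T < p)) = real p"
    using sum_shift[OF assms(1), of "\<lambda>z. of_bool (z < p) :: real" b] sum_of_bool_less[OF assms(2)] by simp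
  finally show ?thesis by simp
qed

lemma abs_shift_dev_le: "p \<le> T \<Longrightarrow> \<bar>shift_dev T p z\<bar> \<le> 1"
  by (cases "T = 0") (auto simp: shift_dev_def of_bool_def field_simps)

text \<open>The coordinates of a uniformly random word are independent, so only the diagonal terms of the
  second moment survive.\<close>

lemma quasirandom_words:
  fixes \<alpha> :: "nat \<Rightarrow> nat \<Rightarrow> real" and \<xi> :: "(nat \<Rightarrow> nat) \<Rightarrow> real"
  assumes T: "T > 0" "p \<le> T"
    and \<alpha>: "\<And>a b. a < K \<Longrightarrow> b < T \<Longrightarrow> 0 \<le> \<alpha> a b \<and> \<alpha> a b \<le> \<alpha>0"
    and \<xi>: "\<And>x. x \<in> words K T \<Longrightarrow> 0 \<le> \<xi> x \<and> \<xi> x \<le> \<xi>0"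
    and nn: "0 \<le> \<alpha>0" "0 \<le> \<xi>0"
  shows "\<bar>\<Sum>x\<in>words K T. \<Sum>a<K. \<Sum>b<T. \<alpha> a b * \<xi> x * shift_dev T p (x a + b)\<bar>
      \<le> \<alpha>0 * \<xi>0 * real T ^ (K + 1) * sqrt K"
proof -
  \<comment> \<open>The contribution of one coordinate as a function of its letter. Each
    \<open>f a\<close> has mean zero over the letters, so distinct coordinates are
    uncorrelated.\<close>
  define f where "f a z = (\<Sum>b<T. \<alpha> a b * shift_dev T p (z + b))" for a z
  have f0: "(\<Sum>z<T. f a z) = 0" for a
    unfolding f_def by (subst sum.swap) (simp add: sum_distrib_left[symmetric] sum_shift_dev[OF T])
  have fb: "\<bar>f a z\<bar> \<le> \<alpha>0 * real T" if "a < K" for a z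
  proof -
    have "\<bar>f a z\<bar> \<le> (\<Sum>b<T. \<bar>\<alpha> a b * shift_dev T p (z + b)\<bar>)" unfolding f_def by (rule sum_abs)
    also have "\<dots> \<le> (\<Sum>b<T. \<alpha>0 * 1)"
    proof (rule sum_mono)
      fix b assume "b \<in> {..<T}"
      then have "\<bar>\<alpha> a b\<bar> * \<bar>shift_dev T p (z + b)\<bar> \<le> \<alpha>0 * 1"
        using \<alpha>[OF that, of b] abs_shift_dev_le[OF T(2)] by (intro mult_mono) auto
      then show "\<bar>\<alpha> a b * shift_dev T p (z + b)\<bar> \<le> \<alpha>0 * 1" by (simp add: abs_mult)
    qed
    finally show ?thesis by (simp add: mult.commute)
  qed
  define F where "F x = (\<Sum>a<K. f a (x a))" for x
  have "(\<Sum>x\<in>words K T. (F x)\<^sup>2) = (\<Sum>a<K. \<Sum>a'<K. \<Sum>x\<in>words K T. f a (x a) * f a' (x a'))"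
  proof -
    have "(\<Sum>x\<in>words K T. (F x)\<^sup>2) = (\<Sum>x\<in>words K T. \<Sum>a<K. \<Sum>a'<K. f a (x a) * f a' (x a'))"
      unfolding F_def power2_eq_square by (simp add: sum_product)
    also have "\<dots> = (\<Sum>a<K. \<Sum>x\<in>words K T. \<Sum>a'<K. f a (x a) * f a' (x a'))"
      by (rule sum.swap)
    also have "\<dots> = (\<Sum>a<K. \<Sum>a'<K. \<Sum>x\<in>words K T. f a (x a) * f a' (x a'))"
      by (intro sum.cong refl sum.swap)
    finally show ?thesis .
  qed
  also have "\<dots> \<le> (\<Sum>a<K. real T ^ K * (\<alpha>0 * real T)\<^sup>2)"
  proof (rule sum_mono)
    fix a assume "a \<in> {..<K}" then have a: "a < K" by simp
    have "(\<Sum>x\<in>words K T. f a (x a) * f a' (x a')) = 0" if "a' < K" "a' \<noteq> a" for a'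
      using sum_words_two[OF a that(1), of T "f a" "f a'"] that T f0 by simp
    then have "(\<Sum>a'<K. \<Sum>x\<in>words K T. f a (x a) * f a' (x a')) = (\<Sum>a'\<in>{a}. \<Sum>x\<in>words K T. f a (x a) * f a' (x a'))"
      using a by (intro sum.mono_neutral_right) auto
    also have "\<dots> = (\<Sum>x\<in>words K T. (f a (x a))\<^sup>2)" by (simp add: power2_eq_square)
    also have "\<dots> \<le> (\<Sum>x\<in>words K T. (\<alpha>0 * real T)\<^sup>2)"
      using power_mono[OF fb[OF a] abs_ge_zero, of _ 2] by (intro sum_mono) simp
    finally show "(\<Sum>a'<K. \<Sum>x\<in>words K T. f a (x a) * f a' (x a')) \<le> real T ^ K * (\<alpha>0 * real T)\<^sup>2"
      by (simp add: card_words)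
  qed
  finally have F2: "(\<Sum>x\<in>words K T. (F x)\<^sup>2) \<le> real K * (real T ^ K * (\<alpha>0 * real T)\<^sup>2)" by simp
  \<comment> \<open>The trivial estimate would have \<open>K\<close> in place of its square root.
    Cauchy-Schwarz applied to the second moment supplies the whole gain.\<close>
  have F1: "(\<Sum>x\<in>words K T. \<bar>F x\<bar>) \<le> \<alpha>0 * real T ^ (K + 1) * sqrt K"
  proof (rule power2_le_imp_le)
    have "(\<Sum>x\<in>words K T. 1 * \<bar>F x\<bar>)\<^sup>2 \<le> (\<Sum>x\<in>words K T. 1\<^sup>2) * (\<Sum>x\<in>words K T. \<bar>F x\<bar>\<^sup>2)"
      by (rule Cauchy_Schwarz_ineq_sum)
    also have "\<dots> \<le> real T ^ K * (real K * (real T ^ K * (\<alpha>0 * real T)\<^sup>2))"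
      using F2 by (simp add: card_words mult_left_mono)
    also have "\<dots> = (\<alpha>0 * real T ^ (K + 1) * sqrt K)\<^sup>2"
      by (simp add: power_mult_distrib power2_eq_square mult_ac)
    finally show "(\<Sum>x\<in>words K T. \<bar>F x\<bar>)\<^sup>2 \<le> (\<alpha>0 * real T ^ (K + 1) * sqrt K)\<^sup>2" by simp
  qed (use nn in simp)
  have "(\<Sum>x\<in>words K T. \<Sum>a<K. \<Sum>b<T. \<alpha> a b * \<xi> x * shift_dev T p (x a + b)) = (\<Sum>x\<in>words K T. \<xi> x * F x)"
    unfolding F_def f_def by (simp add: sum_distrib_left mult_ac)
  also have "\<bar>\<dots>\<bar> \<le> (\<Sum>x\<in>words K T. \<bar>\<xi> x * F x\<bar>)" by (rule sum_abs)
  also have "\<dots> \<le> (\<Sum>x\<in>words K T. \<xi>0 * \<bar>F x\<bar>)"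
    using \<xi> by (intro sum_mono) (auto simp: abs_mult intro!: mult_right_mono)
  also have "\<dots> = \<xi>0 * (\<Sum>x\<in>words K T. \<bar>F x\<bar>)" by (simp add: sum_distrib_left)
  also have "\<dots> \<le> \<xi>0 * (\<alpha>0 * real T ^ (K + 1) * sqrt K)" by (rule mult_left_mono[OF F1 nn(2)])
  finally show ?thesis by (simp add: mult_ac)
qed

text \<open>Rows and columns with a bad sum are replaced by the constant \<open>s\<close>. Then all sums are nearly
  right, and adding \<open>\<alpha> c + \<beta> d - \<gamma>\<close> makes them exact. The final contraction towards \<open>1/2\<close> brings
  the entries back into the unit interval.\<close>

lemma block_regularize:
  fixes X :: "nat \<Rightarrow> nat \<Rightarrow> real" and p q N h :: nat and s :: real
  assumes pos: "p > 0" "q > 0" "N > 0" "h > 0"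
    and X: "\<And>c d. c < p \<Longrightarrow> d < q \<Longrightarrow> 0 \<le> X c d \<and> X c d \<le> 1 \<and> real N * X c d \<in> \<int>"
    and s: "0 \<le> s" "s \<le> 1" "real N * s \<in> \<int>"
    and err: "err = (\<Sum>c<p. \<bar>(\<Sum>d<q. X c d) - s * q\<bar>) + (\<Sum>d<q. \<bar>(\<Sum>c<p. X c d) - s * p\<bar>)"
    and lam: "lam = 1 / real h" and th: "th = 1 / (24 * real h)" and t: "t = (1 - lam) * s + lam / 2"
  shows "\<exists>Y. (\<forall>c<p. \<forall>d<q. 0 \<le> Y c d \<and> Y c d \<le> 1 - lam / 4 \<and> real (2 * h * N * p * q) * Y c d \<in> \<int>) \<and>
    (\<forall>c<p. (\<Sum>d<q. Y c d) = t * q) \<and> (\<forall>d<q. (\<Sum>c<p. Y c d) = t * p) \<and>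
    (\<Sum>c<p. \<Sum>d<q. \<bar>X c d - Y c d\<bar>) \<le> 2 * lam * p * q + err / th\<^sup>2"
proof -
  have lam01: "0 < lam" "lam \<le> 1" and thp: "0 < th" and lth: "lam = 24 * th"
    using pos by (auto simp: lam th field_simps)
  have h1: "real h * lam = 1" using pos by (simp add: lam)
  have err0: "0 \<le> err" unfolding err by (intro add_nonneg_nonneg sum_nonneg) auto
  have t01: "0 \<le> t" "t \<le> 1 - lam / 2"
  proof -
    have "(1 - lam) * s \<le> 1 - lam" using mult_left_mono[of s 1 "1 - lam"] s lam01 by simp
    moreover have "0 \<le> (1 - lam) * s" using s lam01 by simp
    ultimately show "0 \<le> t" "t \<le> 1 - lam / 2" unfolding t using lam01 by linarith+
  qed
  show ?thesis
  proof (cases "err \<le> th\<^sup>2 * p * q")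
    \<comment> \<open>When the total deviation is this large, \<open>err / th\<^sup>2\<close>
      already exceeds the number \<open>p * q\<close> of entries, and replacing the whole block by
      the constant \<open>t\<close> is affordable.\<close>
    case False
    have int: "real (2 * h * N * p * q) * t \<in> \<int>"
    proof -
      have "real (2 * h * N * p * q) * t = (2 * (real h - real h * lam) * (real N * s) + real h * lam * real N) * real (p * q)"
        unfolding t by (simp add: algebra_simps)
      also have "\<dots> = (2 * (real h - 1) * (real N * s) + real N) * real (p * q)" by (simp add: h1)
      also have "\<dots> \<in> \<int>"
      proof -
        have "(2 * (real h - 1) * z + real N) * real (p * q) \<in> \<int>" if "z \<in> \<int>" for z
          using that by (intro Ints_mult Ints_add Ints_diff) auto
        from this[OF s(3)] show ?thesis .
      qed
      finally show ?thesis .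
    qed
    have "(\<Sum>c<p. \<Sum>d<q. \<bar>X c d - t\<bar>) \<le> (\<Sum>c<p. \<Sum>d<q. 1)"
    proof (intro sum_mono)
      fix c d assume "c \<in> {..<p}" "d \<in> {..<q}"
      then show "\<bar>X c d - t\<bar> \<le> 1" using X[of c d] t01 lam01 by auto
    qed
    also have "\<dots> = real p * real q" by simp
    also have "\<dots> \<le> err / th\<^sup>2" using False thp by (simp add: field_simps)
    finally have "(\<Sum>c<p. \<Sum>d<q. \<bar>X c d - t\<bar>) \<le> 2 * lam * p * q + err / th\<^sup>2" using lam01 by (smt (verit) mult_nonneg_nonneg of_nat_0_le_iff)
    then show ?thesis using t01 int lam01 by (intro exI[of _ "\<lambda>_ _. t"]) (auto simp: mult.commute)
  next
    case True
    \<comment> \<open>By Markov's inequality at most \<open>th * p\<close> rows and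
      \<open>th * q\<close> columns are bad, because the total deviation is at most
      \<open>th\<^sup>2 * p * q\<close>.\<close>
    define Br where "Br = {c. c < p \<and> th * q < \<bar>(\<Sum>d<q. X c d) - s * q\<bar>}"
    define Bc where "Bc = {d. d < q \<and> th * p < \<bar>(\<Sum>c<p. X c d) - s * p\<bar>}"
    have fin: "finite Br" "finite Bc" unfolding Br_def Bc_def by auto
    have cBr: "real (card Br) \<le> th * p"
    proof -
      have "real (card Br) * (th * q) = (\<Sum>c\<in>Br. th * q)" by simp
      also have "\<dots> \<le> (\<Sum>c\<in>Br. \<bar>(\<Sum>d<q. X c d) - s * q\<bar>)" by (intro sum_mono) (auto simp: Br_def)
      also have "\<dots> \<le> (\<Sum>c<p. \<bar>(\<Sum>d<q. X c d) - s * q\<bar>)" by (rule sum_mono2) (auto simp: Br_def)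
      also have "\<dots> \<le> err" unfolding err by (simp add: sum_nonneg)
      finally have "real (card Br) * (th * q) \<le> (th * p) * (th * q)" using True by (simp add: power2_eq_square mult_ac)
      then show ?thesis using thp pos by (simp add: mult.commute)
    qed
    have cBc: "real (card Bc) \<le> th * q"
    proof -
      have "real (card Bc) * (th * p) = (\<Sum>d\<in>Bc. th * p)" by simp
      also have "\<dots> \<le> (\<Sum>d\<in>Bc. \<bar>(\<Sum>c<p. X c d) - s * p\<bar>)" by (intro sum_mono) (auto simp: Bc_def)
      also have "\<dots> \<le> (\<Sum>d<q. \<bar>(\<Sum>c<p. X c d) - s * p\<bar>)" by (rule sum_mono2) (auto simp: Bc_def)
      also have "\<dots> \<le> err" unfolding err by (simp add: sum_nonneg)
      finally have "real (card Bc) * (th * p) \<le> (th * q) * (th * p)" using True by (simp add: power2_eq_square mult_ac)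
      then show ?thesis using thp pos by (simp add: mult.commute)
    qed
    define X1 where "X1 c d = (if c \<in> Br \<or> d \<in> Bc then s else X c d)" for c d
    have X1: "0 \<le> X1 c d" "X1 c d \<le> 1" "real N * X1 c d \<in> \<int>" if "c < p" "d < q" for c d
      using X[OF that] s unfolding X1_def by auto
    have diff1: "\<bar>X c d - X1 c d\<bar> \<le> of_bool (c \<in> Br) + of_bool (d \<in> Bc)" if "c < p" "d < q" for c d
      using X[OF that] s unfolding X1_def by auto
    have ofr: "(\<Sum>c<p. of_bool (c \<in> Br) :: real) = card Br"
    proof -
      have "(\<Sum>c<p. of_bool (c \<in> Br) :: real) = (\<Sum>c\<in>Br. of_bool (c \<in> Br))"
        by (rule sum.mono_neutral_right) (auto simp: Br_def)
      then show ?thesis by simp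
    qed
    have ofc: "(\<Sum>d<q. of_bool (d \<in> Bc) :: real) = card Bc"
    proof -
      have "(\<Sum>d<q. of_bool (d \<in> Bc) :: real) = (\<Sum>d\<in>Bc. of_bool (d \<in> Bc))"
        by (rule sum.mono_neutral_right) (auto simp: Bc_def)
      then show ?thesis by simp
    qed
    have row: "\<bar>(\<Sum>d<q. X1 c d) - s * q\<bar> \<le> 2 * th * q" if c: "c < p" for c
    proof (cases "c \<in> Br")
      case True
      then show ?thesis using thp by (simp add: X1_def mult.commute)
    next
      case False
      have "\<bar>(\<Sum>d<q. X c d) - (\<Sum>d<q. X1 c d)\<bar> = \<bar>\<Sum>d<q. X c d - X1 c d\<bar>" by (simp add: sum_subtractf)
      also have "\<dots> \<le> (\<Sum>d<q. \<bar>X c d - X1 c d\<bar>)" by (rule sum_abs)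
      also have "\<dots> \<le> (\<Sum>d<q. of_bool (d \<in> Bc))"
        using diff1[OF c] False by (intro sum_mono) fastforce
      also have "\<dots> \<le> th * q" unfolding ofc by (rule cBc)
      finally have "\<bar>(\<Sum>d<q. X c d) - (\<Sum>d<q. X1 c d)\<bar> \<le> th * q" .
      moreover have "\<bar>(\<Sum>d<q. X c d) - s * q\<bar> \<le> th * q" using False c unfolding Br_def by auto
      ultimately show ?thesis by linarith
    qed
    have col: "\<bar>(\<Sum>c<p. X1 c d) - s * p\<bar> \<le> 2 * th * p" if d: "d < q" for d
    proof (cases "d \<in> Bc")
      case True
      then show ?thesis using thp by (simp add: X1_def mult.commute)
    next
      case False
      have "\<bar>(\<Sum>c<p. X c d) - (\<Sum>c<p. X1 c d)\<bar> = \<bar>\<Sum>c<p. X c d - X1 c d\<bar>" by (simp add: sum_subtractf)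
      also have "\<dots> \<le> (\<Sum>c<p. \<bar>X c d - X1 c d\<bar>)" by (rule sum_abs)
      also have "\<dots> \<le> (\<Sum>c<p. of_bool (c \<in> Br))"
        using diff1[OF _ d] False by (intro sum_mono) fastforce
      also have "\<dots> \<le> th * p" unfolding ofr by (rule cBr)
      finally have "\<bar>(\<Sum>c<p. X c d) - (\<Sum>c<p. X1 c d)\<bar> \<le> th * p" .
      moreover have "\<bar>(\<Sum>c<p. X c d) - s * p\<bar> \<le> th * p" using False d unfolding Bc_def by auto
      ultimately show ?thesis by linarith
    qed
    define tot where "tot = (\<Sum>c<p. \<Sum>d<q. X1 c d)"
    \<comment> \<open>\<open>\<alpha>\<close> and \<open>\<beta>\<close> spread the row and column
      deficits evenly over their entries. Correcting both repairs the total twice;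
      \<open>\<gamma>\<close>, the mean deficit, removes the surplus, as the sums of
      \<open>\<alpha>\<close> and \<open>\<beta>\<close> are \<open>p * \<gamma>\<close> and
      \<open>q * \<gamma>\<close>.\<close>
    define \<alpha> where "\<alpha> c = (s * q - (\<Sum>d<q. X1 c d)) / q" for c
    define \<beta> where "\<beta> d = (s * p - (\<Sum>c<p. X1 c d)) / p" for d
    define \<gamma> where "\<gamma> = s - tot / (real p * q)"
    have sa: "(\<Sum>c<p. \<alpha> c) = p * \<gamma>"
      unfolding \<alpha>_def \<gamma>_def tot_def sum_divide_distrib[symmetric] sum_subtractf using pos by (simp add: field_simps)
    have sb: "(\<Sum>d<q. \<beta> d) = q * \<gamma>"
      unfolding \<beta>_def \<gamma>_def tot_def sum_divide_distrib[symmetric] sum_subtractf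
      using pos by (subst sum.swap) (simp add: field_simps)
    have a: "\<bar>\<alpha> c\<bar> \<le> 2 * th" if "c < p" for c
      using row[OF that] pos unfolding \<alpha>_def by (simp add: field_simps abs_minus_commute)
    have b: "\<bar>\<beta> d\<bar> \<le> 2 * th" if "d < q" for d
      using col[OF that] pos unfolding \<beta>_def by (simp add: field_simps abs_minus_commute)
    have g: "\<bar>\<gamma>\<bar> \<le> 2 * th"
    proof -
      have "\<bar>p * \<gamma>\<bar> \<le> (\<Sum>c<p. \<bar>\<alpha> c\<bar>)" unfolding sa[symmetric] by (rule sum_abs)
      also have "\<dots> \<le> (\<Sum>c<p. 2 * th)" using a by (intro sum_mono) auto
      finally show ?thesis using pos by (simp add: abs_mult)
    qed
    define X3 where "X3 c d = X1 c d + \<alpha> c + \<beta> d - \<gamma>" for c d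
    have X3: "\<bar>X3 c d - X1 c d\<bar> \<le> 6 * th" if "c < p" "d < q" for c d
      using a[OF that(1)] b[OF that(2)] g unfolding X3_def by linarith
    have r3: "(\<Sum>d<q. X3 c d) = s * q" if "c < p" for c
    proof -
      have "(\<Sum>d<q. X3 c d) = (\<Sum>d<q. X1 c d) + q * \<alpha> c + (\<Sum>d<q. \<beta> d) - q * \<gamma>"
        unfolding X3_def by (simp add: sum.distrib sum_subtractf)
      then show ?thesis unfolding sb using pos by (simp add: \<alpha>_def)
    qed
    have c3: "(\<Sum>c<p. X3 c d) = s * p" if "d < q" for d
    proof -
      have "(\<Sum>c<p. X3 c d) = (\<Sum>c<p. X1 c d) + (\<Sum>c<p. \<alpha> c) + p * \<beta> d - p * \<gamma>"
        unfolding X3_def by (simp add: sum.distrib sum_subtractf)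
      then show ?thesis unfolding sa using pos by (simp add: \<beta>_def)
    qed
    \<comment> \<open>Entries of \<open>X3\<close> leave the unit interval by at most
      \<open>6 * th = lam / 4\<close>, which the contraction absorbs. The margin
      \<open>lam / 4\<close> that remains below 1 becomes \<open>1 / E\<close> for
      \<open>E = 4 * h\<close> and allows the density increase by \<open>E / (E - 1)\<close>
      later.\<close>
    define Y where "Y c d = (1 - lam) * X3 c d + lam / 2" for c d
    have rngY: "0 \<le> Y c d" "Y c d \<le> 1 - lam / 4" and YX3: "\<bar>Y c d - X3 c d\<bar> \<le> lam" if "c < p" "d < q" for c d
    proof -
      have lo: "- (lam / 4) \<le> X3 c d" and up: "X3 c d \<le> 1 + lam / 4"
        using X3[OF that] X1[OF that] lth by auto
      have "(1 - lam) * (- (lam / 4)) \<le> (1 - lam) * X3 c d" using lo lam01 by (intro mult_left_mono) auto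
      moreover have "0 \<le> (1 - lam) * (- (lam / 4)) + lam / 2" using lam01 by (simp add: field_simps)
      ultimately show "0 \<le> Y c d" unfolding Y_def by linarith
      have "(1 - lam) * X3 c d \<le> (1 - lam) * (1 + lam / 4)" using up lam01 by (intro mult_left_mono) auto
      moreover have "(1 - lam) * (1 + lam / 4) + lam / 2 \<le> 1 - lam / 4" using lam01 by (simp add: field_simps)
      ultimately show "Y c d \<le> 1 - lam / 4" unfolding Y_def by linarith
      have "Y c d - X3 c d = lam * (1 / 2 - X3 c d)" unfolding Y_def by (simp add: algebra_simps)
      moreover have "\<bar>1 / 2 - X3 c d\<bar> \<le> 1" using lo up lam01 by auto
      ultimately show "\<bar>Y c d - X3 c d\<bar> \<le> lam" using lam01 by (simp add: abs_mult mult_left_le)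
    qed
    \<comment> \<open>\<open>\<alpha>\<close>, \<open>\<beta>\<close> and \<open>\<gamma>\<close>
      bring the denominators \<open>q\<close>, \<open>p\<close> and \<open>p * q\<close>, the
      contraction brings \<open>2 * h\<close>, and the rounded entries bring
      \<open>N\<close>.\<close>
    have intY: "real (2 * h * N * p * q) * Y c d \<in> \<int>" if cd: "c < p" "d < q" for c d
    proof -
      have i1: "real N * (\<Sum>d<q. X1 c d) \<in> \<int>"
        unfolding sum_distrib_left using X1(3)[OF cd(1)] by (intro Ints_sum) auto
      have i2: "real N * (\<Sum>c<p. X1 c d) \<in> \<int>"
        unfolding sum_distrib_left using X1(3)[OF _ cd(2)] by (intro Ints_sum) auto
      have i3: "real N * tot \<in> \<int>"
        unfolding tot_def sum_distrib_left using X1(3) by (intro Ints_sum) auto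
      have "real (N * p * q) * X3 c d =
         (real N * X1 c d) * p * q + ((real N * s) * q - real N * (\<Sum>d<q. X1 c d)) * p
         + ((real N * s) * p - real N * (\<Sum>c<p. X1 c d)) * q - ((real N * s) * p * q - real N * tot)"
        unfolding X3_def \<alpha>_def \<beta>_def \<gamma>_def using pos by (simp add: field_simps)
      also have "\<dots> \<in> \<int>"
      proof -
        have "x * p * q + (z * q - y1) * p + (z * p - y2) * q - (z * p * q - y3) \<in> \<int>"
          if "x \<in> \<int>" "z \<in> \<int>" "y1 \<in> \<int>" "y2 \<in> \<int>" "y3 \<in> \<int>" for x z y1 y2 y3 :: real
          using that by (intro Ints_add Ints_diff Ints_mult) auto
        from this[OF X1(3)[OF cd] s(3) i1 i2 i3] show ?thesis .
      qed
      finally have i4: "real (N * p * q) * X3 c d \<in> \<int>" .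
      have "real (2 * h * N * p * q) * Y c d = 2 * (real h - real h * lam) * (real (N * p * q) * X3 c d) + (real h * lam) * real (N * p * q)"
        unfolding Y_def by (simp add: algebra_simps)
      also have "\<dots> = 2 * (real h - 1) * (real (N * p * q) * X3 c d) + real (N * p * q)" by (simp add: h1)
      also have "\<dots> \<in> \<int>"
      proof -
        have "2 * (real h - 1) * z + real (N * p * q) \<in> \<int>" if "z \<in> \<int>" for z
          using that by (intro Ints_mult Ints_add Ints_diff) auto
        from this[OF i4] show ?thesis .
      qed
      finally show ?thesis .
    qed
    have rY: "(\<Sum>d<q. Y c d) = t * q" if "c < p" for c
      unfolding Y_def sum.distrib sum_distrib_left[symmetric] r3[OF that] t by (simp add: algebra_simps)
    have cY: "(\<Sum>c<p. Y c d) = t * p" if "d < q" for d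
      unfolding Y_def sum.distrib sum_distrib_left[symmetric] c3[OF that] t by (simp add: algebra_simps)
    have "(\<Sum>c<p. \<Sum>d<q. \<bar>X c d - Y c d\<bar>) \<le> (\<Sum>c<p. \<Sum>d<q. of_bool (c \<in> Br) + of_bool (d \<in> Bc) + (6 * th + lam))"
    proof (intro sum_mono)
      fix c d assume "c \<in> {..<p}" "d \<in> {..<q}"
      then have cd: "c < p" "d < q" by auto
      show "\<bar>X c d - Y c d\<bar> \<le> of_bool (c \<in> Br) + of_bool (d \<in> Bc) + (6 * th + lam)"
        using diff1[OF cd] X3[OF cd] YX3[OF cd] by linarith
    qed
    also have "\<dots> = real q * card Br + real p * card Bc + real p * real q * (6 * th + lam)"
      by (simp only: sum.distrib sum.swap[of "\<lambda>c d. of_bool (c \<in> Br)"] sum_constant ofc card_lessThan sum_distrib_left[symmetric] sum_distrib_right[symmetric])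
         (simp add: ofr[symmetric] sum_distrib_left algebra_simps)
    also have "\<dots> \<le> real q * (th * p) + real p * (th * q) + real p * real q * (6 * th + lam)"
      using cBr cBc by (intro add_mono mult_left_mono) auto
    also have "\<dots> = real p * real q * (8 * th + lam)" by (simp add: algebra_simps)
    also have "\<dots> \<le> real p * real q * (2 * lam)"
      using lth thp by (intro mult_left_mono) auto
    also have "\<dots> \<le> 2 * lam * p * q + err / th\<^sup>2" using err0 by (simp add: mult_ac)
    finally have cost: "(\<Sum>c<p. \<Sum>d<q. \<bar>X c d - Y c d\<bar>) \<le> 2 * lam * p * q + err / th\<^sup>2" .
    show ?thesis using rngY intY rY cY cost by (intro exI[of _ Y]) auto
  qed
qed

text \<open>The blocks are corrected independently, so the results for \<open>(i, j)\<close> and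
  \<open>(j, i)\<close> need not be transposes of each other. Averaging with the transpose restores
  symmetry and keeps the row sums, because the columns of every block are exact too. Averaging
  doubles the factor \<open>2 * h\<close>, and \<open>(fact M)\<^sup>2\<close> is a common multiple
  of all products \<open>m i * m j\<close>.\<close>

lemma matrix_regularize:
  fixes m :: "nat \<Rightarrow> nat" and s t :: "nat \<Rightarrow> nat \<Rightarrow> real" and X :: "nat \<times> nat \<Rightarrow> nat \<times> nat \<Rightarrow> real"
    and k N h M :: nat
  assumes Cl: "Cl = (SIGMA i:{..<k}. {..<m i})"
    and pos: "N > 0" "h > 0" and mM: "\<And>i. i < k \<Longrightarrow> m i \<le> M"
    and X: "\<And>c d. c \<in> Cl \<Longrightarrow> d \<in> Cl \<Longrightarrow> 0 \<le> X c d \<and> X c d \<le> 1 \<and> real N * X c d \<in> \<int> \<and> X c d = X d c"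
    and s: "\<And>i j. i < k \<Longrightarrow> j < k \<Longrightarrow> 0 \<le> s i j \<and> s i j \<le> 1 \<and> real N * s i j \<in> \<int> \<and> s i j = s j i"
    and err: "err = (\<Sum>c\<in>Cl. \<Sum>j<k. \<bar>(\<Sum>l<m j. X c (j, l)) - s (fst c) j * m j\<bar>)"
    and lam: "lam = 1 / real h" and th: "th = 1 / (24 * real h)"
    and t: "\<And>i j. t i j = (1 - lam) * s i j + lam / 2"
  shows "\<exists>Y. (\<forall>c\<in>Cl. \<forall>d\<in>Cl. Y c d = Y d c \<and> 0 \<le> Y c d \<and> Y c d \<le> 1 - lam / 4 \<and> real (4 * h * N * (fact M)\<^sup>2) * Y c d \<in> \<int>) \<and>
    (\<forall>c\<in>Cl. \<forall>j<k. (\<Sum>l<m j. Y c (j, l)) = t (fst c) j * m j) \<and>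
    (\<Sum>c\<in>Cl. \<Sum>d\<in>Cl. \<bar>X c d - Y c d\<bar>) \<le> 2 * lam * (real (card Cl))\<^sup>2 + 2 * err / th\<^sup>2"
proof -
  define er where "er i j = (\<Sum>c<m i. \<bar>(\<Sum>d<m j. X (i, c) (j, d)) - s i j * m j\<bar>) +
      (\<Sum>d<m j. \<bar>(\<Sum>c<m i. X (i, c) (j, d)) - s i j * m i\<bar>)" for i j
  define P where "P i j Z \<longleftrightarrow> (\<forall>c<m i. \<forall>d<m j. 0 \<le> Z c d \<and> Z c d \<le> 1 - lam / 4 \<and> real (2 * h * N * m i * m j) * Z c d \<in> \<int>) \<and>
    (\<forall>c<m i. (\<Sum>d<m j. Z c d) = t i j * m j) \<and> (\<forall>d<m j. (\<Sum>c<m i. Z c d) = t i j * m i) \<and>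
    (\<Sum>c<m i. \<Sum>d<m j. \<bar>X (i, c) (j, d) - Z c d\<bar>) \<le> 2 * lam * m i * m j + er i j / th\<^sup>2" for i j and Z :: "nat \<Rightarrow> nat \<Rightarrow> real"
  have "\<exists>Z. P i j Z"
    if ij: "i < k" "j < k" for i j
  proof (cases "m i > 0 \<and> m j > 0")
    case True
    show ?thesis unfolding P_def
      by (rule block_regularize[OF _ _ pos _ _ _ _ er_def lam th t])
         (use True ij s[OF ij] X in \<open>auto simp: Cl\<close>)
  next
    case False
    have "0 \<le> er i j" unfolding er_def by (intro add_nonneg_nonneg sum_nonneg) auto
    then show ?thesis unfolding P_def using False by auto
  qed
  then obtain Z where "\<And>i j. i < k \<Longrightarrow> j < k \<Longrightarrow> P i j (Z i j)" by metis
  note Z = this[unfolded P_def]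
  define Y0 where "Y0 c d = Z (fst c) (fst d) (snd c) (snd d)" for c d
  define Y where "Y c d = (Y0 c d + Y0 d c) / 2" for c d
  have Y0: "0 \<le> Y0 c d" "Y0 c d \<le> 1 - lam / 4" "real (2 * h * N * m (fst c) * m (fst d)) * Y0 c d \<in> \<int>"
    if "c \<in> Cl" "d \<in> Cl" for c d
    using Z[of "fst c" "fst d"] that unfolding Y0_def Cl by auto
  have Y0i: "real (2 * h * N * (fact M)\<^sup>2) * Y0 c d \<in> \<int>" if cd: "c \<in> Cl" "d \<in> Cl" for c d
  proof -
    have "m (fst c) dvd (fact M :: nat)" "m (fst d) dvd (fact M :: nat)"
      using cd mM by (auto simp: Cl intro!: dvd_fact)
    then obtain u v where uv: "fact M = m (fst c) * u" "fact M = m (fst d) * v" by (auto elim!: dvdE)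
    have "(fact M :: nat)\<^sup>2 = m (fst c) * u * (m (fst d) * v)" using uv by (simp add: power2_eq_square)
    then have "real (2 * h * N * (fact M)\<^sup>2) * Y0 c d = real (u * v) * (real (2 * h * N * m (fst c) * m (fst d)) * Y0 c d)"
      by (simp add: mult_ac)
    also have "\<dots> \<in> \<int>" by (rule Ints_mult[OF _ Y0(3)[OF cd]]) simp
    finally show ?thesis .
  qed
  have "finite Cl" unfolding Cl by auto
  have sumCl: "(\<Sum>c\<in>Cl. f c) = (\<Sum>i<k. \<Sum>l<m i. f (i, l))" for f :: "nat \<times> nat \<Rightarrow> real"
    unfolding Cl by (subst sum.Sigma) auto
  have i: "real (4 * h * N * (fact M)\<^sup>2) * Y c d \<in> \<int>" if "c \<in> Cl" "d \<in> Cl" for c d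
  proof -
    have "real (4 * h * N * (fact M)\<^sup>2) * Y c d = real (2 * h * N * (fact M)\<^sup>2) * Y0 c d + real (2 * h * N * (fact M)\<^sup>2) * Y0 d c"
      unfolding Y_def by (simp add: algebra_simps)
    then show ?thesis using Y0i[OF that] Y0i[OF that(2,1)] by (simp only: Ints_add)
  qed
  have ii: "(\<Sum>l<m j. Y c (j, l)) = t (fst c) j * m j" if "c \<in> Cl" "j < k" for c j
  proof -
    have c: "fst c < k" "snd c < m (fst c)" using that by (auto simp: Cl)
    have tt: "t j (fst c) = t (fst c) j" unfolding t using s[OF c(1) that(2)] by simp
    have "(\<Sum>l<m j. Y0 c (j, l)) = t (fst c) j * m j" "(\<Sum>l<m j. Y0 (j, l) c) = t j (fst c) * m j"
      unfolding Y0_def using Z[OF c(1) that(2)] Z[OF that(2) c(1)] c(2) by auto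
    then show ?thesis unfolding Y_def sum_divide_distrib[symmetric] sum.distrib tt by simp
  qed
  have Xs: "X d c = X c d" if "c \<in> Cl" "d \<in> Cl" for c d using X[OF that] by simp
  have "(\<Sum>c\<in>Cl. \<Sum>d\<in>Cl. \<bar>X c d - Y c d\<bar>) \<le> (\<Sum>c\<in>Cl. \<Sum>d\<in>Cl. \<bar>X c d - Y0 c d\<bar> / 2 + \<bar>X d c - Y0 d c\<bar> / 2)"
  proof (intro sum_mono)
    fix c d assume "c \<in> Cl" "d \<in> Cl"
    then have "X c d - Y c d = (X c d - Y0 c d) / 2 + (X d c - Y0 d c) / 2"
      using Xs[of c d] by (simp add: Y_def field_simps)
    then show "\<bar>X c d - Y c d\<bar> \<le> \<bar>X c d - Y0 c d\<bar> / 2 + \<bar>X d c - Y0 d c\<bar> / 2"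
      using abs_triangle_ineq[of "(X c d - Y0 c d) / 2" "(X d c - Y0 d c) / 2"] by simp
  qed
  also have "\<dots> = (\<Sum>c\<in>Cl. \<Sum>d\<in>Cl. \<bar>X c d - Y0 c d\<bar> / 2) + (\<Sum>c\<in>Cl. \<Sum>d\<in>Cl. \<bar>X d c - Y0 d c\<bar> / 2)"
    by (simp add: sum.distrib)
  also have "(\<Sum>c\<in>Cl. \<Sum>d\<in>Cl. \<bar>X d c - Y0 d c\<bar> / 2) = (\<Sum>c\<in>Cl. \<Sum>d\<in>Cl. \<bar>X c d - Y0 c d\<bar> / 2)"
    by (rule sum.swap)
  also have "(\<Sum>c\<in>Cl. \<Sum>d\<in>Cl. \<bar>X c d - Y0 c d\<bar> / 2) + (\<Sum>c\<in>Cl. \<Sum>d\<in>Cl. \<bar>X c d - Y0 c d\<bar> / 2) = (\<Sum>c\<in>Cl. \<Sum>d\<in>Cl. \<bar>X c d - Y0 c d\<bar>)"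
    by (simp add: sum_divide_distrib[symmetric])
  also have "\<dots> = (\<Sum>i<k. \<Sum>l<m i. \<Sum>j<k. \<Sum>l'<m j. \<bar>X (i, l) (j, l') - Z i j l l'\<bar>)"
    unfolding sumCl Y0_def by simp
  also have "\<dots> = (\<Sum>i<k. \<Sum>j<k. \<Sum>l<m i. \<Sum>l'<m j. \<bar>X (i, l) (j, l') - Z i j l l'\<bar>)"
    by (intro sum.cong refl sum.swap)
  also have "\<dots> \<le> (\<Sum>i<k. \<Sum>j<k. 2 * lam * m i * m j + er i j / th\<^sup>2)"
    using Z by (intro sum_mono) auto
  also have "\<dots> = 2 * lam * (\<Sum>i<k. \<Sum>j<k. real (m i) * real (m j)) + (\<Sum>i<k. \<Sum>j<k. er i j) / th\<^sup>2"
    by (simp add: sum.distrib sum_distrib_left sum_divide_distrib mult.assoc)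
  also have "(\<Sum>i<k. \<Sum>j<k. real (m i) * real (m j)) = (real (card Cl))\<^sup>2"
    unfolding sum_product[symmetric] Cl by (simp add: power2_eq_square)
  \<comment> \<open>The column deviations of one block are the row deviations of the transposed
    block, so each deviation is counted twice.\<close>
  also have "(\<Sum>i<k. \<Sum>j<k. er i j) = 2 * err"
  proof -
    have "(\<Sum>i<k. \<Sum>j<k. \<Sum>c<m i. \<bar>(\<Sum>d<m j. X (i, c) (j, d)) - s i j * m j\<bar>) = err"
      unfolding err sumCl fst_conv by (rule sum.cong[OF refl], rule sum.swap)
    moreover have "(\<Sum>i<k. \<Sum>j<k. \<Sum>d<m j. \<bar>(\<Sum>c<m i. X (i, c) (j, d)) - s i j * m i\<bar>) = err"
    proof -
      have "(\<Sum>i<k. \<Sum>j<k. \<Sum>d<m j. \<bar>(\<Sum>c<m i. X (i, c) (j, d)) - s i j * m i\<bar>)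
          = (\<Sum>j<k. \<Sum>i<k. \<Sum>d<m j. \<bar>(\<Sum>c<m i. X (j, d) (i, c)) - s j i * m i\<bar>)"
      proof (subst sum.swap, intro sum.cong refl)
        fix j i d assume *: "j \<in> {..<k}" "i \<in> {..<k}" "d \<in> {..<m j}"
        have "(\<Sum>c<m i. X (i, c) (j, d)) = (\<Sum>c<m i. X (j, d) (i, c))"
          using * by (intro sum.cong refl Xs) (auto simp: Cl)
        moreover have "s i j = s j i" using * s[of i j] by auto
        ultimately show "\<bar>(\<Sum>c<m i. X (i, c) (j, d)) - s i j * m i\<bar> = \<bar>(\<Sum>c<m i. X (j, d) (i, c)) - s j i * m i\<bar>" by simp
      qed
      also have "\<dots> = err" unfolding err sumCl fst_conv by (rule sum.cong[OF refl], rule sum.swap)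
      finally show ?thesis .
    qed
    ultimately show ?thesis unfolding er_def by (simp add: sum.distrib)
  qed
  finally have iii: "(\<Sum>c\<in>Cl. \<Sum>d\<in>Cl. \<bar>X c d - Y c d\<bar>) \<le> 2 * lam * (real (card Cl))\<^sup>2 + 2 * err / th\<^sup>2" .
  have iv: "0 \<le> Y c d" "Y c d \<le> 1 - lam / 4" "Y c d = Y d c" if "c \<in> Cl" "d \<in> Cl" for c d
    using Y0(1,2)[OF that] Y0(1,2)[OF that(2,1)] unfolding Y_def by auto
  show ?thesis using i ii iii iv by (intro exI[of _ Y]) blast
qed

section \<open>Graphs with prescribed degrees\<close>

text \<open>Each vertex carries a subcell \<open>fc\<close>, a position \<open>av\<close>, a shift
  \<open>bv\<close> and a word \<open>xv\<close>, and every combination of labels occurs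
  \<open>s\<close> times in each subcell. One end of a pair contributes a position and a shift, the
  other end a word: the letter at that position plus the shift is uniform modulo \<open>T\<close>
  both when the word varies and when the shift varies. This makes all degrees exact, while
  independence of the letters makes the pairs quasirandom.\<close>

locale word_graph =
  fixes V :: "nat set" and fc av bv :: "nat \<Rightarrow> nat" and xv :: "nat \<Rightarrow> nat \<Rightarrow> nat"
    and Fc :: "nat set" and K T s :: nat and p :: "nat \<Rightarrow> nat \<Rightarrow> nat"
  assumes finV: "finite V" and T: "T > 0" and K: "K > 0" and finFc: "finite Fc"
    and label: "\<And>v. v \<in> V \<Longrightarrow> fc v \<in> Fc \<and> av v < K \<and> bv v < T \<and> xv v \<in> words K T"
    and fibre: "\<And>f a b x. f \<in> Fc \<Longrightarrow> a < K \<Longrightarrow> b < T \<Longrightarrow> x \<in> words K T \<Longrightarrow>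
       card {v \<in> V. fc v = f \<and> av v = a \<and> bv v = b \<and> xv v = x} = s"
    and psym: "\<And>f f'. f \<in> Fc \<Longrightarrow> f' \<in> Fc \<Longrightarrow> p f f' = p f' f \<and> p f f' \<le> T"
begin

text \<open>The order of the subcell codes decides which end acts through position and shift and
  which through its word; this makes the relation symmetric. Two vertices of one subcell are never
  adjacent, which also excludes loops.\<close>

definition adj :: "nat \<Rightarrow> nat \<Rightarrow> bool" where
  "adj u v \<longleftrightarrow> u \<in> V \<and> v \<in> V \<and>
     (fc u < fc v \<and> (xv v (av u) + bv u) mod T < p (fc u) (fc v) \<or>
      fc v < fc u \<and> (xv u (av v) + bv v) mod T < p (fc v) (fc u))"

definition edges :: "nat set set" where
  "edges = {{u, v} |u v. adj u v}"

lemma adj_commute: "adj u v \<longleftrightarrow> adj v u" unfolding adj_def by auto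

lemma edges_iff: "{u, v} \<in> edges \<longleftrightarrow> adj u v"
  unfolding edges_def using adj_commute by (auto simp: doubleton_eq_iff)

lemma edgesD:
  assumes "e \<in> edges"
  shows "e \<subseteq> V \<and> card e = 2"
proof -
  obtain u v where uv: "e = {u, v}" "adj u v" using assms unfolding edges_def by blast
  then have "u \<noteq> v" unfolding adj_def by auto
  then show ?thesis using uv unfolding adj_def by auto
qed

lemma sum_cell:
  fixes \<psi> :: "nat \<Rightarrow> nat \<Rightarrow> (nat \<Rightarrow> nat) \<Rightarrow> real"
  assumes f: "f \<in> Fc"
  shows "(\<Sum>v\<in>{v\<in>V. fc v = f}. \<psi> (av v) (bv v) (xv v)) = s * (\<Sum>a<K. \<Sum>b<T. \<Sum>x\<in>words K T. \<psi> a b x)"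
proof -
  let ?A = "{v\<in>V. fc v = f}" and ?B = "{..<K} \<times> {..<T} \<times> words K T"
  have finB: "finite ?B" by (intro finite_cartesian_product finite_PiE) auto
  have "(\<Sum>v\<in>?A. \<psi> (av v) (bv v) (xv v)) = (\<Sum>y\<in>?B. \<Sum>v\<in>{v \<in> ?A. (av v, bv v, xv v) = y}. \<psi> (av v) (bv v) (xv v))"
    by (rule sum.group[symmetric]) (use finV finB label in auto)
  also have "\<dots> = (\<Sum>y\<in>?B. s * (case y of (a, b, x) \<Rightarrow> \<psi> a b x))"
  proof (rule sum.cong[OF refl])
    fix y assume "y \<in> ?B"
    then obtain a b x where y: "y = (a, b, x)" "a < K" "b < T" "x \<in> words K T" by auto
    have "(\<Sum>v\<in>{v \<in> ?A. (av v, bv v, xv v) = y}. \<psi> (av v) (bv v) (xv v)) = (\<Sum>v\<in>{v \<in> ?A. (av v, bv v, xv v) = y}. \<psi> a b x)"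
      by (rule sum.cong) (auto simp: y(1))
    also have "{v \<in> ?A. (av v, bv v, xv v) = y} = {v \<in> V. fc v = f \<and> av v = a \<and> bv v = b \<and> xv v = x}"
      using y(1) by auto
    finally show "(\<Sum>v\<in>{v \<in> ?A. (av v, bv v, xv v) = y}. \<psi> (av v) (bv v) (xv v)) = s * (case y of (a, b, x) \<Rightarrow> \<psi> a b x)"
      using fibre[OF f y(2-4)] y(1) by simp
  qed
  also have "\<dots> = s * (\<Sum>y\<in>?B. case y of (a, b, x) \<Rightarrow> \<psi> a b x)" by (simp add: sum_distrib_left)
  also have "(\<Sum>y\<in>?B. case y of (a, b, x) \<Rightarrow> \<psi> a b x) = (\<Sum>a<K. \<Sum>b<T. \<Sum>x\<in>words K T. \<psi> a b x)"
    by (simp add: sum.cartesian_product split_def)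
  finally show ?thesis .
qed

lemma card_cell: "f \<in> Fc \<Longrightarrow> card {v\<in>V. fc v = f} = s * K * T ^ (K + 1)"
proof -
  assume f: "f \<in> Fc"
  have "real (card {v\<in>V. fc v = f}) = real (s * K * T ^ (K + 1))"
    using sum_cell[OF f, of "\<lambda>_ _ _. 1"] by (simp add: card_words)
  then show ?thesis by (simp only: of_nat_eq_iff)
qed

lemma count_shift:
  assumes "q \<le> T"
  shows "(\<Sum>z<T. of_bool ((z + b) mod T < q) :: real) = q"
  using sum_shift[OF T, of "\<lambda>z. of_bool (z < q) :: real" b] sum_of_bool_less[OF assms] by simp

text \<open>If \<open>u\<close> is the position end, the letter at its fixed position is uniform
  over the words of the other subcell; if \<open>u\<close> is the word end, the shift is uniform for
  every position. Either way exactly the fraction \<open>p / T\<close> of the labels is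
  adjacent.\<close>

lemma degree_cell:
  assumes u: "u \<in> V" and f: "f \<in> Fc" "f \<noteq> fc u"
  shows "card {v \<in> V. fc v = f \<and> adj u v} = s * K * T ^ K * p (fc u) f"
proof -
  have pT: "p (fc u) f \<le> T" "p f (fc u) = p (fc u) f" using psym[of "fc u" f] label[OF u] f by auto
  have "real (card {v \<in> V. fc v = f \<and> adj u v}) = (\<Sum>v\<in>{v \<in> V. fc v = f}. of_bool (adj u v))"
  proof -
    have "(\<Sum>v\<in>{v \<in> V. fc v = f}. of_bool (adj u v) :: real) = (\<Sum>v\<in>{v \<in> V. fc v = f \<and> adj u v}. of_bool (adj u v))"
      by (rule sum.mono_neutral_right) (use finV in auto)
    then show ?thesis by simp
  qed
  also have "\<dots> = real (s * K * T ^ K * p (fc u) f)"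
  proof (cases "fc u < f")
    case True
    have "(\<Sum>v\<in>{v \<in> V. fc v = f}. of_bool (adj u v) :: real)
        = (\<Sum>v\<in>{v \<in> V. fc v = f}. of_bool ((xv v (av u) + bv u) mod T < p (fc u) f))"
      by (rule sum.cong) (use True u in \<open>auto simp: adj_def\<close>)
    also have "\<dots> = real s * (\<Sum>a<K. \<Sum>b<T. \<Sum>x\<in>words K T. of_bool ((x (av u) + bv u) mod T < p (fc u) f))"
      by (rule sum_cell[OF f(1)])
    also have "\<dots> = real s * (real K * (real T * (\<Sum>x\<in>words K T. of_bool ((x (av u) + bv u) mod T < p (fc u) f))))"
      by simp
    also have "real T * (\<Sum>x\<in>words K T. of_bool ((x (av u) + bv u) mod T < p (fc u) f)) = real T ^ K * p (fc u) f"
      using sum_words_one[of "av u" K T "\<lambda>z. of_bool ((z + bv u) mod T < p (fc u) f)"] label[OF u]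
      by (simp add: count_shift[OF pT(1)])
    finally show ?thesis by (simp add: mult_ac)
  next
    case False
    then have lt: "f < fc u" using f by simp
    have "(\<Sum>v\<in>{v \<in> V. fc v = f}. of_bool (adj u v) :: real)
        = (\<Sum>v\<in>{v \<in> V. fc v = f}. of_bool ((xv u (av v) + bv v) mod T < p (fc u) f))"
      by (rule sum.cong) (use lt u pT in \<open>auto simp: adj_def\<close>)
    also have "\<dots> = real s * (\<Sum>a<K. \<Sum>b<T. \<Sum>x\<in>words K T. of_bool ((xv u a + b) mod T < p (fc u) f))"
      by (rule sum_cell[OF f(1)])
    also have "\<dots> = real s * (\<Sum>a<K. real T ^ K * (\<Sum>b<T. of_bool ((b + xv u a) mod T < p (fc u) f)))"
      by (simp add: card_words sum_distrib_left add.commute mult_ac)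
    finally show ?thesis by (simp add: count_shift[OF pT(1)] mult_ac)
  qed
  finally show ?thesis by (simp only: of_nat_eq_iff)
qed

text \<open>\<open>I\<close> matters only through the number of its vertices with given position and
  shift, at most \<open>s * T ^ K\<close>, and \<open>J\<close> only through the number with a given
  word, at most \<open>s * K * T\<close>. With these counts as weights the bound for random words
  applies.\<close>

lemma cut_cell_less:
  assumes f: "f1 \<in> Fc" "f2 \<in> Fc" "f1 < f2" and IJ: "I \<subseteq> V" "J \<subseteq> V"
  shows "\<bar>\<Sum>u\<in>{u\<in>I. fc u = f1}. \<Sum>v\<in>{v\<in>J. fc v = f2}. of_bool (adj u v) - real (p f1 f2) / real T\<bar>
    \<le> (real (s * K * T ^ (K + 1)))\<^sup>2 / sqrt K"
proof -
  let ?I = "{u\<in>I. fc u = f1}" and ?J = "{v\<in>J. fc v = f2}"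
  have fin: "finite ?I" "finite ?J" using IJ by (auto intro: finite_subset[OF _ finV])
  let ?\<phi> = "\<lambda>a b x. shift_dev T (p f1 f2) (x a + b)"
  define \<alpha> where "\<alpha> a b = real (card {u \<in> ?I. (av u, bv u) = (a, b)})" for a b
  define \<xi> where "\<xi> x = real (card {v \<in> ?J. xv v = x})" for x
  have "(\<Sum>u\<in>?I. \<Sum>v\<in>?J. of_bool (adj u v) - real (p f1 f2) / real T) = (\<Sum>u\<in>?I. \<Sum>v\<in>?J. ?\<phi> (av u) (bv u) (xv v))"
    using IJ f(3) by (intro sum.cong refl) (auto simp: adj_def shift_dev_def)
  also have "\<dots> = (\<Sum>v\<in>?J. \<Sum>u\<in>?I. ?\<phi> (av u) (bv u) (xv v))" by (rule sum.swap)
  also have "\<dots> = (\<Sum>v\<in>?J. \<Sum>y\<in>{..<K} \<times> {..<T}. \<alpha> (fst y) (snd y) * ?\<phi> (fst y) (snd y) (xv v))"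
  proof (rule sum.cong[OF refl])
    fix v assume v: "v \<in> ?J"
    have "(\<Sum>u\<in>?I. ?\<phi> (av u) (bv u) (xv v)) = (\<Sum>y\<in>{..<K} \<times> {..<T}. \<Sum>u\<in>{u \<in> ?I. (av u, bv u) = y}. ?\<phi> (av u) (bv u) (xv v))"
      by (rule sum.group[symmetric]) (use fin label IJ in auto)
    also have "\<dots> = (\<Sum>y\<in>{..<K} \<times> {..<T}. \<alpha> (fst y) (snd y) * ?\<phi> (fst y) (snd y) (xv v))"
    proof (rule sum.cong[OF refl])
      fix y
      have "(\<Sum>u\<in>{u \<in> ?I. (av u, bv u) = y}. ?\<phi> (av u) (bv u) (xv v)) = (\<Sum>u\<in>{u \<in> ?I. (av u, bv u) = y}. ?\<phi> (fst y) (snd y) (xv v))"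
        by (rule sum.cong) auto
      then show "(\<Sum>u\<in>{u \<in> ?I. (av u, bv u) = y}. ?\<phi> (av u) (bv u) (xv v)) = \<alpha> (fst y) (snd y) * ?\<phi> (fst y) (snd y) (xv v)"
        by (simp add: \<alpha>_def)
    qed
    finally show "(\<Sum>u\<in>?I. ?\<phi> (av u) (bv u) (xv v)) = (\<Sum>y\<in>{..<K} \<times> {..<T}. \<alpha> (fst y) (snd y) * ?\<phi> (fst y) (snd y) (xv v))" .
  qed
  also have "\<dots> = (\<Sum>x\<in>words K T. \<Sum>v\<in>{v\<in>?J. xv v = x}. \<Sum>y\<in>{..<K} \<times> {..<T}. \<alpha> (fst y) (snd y) * ?\<phi> (fst y) (snd y) (xv v))"
    by (rule sum.group[symmetric]) (use fin label IJ in \<open>auto intro!: finite_PiE\<close>)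
  also have "\<dots> = (\<Sum>x\<in>words K T. \<xi> x * (\<Sum>y\<in>{..<K} \<times> {..<T}. \<alpha> (fst y) (snd y) * ?\<phi> (fst y) (snd y) x))"
    by (intro sum.cong refl) (simp add: \<xi>_def)
  also have "\<dots> = (\<Sum>x\<in>words K T. \<Sum>a<K. \<Sum>b<T. \<alpha> a b * \<xi> x * ?\<phi> a b x)"
    by (intro sum.cong refl) (simp add: sum.cartesian_product split_def sum_distrib_left mult_ac)
  finally have eq: "(\<Sum>u\<in>?I. \<Sum>v\<in>?J. of_bool (adj u v) - real (p f1 f2) / real T) = \<dots>" .
  have "\<bar>\<Sum>x\<in>words K T. \<Sum>a<K. \<Sum>b<T. \<alpha> a b * \<xi> x * ?\<phi> a b x\<bar> \<le> real (s * T ^ K) * real (s * K * T) * real T ^ (K + 1) * sqrt K"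
  proof (rule quasirandom_words[OF T])
    show "p f1 f2 \<le> T" using psym f by auto
    show "0 \<le> \<alpha> a b \<and> \<alpha> a b \<le> real (s * T ^ K)" if "a < K" "b < T" for a b
    proof -
      have "\<alpha> a b \<le> real (card {u \<in> V. fc u = f1 \<and> av u = a \<and> bv u = b})"
        unfolding \<alpha>_def using IJ finV by (intro of_nat_mono card_mono) auto
      also have "\<dots> = (\<Sum>u\<in>{u\<in>V. fc u = f1}. of_bool (av u = a \<and> bv u = b))"
        using finV by (simp add: of_bool_def sum.inter_filter[symmetric] conj_assoc)
      also have "\<dots> = real s * (\<Sum>a'<K. \<Sum>b'<T. \<Sum>x\<in>words K T. of_bool (a' = a \<and> b' = b))"
        by (rule sum_cell[OF f(1)])
      also have "(\<Sum>a'<K. \<Sum>b'<T. \<Sum>x\<in>words K T. of_bool (a' = a \<and> b' = b) :: real) = real T ^ K"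
      proof -
        have "(\<Sum>b'<T. \<Sum>x\<in>words K T. of_bool (a' = a \<and> b' = b) :: real) = (if a' = a then real T ^ K else 0)" for a'
          using that by (simp add: card_words of_bool_def sum.delta if_distrib[of "\<lambda>x. _ * x"] cong: if_cong)
        then show ?thesis using that by (simp add: sum.delta)
      qed
      finally show ?thesis by (simp add: \<alpha>_def)
    qed
    show "0 \<le> \<xi> x \<and> \<xi> x \<le> real (s * K * T)" if "x \<in> words K T" for x
    proof -
      have "\<xi> x \<le> real (card {u \<in> V. fc u = f2 \<and> xv u = x})"
        unfolding \<xi>_def using IJ finV by (intro of_nat_mono card_mono) auto
      also have "\<dots> = (\<Sum>u\<in>{u\<in>V. fc u = f2}. of_bool (xv u = x))"
        using finV by (simp add: of_bool_def sum.inter_filter[symmetric] conj_assoc)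
      also have "\<dots> = real s * (\<Sum>a'<K. \<Sum>b'<T. \<Sum>x'\<in>words K T. of_bool (x' = x))"
        by (rule sum_cell[OF f(2)])
      also have "(\<Sum>x'\<in>words K T. of_bool (x' = x) :: real) = 1"
        using that by (simp add: of_bool_def sum.delta finite_PiE)
      finally show ?thesis by (simp add: \<xi>_def mult_ac)
    qed
  qed auto
  also have "\<dots> = (real (s * K * T ^ (K + 1)))\<^sup>2 / sqrt K"
  proof -
    have "sqrt K * sqrt K = real K" "sqrt K \<noteq> 0" using K by auto
    then show ?thesis by (simp add: field_simps power2_eq_square)
  qed
  finally show ?thesis unfolding eq .
qed

lemma cut_cell:
  assumes f: "f1 \<in> Fc" "f2 \<in> Fc" "f1 \<noteq> f2" and IJ: "I \<subseteq> V" "J \<subseteq> V"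
  shows "\<bar>\<Sum>u\<in>{u\<in>I. fc u = f1}. \<Sum>v\<in>{v\<in>J. fc v = f2}. of_bool (adj u v) - real (p f1 f2) / real T\<bar>
    \<le> (real (s * K * T ^ (K + 1)))\<^sup>2 / sqrt K"
proof (cases "f1 < f2")
  case True
  then show ?thesis by (rule cut_cell_less[OF f(1,2) _ IJ])
next
  case False
  then have lt: "f2 < f1" using f(3) by simp
  have "p f1 f2 = p f2 f1" using psym f by auto
  then show ?thesis
    using cut_cell_less[OF f(2,1) lt IJ(2,1)] by (subst sum.swap) (simp add: adj_commute)
qed

end

section \<open>Cut norm and weak regularity\<close>

abbreviation rect_integral :: "'a measure \<Rightarrow> ('a \<times> 'a \<Rightarrow> real) \<Rightarrow> 'a set \<Rightarrow> 'a set \<Rightarrow> real" where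
  "rect_integral M W S T \<equiv> set_lebesgue_integral (M \<Otimes>\<^sub>M M) (S \<times> T) W"

section \<open>Integrals over rectangles\<close>

context prob_space
begin

lemma pair_prob_space_self: "pair_prob_space M M"
  by standard

lemma integrable_bounded_pair:
  assumes "W \<in> borel_measurable (M \<Otimes>\<^sub>M M)" "\<And>z. z \<in> space (M \<Otimes>\<^sub>M M) \<Longrightarrow> \<bar>W z\<bar> \<le> (B::real)"
  shows "integrable (M \<Otimes>\<^sub>M M) W"
proof -
  interpret P: pair_prob_space M M by (rule pair_prob_space_self)
  show ?thesis
    by (rule P.integrable_const_bound[of _ B]) (use assms in \<open>auto intro!: AE_I2\<close>)
qed

lemma set_integrable_bounded_pair:
  assumes "W \<in> borel_measurable (M \<Otimes>\<^sub>M M)" "\<And>z. z \<in> space (M \<Otimes>\<^sub>M M) \<Longrightarrow> \<bar>W z\<bar> \<le> (B::real)"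
    and [measurable]: "A \<in> sets (M \<Otimes>\<^sub>M M)"
  shows "set_integrable (M \<Otimes>\<^sub>M M) A W"
  unfolding set_integrable_def
  by (rule integrable_mult_indicator) (use assms integrable_bounded_pair[OF assms(1,2)] in auto)

lemma measure_rect:
  assumes "S \<in> sets M" "T \<in> sets M"
  shows "measure (M \<Otimes>\<^sub>M M) (S \<times> T) = measure M S * measure M T"
  using assms by (simp add: measure_def emeasure_pair_measure_Times enn2real_mult)

lemma rect_integral_const:
  assumes "S \<in> sets M" "T \<in> sets M" "\<And>x y. x \<in> S \<Longrightarrow> y \<in> T \<Longrightarrow> W (x, y) = c"
  shows "rect_integral M W S T = c * measure M S * measure M T"
proof -
  interpret P: pair_prob_space M M by (rule pair_prob_space_self)
  have "rect_integral M W S T = (\<integral>z\<in>S \<times> T. c \<partial>(M \<Otimes>\<^sub>M M))"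
    using assms by (intro set_lebesgue_integral_cong) auto
  also have "\<dots> = measure (M \<Otimes>\<^sub>M M) (S \<times> T) * c"
    using assms by (subst set_integral_const) (auto simp: P.emeasure_finite)
  finally show ?thesis using measure_rect[OF assms(1,2)] by simp
qed

lemma rect_integral_mono:
  assumes "W \<in> borel_measurable (M \<Otimes>\<^sub>M M)" "\<And>z. z \<in> space (M \<Otimes>\<^sub>M M) \<Longrightarrow> \<bar>W z\<bar> \<le> (B::real)"
    and "W' \<in> borel_measurable (M \<Otimes>\<^sub>M M)" "\<And>z. z \<in> space (M \<Otimes>\<^sub>M M) \<Longrightarrow> \<bar>W' z\<bar> \<le> (B'::real)"
    and "S \<in> sets M" "T \<in> sets M" "\<And>x y. x \<in> S \<Longrightarrow> y \<in> T \<Longrightarrow> W (x, y) \<le> W' (x, y)"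
  shows "rect_integral M W S T \<le> rect_integral M W' S T"
  unfolding set_lebesgue_integral_def
proof (rule integral_mono)
  show "integrable (M \<Otimes>\<^sub>M M) (\<lambda>z. indicator (S \<times> T) z *\<^sub>R W z)"
    using set_integrable_bounded_pair[OF assms(1,2), of "S \<times> T"] assms by (simp add: set_integrable_def)
  show "integrable (M \<Otimes>\<^sub>M M) (\<lambda>z. indicator (S \<times> T) z *\<^sub>R W' z)"
    using set_integrable_bounded_pair[OF assms(3,4), of "S \<times> T"] assms by (simp add: set_integrable_def)
qed (use assms in \<open>auto simp: indicator_def\<close>)

lemma rect_integral_bound:
  assumes "W \<in> borel_measurable (M \<Otimes>\<^sub>M M)" "\<And>z. z \<in> space (M \<Otimes>\<^sub>M M) \<Longrightarrow> \<bar>W z\<bar> \<le> (B::real)"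
    and ST: "S \<in> sets M" "T \<in> sets M"
  shows "\<bar>rect_integral M W S T\<bar> \<le> B * measure M S * measure M T"
proof -
  have sub: "S \<subseteq> space M" "T \<subseteq> space M" using ST sets.sets_into_space by auto
  have W: "\<bar>W (x, y)\<bar> \<le> B" if "x \<in> S" "y \<in> T" for x y
    using assms(2)[of "(x, y)"] sub that by (auto simp: space_pair_measure)
  have "rect_integral M W S T \<le> rect_integral M (\<lambda>_. B) S T"
    by (rule rect_integral_mono[OF assms(1,2) _ _ ST, of _ "\<bar>B\<bar>"]) (use W in \<open>auto simp: abs_le_iff\<close>)
  moreover have "rect_integral M (\<lambda>_. - B) S T \<le> rect_integral M W S T"
  proof (rule rect_integral_mono[OF _ _ assms(1,2) ST, of _ "\<bar>B\<bar>"])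
    fix x y assume "x \<in> S" "y \<in> T" then show "- B \<le> W (x, y)" using W[of x y] by simp
  qed auto
  ultimately show ?thesis by (simp add: rect_integral_const[OF ST])
qed

lemma rect_integral_UN_left:
  assumes "W \<in> borel_measurable (M \<Otimes>\<^sub>M M)" "\<And>z. z \<in> space (M \<Otimes>\<^sub>M M) \<Longrightarrow> \<bar>W z\<bar> \<le> (B::real)"
    and "finite I" "disjoint_family_on S I" "\<And>i. i \<in> I \<Longrightarrow> S i \<in> sets M" "T \<in> sets M"
  shows "rect_integral M W (\<Union>i\<in>I. S i) T = (\<Sum>i\<in>I. rect_integral M W (S i) T)"
proof -
  have e: "(\<Union>i\<in>I. S i) \<times> T = (\<Union>i\<in>I. S i \<times> T)" by auto
  have d: "disjoint_family_on (\<lambda>i. S i \<times> T) I"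
    using assms(4) unfolding disjoint_family_on_def by blast
  have "set_lebesgue_integral (M \<Otimes>\<^sub>M M) (\<Union>i\<in>I. S i \<times> T) W = (\<Sum>i\<in>I. rect_integral M W (S i) T)"
    by (rule set_integral_finite_Union)
       (use assms d in \<open>auto intro!: set_integrable_bounded_pair[OF assms(1,2)]\<close>)
  then show ?thesis unfolding e .
qed

lemma rect_integral_UN_right:
  assumes "W \<in> borel_measurable (M \<Otimes>\<^sub>M M)" "\<And>z. z \<in> space (M \<Otimes>\<^sub>M M) \<Longrightarrow> \<bar>W z\<bar> \<le> (B::real)"
    and "finite I" "disjoint_family_on S I" "\<And>i. i \<in> I \<Longrightarrow> S i \<in> sets M" "T \<in> sets M"
  shows "rect_integral M W T (\<Union>i\<in>I. S i) = (\<Sum>i\<in>I. rect_integral M W T (S i))"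
proof -
  have e: "T \<times> (\<Union>i\<in>I. S i) = (\<Union>i\<in>I. T \<times> S i)" by auto
  have d: "disjoint_family_on (\<lambda>i. T \<times> S i) I"
    using assms(4) unfolding disjoint_family_on_def by blast
  have "set_lebesgue_integral (M \<Otimes>\<^sub>M M) (\<Union>i\<in>I. T \<times> S i) W = (\<Sum>i\<in>I. rect_integral M W T (S i))"
    by (rule set_integral_finite_Union)
       (use assms d in \<open>auto intro!: set_integrable_bounded_pair[OF assms(1,2)]\<close>)
  then show ?thesis unfolding e .
qed

lemma rect_integral_swap:
  assumes "W \<in> borel_measurable (M \<Otimes>\<^sub>M M)" and ST: "S \<in> sets M" "T \<in> sets M"
    and "\<And>x y. x \<in> space M \<Longrightarrow> y \<in> space M \<Longrightarrow> W (x, y) = W (y, x)"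
  shows "rect_integral M W S T = rect_integral M W T S"
proof -
  interpret P: pair_prob_space M M by (rule pair_prob_space_self)
  have "rect_integral M W S T = (\<integral>(x, y). indicator (S \<times> T) (y, x) * W (y, x) \<partial>(M \<Otimes>\<^sub>M M))"
    unfolding set_lebesgue_integral_def real_scaleR_def
    using assms by (subst P.integral_product_swap[symmetric]) auto
  also have "\<dots> = rect_integral M W T S"
    unfolding set_lebesgue_integral_def real_scaleR_def
    by (rule Bochner_Integration.integral_cong) (use assms(4) in \<open>auto simp: space_pair_measure indicator_def\<close>)
  finally show ?thesis .
qed

lemma rect_integral_fubini:
  assumes "W \<in> borel_measurable (M \<Otimes>\<^sub>M M)" "\<And>z. z \<in> space (M \<Otimes>\<^sub>M M) \<Longrightarrow> \<bar>W z\<bar> \<le> (B::real)"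
    and ST: "S \<in> sets M" "T \<in> sets M"
  shows "rect_integral M W S T = (\<integral>x. indicator S x * (\<integral>y. indicator T y * W (x, y) \<partial>M) \<partial>M)"
proof -
  interpret P: pair_prob_space M M by (rule pair_prob_space_self)
  have "integrable (M \<Otimes>\<^sub>M M) (\<lambda>z. indicator (S \<times> T) z * W z)"
    using set_integrable_bounded_pair[OF assms(1,2), of "S \<times> T"] ST by (simp add: set_integrable_def)
  then have "rect_integral M W S T = (\<integral>x. \<integral>y. indicator (S \<times> T) (x, y) * W (x, y) \<partial>M \<partial>M)"
    unfolding set_lebesgue_integral_def real_scaleR_def by (rule P.integral_fst'[symmetric])
  also have "\<dots> = (\<integral>x. indicator S x * (\<integral>y. indicator T y * W (x, y) \<partial>M) \<partial>M)"
    by (intro Bochner_Integration.integral_cong refl) (simp add: indicator_times mult.assoc flip: Bochner_Integration.integral_mult_right_zero)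
  finally show ?thesis .
qed

text \<open>As long as some rectangle sees a large discrepancy, subtracting the corresponding multiple of
  its indicator lowers the square integral by \<open>\<epsilon>\<^sup>2\<close>.\<close>

lemma weak_regularity:
  assumes W [measurable]: "W \<in> borel_measurable (M \<Otimes>\<^sub>M M)" and W1: "\<And>z. z \<in> space (M \<Otimes>\<^sub>M M) \<Longrightarrow> \<bar>W z\<bar> \<le> 1"
    and eps: "\<epsilon> > 0" "real N * \<epsilon>\<^sup>2 > 1"
  shows "\<exists>c S T. (\<forall>i<N. S i \<in> sets M \<and> T i \<in> sets M) \<and>
    (\<forall>A\<in>sets M. \<forall>B\<in>sets M. \<bar>rect_integral M (\<lambda>z. W z - (\<Sum>i<N. c i * indicator (S i \<times> T i) z)) A B\<bar> \<le> \<epsilon>)"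
proof -
  interpret P: pair_prob_space M M by (rule pair_prob_space_self)
  define F where "F j c S T z = W z - (\<Sum>i<j. c i * indicator (S i \<times> T i :: ('a \<times> 'a) set) z)" for j :: nat and c S T z
  define ok where "ok j S T \<longleftrightarrow> (\<forall>i<j. S i \<in> sets M \<and> T i \<in> sets M)" for j :: nat and S T
  have Fm: "F j c S T \<in> borel_measurable (M \<Otimes>\<^sub>M M)" if "ok j S T" for j c S T
    unfolding F_def using that by (intro borel_measurable_diff W borel_measurable_sum borel_measurable_times) (auto simp: ok_def)
  have Fb: "\<bar>F j c S T z\<bar> \<le> 1 + (\<Sum>i<j. \<bar>c i\<bar>)" if "z \<in> space (M \<Otimes>\<^sub>M M)" for j c S T z
  proof -
    have "\<bar>\<Sum>i<j. c i * indicator (S i \<times> T i) z\<bar> \<le> (\<Sum>i<j. \<bar>c i\<bar>)"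
      by (rule order_trans[OF sum_abs]) (intro sum_mono, auto simp: abs_mult indicator_def)
    then show ?thesis using W1[OF that] unfolding F_def by linarith
  qed
  define good where "good j c S T \<longleftrightarrow> ok j S T \<and> (\<forall>A\<in>sets M. \<forall>B\<in>sets M. \<bar>rect_integral M (F j c S T) A B\<bar> \<le> \<epsilon>)" for j c S T
  have claim: "(\<exists>i\<le>j. \<exists>c S T. good i c S T) \<or> (\<exists>c S T. ok j S T \<and> (\<integral>z. (F j c S T z)\<^sup>2 \<partial>(M \<Otimes>\<^sub>M M)) \<le> 1 - real j * \<epsilon>\<^sup>2)" for j
  proof (induction j)
    case 0
    have "(\<integral>z. (W z)\<^sup>2 \<partial>(M \<Otimes>\<^sub>M M)) \<le> (\<integral>z. 1 \<partial>(M \<Otimes>\<^sub>M M))"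
    proof (rule integral_mono)
      show "integrable (M \<Otimes>\<^sub>M M) (\<lambda>z. (W z)\<^sup>2)"
        by (rule integrable_bounded_pair[of _ 1]) (use W1 in \<open>auto simp: abs_square_le_1\<close>)
    qed (use W1 in \<open>auto simp: abs_square_le_1\<close>)
    then show ?case by (auto simp: ok_def F_def P.prob_space)
  next
    case (Suc j)
    show ?case
    proof (cases "\<exists>i\<le>j. \<exists>c S T. good i c S T")
      case True
      then show ?thesis by (meson le_SucI)
    next
      case False
      then obtain c S T where o: "ok j S T" and le: "(\<integral>z. (F j c S T z)\<^sup>2 \<partial>(M \<Otimes>\<^sub>M M)) \<le> 1 - real j * \<epsilon>\<^sup>2"
        using Suc by blast
      have "\<not> good j c S T" using False by blast
      then obtain A B where AB: "A \<in> sets M" "B \<in> sets M" "\<not> \<bar>rect_integral M (F j c S T) A B\<bar> \<le> \<epsilon>"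
        using o unfolding good_def by blast
      let ?F = "F j c S T" and ?r = "rect_integral M (F j c S T) A B"
      \<comment> \<open>The coefficient is the discrepancy itself, not its mean on the rectangle: as
        the rectangle has measure at most 1, the square integral falls by at least the square of the
        discrepancy.\<close>
      let ?c = "c(j := ?r)" and ?S = "S(j := A)" and ?T = "T(j := B)"
      have "ok (Suc j) ?S ?T" using o AB unfolding ok_def by (auto simp: less_Suc_eq)
      have Feq: "F (Suc j) ?c ?S ?T z = ?F z - ?r * indicator (A \<times> B) z" for z
        unfolding F_def by simp
      have i1: "integrable (M \<Otimes>\<^sub>M M) (\<lambda>z. (?F z)\<^sup>2)"
      proof (rule integrable_bounded_pair)
        show "\<bar>(?F z)\<^sup>2\<bar> \<le> (1 + (\<Sum>i<j. \<bar>c i\<bar>))\<^sup>2" if "z \<in> space (M \<Otimes>\<^sub>M M)" for z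
          using power_mono[OF Fb[OF that, of j c S T] abs_ge_zero, of 2] by simp
      qed (use Fm[OF o] in measurable)
      have i2: "integrable (M \<Otimes>\<^sub>M M) (\<lambda>z. indicator (A \<times> B) z * ?F z)"
        using set_integrable_bounded_pair[OF Fm[OF o] Fb, of "A \<times> B"] AB by (simp add: set_integrable_def)
      have i3: "integrable (M \<Otimes>\<^sub>M M) (\<lambda>z. indicator (A \<times> B) z :: real)"
        by (rule integrable_bounded_pair[of _ 1]) (use AB in \<open>auto simp: indicator_def\<close>)
      have "(\<integral>z. (F (Suc j) ?c ?S ?T z)\<^sup>2 \<partial>(M \<Otimes>\<^sub>M M))
          = (\<integral>z. (?F z)\<^sup>2 - 2 * ?r * (indicator (A \<times> B) z * ?F z) + ?r\<^sup>2 * indicator (A \<times> B) z \<partial>(M \<Otimes>\<^sub>M M))"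
        unfolding Feq by (rule Bochner_Integration.integral_cong) (auto simp: indicator_def power2_eq_square algebra_simps)
      also have "\<dots> = (\<integral>z. (?F z)\<^sup>2 \<partial>(M \<Otimes>\<^sub>M M)) - 2 * ?r * ?r + ?r\<^sup>2 * measure (M \<Otimes>\<^sub>M M) (A \<times> B)"
        using i1 i2 i3 AB by (simp add: set_lebesgue_integral_def)
      also have "\<dots> \<le> (\<integral>z. (?F z)\<^sup>2 \<partial>(M \<Otimes>\<^sub>M M)) - ?r\<^sup>2"
        using P.prob_le_1[of "A \<times> B"] mult_left_mono[of "measure (M \<Otimes>\<^sub>M M) (A \<times> B)" 1 "?r\<^sup>2"]
        by (simp add: power2_eq_square)
      also have "\<dots> \<le> 1 - real (Suc j) * \<epsilon>\<^sup>2"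
      proof -
        have "\<epsilon>\<^sup>2 \<le> ?r\<^sup>2" using AB(3) eps(1) by (metis abs_le_square_iff abs_of_pos linear)
        then show ?thesis using le by (simp add: algebra_simps)
      qed
      finally show ?thesis using \<open>ok (Suc j) ?S ?T\<close> by blast
    qed
  qed
  have "\<not> (\<exists>c S T. ok N S T \<and> (\<integral>z. (F N c S T z)\<^sup>2 \<partial>(M \<Otimes>\<^sub>M M)) \<le> 1 - real N * \<epsilon>\<^sup>2)"
  proof
    assume "\<exists>c S T. ok N S T \<and> (\<integral>z. (F N c S T z)\<^sup>2 \<partial>(M \<Otimes>\<^sub>M M)) \<le> 1 - real N * \<epsilon>\<^sup>2"
    then obtain c S T where "(\<integral>z. (F N c S T z)\<^sup>2 \<partial>(M \<Otimes>\<^sub>M M)) \<le> 1 - real N * \<epsilon>\<^sup>2" by blast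
    moreover have "0 \<le> (\<integral>z. (F N c S T z)\<^sup>2 \<partial>(M \<Otimes>\<^sub>M M))" by simp
    ultimately show False using eps(2) by linarith
  qed
  then obtain i c S T where i: "i \<le> N" "good i c S T" using claim[of N] by blast
  \<comment> \<open>Padding with empty rectangles makes their number exactly \<open>N\<close>,
    whatever \<open>W\<close> is. The partition they generate then has a size bounded uniformly over
    all graphons.\<close>
  let ?c = "\<lambda>l. if l < i then c l else 0" and ?S = "\<lambda>l. if l < i then S l else {}" and ?T = "\<lambda>l. if l < i then T l else {}"
  have eq: "(\<Sum>l<N. ?c l * indicator (?S l \<times> ?T l) z) = (\<Sum>l<i. c l * indicator (S l \<times> T l) z)" for z
    using i(1) by (intro sum.mono_neutral_cong_right) auto
  have "\<bar>rect_integral M (\<lambda>z. W z - (\<Sum>l<i. c l * indicator (S l \<times> T l) z)) A B\<bar> \<le> \<epsilon>"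
    if "A \<in> sets M" "B \<in> sets M" for A B
  proof -
    have "(\<lambda>z. W z - (\<Sum>l<i. c l * indicator (S l \<times> T l) z)) = F i c S T" by (rule ext) (simp only: F_def)
    then show ?thesis using i(2) that unfolding good_def by simp
  qed
  moreover have "\<forall>l<N. ?S l \<in> sets M \<and> ?T l \<in> sets M" using i(2) by (auto simp: good_def ok_def)
  ultimately have all: "(\<forall>l<N. ?S l \<in> sets M \<and> ?T l \<in> sets M) \<and>
      (\<forall>A\<in>sets M. \<forall>B\<in>sets M. \<bar>rect_integral M (\<lambda>z. W z - (\<Sum>l<N. ?c l * indicator (?S l \<times> ?T l) z)) A B\<bar> \<le> \<epsilon>)"
    unfolding eq by simp
  show ?thesis by (rule exI[of _ ?c], rule exI[of _ ?S], rule exI[of _ ?T], rule all)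
qed

end

text \<open>The probability integral transform of \<open>\<sigma> x + x\<close>: it carries the classes of \<open>\<sigma>\<close> to consecutive intervals.\<close>

lemma sort_map:
  fixes \<sigma> :: "real \<Rightarrow> nat"
  assumes [measurable]: "\<sigma> \<in> unit_space \<rightarrow>\<^sub>M count_space UNIV"
  defines "\<beta> b \<equiv> measure unit_space {x \<in> {0..<1}. \<sigma> x < b}"
  shows "\<exists>H. H \<in> borel_measurable unit_space \<and> (\<forall>x. 0 \<le> H x \<and> H x \<le> 1) \<and>
    (\<forall>S\<in>sets borel. emeasure unit_space {x \<in> {0..<1}. H x \<in> S} = emeasure lborel (S \<inter> {0<..<1})) \<and>
    (\<forall>x\<in>{0..<1}. \<beta> (\<sigma> x) \<le> H x \<and> H x \<le> \<beta> (Suc (\<sigma> x)))"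
proof -
  interpret U: prob_space unit_space by (rule prob_space_unit)
  have idm [measurable]: "(\<lambda>x. x) \<in> borel_measurable unit_space" by (rule measurable_unitI) simp
  define y where "y x = real (\<sigma> x) + x" for x
  have ym [measurable]: "y \<in> borel_measurable unit_space"
    unfolding y_def by (intro borel_measurable_add measurable_compose[OF assms(1)] idm) simp
  define \<mu> where "\<mu> = distr unit_space borel y"
  have "real_distribution \<mu>" unfolding \<mu>_def by (rule real_distribution_distr[OF prob_space_unit ym])
  then interpret \<mu>: cdf_distribution \<mu> unfolding cdf_distribution_def .
  have em: "emeasure \<mu> S = emeasure unit_space {x \<in> {0..<1}. y x \<in> S}" if "S \<in> sets borel" for S
    unfolding \<mu>_def using that by (subst emeasure_distr[OF ym]) (auto intro!: arg_cong[of _ _ "emeasure unit_space"])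
  have "emeasure \<mu> {r} = 0" for r
  proof -
    \<comment> \<open>A value of \<open>\<sigma> x + x\<close> determines the class as its integer
      part and \<open>x\<close> as its fractional part, so the law has no atoms.\<close>
    have "{x \<in> {0..<1}. y x \<in> {r}} \<subseteq> {frac r}"
    proof
      fix x assume x: "x \<in> {x \<in> {0..<1}. y x \<in> {r}}"
      then have "\<lfloor>r\<rfloor> = int (\<sigma> x)" unfolding y_def by (intro floor_unique) auto
      then show "x \<in> {frac r}" using x unfolding y_def frac_def by auto
    qed
    moreover have "emeasure unit_space {frac r} = 0"
      by (subst emeasure_restrict_space) (auto simp: frac_lt_1)
    moreover have "{frac r} \<in> sets unit_space" by (simp add: sets_restrict_space_iff frac_lt_1)
    ultimately have "emeasure unit_space {x \<in> {0..<1}. y x \<in> {r}} = 0"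
      using emeasure_mono[of _ "{frac r}" unit_space] by (metis le_zero_eq)
    then show ?thesis using em[of "{r}"] by simp
  qed
  then have \<mu>0: "measure \<mu> {r} = 0" for r by (simp add: measure_def)
  define H where "H x = cdf \<mu> (y x)" for x
  have Hm: "H \<in> borel_measurable unit_space" unfolding H_def by measurable
  have H01: "0 \<le> H x" "H x \<le> 1" for x
    unfolding H_def using \<mu>.cdf_nonneg \<mu>.cdf_bounded_prob by auto
  have HS: "emeasure unit_space {x \<in> {0..<1}. H x \<in> S} = emeasure lborel (S \<inter> {0<..<1})" if [measurable]: "S \<in> sets borel" for S
  proof -
    have cm: "cdf \<mu> -` S \<in> sets borel" using measurable_sets[OF \<mu>.measurable_C that] by simp
    have "emeasure unit_space {x \<in> {0..<1}. H x \<in> S} = emeasure \<mu> (cdf \<mu> -` S \<inter> space \<mu>)"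
      using em[OF cm] by (simp add: H_def \<mu>.borel_UNIV)
    also have "\<dots> = emeasure (distr \<mu> borel (cdf \<mu>)) S"
      by (rule emeasure_distr[symmetric]) auto
    also have "\<dots> = emeasure lborel (S \<inter> {0<..<1})"
      unfolding \<mu>.distr_cdf[OF \<mu>0]
      by (subst emeasure_distr) (auto simp: measurable_restrict_space1 space_restrict_space emeasure_restrict_space)
    finally show ?thesis .
  qed
  have cdf: "cdf \<mu> (real b) = \<beta> b" for b
  proof -
    have "emeasure unit_space {x \<in> {0..<1}. y x \<in> {..real b}} = emeasure unit_space {x \<in> {0..<1}. \<sigma> x < b}"
    proof (rule emeasure_eq_AE)
      \<comment> \<open>At \<open>x = 0\<close> a point of class \<open>b\<close> would also satisfy
        \<open>y x \<le> b\<close>; this single null point is the only discrepancy between the two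
        sets.\<close>
      have "AE x in lborel. x \<noteq> (0::real)" by (rule AE_lborel_singleton)
      then have "AE x in unit_space. x \<noteq> 0" unfolding AE_unit_iff by eventually_elim simp
      then show "AE x in unit_space. x \<in> {x \<in> {0..<1}. y x \<in> {..real b}} \<longleftrightarrow> x \<in> {x \<in> {0..<1}. \<sigma> x < b}"
        using AE_space
      proof eventually_elim
        case (elim x)
        then have x: "0 < x" "x < 1" by auto
        have "y x \<le> real b \<longleftrightarrow> \<sigma> x < b"
        proof
          assume "y x \<le> real b"
          then have "real (\<sigma> x) < real b" using x unfolding y_def by linarith
          then show "\<sigma> x < b" by simp
        next
          assume "\<sigma> x < b"
          then have "real (\<sigma> x) + 1 \<le> real b" by linarith
          then show "y x \<le> real b" using x unfolding y_def by linarith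
        qed
        then show ?case by simp
      qed
      have "{x \<in> space unit_space. y x \<in> {..real b}} \<in> sets unit_space" by measurable
      then show "{x \<in> {0..<1}. y x \<in> {..real b}} \<in> sets unit_space" by simp
      have "{x \<in> space unit_space. \<sigma> x < b} \<in> sets unit_space" by measurable
      then show "{x \<in> {0..<1}. \<sigma> x < b} \<in> sets unit_space" by simp
    qed
    then show ?thesis unfolding cdf_def \<beta>_def measure_def by (subst em) auto
  qed
  have "\<beta> (\<sigma> x) \<le> H x \<and> H x \<le> \<beta> (Suc (\<sigma> x))" if "x \<in> {0..<1}" for x
    unfolding cdf[symmetric] H_def using that by (auto intro!: \<mu>.cdf_nondecreasing simp: y_def)
  then show ?thesis using Hm H01 HS by (intro exI[of _ H]) auto
qed

section \<open>Realising a matrix of densities by a graph\<close>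

lemma card_residue_class:
  fixes N s z :: nat
  assumes "z < N"
  shows "card {i. i < N * s \<and> i mod N = z} = s"
proof -
  have "{i. i < N * s \<and> i mod N = z} = (\<lambda>i. z + N * i) ` {..<s}"
  proof (intro equalityI subsetI)
    fix i assume i: "i \<in> {i. i < N * s \<and> i mod N = z}"
    then have "i = z + N * (i div N)" by (metis (mono_tags, lifting) mem_Collect_eq mod_mult_div_eq)
    moreover have "i div N < s" using i by (simp add: less_mult_imp_div_less mult.commute)
    ultimately show "i \<in> (\<lambda>i. z + N * i) ` {..<s}" by blast
  next
    fix i assume "i \<in> (\<lambda>i. z + N * i) ` {..<s}"
    then obtain j where j: "j < s" "i = z + N * j" by auto
    have "z + N * j < N * Suc j" using assms by simp
    also have "\<dots> \<le> N * s" using j(1) by (intro mult_le_mono2) simp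
    finally show "i \<in> {i. i < N * s \<and> i mod N = z}" using j assms by simp
  qed
  moreover have "inj_on (\<lambda>i. z + N * i) {..<s}" using assms by (auto intro: inj_onI)
  ultimately show ?thesis by (simp add: card_image)
qed

text \<open>Every cell is split into \<open>E\<close> subcells carrying no inner edges; the loss inside the cell is made up for
  by the factor \<open>E / (E - 1)\<close> between its subcells.\<close>

lemma graph_realization:
  fixes Cl :: "(nat \<times> nat) set" and cell :: "nat \<Rightarrow> nat \<times> nat" and V :: "nat set"
    and Y :: "nat \<times> nat \<Rightarrow> nat \<times> nat \<Rightarrow> real" and E K T s :: nat
  assumes fin: "finite Cl" "finite V" and pos: "E \<ge> 2" "K > 0" "T > 0"
    and cellV: "\<And>v. v \<in> V \<Longrightarrow> cell v \<in> Cl"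
    and cardcell: "\<And>c. c \<in> Cl \<Longrightarrow> card {v \<in> V. cell v = c} = E * K * T ^ (K + 1) * s"
    and Y: "\<And>c d. c \<in> Cl \<Longrightarrow> d \<in> Cl \<Longrightarrow> Y c d = Y d c \<and> 0 \<le> Y c d \<and> Y c d \<le> 1 - 1 / real E \<and>
       real T * Y c d \<in> \<int> \<and> real T * Y c d * (real E / (real E - 1)) \<in> \<int>"
  shows "\<exists>G. (\<forall>e\<in>G. e \<subseteq> V \<and> card e = 2) \<and>
    (\<forall>u\<in>V. \<forall>B\<subseteq>Cl. real (card {v \<in> V. cell v \<in> B \<and> {u, v} \<in> G}) = real (E * K * T ^ (K + 1) * s) * (\<Sum>d\<in>B. Y (cell u) d)) \<and>
    (\<forall>I\<subseteq>V. \<forall>J\<subseteq>V. \<bar>\<Sum>u\<in>I. \<Sum>v\<in>J. of_bool ({u, v} \<in> G) - Y (cell u) (cell v)\<bar>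
        \<le> (real (card V))\<^sup>2 / sqrt K + real (card Cl) * (real (E * K * T ^ (K + 1) * s))\<^sup>2)"
proof -
  define N where "N = E * K * T ^ (K + 1)"
  let ?Lb = "{..<E} \<times> {..<K} \<times> {..<T} \<times> words K T"
  have finLb: "finite ?Lb" by (intro finite_cartesian_product finite_PiE) auto
  have cLb: "card ?Lb = N" by (simp add: N_def card_cartesian_product card_words)
  have Npos: "N > 0" using pos by (simp add: N_def)
  obtain enc where enc: "bij_betw enc {0..<N} ?Lb"
    using ex_bij_betw_nat_finite[OF finLb] unfolding cLb by blast
  have "\<exists>g. bij_betw g {v \<in> V. cell v = c} {0..<N * s}" if "c \<in> Cl" for c
    using ex_bij_betw_finite_nat[of "{v \<in> V. cell v = c}"] fin cardcell[OF that] by (simp add: N_def)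
  then obtain g where g: "\<And>c. c \<in> Cl \<Longrightarrow> bij_betw (g c) {v \<in> V. cell v = c} {0..<N * s}" by metis
  have Y1: "Y c d \<le> 1" if "c \<in> Cl" "d \<in> Cl" for c d
  proof -
    have "0 \<le> 1 / real E" by simp
    then show ?thesis using Y[OF that] by linarith
  qed
  \<comment> \<open>Numbering the vertices of a cell and reducing modulo the number \<open>N\<close>
    of labels gives each label to exactly \<open>s\<close> vertices, since the cell has
    \<open>N * s\<close> of them.\<close>
  define lab where "lab v = enc (g (cell v) v mod N)" for v
  have labLb: "lab v \<in> ?Lb" for v
    using bij_betwE[OF enc] Npos unfolding lab_def by auto
  have fib: "card {v \<in> V. cell v = c \<and> lab v = y} = s" if c: "c \<in> Cl" and y: "y \<in> ?Lb" for c y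
  proof -
    obtain z where z: "z < N" "enc z = y" using enc y unfolding bij_betw_def by (metis atLeastLessThan_iff imageE)
    have "lab v = y \<longleftrightarrow> g c v mod N = z" if "cell v = c" for v
    proof -
      have "inj_on enc {0..<N}" using enc by (simp add: bij_betw_def)
      then show ?thesis using z Npos that unfolding lab_def
        by (metis atLeastLessThan_iff inj_on_eq_iff mod_less_divisor zero_le)
    qed
    then have e: "{v \<in> V. cell v = c \<and> lab v = y} = {v \<in> {v \<in> V. cell v = c}. g c v \<in> {i. i < N * s \<and> i mod N = z}}"
      using bij_betwE[OF g[OF c]] by auto
    have b: "bij_betw (g c) {v \<in> {v \<in> V. cell v = c}. g c v \<in> {i. i < N * s \<and> i mod N = z}} {i. i < N * s \<and> i mod N = z}"
    proof (rule bij_betw_subset[OF g[OF c]])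
      show "g c ` {v \<in> {v \<in> V. cell v = c}. g c v \<in> {i. i < N * s \<and> i mod N = z}} = {i. i < N * s \<and> i mod N = z}"
        using g[OF c] unfolding bij_betw_def by force
    qed auto
    show ?thesis using bij_betw_same_card[OF b] card_residue_class[OF z(1), of s] unfolding e by (rule trans)
  qed
  define ev where "ev v = fst (lab v)" for v
  define av where "av v = fst (snd (lab v))" for v
  define bv where "bv v = fst (snd (snd (lab v)))" for v
  define xv where "xv v = snd (snd (snd (lab v)))" for v
  \<comment> \<open>Subcells are coded by natural numbers because the adjacency relation orients
    pairs by the order of the codes.\<close>
  define fc where "fc v = to_nat (cell v, ev v)" for v
  define Fc where "Fc = to_nat ` (Cl \<times> {..<E})"
  define co where "co f = fst (from_nat f :: (nat \<times> nat) \<times> nat)" for f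
  define p where "p f f' = (if co f = co f' then nat \<lfloor>real T * Y (co f) (co f') * (real E / (real E - 1))\<rfloor>
      else nat \<lfloor>real T * Y (co f) (co f')\<rfloor>)" for f f'
  have coF: "co f \<in> Cl" if "f \<in> Fc" for f using that unfolding Fc_def co_def by auto
  have cofc: "co (fc v) = cell v" for v by (simp add: co_def fc_def)
  have E1: "real E - 1 > 0" using pos by simp
  \<comment> \<open>Here the margin below 1 is spent: entries up to \<open>1 - 1 / E\<close> remain
    at most 1 after the increase, so the thresholds do not exceed \<open>T\<close>.\<close>
  have EE: "(1 - 1 / real E) * (real E / (real E - 1)) = 1" using E1 pos by (simp add: field_simps)
  have preal: "real (p f f') = (if co f = co f' then real T * Y (co f) (co f') * (real E / (real E - 1)) else real T * Y (co f) (co f'))"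
    if "f \<in> Fc" "f' \<in> Fc" for f f'
  proof -
    note y = Y[OF coF[OF that(1)] coF[OF that(2)]]
    have nf: "real (nat \<lfloor>x\<rfloor>) = x" if "x \<in> \<int>" "0 \<le> x" for x :: real
      using that by (auto elim!: Ints_cases)
    have "0 \<le> real T * Y (co f) (co f')" using y by simp
    moreover have "0 \<le> real E / (real E - 1)" using E1 by simp
    ultimately have "0 \<le> real T * Y (co f) (co f') * (real E / (real E - 1))" by (rule mult_nonneg_nonneg)
    then have "real (nat \<lfloor>real T * Y (co f) (co f') * (real E / (real E - 1))\<rfloor>) = real T * Y (co f) (co f') * (real E / (real E - 1))"
      using y by (intro nf) blast+
    moreover have "real (nat \<lfloor>real T * Y (co f) (co f')\<rfloor>) = real T * Y (co f) (co f')"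
      using y \<open>0 \<le> real T * Y (co f) (co f')\<close> by (intro nf) blast+
    ultimately show ?thesis unfolding p_def by (simp only: split: if_split) blast
  qed
  have pT: "p f f' \<le> T" if "f \<in> Fc" "f' \<in> Fc" for f f'
  proof -
    note y = Y[OF coF[OF that(1)] coF[OF that(2)]]
    have "Y (co f) (co f') * (real E / (real E - 1)) \<le> (1 - 1 / real E) * (real E / (real E - 1))"
      using y E1 by (intro mult_right_mono) auto
    then have "real T * (Y (co f) (co f') * (real E / (real E - 1))) \<le> real T * 1"
      unfolding EE by (intro mult_left_mono) auto
    moreover have "real T * Y (co f) (co f') \<le> real T * 1"
    proof (intro mult_left_mono)
      have "0 \<le> 1 / real E" by simp
      then show "Y (co f) (co f') \<le> 1" using y by linarith
    qed auto
    ultimately have "real (p f f') \<le> real T" unfolding preal[OF that] by (auto simp: mult.assoc)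
    then show ?thesis by simp
  qed
  interpret wg: word_graph V fc av bv xv Fc K T s p
  proof
    show "finite Fc" unfolding Fc_def using fin by auto
    show "fc v \<in> Fc \<and> av v < K \<and> bv v < T \<and> xv v \<in> words K T" if "v \<in> V" for v
      using labLb[of v] cellV[OF that] unfolding fc_def Fc_def av_def bv_def xv_def ev_def by (auto simp: mem_Times_iff)
    show "card {v \<in> V. fc v = f \<and> av v = a \<and> bv v = b \<and> xv v = x} = s"
      if "f \<in> Fc" "a < K" "b < T" "x \<in> words K T" for f a b x
    proof -
      obtain c e where f: "f = to_nat (c, e)" "c \<in> Cl" "e < E" using \<open>f \<in> Fc\<close> unfolding Fc_def by auto
      have "{v \<in> V. fc v = f \<and> av v = a \<and> bv v = b \<and> xv v = x} = {v \<in> V. cell v = c \<and> lab v = (e, a, b, x)}"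
        unfolding fc_def f(1) av_def bv_def xv_def ev_def by (auto simp: prod_eq_iff)
      then show ?thesis using fib[OF f(2), of "(e, a, b, x)"] f(3) that by simp
    qed
    show "p f f' = p f' f \<and> p f f' \<le> T" if "f \<in> Fc" "f' \<in> Fc" for f f'
      using Y[OF coF[OF that(1)] coF[OF that(2)]] pT[OF that] unfolding p_def by auto
  qed (use fin pos in auto)
  let ?G = "wg.edges"
  define l where "l = s * K * T ^ (K + 1)"
  have deg: "real (card {v \<in> V. cell v \<in> B \<and> {u, v} \<in> ?G}) = real (E * K * T ^ (K + 1) * s) * (\<Sum>d\<in>B. Y (cell u) d)"
    if u: "u \<in> V" and B: "B \<subseteq> Cl" for u B
  proof -
    have finB: "finite B" using B fin finite_subset by auto
    have uF: "fc u \<in> Fc" using wg.label[OF u] by simp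
    let ?S = "\<lambda>y. {v \<in> V. fc v = to_nat y \<and> wg.adj u v}"
    have "{v \<in> V. cell v \<in> B \<and> {u, v} \<in> ?G} = (\<Union>y\<in>B \<times> {..<E}. ?S y)"
      unfolding wg.edges_iff fc_def using labLb by (fastforce simp: ev_def mem_Times_iff)
    moreover have "card (\<Union>y\<in>B \<times> {..<E}. ?S y) = (\<Sum>y\<in>B \<times> {..<E}. card (?S y))"
      by (rule card_UN_disjoint) (use finB fin in auto)
    ultimately have "real (card {v \<in> V. cell v \<in> B \<and> {u, v} \<in> ?G}) = (\<Sum>y\<in>B \<times> {..<E}. real (card (?S y)))"
      by simp
    also have "\<dots> = (\<Sum>d\<in>B. \<Sum>e<E. real (card (?S (d, e))))"
      by (simp add: sum.cartesian_product split_def)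
    also have "\<dots> = (\<Sum>d\<in>B. real (s * K * T ^ K) * (real E * (real T * Y (cell u) d)))"
    proof (rule sum.cong[OF refl])
      fix d assume "d \<in> B"
      then have d: "d \<in> Cl" using B by auto
      have FF: "to_nat (d, e) \<in> Fc" if "e < E" for e using d that unfolding Fc_def by auto
      have cod: "co (to_nat (d, e)) = d" for e :: nat by (simp add: co_def)
      have val: "real (card (?S (d, e))) = real (s * K * T ^ K) * real (p (fc u) (to_nat (d, e)))" if "e < E" "to_nat (d, e) \<noteq> fc u" for e
        using wg.degree_cell[OF u FF[OF that(1)] that(2)] by simp
      show "(\<Sum>e<E. real (card (?S (d, e)))) = real (s * K * T ^ K) * (real E * (real T * Y (cell u) d))"
      proof (cases "d = cell u")
        case False
        have "(\<Sum>e<E. real (card (?S (d, e)))) = (\<Sum>e<E. real (s * K * T ^ K) * (real T * Y (cell u) d))"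
        proof (rule sum.cong[OF refl])
          fix e assume "e \<in> {..<E}"
          then have e: "e < E" by simp
          have "to_nat (d, e) \<noteq> fc u" using False unfolding fc_def by auto
          then show "real (card (?S (d, e))) = real (s * K * T ^ K) * (real T * Y (cell u) d)"
            using val[OF e] preal[OF uF FF[OF e], unfolded cofc cod] False by simp
        qed
        then show ?thesis by simp
      next
        case True
        have eu: "ev u < E" using labLb[of u] by (auto simp: ev_def mem_Times_iff)
        have "(\<Sum>e<E. real (card (?S (d, e)))) = (\<Sum>e\<in>{..<E} - {ev u}. real (card (?S (d, e))))"
        proof (rule sum.mono_neutral_right)
          have "?S (d, ev u) = {}" using True by (auto simp: wg.adj_def fc_def)
          then have "real (card (?S (d, ev u))) = 0" by (simp only: card.empty of_nat_0)
          then show "\<forall>i\<in>{..<E} - ({..<E} - {ev u}). real (card (?S (d, i))) = 0" by blast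
        qed auto
        also have "\<dots> = (\<Sum>e\<in>{..<E} - {ev u}. real (s * K * T ^ K) * (real T * Y (cell u) d * (real E / (real E - 1))))"
        proof (rule sum.cong[OF refl])
          fix e assume "e \<in> {..<E} - {ev u}"
          then have e: "e < E" "to_nat (d, e) \<noteq> fc u" unfolding fc_def by auto
          then show "real (card (?S (d, e))) = real (s * K * T ^ K) * (real T * Y (cell u) d * (real E / (real E - 1)))"
            unfolding val[OF e] using preal[OF uF FF[OF e(1)], unfolded cofc cod]
            by (simp only: True[symmetric] refl if_True)
        qed
        also have "\<dots> = (real E - 1) * (real (s * K * T ^ K) * (real T * Y (cell u) d * (real E / (real E - 1))))"
          using eu pos by (simp add: of_nat_diff)
        also have "\<dots> = real (s * K * T ^ K) * (real E * (real T * Y (cell u) d))"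
          using E1 by (simp add: field_simps)
        finally show ?thesis .
      qed
    qed
    also have "\<dots> = real (E * K * T ^ (K + 1) * s) * (\<Sum>d\<in>B. Y (cell u) d)"
      by (simp add: sum_distrib_left mult_ac)
    finally show ?thesis .
  qed
  have cardV: "card V = card Cl * (E * l)"
  proof -
    have "card V = (\<Sum>v\<in>V. 1)" by simp
    also have "\<dots> = (\<Sum>c\<in>Cl. \<Sum>v\<in>{v \<in> V. cell v = c}. 1)"
      by (rule sum.group[symmetric]) (use fin cellV in auto)
    also have "\<dots> = (\<Sum>c\<in>Cl. E * l)" using cardcell by (simp add: l_def mult_ac)
    finally show ?thesis by simp
  qed
  have cardF: "card Fc = card Cl * E"
    unfolding Fc_def by (subst card_image) (auto simp: card_cartesian_product)
  have cut: "\<bar>\<Sum>u\<in>I. \<Sum>v\<in>J. of_bool ({u, v} \<in> ?G) - Y (cell u) (cell v)\<bar>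
        \<le> (real (card V))\<^sup>2 / sqrt K + real (card Cl) * (real (E * K * T ^ (K + 1) * s))\<^sup>2"
    if IJ: "I \<subseteq> V" "J \<subseteq> V" for I J
  proof -
    have finIJ: "finite I" "finite J" using IJ fin by (auto intro: finite_subset)
    let ?Z = "\<lambda>u v. of_bool (wg.adj u v) - Y (cell u) (cell v)"
    let ?I = "\<lambda>f. {u \<in> I. fc u = f}" and ?J = "\<lambda>f. {v \<in> J. fc v = f}"
    have FI: "fc ` I \<subseteq> Fc" "fc ` J \<subseteq> Fc" using IJ wg.label by auto
    have "(\<Sum>u\<in>I. \<Sum>v\<in>J. ?Z u v) = (\<Sum>f\<in>Fc. \<Sum>u\<in>?I f. \<Sum>v\<in>J. ?Z u v)"
      by (rule sum.group[symmetric]) (use finIJ wg.finFc FI in auto)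
    also have "\<dots> = (\<Sum>f\<in>Fc. \<Sum>u\<in>?I f. \<Sum>f'\<in>Fc. \<Sum>v\<in>?J f'. ?Z u v)"
      by (intro sum.cong refl sum.group[symmetric]) (use finIJ wg.finFc FI in auto)
    also have "\<dots> = (\<Sum>f\<in>Fc. \<Sum>f'\<in>Fc. \<Sum>u\<in>?I f. \<Sum>v\<in>?J f'. ?Z u v)"
      by (intro sum.cong refl sum.swap)
    finally have "\<bar>\<Sum>u\<in>I. \<Sum>v\<in>J. ?Z u v\<bar> = \<bar>\<Sum>f\<in>Fc. \<Sum>f'\<in>Fc. \<Sum>u\<in>?I f. \<Sum>v\<in>?J f'. ?Z u v\<bar>"
      by (rule arg_cong)
    also have "\<dots> \<le> (\<Sum>f\<in>Fc. \<bar>\<Sum>f'\<in>Fc. \<Sum>u\<in>?I f. \<Sum>v\<in>?J f'. ?Z u v\<bar>)" by (rule sum_abs)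
    also have "\<dots> \<le> (\<Sum>f\<in>Fc. \<Sum>f'\<in>Fc. \<bar>\<Sum>u\<in>?I f. \<Sum>v\<in>?J f'. ?Z u v\<bar>)" by (rule sum_mono, rule sum_abs)
    \<comment> \<open>Subcells of different cells are quasirandom with the right density. Subcells
      of one cell have a wrong density and are estimated trivially; there are only \<open>E\<close>
      times \<open>E\<close> such pairs per cell, so their total is one squared cell size per
      cell.\<close>
    also have "\<dots> \<le> (\<Sum>f\<in>Fc. \<Sum>f'\<in>Fc. (real l)\<^sup>2 / sqrt K + of_bool (co f = co f') * (real l)\<^sup>2)"
    proof (intro sum_mono)
      fix f f' assume ff: "f \<in> Fc" "f' \<in> Fc"
      show "\<bar>\<Sum>u\<in>?I f. \<Sum>v\<in>?J f'. ?Z u v\<bar> \<le> (real l)\<^sup>2 / sqrt K + of_bool (co f = co f') * (real l)\<^sup>2"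
      proof (cases "co f = co f'")
        case False
        then have "f \<noteq> f'" by auto
        have "(\<Sum>u\<in>?I f. \<Sum>v\<in>?J f'. ?Z u v) = (\<Sum>u\<in>?I f. \<Sum>v\<in>?J f'. of_bool (wg.adj u v) - real (p f f') / real T)"
        proof (intro sum.cong refl)
          fix u v assume "u \<in> ?I f" "v \<in> ?J f'"
          then have "cell u = co f" "cell v = co f'" using cofc by auto
          then show "?Z u v = of_bool (wg.adj u v) - real (p f f') / real T"
            using preal[OF ff] False pos by simp
        qed
        then show ?thesis using wg.cut_cell[OF ff \<open>f \<noteq> f'\<close> IJ] False by (simp add: l_def)
      next
        case True
        have cb: "card (?I f) \<le> l" "card (?J f') \<le> l"
          unfolding l_def wg.card_cell[OF ff(1), symmetric]
           apply (rule card_mono, use fin IJ in auto)[1]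
          unfolding wg.card_cell[OF ff(1)] wg.card_cell[OF ff(2), symmetric]
          by (rule card_mono) (use fin IJ in auto)
        have "\<bar>\<Sum>u\<in>?I f. \<Sum>v\<in>?J f'. ?Z u v\<bar> \<le> (\<Sum>u\<in>?I f. \<bar>\<Sum>v\<in>?J f'. ?Z u v\<bar>)" by (rule sum_abs)
        also have "\<dots> \<le> (\<Sum>u\<in>?I f. \<Sum>v\<in>?J f'. \<bar>?Z u v\<bar>)" by (rule sum_mono, rule sum_abs)
        also have "\<dots> \<le> (\<Sum>u\<in>?I f. \<Sum>v\<in>?J f'. 1)"
        proof (intro sum_mono)
          fix u v assume "u \<in> ?I f" "v \<in> ?J f'"
          then have "cell u \<in> Cl" "cell v \<in> Cl" using IJ cellV by auto
          then have "0 \<le> Y (cell u) (cell v)" "Y (cell u) (cell v) \<le> 1" using Y Y1 by blast+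
          then show "\<bar>?Z u v\<bar> \<le> 1" by auto
        qed
        also have "\<dots> = real (card (?I f)) * real (card (?J f'))" by simp
        also have "\<dots> \<le> real l * real l" using cb by (intro mult_mono) auto
        finally show ?thesis using True by (simp add: power2_eq_square add_increasing)
      qed
    qed
    also have "\<dots> = real (card Fc) * (real (card Fc) * ((real l)\<^sup>2 / sqrt K)) + (\<Sum>f\<in>Fc. \<Sum>f'\<in>Fc. of_bool (co f = co f')) * (real l)\<^sup>2"
      by (simp add: sum.distrib sum_distrib_right)
    also have "(\<Sum>f\<in>Fc. \<Sum>f'\<in>Fc. of_bool (co f = co f')) = (\<Sum>f\<in>Fc. real E)"
    proof (rule sum.cong[OF refl])
      fix f assume f: "f \<in> Fc"
      have "{f' \<in> Fc. co f = co f'} = to_nat ` ({co f} \<times> {..<E})"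
        using coF[OF f] unfolding Fc_def by (auto simp: co_def)
      then have "card {f' \<in> Fc. co f = co f'} = E" by (simp add: card_image card_cartesian_product)
      moreover have "(\<Sum>f'\<in>Fc. of_bool (co f = co f') :: real) = (\<Sum>f'\<in>{f' \<in> Fc. co f = co f'}. of_bool (co f = co f'))"
        by (rule sum.mono_neutral_right) (use wg.finFc in auto)
      ultimately show "(\<Sum>f'\<in>Fc. of_bool (co f = co f') :: real) = real E" by simp
    qed
    also have "real (card Fc) * (real (card Fc) * ((real l)\<^sup>2 / sqrt K)) + (\<Sum>f\<in>Fc. real E) * (real l)\<^sup>2
      = (real (card V))\<^sup>2 / sqrt K + real (card Cl) * (real (E * K * T ^ (K + 1) * s))\<^sup>2"
      unfolding cardV l_def by (simp add: cardF power2_eq_square mult_ac)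
    finally show ?thesis unfolding wg.edges_iff .
  qed
  show ?thesis by (intro exI[of _ ?G] conjI ballI allI impI) (use wg.edgesD deg cut in auto)
qed

section \<open>Averaging a kernel over cells of equal measure\<close>

context prob_space
begin

lemma rect_integral_Un:
  assumes W: "W \<in> borel_measurable (M \<Otimes>\<^sub>M M)" "\<And>z. z \<in> space (M \<Otimes>\<^sub>M M) \<Longrightarrow> \<bar>W z\<bar> \<le> (B::real)"
    and S: "S1 \<in> sets M" "S2 \<in> sets M" "S1 \<inter> S2 = {}" "T \<in> sets M"
  shows "rect_integral M W (S1 \<union> S2) T = rect_integral M W S1 T + rect_integral M W S2 T"
    and "rect_integral M W T (S1 \<union> S2) = rect_integral M W T S1 + rect_integral M W T S2"
proof -
  have "(S1 \<union> S2) \<times> T = S1 \<times> T \<union> S2 \<times> T" "T \<times> (S1 \<union> S2) = T \<times> S1 \<union> T \<times> S2" by auto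
  then show "rect_integral M W (S1 \<union> S2) T = rect_integral M W S1 T + rect_integral M W S2 T"
    "rect_integral M W T (S1 \<union> S2) = rect_integral M W T S1 + rect_integral M W T S2"
    using S by (auto intro!: set_integral_Un set_integrable_bounded_pair[OF W])
qed

lemma rect_integral_unit_range:
  assumes W: "W \<in> borel_measurable (M \<Otimes>\<^sub>M M)" "\<And>z. z \<in> space (M \<Otimes>\<^sub>M M) \<Longrightarrow> 0 \<le> W z \<and> W z \<le> (1::real)"
    and ST: "S \<in> sets M" "T \<in> sets M"
  shows "0 \<le> rect_integral M W S T" "rect_integral M W S T \<le> measure M S * measure M T"
proof -
  have W1: "\<bar>W z\<bar> \<le> 1" if "z \<in> space (M \<Otimes>\<^sub>M M)" for z using W(2)[OF that] by simp
  have sub: "S \<subseteq> space M" "T \<subseteq> space M"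
    using sets.sets_into_space[OF ST(1)] sets.sets_into_space[OF ST(2)] by auto
  have "rect_integral M (\<lambda>_. 0) S T \<le> rect_integral M W S T"
  proof (rule rect_integral_mono[OF _ _ W(1) W1 ST, of _ 0])
    fix x y assume "x \<in> S" "y \<in> T" then show "0 \<le> W (x, y)" using W(2)[of "(x, y)"] sub by (auto simp: space_pair_measure)
  qed auto
  then show "0 \<le> rect_integral M W S T" by (simp add: set_lebesgue_integral_def)
  show "rect_integral M W S T \<le> measure M S * measure M T"
    using rect_integral_bound[OF W(1) W1 ST] by simp
qed

lemma rect_integral_step:
  assumes W: "W \<in> borel_measurable (M \<Otimes>\<^sub>M M)" "\<And>z. z \<in> space (M \<Otimes>\<^sub>M M) \<Longrightarrow> \<bar>W z\<bar> \<le> (B::real)"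
    and \<Omega>: "finite I" "disjoint_family_on \<Omega> I" "\<And>i. i \<in> I \<Longrightarrow> \<Omega> i \<in> sets M"
    and ST: "S \<in> sets M" "T \<in> sets M" "S \<subseteq> (\<Union>i\<in>I. \<Omega> i)" "T \<subseteq> (\<Union>i\<in>I. \<Omega> i)"
    and Z: "\<And>i j x y. i \<in> I \<Longrightarrow> j \<in> I \<Longrightarrow> x \<in> \<Omega> i \<Longrightarrow> y \<in> \<Omega> j \<Longrightarrow> W (x, y) = Z i j"
  shows "rect_integral M W S T = (\<Sum>i\<in>I. \<Sum>j\<in>I. Z i j * measure M (S \<inter> \<Omega> i) * measure M (T \<inter> \<Omega> j))"
proof -
  have d: "disjoint_family_on (\<lambda>i. X \<inter> \<Omega> i) I" for X using \<Omega>(2) unfolding disjoint_family_on_def by blast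
  have S: "S = (\<Union>i\<in>I. S \<inter> \<Omega> i)" and T: "T = (\<Union>i\<in>I. T \<inter> \<Omega> i)" using ST(3,4) by auto
  have "rect_integral M W S T = rect_integral M W (\<Union>i\<in>I. S \<inter> \<Omega> i) T" using S by simp
  also have "\<dots> = (\<Sum>i\<in>I. rect_integral M W (S \<inter> \<Omega> i) T)"
    by (rule rect_integral_UN_left[OF W \<Omega>(1) d]) (use ST \<Omega> in auto)
  also have "\<dots> = (\<Sum>i\<in>I. rect_integral M W (S \<inter> \<Omega> i) (\<Union>j\<in>I. T \<inter> \<Omega> j))" using T by simp
  also have "\<dots> = (\<Sum>i\<in>I. \<Sum>j\<in>I. rect_integral M W (S \<inter> \<Omega> i) (T \<inter> \<Omega> j))"
    by (intro sum.cong refl rect_integral_UN_right[OF W \<Omega>(1) d]) (use ST \<Omega> in auto)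
  also have "\<dots> = (\<Sum>i\<in>I. \<Sum>j\<in>I. Z i j * measure M (S \<inter> \<Omega> i) * measure M (T \<inter> \<Omega> j))"
    by (intro sum.cong refl rect_integral_const) (use ST \<Omega> Z in auto)
  finally show ?thesis .
qed

text \<open>On pairs of pure cells \<open>W - F\<close> is constant and is unchanged by averaging,
  so only \<open>F\<close> matters there. \<open>F\<close> is small in cut norm, and so is its cell
  average, because averaging amounts to testing with fractional weights on the cells. What is left
  is the uncovered mass and at most \<open>R\<close> impure cells.\<close>

lemma cell_average_cut:
  fixes \<Omega> :: "'c \<Rightarrow> 'a set"
  assumes W: "W \<in> borel_measurable (M \<Otimes>\<^sub>M M)" "\<And>z. z \<in> space (M \<Otimes>\<^sub>M M) \<Longrightarrow> 0 \<le> W z \<and> W z \<le> (1::real)"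
    and F: "F \<in> borel_measurable (M \<Otimes>\<^sub>M M)" "\<And>z. z \<in> space (M \<Otimes>\<^sub>M M) \<Longrightarrow> \<bar>F z\<bar> \<le> (B::real)"
    and cutF: "\<And>S T. S \<in> sets M \<Longrightarrow> T \<in> sets M \<Longrightarrow> \<bar>rect_integral M F S T\<bar> \<le> \<epsilon>"
    and \<Omega>: "finite Cl" "disjoint_family_on \<Omega> Cl" "\<And>c. c \<in> Cl \<Longrightarrow> \<Omega> c \<in> sets M" "\<And>c. c \<in> Cl \<Longrightarrow> measure M (\<Omega> c) = w" "w > 0"
    and Pr: "Pr \<subseteq> Cl" "card (Cl - Pr) \<le> R"
    and a: "\<And>c d x y. c \<in> Pr \<Longrightarrow> d \<in> Pr \<Longrightarrow> x \<in> \<Omega> c \<Longrightarrow> y \<in> \<Omega> d \<Longrightarrow> W (x, y) - F (x, y) = a c d"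
    and X: "\<And>c d. c \<in> Cl \<Longrightarrow> d \<in> Cl \<Longrightarrow> X c d = rect_integral M W (\<Omega> c) (\<Omega> d) / w\<^sup>2"
    and ST: "S \<in> sets M" "T \<in> sets M"
  shows "\<bar>rect_integral M W S T - (\<Sum>c\<in>Cl. \<Sum>d\<in>Cl. X c d * measure M (S \<inter> \<Omega> c) * measure M (T \<inter> \<Omega> d))\<bar>
     \<le> 2 * \<epsilon> + 2 * (1 - w * card Cl) + 2 * real R * w"
proof -
  have W1: "\<bar>W z\<bar> \<le> 1" if "z \<in> space (M \<Otimes>\<^sub>M M)" for z using W(2)[OF that] by simp
  define G where "G = (\<Union>c\<in>Pr. \<Omega> c)"
  have finPr: "finite Pr" using Pr \<Omega>(1) finite_subset by blast
  have dPr: "disjoint_family_on \<Omega> Pr" using \<Omega>(2) Pr(1) unfolding disjoint_family_on_def by blast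
  have mPr: "\<Omega> c \<in> sets M" if "c \<in> Pr" for c using \<Omega>(3) Pr(1) that by auto
  have Gm [measurable]: "G \<in> sets M" unfolding G_def using finPr mPr by (intro sets.finite_UN) auto
  note [measurable] = ST
  have measU: "measure M (\<Union>c\<in>I. \<Omega> c) = w * card I" if "I \<subseteq> Cl" for I
  proof -
    have "disjoint_family_on \<Omega> I" using \<Omega>(2) that unfolding disjoint_family_on_def by blast
    moreover have "finite I" using that \<Omega>(1) by (rule finite_subset)
    ultimately have "measure M (\<Union>c\<in>I. \<Omega> c) = (\<Sum>c\<in>I. measure M (\<Omega> c))"
      using \<Omega>(3) that by (intro finite_measure_finite_Union) auto
    also have "\<dots> = (\<Sum>c\<in>I. w)" using that \<Omega>(4) by (intro sum.cong) auto
    finally show ?thesis by simp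
  qed
  have cCl: "w * card Cl \<le> 1" using measU[of Cl] prob_le_1 by (metis order_refl)
  have cPr: "card Cl \<le> card Pr + R"
    using Pr card_Diff_subset[OF finPr Pr(1)] by linarith
  have "real (card Cl) \<le> real (card Pr) + real R" using cPr by (metis of_nat_add of_nat_le_iff)
  then have "w * card Cl \<le> w * (real (card Pr) + real R)" using \<Omega>(5) by (intro mult_left_mono) auto
  then have rest: "measure M (space M - G) \<le> 1 - w * card Cl + R * w"
    using measU[OF Pr(1)] prob_compl[OF Gm] unfolding G_def by (simp add: algebra_simps)
  have sub: "S \<subseteq> space M" "T \<subseteq> space M"
    using sets.sets_into_space[OF ST(1)] sets.sets_into_space[OF ST(2)] by auto
  have SG: "measure M (S - G) \<le> 1 - w * card Cl + R * w" "measure M (T - G) \<le> 1 - w * card Cl + R * w"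
    using sub by (auto intro!: order_trans[OF finite_measure_mono rest])
  define \<sigma> where "\<sigma> c = measure M (S \<inter> \<Omega> c)" for c
  define \<tau> where "\<tau> c = measure M (T \<inter> \<Omega> c)" for c
  have \<sigma>: "0 \<le> \<sigma> c" "\<sigma> c \<le> w" and \<tau>: "0 \<le> \<tau> c" "\<tau> c \<le> w" if "c \<in> Cl" for c
    using \<Omega>(3)[OF that] \<Omega>(4)[OF that] unfolding \<sigma>_def \<tau>_def by (auto intro!: finite_measure_mono simp flip: \<Omega>(4)[OF that])
  have sum1: "(\<Sum>c\<in>I. f c) \<le> w * card I" if "I \<subseteq> Cl" "\<And>c. c \<in> Cl \<Longrightarrow> f c \<le> w" for I f
    using that sum_bounded_above[of I f w] by (auto simp: mult.commute)
  have X01: "0 \<le> X c d" "X c d \<le> 1" if "c \<in> Cl" "d \<in> Cl" for c d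
    using rect_integral_unit_range[OF W \<Omega>(3)[OF that(1)] \<Omega>(3)[OF that(2)]] \<Omega>(4)[OF that(1)] \<Omega>(4)[OF that(2)] \<Omega>(5)
    unfolding X[OF that] by (auto simp: power2_eq_square)
  have t0: "0 \<le> X c d * \<sigma> c * \<tau> d" "X c d * \<sigma> c * \<tau> d \<le> \<sigma> c * \<tau> d" if "c \<in> Cl" "d \<in> Cl" for c d
    using X01[OF that] \<sigma>[OF that(1)] \<tau>[OF that(2)] by (auto intro!: mult_right_mono[of "X c d" 1 "\<sigma> c * \<tau> d", simplified] simp: mult.assoc)
  have part: "0 \<le> (\<Sum>c\<in>I. \<Sum>d\<in>J. X c d * \<sigma> c * \<tau> d) \<and> (\<Sum>c\<in>I. \<Sum>d\<in>J. X c d * \<sigma> c * \<tau> d) \<le> (w * card I) * (w * card J)"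
    if "I \<subseteq> Cl" "J \<subseteq> Cl" for I J
  proof
    show "0 \<le> (\<Sum>c\<in>I. \<Sum>d\<in>J. X c d * \<sigma> c * \<tau> d)" using t0(1) that by (intro sum_nonneg) auto
    have "(\<Sum>c\<in>I. \<Sum>d\<in>J. X c d * \<sigma> c * \<tau> d) \<le> (\<Sum>c\<in>I. \<Sum>d\<in>J. \<sigma> c * \<tau> d)"
      using t0(2) that by (intro sum_mono) auto
    also have "\<dots> = (\<Sum>c\<in>I. \<sigma> c) * (\<Sum>d\<in>J. \<tau> d)" by (simp add: sum_product)
    also have "\<dots> \<le> (w * card I) * (w * card J)"
      using \<sigma> \<tau> that \<Omega>(5) by (intro mult_mono sum1 sum_nonneg) auto
    finally show "(\<Sum>c\<in>I. \<Sum>d\<in>J. X c d * \<sigma> c * \<tau> d) \<le> (w * card I) * (w * card J)" .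
  qed
  define big where "big = (\<Sum>c\<in>Cl. \<Sum>d\<in>Cl. X c d * \<sigma> c * \<tau> d)"
  define small where "small = (\<Sum>c\<in>Pr. \<Sum>d\<in>Pr. X c d * \<sigma> c * \<tau> d)"
  have Rw: "w * card (Cl - Pr) \<le> w * R" using Pr \<Omega>(5) by (intro mult_left_mono) auto
  have wI: "0 \<le> w * card I" "w * card I \<le> 1" if "I \<subseteq> Cl" for I
    using measU[OF that] prob_le_1 \<Omega>(5) by (auto, metis)
  have split: "(\<Sum>c\<in>Cl. g c) = (\<Sum>c\<in>Pr. g c) + (\<Sum>c\<in>Cl - Pr. g c)" for g :: "_ \<Rightarrow> real"
    using sum.subset_diff[OF Pr(1) \<Omega>(1), of g] by simp
  have bs: "0 \<le> big - small" "big - small \<le> 2 * (R * w)"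
  proof -
    have eq: "big = small + (\<Sum>c\<in>Pr. \<Sum>d\<in>Cl - Pr. X c d * \<sigma> c * \<tau> d) + (\<Sum>c\<in>Cl - Pr. \<Sum>d\<in>Cl. X c d * \<sigma> c * \<tau> d)"
      unfolding big_def small_def by (subst (1) split) (simp add: split[of "\<lambda>d. X _ d * \<sigma> _ * \<tau> d"] sum.distrib)
    have "(w * card Pr) * (w * card (Cl - Pr)) \<le> 1 * (w * R)"
      by (rule mult_mono[OF wI(2)[OF Pr(1)] Rw]) (use wI(1)[of "Cl - Pr"] in auto)
    moreover have "(w * card (Cl - Pr)) * (w * card Cl) \<le> (w * R) * 1"
      by (rule mult_mono[OF Rw wI(2)]) (use wI(1)[of Cl] \<Omega>(5) in auto)
    ultimately show "0 \<le> big - small" "big - small \<le> 2 * (R * w)"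
      using part[of Pr "Cl - Pr"] part[of "Cl - Pr" Cl] Pr(1) unfolding eq by (auto simp: mult.commute)
  qed
  have eqW: "rect_integral M W S T = rect_integral M W (S \<inter> G) (T \<inter> G) + rect_integral M W (S \<inter> G) (T - G) + rect_integral M W (S - G) T"
  proof -
    have "rect_integral M W ((S \<inter> G) \<union> (S - G)) T = rect_integral M W (S \<inter> G) T + rect_integral M W (S - G) T"
      by (rule rect_integral_Un(1)[OF W(1) W1]) auto
    moreover have "rect_integral M W (S \<inter> G) ((T \<inter> G) \<union> (T - G)) = rect_integral M W (S \<inter> G) (T \<inter> G) + rect_integral M W (S \<inter> G) (T - G)"
      by (rule rect_integral_Un(2)[OF W(1) W1]) auto
    moreover have "(S \<inter> G) \<union> (S - G) = S" "(T \<inter> G) \<union> (T - G) = T" by auto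
    ultimately show ?thesis by simp
  qed
  have rW: "0 \<le> rect_integral M W (S \<inter> G) (T - G)" "rect_integral M W (S \<inter> G) (T - G) \<le> measure M (T - G)"
    "0 \<le> rect_integral M W (S - G) T" "rect_integral M W (S - G) T \<le> measure M (S - G)"
  proof -
    have le: "measure M A * measure M B \<le> measure M B" "measure M A * measure M B \<le> measure M A" for A B
      by (simp_all add: mult_left_le_one_le mult_left_le)
    show "0 \<le> rect_integral M W (S \<inter> G) (T - G)" "0 \<le> rect_integral M W (S - G) T"
      by (rule rect_integral_unit_range(1)[OF W]; simp)+
    show "rect_integral M W (S \<inter> G) (T - G) \<le> measure M (T - G)"
      by (rule order_trans[OF rect_integral_unit_range(2)[OF W] le(1)]) auto
    show "rect_integral M W (S - G) T \<le> measure M (S - G)"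
      by (rule order_trans[OF rect_integral_unit_range(2)[OF W] le(2)]) auto
  qed
  have core: "\<bar>rect_integral M W (S \<inter> G) (T \<inter> G) - small\<bar> \<le> 2 * \<epsilon>"
  proof -
    have d: "disjoint_family_on (\<lambda>c. A \<inter> \<Omega> c) Pr" for A using dPr unfolding disjoint_family_on_def by blast
    have UN: "rect_integral M H (A \<inter> G) (A' \<inter> G) = (\<Sum>c\<in>Pr. \<Sum>d\<in>Pr. rect_integral M H (A \<inter> \<Omega> c) (A' \<inter> \<Omega> d))"
      if H: "H \<in> borel_measurable (M \<Otimes>\<^sub>M M)" "\<And>z. z \<in> space (M \<Otimes>\<^sub>M M) \<Longrightarrow> \<bar>H z\<bar> \<le> (b::real)" and A: "A \<in> sets M" "A' \<in> sets M" for H b A A'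
    proof -
      have e: "A \<inter> G = (\<Union>c\<in>Pr. A \<inter> \<Omega> c)" "A' \<inter> G = (\<Union>c\<in>Pr. A' \<inter> \<Omega> c)" unfolding G_def by auto
      have m: "A \<inter> \<Omega> c \<in> sets M" "A' \<inter> \<Omega> c \<in> sets M" if "c \<in> Pr" for c using A mPr[OF that] by auto
      have "rect_integral M H (A \<inter> G) (A' \<inter> G) = (\<Sum>c\<in>Pr. rect_integral M H (A \<inter> \<Omega> c) (A' \<inter> G))"
        unfolding e(1) by (rule rect_integral_UN_left[OF H finPr d m(1)]) (use A in auto)
      also have "\<dots> = (\<Sum>c\<in>Pr. \<Sum>d\<in>Pr. rect_integral M H (A \<inter> \<Omega> c) (A' \<inter> \<Omega> d))"
        unfolding e(2) by (intro sum.cong refl rect_integral_UN_right[OF H finPr d m(2)] m(1))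
      finally show ?thesis .
    qed
    have WF: "rect_integral M W A A' = rect_integral M F A A' + a c d * measure M A * measure M A'"
      if "c \<in> Pr" "d \<in> Pr" "A \<in> sets M" "A' \<in> sets M" "A \<subseteq> \<Omega> c" "A' \<subseteq> \<Omega> d" for c d A A'
    proof -
      have iW: "set_integrable (M \<Otimes>\<^sub>M M) (A \<times> A') W" "set_integrable (M \<Otimes>\<^sub>M M) (A \<times> A') F"
        using that by (auto intro!: set_integrable_bounded_pair[OF W(1) W1] set_integrable_bounded_pair[OF F])
      have "rect_integral M (\<lambda>z. W z - F z) A A' = a c d * measure M A * measure M A'"
        by (rule rect_integral_const[OF that(3,4)], rule a[OF that(1,2)]) (use that(5,6) in blast)+
      then show ?thesis using set_integral_diff(2)[OF iW] by simp
    qed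
    have "rect_integral M W (S \<inter> G) (T \<inter> G) = (\<Sum>c\<in>Pr. \<Sum>d\<in>Pr. rect_integral M W (S \<inter> \<Omega> c) (T \<inter> \<Omega> d))"
      by (rule UN[OF W(1) W1 ST])
    also have "\<dots> = (\<Sum>c\<in>Pr. \<Sum>d\<in>Pr. rect_integral M F (S \<inter> \<Omega> c) (T \<inter> \<Omega> d) + a c d * \<sigma> c * \<tau> d)"
      unfolding \<sigma>_def \<tau>_def
      by (intro sum.cong refl WF) (use mPr in auto)
    also have "\<dots> = rect_integral M F (S \<inter> G) (T \<inter> G) + (\<Sum>c\<in>Pr. \<Sum>d\<in>Pr. a c d * \<sigma> c * \<tau> d)"
      using UN[OF F ST] by (simp add: sum.distrib)
    finally have 1: "rect_integral M W (S \<inter> G) (T \<inter> G) = rect_integral M F (S \<inter> G) (T \<inter> G) + (\<Sum>c\<in>Pr. \<Sum>d\<in>Pr. a c d * \<sigma> c * \<tau> d)" .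
    \<comment> \<open>Only the fractions \<open>\<sigma> c / w\<close> and
      \<open>\<tau> d / w\<close> of the cells enter the averaged form, and the constants
      \<open>a c d\<close> reappear unchanged, so they cancel in the comparison.\<close>
    have "small = (\<Sum>c\<in>Pr. \<Sum>d\<in>Pr. (\<sigma> c / w) * (\<tau> d / w) * rect_integral M F (\<Omega> c) (\<Omega> d) + a c d * \<sigma> c * \<tau> d)"
      unfolding small_def
    proof (intro sum.cong refl)
      fix c d assume cd: "c \<in> Pr" "d \<in> Pr"
      have "X c d = (rect_integral M F (\<Omega> c) (\<Omega> d) + a c d * w * w) / w\<^sup>2"
        using X[of c d] WF[OF cd mPr[OF cd(1)] mPr[OF cd(2)]] \<Omega>(4) cd Pr(1) by auto
      then show "X c d * \<sigma> c * \<tau> d = (\<sigma> c / w) * (\<tau> d / w) * rect_integral M F (\<Omega> c) (\<Omega> d) + a c d * \<sigma> c * \<tau> d"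
        using \<Omega>(5) by (simp add: field_simps power2_eq_square)
    qed
    also have "\<dots> = (\<Sum>c\<in>Pr. \<Sum>d\<in>Pr. (\<sigma> c / w) * (\<tau> d / w) * rect_integral M F (\<Omega> c) (\<Omega> d)) + (\<Sum>c\<in>Pr. \<Sum>d\<in>Pr. a c d * \<sigma> c * \<tau> d)"
      by (simp add: sum.distrib)
    finally have 2: "small = (\<Sum>c\<in>Pr. \<Sum>d\<in>Pr. (\<sigma> c / w) * (\<tau> d / w) * rect_integral M F (\<Omega> c) (\<Omega> d)) + (\<Sum>c\<in>Pr. \<Sum>d\<in>Pr. a c d * \<sigma> c * \<tau> d)" .
    have 3: "\<bar>\<Sum>c\<in>Pr. \<Sum>d\<in>Pr. (\<sigma> c / w) * (\<tau> d / w) * rect_integral M F (\<Omega> c) (\<Omega> d)\<bar> \<le> \<epsilon>"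
    proof (rule weights_extreme[OF finPr _ finPr])
      show "0 \<le> \<sigma> c / w \<and> \<sigma> c / w \<le> 1" "0 \<le> \<tau> c / w \<and> \<tau> c / w \<le> 1" if "c \<in> Pr" for c
        using \<sigma>[of c] \<tau>[of c] \<Omega>(5) that Pr(1) by auto
      fix I J assume IJ: "I \<subseteq> Pr" "J \<subseteq> Pr"
      have f: "finite I" "finite J" using IJ finPr finite_subset by blast+
      have dI: "disjoint_family_on \<Omega> I" "disjoint_family_on \<Omega> J" using dPr IJ unfolding disjoint_family_on_def by blast+
      have m: "\<Omega> c \<in> sets M" if "c \<in> I \<union> J" for c using that IJ mPr by auto
      have "(\<Sum>c\<in>I. \<Sum>d\<in>J. rect_integral M F (\<Omega> c) (\<Omega> d)) = (\<Sum>c\<in>I. rect_integral M F (\<Omega> c) (\<Union>d\<in>J. \<Omega> d))"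
        by (intro sum.cong refl rect_integral_UN_right[OF F f(2) dI(2), symmetric]) (use m in auto)
      also have "\<dots> = rect_integral M F (\<Union>c\<in>I. \<Omega> c) (\<Union>d\<in>J. \<Omega> d)"
        by (intro rect_integral_UN_left[OF F f(1) dI(1), symmetric]) (use m f in \<open>auto intro!: sets.finite_UN\<close>)
      finally show "\<bar>\<Sum>c\<in>I. \<Sum>d\<in>J. rect_integral M F (\<Omega> c) (\<Omega> d)\<bar> \<le> \<epsilon>"
        using cutF[of "\<Union>c\<in>I. \<Omega> c" "\<Union>d\<in>J. \<Omega> d"] m f by (auto intro!: sets.finite_UN)
    qed
    have "\<bar>rect_integral M F (S \<inter> G) (T \<inter> G)\<bar> \<le> \<epsilon>" by (rule cutF) auto
    then show ?thesis using 1 2 3 by linarith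
  qed
  have "\<bar>rect_integral M W S T - big\<bar> \<le> 2 * \<epsilon> + 2 * (1 - w * card Cl) + 2 * (R * w)"
  proof -
    \<comment> \<open>The mass neglected in the integral and the mass neglected in the sum are both
      nonnegative and enter with opposite signs, so only the larger one counts.\<close>
    have ar: "\<bar>r - b\<bar> \<le> 2 * \<epsilon> + 2 * (1 - wc) + 2 * Rw"
      if "r = r1 + r2 + r3" "0 \<le> r2" "r2 \<le> t" "0 \<le> r3" "r3 \<le> u" "\<bar>r1 - sm\<bar> \<le> 2 * \<epsilon>" "0 \<le> b - sm" "b - sm \<le> 2 * Rw"
        "u \<le> 1 - wc + Rw" "t \<le> 1 - wc + Rw" "wc \<le> 1" for r b wc Rw r1 r2 r3 t u sm :: real
    proof -
      have "r1 - sm \<le> 2 * \<epsilon>" "- (2 * \<epsilon>) \<le> r1 - sm" using that(6) by auto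
      then show ?thesis unfolding abs_le_iff using that(1-5,7-11) by auto
    qed
    show ?thesis by (rule ar[OF eqW rW core bs SG cCl])
  qed
  then show ?thesis unfolding big_def \<sigma>_def \<tau>_def by (simp add: mult.assoc)
qed

text \<open>A row sum of cell averages is, after scaling, the integral over one cell of the degree
  into the covered part of a class. Near regularity controls the degree into the whole class, and
  the uncovered parts of all classes together have measure \<open>1 - w * card Cl\<close>.\<close>

lemma degree_error:
  fixes \<Omega> :: "nat \<times> nat \<Rightarrow> 'a set" and Q :: "nat \<Rightarrow> 'a set" and s :: "nat \<Rightarrow> nat \<Rightarrow> real" and a :: "nat \<Rightarrow> real"
  assumes W: "W \<in> borel_measurable (M \<Otimes>\<^sub>M M)" "\<And>z. z \<in> space (M \<Otimes>\<^sub>M M) \<Longrightarrow> 0 \<le> W z \<and> W z \<le> (1::real)"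
    and Cl: "Cl = (SIGMA i:{..<k}. {..<m i})"
    and \<Omega>: "disjoint_family_on \<Omega> Cl" "\<And>c. c \<in> Cl \<Longrightarrow> \<Omega> c \<in> sets M" "\<And>c. c \<in> Cl \<Longrightarrow> measure M (\<Omega> c) = w" "w > 0"
    and Q: "\<And>i. i < k \<Longrightarrow> Q i \<in> sets M" "\<And>i. i < k \<Longrightarrow> measure M (Q i) = a i" "\<And>c. c \<in> Cl \<Longrightarrow> \<Omega> c \<subseteq> Q (fst c)"
    and a1: "(\<Sum>i<k. a i) = 1"
    and s: "\<And>i j. i < k \<Longrightarrow> j < k \<Longrightarrow> 0 \<le> s i j \<and> s i j \<le> 1"
    and X: "\<And>c d. c \<in> Cl \<Longrightarrow> d \<in> Cl \<Longrightarrow> X c d = rect_integral M W (\<Omega> c) (\<Omega> d) / w\<^sup>2"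
    and NR: "(\<Sum>i<k. \<Sum>j<k. \<integral>x. indicator (Q i) x * \<bar>(\<integral>y. indicator (Q j) y * W (x, y) \<partial>M) - s i j * a j\<bar> \<partial>M) \<le> \<eta>"
  shows "w\<^sup>2 * (\<Sum>c\<in>Cl. \<Sum>j<k. \<bar>(\<Sum>l<m j. X c (j, l)) - s (fst c) j * m j\<bar>) \<le> \<eta> + (1 - w * card Cl)"
proof -
  have W1: "\<bar>W z\<bar> \<le> 1" if "z \<in> space (M \<Otimes>\<^sub>M M)" for z using W(2)[OF that] by simp
  have finCl: "finite Cl" unfolding Cl by auto
  have sumCl: "(\<Sum>c\<in>Cl. f c) = (\<Sum>i<k. \<Sum>l<m i. f (i, l))" for f :: "nat \<times> nat \<Rightarrow> real"
    unfolding Cl by (subst sum.Sigma) auto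
  have cardCl: "real (card Cl) = (\<Sum>j<k. real (m j))" unfolding Cl by simp
  note [measurable] = W(1)
  define D where "D i j x = (\<integral>y. indicator (Q j) y * W (x, y) \<partial>M) - s i j * a j" for i j x
  have Dm: "D i j \<in> borel_measurable M" if "i < k" "j < k" for i j
  proof -
    note [measurable] = Q(1)[OF that(2)]
    show ?thesis unfolding D_def by measurable
  qed
  have degb: "\<bar>\<integral>y. indicator (Q j) y * W (x, y) \<partial>M\<bar> \<le> 1" if "x \<in> space M" for j x
  proof -
    have "\<bar>\<integral>y. indicator (Q j) y * W (x, y) \<partial>M\<bar> \<le> (\<integral>y. 1 \<partial>M)"
    proof (cases "integrable M (\<lambda>y. indicator (Q j) y * W (x, y))")
      case True
      have "\<bar>\<integral>y. indicator (Q j) y * W (x, y) \<partial>M\<bar> \<le> (\<integral>y. \<bar>indicator (Q j) y * W (x, y)\<bar> \<partial>M)" by (rule integral_abs_bound)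
      also have "\<dots> \<le> (\<integral>y. 1 \<partial>M)"
        by (rule integral_mono[OF integrable_abs[OF True]])
           (use that W1 in \<open>auto simp: abs_mult indicator_def space_pair_measure\<close>)
      finally show ?thesis .
    qed (simp add: not_integrable_integral_eq)
    then show ?thesis by (simp add: prob_space)
  qed
  have Db: "\<bar>D i j x\<bar> \<le> 2" if "x \<in> space M" "i < k" "j < k" for i j x
  proof -
    have "0 \<le> a j" "a j \<le> 1" using Q(2)[OF that(3)] by (auto simp flip: Q(2)[OF that(3)])
    then have "0 \<le> s i j * a j" "s i j * a j \<le> 1" using s[OF that(2,3)] by (auto intro: mult_le_one)
    then show ?thesis using degb[OF that(1), of j] unfolding D_def by linarith
  qed
  have Di: "integrable M (\<lambda>x. indicator A x * \<bar>D i j x\<bar>)" if "A \<in> sets M" "i < k" "j < k" for A i j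
    by (rule integrable_const_bound[of _ 2]) (use Db Dm that in \<open>auto intro!: AE_I2 simp: indicator_def\<close>)
  have one: "w\<^sup>2 * \<bar>(\<Sum>l<m j. X c (j, l)) - s (fst c) j * m j\<bar> \<le> (\<integral>x. indicator (\<Omega> c) x * \<bar>D (fst c) j x\<bar> \<partial>M) + w * (a j - w * m j)"
    if c: "c \<in> Cl" and j: "j < k" for c j
  proof -
    have ck: "fst c < k" using c by (auto simp: Cl)
    define Q' where "Q' = (\<Union>l<m j. \<Omega> (j, l))"
    have jl: "(j, l) \<in> Cl" if "l < m j" for l using j that by (simp add: Cl)
    have dj: "disjoint_family_on (\<lambda>l. \<Omega> (j, l)) {..<m j}"
      using \<Omega>(1) jl unfolding disjoint_family_on_def by (metis lessThan_iff prod.inject)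
    have mj: "\<Omega> (j, l) \<in> sets M" if "l < m j" for l using \<Omega>(2)[OF jl[OF that]] .
    have Q'm: "Q' \<in> sets M" unfolding Q'_def using mj by (intro sets.finite_UN) auto
    have Q'Q: "Q' \<subseteq> Q j" unfolding Q'_def using Q(3)[OF jl] by auto
    have mQ': "measure M Q' = w * m j"
    proof -
      have "measure M Q' = (\<Sum>l<m j. measure M (\<Omega> (j, l)))"
        unfolding Q'_def by (rule finite_measure_finite_Union) (use mj dj in auto)
      also have "\<dots> = (\<Sum>l<m j. w)" using \<Omega>(3)[OF jl] by (intro sum.cong) auto
      finally show ?thesis by simp
    qed
    have mD: "measure M (Q j - Q') = a j - w * m j"
      using finite_measure_Diff[OF Q(1)[OF j] Q'm Q'Q] Q(2)[OF j] mQ' by simp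
    have "rect_integral M W (\<Omega> c) (Q' \<union> (Q j - Q')) = rect_integral M W (\<Omega> c) Q' + rect_integral M W (\<Omega> c) (Q j - Q')"
      by (rule rect_integral_Un(2)[OF W(1) W1]) (use Q(1)[OF j] Q'm \<Omega>(2)[OF c] in auto)
    moreover have "Q' \<union> (Q j - Q') = Q j" using Q'Q by auto
    ultimately have sp: "rect_integral M W (\<Omega> c) (Q j) = rect_integral M W (\<Omega> c) Q' + rect_integral M W (\<Omega> c) (Q j - Q')" by simp
    have rg: "0 \<le> rect_integral M W (\<Omega> c) (Q j - Q')" "rect_integral M W (\<Omega> c) (Q j - Q') \<le> w * (a j - w * m j)"
      using rect_integral_unit_range[OF W \<Omega>(2)[OF c], of "Q j - Q'"] Q(1)[OF j] Q'm \<Omega>(3)[OF c] mD by auto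
    have "rect_integral M W (\<Omega> c) Q' = (\<Sum>l<m j. rect_integral M W (\<Omega> c) (\<Omega> (j, l)))"
      unfolding Q'_def by (rule rect_integral_UN_right[OF W(1) W1 _ dj]) (use mj \<Omega>(2)[OF c] in auto)
    also have "\<dots> = w\<^sup>2 * (\<Sum>l<m j. X c (j, l))"
      unfolding sum_distrib_left using X[OF c jl] \<Omega>(4) by (intro sum.cong) auto
    finally have e1: "w\<^sup>2 * (\<Sum>l<m j. X c (j, l)) = rect_integral M W (\<Omega> c) Q'" by simp
    have "rect_integral M W (\<Omega> c) (Q j) - s (fst c) j * a j * w = (\<integral>x. indicator (\<Omega> c) x * D (fst c) j x \<partial>M)"
    proof -
      have i1: "integrable M (\<lambda>x. indicator (\<Omega> c) x * (\<integral>y. indicator (Q j) y * W (x, y) \<partial>M))"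
      proof (rule integrable_const_bound[of _ 1])
        note [measurable] = Q(1)[OF j] \<Omega>(2)[OF c]
        show "(\<lambda>x. indicator (\<Omega> c) x * (\<integral>y. indicator (Q j) y * W (x, y) \<partial>M)) \<in> borel_measurable M" by measurable
      qed (use degb in \<open>auto intro!: AE_I2 simp: indicator_def\<close>)
      have i2: "integrable M (\<lambda>x. indicator (\<Omega> c) x * (s (fst c) j * a j))"
        using \<Omega>(2)[OF c] by (auto intro!: integrable_real_indicator simp: less_top[symmetric])
      have "(\<integral>x. indicator (\<Omega> c) x * D (fst c) j x \<partial>M) = (\<integral>x. indicator (\<Omega> c) x * (\<integral>y. indicator (Q j) y * W (x, y) \<partial>M) - indicator (\<Omega> c) x * (s (fst c) j * a j) \<partial>M)"
        unfolding D_def by (simp add: algebra_simps)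
      also have "\<dots> = rect_integral M W (\<Omega> c) (Q j) - w * (s (fst c) j * a j)"
        unfolding Bochner_Integration.integral_diff[OF i1 i2]
        using rect_integral_fubini[OF W(1) W1 \<Omega>(2)[OF c] Q(1)[OF j]] \<Omega>(2,3)[OF c] by (simp add: Int_absorb2 sets.sets_into_space)
      finally show ?thesis by (simp add: mult_ac)
    qed
    then have "\<bar>rect_integral M W (\<Omega> c) (Q j) - s (fst c) j * a j * w\<bar> \<le> (\<integral>x. \<bar>indicator (\<Omega> c) x * D (fst c) j x\<bar> \<partial>M)"
      using integral_abs_bound[of M "\<lambda>x. indicator (\<Omega> c) x * D (fst c) j x"] by simp
    also have "\<dots> = (\<integral>x. indicator (\<Omega> c) x * \<bar>D (fst c) j x\<bar> \<partial>M)" by (simp add: abs_mult)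
    finally have e2: "\<bar>rect_integral M W (\<Omega> c) (Q j) - s (fst c) j * a j * w\<bar> \<le> (\<integral>x. indicator (\<Omega> c) x * \<bar>D (fst c) j x\<bar> \<partial>M)" .
    have gap: "0 \<le> w * (a j - w * m j)" using mD \<Omega>(4) measure_nonneg[of M "Q j - Q'"] by simp
    have "0 \<le> s (fst c) j" "s (fst c) j \<le> 1" using s[OF ck j] by auto
    \<comment> \<open>The uncovered part of the class appears once with its true integral and once
      with its expected share. Both lie between 0 and the same gap, so together they cost the gap
      once.\<close>
    then have e3: "0 \<le> s (fst c) j * (w * (a j - w * m j))" "s (fst c) j * (w * (a j - w * m j)) \<le> 1 * (w * (a j - w * m j))"
      using gap by (simp_all only: mult_nonneg_nonneg mult_right_mono)
    have "w\<^sup>2 * \<bar>(\<Sum>l<m j. X c (j, l)) - s (fst c) j * m j\<bar> = \<bar>w\<^sup>2 * (\<Sum>l<m j. X c (j, l)) - w\<^sup>2 * (s (fst c) j * m j)\<bar>"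
      by (simp add: abs_mult flip: right_diff_distrib)
    also have "w\<^sup>2 * (s (fst c) j * m j) = s (fst c) j * a j * w - s (fst c) j * (w * (a j - w * m j))"
      by (simp add: algebra_simps power2_eq_square)
    finally show ?thesis using e1 e2 e3 sp rg by linarith
  qed
  have "w\<^sup>2 * (\<Sum>c\<in>Cl. \<Sum>j<k. \<bar>(\<Sum>l<m j. X c (j, l)) - s (fst c) j * m j\<bar>)
      \<le> (\<Sum>c\<in>Cl. \<Sum>j<k. (\<integral>x. indicator (\<Omega> c) x * \<bar>D (fst c) j x\<bar> \<partial>M) + w * (a j - w * m j))"
    unfolding sum_distrib_left using one by (intro sum_mono) auto
  also have "\<dots> = (\<Sum>c\<in>Cl. \<Sum>j<k. \<integral>x. indicator (\<Omega> c) x * \<bar>D (fst c) j x\<bar> \<partial>M) + (\<Sum>c\<in>Cl. \<Sum>j<k. w * (a j - w * m j))"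
    by (simp only: sum.distrib)
  also have "(\<Sum>c\<in>Cl. \<Sum>j<k. w * (a j - w * m j)) = (w * card Cl) * (1 - w * card Cl)"
    unfolding cardCl by (simp add: sum_distrib_left[symmetric] sum_subtractf a1 cardCl mult_ac)
  also have "(w * card Cl) * (1 - w * card Cl) \<le> 1 - w * card Cl"
  proof -
    have "measure M (\<Union>c\<in>Cl. \<Omega> c) = (\<Sum>c\<in>Cl. measure M (\<Omega> c))"
      by (rule finite_measure_finite_Union) (use finCl \<Omega> in auto)
    also have "\<dots> = w * card Cl" using \<Omega>(3) by simp
    finally have "w * card Cl \<le> 1" using prob_le_1 by metis
    then show ?thesis using \<Omega>(4) by (intro mult_left_le_one_le) auto
  qed
  also have "(\<Sum>c\<in>Cl. \<Sum>j<k. \<integral>x. indicator (\<Omega> c) x * \<bar>D (fst c) j x\<bar> \<partial>M) \<le> \<eta>"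
  proof -
    have "(\<Sum>c\<in>Cl. \<Sum>j<k. \<integral>x. indicator (\<Omega> c) x * \<bar>D (fst c) j x\<bar> \<partial>M) = (\<Sum>i<k. \<Sum>l<m i. \<Sum>j<k. \<integral>x. indicator (\<Omega> (i, l)) x * \<bar>D i j x\<bar> \<partial>M)"
      unfolding sumCl by simp
    also have "\<dots> = (\<Sum>i<k. \<Sum>j<k. \<Sum>l<m i. \<integral>x. indicator (\<Omega> (i, l)) x * \<bar>D i j x\<bar> \<partial>M)"
      by (rule sum.cong[OF refl], rule sum.swap)
    also have "\<dots> \<le> (\<Sum>i<k. \<Sum>j<k. \<integral>x. indicator (Q i) x * \<bar>D i j x\<bar> \<partial>M)"
    proof (intro sum_mono)
      fix i j assume "i \<in> {..<k}" "j \<in> {..<k}"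
      then have ij: "i < k" "j < k" by auto
      have il: "(i, l) \<in> Cl" if "l < m i" for l using ij that by (simp add: Cl)
      have di: "disjoint_family_on (\<lambda>l. \<Omega> (i, l)) {..<m i}"
        using \<Omega>(1) il unfolding disjoint_family_on_def by (metis lessThan_iff prod.inject)
      have "(\<Sum>l<m i. \<integral>x. indicator (\<Omega> (i, l)) x * \<bar>D i j x\<bar> \<partial>M) = (\<integral>x. (\<Sum>l<m i. indicator (\<Omega> (i, l)) x * \<bar>D i j x\<bar>) \<partial>M)"
        by (rule Bochner_Integration.integral_sum[symmetric]) (use Di \<Omega>(2)[OF il] ij in auto)
      also have "\<dots> \<le> (\<integral>x. indicator (Q i) x * \<bar>D i j x\<bar> \<partial>M)"
      proof (rule integral_mono)
        show "integrable M (\<lambda>x. \<Sum>l<m i. indicator (\<Omega> (i, l)) x * \<bar>D i j x\<bar>)"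
          by (rule Bochner_Integration.integrable_sum) (use Di \<Omega>(2)[OF il] ij in auto)
        show "integrable M (\<lambda>x. indicator (Q i) x * \<bar>D i j x\<bar>)" by (rule Di[OF Q(1)[OF ij(1)] ij])
        fix x
        have "(\<Sum>l<m i. indicator (\<Omega> (i, l)) x :: real) = indicator (\<Union>l<m i. \<Omega> (i, l)) x"
          by (rule indicator_UN_disjoint[symmetric]) (use di in auto)
        also have "\<dots> \<le> indicator (Q i) x" using Q(3)[OF il] by (auto simp: indicator_def)
        finally show "(\<Sum>l<m i. indicator (\<Omega> (i, l)) x * \<bar>D i j x\<bar>) \<le> indicator (Q i) x * \<bar>D i j x\<bar>"
          unfolding sum_distrib_right[symmetric] by (rule mult_right_mono) simp
      qed
      finally show "(\<Sum>l<m i. \<integral>x. indicator (\<Omega> (i, l)) x * \<bar>D i j x\<bar> \<partial>M) \<le> (\<integral>x. indicator (Q i) x * \<bar>D i j x\<bar> \<partial>M)" .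
    qed
    also have "\<dots> \<le> \<eta>" using NR unfolding D_def .
    finally show ?thesis .
  qed
  finally show ?thesis by simp
qed

end

section \<open>Placing the cells on consecutive vertices\<close>

lemma layout:
  fixes a :: "nat \<Rightarrow> real" and m :: "nat \<Rightarrow> nat" and n k L :: nat
  assumes n: "n > 0" and a: "\<And>i. 0 \<le> a i" "(\<Sum>i<k. a i) = 1"
    and Cl: "Cl = (SIGMA i:{..<k}. {..<m i})"
    and fit: "\<And>i. i < k \<Longrightarrow> m i > 0 \<Longrightarrow> real (m i * L) + 3 \<le> n * a i"
  shows "\<exists>V cell. V \<subseteq> {1..<n} \<and> (\<forall>v\<in>V. cell v \<in> Cl) \<and>
    (\<forall>c\<in>Cl. \<exists>p. {v \<in> V. cell v = c} = {p<..p + L}) \<and>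
    (\<forall>v\<in>V. (\<Sum>i<fst (cell v). a i) < (real v - 1) / n \<and> real v / n \<le> (\<Sum>i<Suc (fst (cell v)). a i))"
proof -
  define A where "A i = (\<Sum>i'<i. a i')" for i
  have Amono: "A i \<le> A j" if "i \<le> j" for i j unfolding A_def using that a(1) by (intro sum_mono2) auto
  have A0: "0 \<le> A i" for i unfolding A_def using a(1) by (intro sum_nonneg) auto
  define st where "st i = nat \<lfloor>n * A i\<rfloor> + 1" for i
  have st: "n * A i < real (st i)" "real (st i) \<le> n * A i + 1" for i
  proof -
    have "0 \<le> n * A i" using A0 by simp
    then have "real (st i) = of_int \<lfloor>n * A i\<rfloor> + 1" unfolding st_def by simp
    then show "n * A i < real (st i)" "real (st i) \<le> n * A i + 1" by linarith+
  qed
  define cs where "cs c = {st (fst c) + snd c * L <.. st (fst c) + snd c * L + L}" for c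
  have lo: "n * A (fst c) < real v - 1" and up: "real v \<le> n * A (Suc (fst c)) - 2" if c: "c \<in> Cl" and v: "v \<in> cs c" for c v
  proof -
    have ck: "fst c < k" "snd c < m (fst c)" using c by (auto simp: Cl)
    have "st (fst c) + 1 \<le> v" using v by (auto simp: cs_def)
    then have "real (st (fst c)) + 1 \<le> real v" by linarith
    then show "n * A (fst c) < real v - 1" using st(1)[of "fst c"] by linarith
    have "snd c * L + L \<le> m (fst c) * L" using ck(2) by (metis Suc_leI add.commute mult_Suc mult_le_mono1)
    then have "v \<le> st (fst c) + m (fst c) * L" using v by (auto simp: cs_def)
    then have "real v \<le> real (st (fst c)) + real (m (fst c) * L)" by (metis of_nat_add of_nat_mono)
    also have "\<dots> \<le> n * A (fst c) + 1 + (n * a (fst c) - 3)" using st(2)[of "fst c"] fit[OF ck(1)] ck(2) by linarith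
    also have "\<dots> = n * A (Suc (fst c)) - 2" by (simp add: A_def algebra_simps)
    finally show "real v \<le> n * A (Suc (fst c)) - 2" .
  qed
  have uniq: "c = d" if cd: "c \<in> Cl" "d \<in> Cl" "v \<in> cs c" "v \<in> cs d" for c d v
  proof -
    have nl: "\<not> fst c < fst d" if "c \<in> Cl" "d \<in> Cl" "v \<in> cs c" "v \<in> cs d" for c d
    proof
      assume "fst c < fst d"
      then have "n * A (Suc (fst c)) \<le> n * A (fst d)" using Amono by (intro mult_left_mono) auto
      then show False using up[OF that(1,3)] lo[OF that(2,4)] by linarith
    qed
    have f: "fst c = fst d" using nl[OF cd] nl[OF cd(2,1,4,3)] by simp
    have nl2: "\<not> snd c < snd d" if "fst c = fst d" "v \<in> cs c" "v \<in> cs d" for c d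
    proof
      assume "snd c < snd d"
      then have "snd c * L + L \<le> snd d * L" by (metis Suc_leI add.commute mult_Suc mult_le_mono1)
      then show False using that by (auto simp: cs_def)
    qed
    then have "snd c = snd d" using nl2[OF f cd(3,4)] nl2[OF f[symmetric] cd(4,3)] by simp
    then show ?thesis using f by (simp add: prod_eq_iff)
  qed
  define V where "V = (\<Union>c\<in>Cl. cs c)"
  define cell where "cell v = (SOME c. c \<in> Cl \<and> v \<in> cs c)" for v
  have cell: "cell v \<in> Cl" "v \<in> cs (cell v)" if "v \<in> V" for v
    using someI_ex[of "\<lambda>c. c \<in> Cl \<and> v \<in> cs c"] that unfolding V_def cell_def by auto
  have "{v \<in> V. cell v = c} = cs c" if "c \<in> Cl" for c
    using cell uniq that unfolding V_def by blast
  then have 1: "\<forall>c\<in>Cl. \<exists>p. {v \<in> V. cell v = c} = {p<..p + L}" unfolding cs_def by blast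
  have 2: "A (fst (cell v)) < (real v - 1) / n" "real v / n \<le> A (Suc (fst (cell v)))" if "v \<in> V" for v
    using lo[OF cell[OF that]] up[OF cell[OF that]] n by (auto simp: field_simps)
  have 3: "V \<subseteq> {1..<n}"
  proof
    fix v assume v: "v \<in> V"
    have "A (Suc (fst (cell v))) \<le> A k" using cell(1)[OF v] by (intro Amono) (auto simp: Cl)
    then have "A (Suc (fst (cell v))) \<le> 1" using a(2) unfolding A_def by simp
    then have "real n * A (Suc (fst (cell v))) \<le> real n * 1" by (intro mult_left_mono) auto
    then have "real v < n" using up[OF cell[OF v]] by linarith
    moreover have "0 \<le> n * A (fst (cell v))" using A0 by simp
    then have "0 < real v" using lo[OF cell[OF v]] by linarith
    ultimately show "v \<in> {1..<n}" by simp
  qed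
  show ?thesis using 1 2 3 cell(1) unfolding A_def by (intro exI[of _ V] exI[of _ cell]) auto
qed

text \<open>The last block is closed because the sorting map may attain the value 1, and the blocks
  have to exhaust the interval exactly. Cells use vertices below \<open>n\<close> only, hence only
  half-open blocks.\<close>

definition sorted_block :: "(real \<Rightarrow> real) \<Rightarrow> nat \<Rightarrow> nat \<Rightarrow> real set" where
  "sorted_block H n v = {x \<in> {0..<1}. H x \<in> (if v = n then {(real n - 1) / real n..1} else vertex_part n v)}"

lemma sorted_block:
  assumes n: "n > 0" and H: "H \<in> borel_measurable unit_space" "\<And>x. 0 \<le> H x \<and> H x \<le> 1"
    and HS: "\<And>S. S \<in> sets borel \<Longrightarrow> emeasure unit_space {x \<in> {0..<1}. H x \<in> S} = emeasure lborel (S \<inter> {0<..<1})"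
  shows "sorted_block H n v \<in> sets unit_space" "sorted_block H n v \<subseteq> {0..<1}" "sorted_block H n v \<in> sets borel"
    "(\<Union>v\<in>{1..n}. sorted_block H n v) = {0..<1}" "disjoint_family_on (sorted_block H n) {1..n}"
    "v \<in> {1..n} \<Longrightarrow> emeasure lborel (sorted_block H n v) = ennreal (1 / n)"
    "v \<in> {1..n} \<Longrightarrow> measure unit_space (sorted_block H n v) = 1 / n"
proof -
  let ?P = "\<lambda>v. if v = n then {(real n - 1) / real n..1} else vertex_part n v"
  have Pm [measurable]: "?P v \<in> sets borel" for v by (simp add: vertex_part_def)
  note [measurable] = H(1)
  have "{x \<in> space unit_space. H x \<in> ?P v} \<in> sets unit_space" by measurable
  then show m: "sorted_block H n v \<in> sets unit_space" by (simp add: sorted_block_def)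
  show sub: "sorted_block H n v \<subseteq> {0..<1}" by (auto simp: sorted_block_def)
  show "sorted_block H n v \<in> sets borel" using m by (auto simp: sets_restrict_space_iff)
  show "(\<Union>v\<in>{1..n}. sorted_block H n v) = {0..<1}"
  proof (intro equalityI subsetI)
    fix x :: real assume x: "x \<in> {0..<1}"
    show "x \<in> (\<Union>v\<in>{1..n}. sorted_block H n v)"
    proof (cases "H x < 1")
      case True
      then obtain v where v: "v \<in> {1..n}" "H x \<in> vertex_part n v" using vertex_part_cover[of "H x" n] H(2) n by auto
      then have "H x \<in> ?P v" using H(2)[of x] by (auto simp: vertex_part_def)
      then show ?thesis using v x unfolding sorted_block_def by blast
    next
      case False
      then have "H x = 1" using H(2)[of x] by simp
      then have "x \<in> sorted_block H n n" using x n by (simp add: sorted_block_def field_simps)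
      then show ?thesis using n by auto
    qed
  qed (auto simp: sorted_block_def)
  show "disjoint_family_on (sorted_block H n) {1..n}"
    unfolding disjoint_family_on_def
  proof (intro ballI impI)
    have *: False if "v \<in> {1..n}" "w \<in> {1..n}" "v < w" "x \<in> sorted_block H n v" "x \<in> sorted_block H n w" for v w x
    proof -
      have "v < n" using that by auto
      then have "H x < real v / n" using that(4) by (auto simp: sorted_block_def vertex_part_def)
      moreover have "(real w - 1) / n \<le> H x" using that(5) by (auto simp: sorted_block_def vertex_part_def split: if_splits)
      moreover have "real v / n \<le> (real w - 1) / n" using that(3) by (intro divide_right_mono) auto
      ultimately show False by linarith
    qed
    fix v w assume vw: "v \<in> {1..n}" "w \<in> {1..n}" "v \<noteq> w"
    show "sorted_block H n v \<inter> sorted_block H n w = {}"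
    proof (rule ccontr)
      assume "sorted_block H n v \<inter> sorted_block H n w \<noteq> {}"
      then obtain x where "x \<in> sorted_block H n v" "x \<in> sorted_block H n w" by auto
      then show False using *[OF vw(1,2)] *[OF vw(2,1)] vw(3) by (metis linorder_neqE_nat)
    qed
  qed
  assume v: "v \<in> {1..n}"
  have "emeasure lborel (sorted_block H n v) = emeasure unit_space (sorted_block H n v)"
    using sub by (intro emeasure_restrict_space[symmetric]) auto
  also have "\<dots> = emeasure lborel (?P v \<inter> {0<..<1})"
    unfolding sorted_block_def by (rule HS[OF Pm])
  also have "\<dots> = emeasure lborel {(real v - 1) / n ..< real v / n}"
  proof (rule emeasure_eq_AE)
    have "AE x in lborel. x \<noteq> (0::real)" "AE x in lborel. x \<noteq> (1::real)" by (rule AE_lborel_singleton)+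
    then show "AE x in lborel. x \<in> ?P v \<inter> {0<..<1} \<longleftrightarrow> x \<in> {(real v - 1) / n ..< real v / n}"
    proof eventually_elim
      case (elim x)
      define lo hi where "lo = (real v - 1) / n" and "hi = real v / n"
      have lh: "0 \<le> lo" "hi \<le> 1" using v n unfolding lo_def hi_def by (auto simp: field_simps)
      show ?case
      proof (cases "v = n")
        case True
        then have "hi = 1" using n by (simp add: hi_def)
        have "x \<in> {lo..1} \<inter> {0<..<1} \<longleftrightarrow> x \<in> {lo..<hi}" unfolding \<open>hi = 1\<close> using lh elim by auto
        then show ?thesis using True by (simp add: lo_def hi_def)
      next
        case False
        have "x \<in> {lo..<hi} \<inter> {0<..<1} \<longleftrightarrow> x \<in> {lo..<hi}" using lh elim by auto
        then show ?thesis using False by (simp add: lo_def hi_def vertex_part_def)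
      qed
    qed
  qed (use Pm[of v] in simp_all)
  also have "\<dots> = ennreal (1 / n)"
  proof -
    have "(real v - 1) / n \<le> real v / n" by (intro divide_right_mono) auto
    moreover have "real v / n - (real v - 1) / n = 1 / n" by (simp add: diff_divide_distrib)
    ultimately show ?thesis by simp
  qed
  finally show e: "emeasure lborel (sorted_block H n v) = ennreal (1 / n)" .
  then have "emeasure unit_space (sorted_block H n v) = ennreal (1 / n)"
    using sub by (subst emeasure_restrict_space) auto
  then show "measure unit_space (sorted_block H n v) = 1 / n" by (simp add: measure_def)
qed

section \<open>Membership codes, pull-backs and kernels of graphs\<close>

lemma measurable_nat_borel:
  fixes f :: "'a \<Rightarrow> nat"
  assumes "f \<in> borel_measurable M"
  shows "f \<in> M \<rightarrow>\<^sub>M count_space UNIV"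
  using measurable_sets[OF assms, of "{_}"] by (subst measurable_count_space_eq_countable) auto

text \<open>The binary number whose digits record the memberships; its fibres are the atoms of the
  algebra generated by the sets.\<close>

lemma membership_code:
  fixes B :: "nat \<Rightarrow> 'a set"
  assumes "\<And>b. b < N \<Longrightarrow> B b \<in> sets M"
  shows "\<exists>code. code \<in> M \<rightarrow>\<^sub>M count_space UNIV \<and> (\<forall>x. code x < (2::nat) ^ N) \<and>
    (\<forall>x y. code x = code y \<longrightarrow> (\<forall>b<N. x \<in> B b \<longleftrightarrow> y \<in> B b))"
proof -
  define code where "code x = (\<Sum>b<N. if x \<in> B b then 2 ^ b else (0::nat))" for x
  have enc: "code x = set_encode {b. b < N \<and> x \<in> B b}" for x
    unfolding code_def set_encode_def by (simp add: sum.inter_filter[symmetric] conj_commute)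
  have "code \<in> borel_measurable M" unfolding code_def
  proof (rule borel_measurable_sum)
    fix b assume "b \<in> {..<N}"
    then have [measurable]: "B b \<in> sets M" using assms by simp
    show "(\<lambda>x. if x \<in> B b then 2 ^ b else (0::nat)) \<in> borel_measurable M" by measurable
  qed
  then have cm: "code \<in> M \<rightarrow>\<^sub>M count_space UNIV" by (rule measurable_nat_borel)
  have cb: "code x < 2 ^ N" for x
  proof -
    have "code x \<le> (\<Sum>b<N. 2 ^ b)" unfolding code_def by (intro sum_mono) auto
    also have "\<dots> < 2 ^ N" by (induction N) auto
    finally show ?thesis .
  qed
  have ci: "x \<in> B b \<longleftrightarrow> y \<in> B b" if "code x = code y" "b < N" for x y b
  proof -
    have "{b. b < N \<and> x \<in> B b} = {b. b < N \<and> y \<in> B b}"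
      using that(1) unfolding enc by (subst (asm) set_encode_eq) auto
    then show ?thesis using that(2) by blast
  qed
  show ?thesis
    by (rule exI[of _ code], intro conjI allI impI) (rule cm, rule cb, rule ci)
qed

lemma distr_pair_self:
  assumes "prob_space N" "p \<in> M \<rightarrow>\<^sub>M N" "distr M N p = N"
  shows "distr (M \<Otimes>\<^sub>M M) (N \<Otimes>\<^sub>M N) (\<lambda>(x, y). (p x, p y)) = N \<Otimes>\<^sub>M N"
proof -
  interpret N: prob_space N by (rule assms(1))
  have "distr M N p \<Otimes>\<^sub>M distr M N p = distr (M \<Otimes>\<^sub>M M) (N \<Otimes>\<^sub>M N) (\<lambda>(x, y). (p x, p y))"
    by (rule pair_measure_distr[OF assms(2,2)]) (simp add: assms(3) N.sigma_finite_measure_axioms)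
  then show ?thesis by (simp add: assms(3))
qed

lemma pull_back_measurable:
  assumes "W \<in> borel_measurable (N \<Otimes>\<^sub>M N)" "p \<in> M \<rightarrow>\<^sub>M N"
  shows "pull_back W p \<in> borel_measurable (M \<Otimes>\<^sub>M M)"
proof -
  note [measurable] = assms
  have "pull_back W p = (\<lambda>z. W (p (fst z), p (snd z)))" by (auto simp: pull_back_def)
  then show ?thesis by simp
qed

lemma rect_integral_pull_back:
  assumes "prob_space N" "p \<in> M \<rightarrow>\<^sub>M N" "distr M N p = N" and W: "W \<in> borel_measurable (N \<Otimes>\<^sub>M N)"
    and ST: "S \<in> sets N" "T \<in> sets N"
  shows "rect_integral M (pull_back W p) (p -` S \<inter> space M) (p -` T \<inter> space M) = rect_integral N W S T"
proof -
  note [measurable] = assms(2) W ST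
  have "rect_integral N W S T = (\<integral>z. indicator (S \<times> T) z * W z \<partial>distr (M \<Otimes>\<^sub>M M) (N \<Otimes>\<^sub>M N) (\<lambda>(x, y). (p x, p y)))"
    unfolding distr_pair_self[OF assms(1-3)] set_lebesgue_integral_def by simp
  also have "\<dots> = (\<integral>z. indicator (S \<times> T) (case z of (x, y) \<Rightarrow> (p x, p y)) * W (case z of (x, y) \<Rightarrow> (p x, p y)) \<partial>(M \<Otimes>\<^sub>M M))"
    by (rule integral_distr) measurable
  also have "\<dots> = rect_integral M (pull_back W p) (p -` S \<inter> space M) (p -` T \<inter> space M)"
    unfolding set_lebesgue_integral_def
    by (rule Bochner_Integration.integral_cong) (auto simp: pull_back_def space_pair_measure indicator_def)
  finally show ?thesis by simp
qed

lemma graph_kernel: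
  assumes n: "n > 0"
  shows "kernel (graph_representation n G) \<in> borel_measurable (unit_space \<Otimes>\<^sub>M unit_space)"
    and "\<bar>kernel (graph_representation n G) z\<bar> \<le> 1"
    and "u \<in> {1..n} \<Longrightarrow> v \<in> {1..n} \<Longrightarrow> x \<in> vertex_part n u \<Longrightarrow> y \<in> vertex_part n v \<Longrightarrow>
      kernel (graph_representation n G) (x, y) = of_bool ({u, v} \<in> G)"
proof -
  have vm: "vertex_part n v \<inter> {0..<1} \<in> sets unit_space" for v
    by (auto simp: sets_restrict_space_iff vertex_part_def)
  have "{z \<in> space (unit_space \<Otimes>\<^sub>M unit_space). fst z \<in> vertex_part n u \<and> snd z \<in> vertex_part n v}
     = (vertex_part n u \<inter> {0..<1}) \<times> (vertex_part n v \<inter> {0..<1})" for u v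
    by (auto simp: space_pair_measure)
  then have [measurable]: "Measurable.pred (unit_space \<Otimes>\<^sub>M unit_space) (\<lambda>z. fst z \<in> vertex_part n u \<and> snd z \<in> vertex_part n v)" for u v
    using vm unfolding pred_def by (metis pair_measureI)
  have eq: "kernel (graph_representation n G) = (\<lambda>z. if \<exists>u\<in>{1..n}. \<exists>v\<in>{1..n}. {u, v} \<in> G \<and> (fst z \<in> vertex_part n u \<and> snd z \<in> vertex_part n v) then 1 else 0)"
    by (auto simp: graph_representation_def fun_eq_iff)
  show "kernel (graph_representation n G) \<in> borel_measurable (unit_space \<Otimes>\<^sub>M unit_space)"
    unfolding eq by measurable
  show "\<bar>kernel (graph_representation n G) z\<bar> \<le> 1" unfolding eq by simp
  assume uv: "u \<in> {1..n}" "v \<in> {1..n}" "x \<in> vertex_part n u" "y \<in> vertex_part n v"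
  have "(\<exists>u'\<in>{1..n}. \<exists>v'\<in>{1..n}. {u', v'} \<in> G \<and> (x \<in> vertex_part n u' \<and> y \<in> vertex_part n v')) \<longleftrightarrow> {u, v} \<in> G"
    using uv vertex_part_disjoint[OF uv(1) _ uv(3)] vertex_part_disjoint[OF uv(2) _ uv(4)] by blast
  then show "kernel (graph_representation n G) (x, y) = of_bool ({u, v} \<in> G)" unfolding eq by simp
qed

lemma sum_block_measure:
  fixes f :: "nat \<Rightarrow> real" and w :: real
  assumes "finite V" "finite Cl" "\<And>v. v \<in> V \<Longrightarrow> cell v \<in> Cl"
  shows "(\<Sum>c\<in>Cl. \<Sum>d\<in>Cl. Y c d * (\<Sum>u\<in>{u\<in>V. cell u = c}. f u) * (\<Sum>v\<in>{v\<in>V. cell v = d}. f' v))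
     = (\<Sum>u\<in>V. \<Sum>v\<in>V. Y (cell u) (cell v) * f u * f' v)"
proof -
  have g: "(\<Sum>c\<in>Cl. \<Sum>u\<in>{u\<in>V. cell u = c}. h u) = (\<Sum>u\<in>V. h u)" for h :: "nat \<Rightarrow> real"
    by (rule sum.group) (use assms in auto)
  have "(\<Sum>u\<in>V. \<Sum>v\<in>V. Y (cell u) (cell v) * f u * f' v) = (\<Sum>c\<in>Cl. \<Sum>u\<in>{u\<in>V. cell u = c}. \<Sum>v\<in>V. Y (cell u) (cell v) * f u * f' v)"
    by (rule g[symmetric])
  also have "\<dots> = (\<Sum>c\<in>Cl. \<Sum>u\<in>{u\<in>V. cell u = c}. \<Sum>d\<in>Cl. \<Sum>v\<in>{v\<in>V. cell v = d}. Y c d * f u * f' v)"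
  proof (intro sum.cong refl)
    fix c u assume u: "u \<in> {u\<in>V. cell u = c}"
    have "(\<Sum>v\<in>V. Y (cell u) (cell v) * f u * f' v) = (\<Sum>d\<in>Cl. \<Sum>v\<in>{v\<in>V. cell v = d}. Y (cell u) (cell v) * f u * f' v)"
      by (rule g[symmetric])
    also have "\<dots> = (\<Sum>d\<in>Cl. \<Sum>v\<in>{v\<in>V. cell v = d}. Y c d * f u * f' v)"
      using u by (intro sum.cong refl) auto
    finally show "(\<Sum>v\<in>V. Y (cell u) (cell v) * f u * f' v) = (\<Sum>d\<in>Cl. \<Sum>v\<in>{v\<in>V. cell v = d}. Y c d * f u * f' v)" .
  qed
  also have "\<dots> = (\<Sum>c\<in>Cl. \<Sum>d\<in>Cl. \<Sum>u\<in>{u\<in>V. cell u = c}. \<Sum>v\<in>{v\<in>V. cell v = d}. Y c d * f u * f' v)"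
    by (rule sum.cong[OF refl], rule sum.swap)
  also have "\<dots> = (\<Sum>c\<in>Cl. \<Sum>d\<in>Cl. Y c d * (\<Sum>u\<in>{u\<in>V. cell u = c}. f u) * (\<Sum>v\<in>{v\<in>V. cell v = d}. f' v))"
    by (simp only: mult.assoc sum_distrib_left[symmetric] sum_distrib_right[symmetric])
  finally show ?thesis by simp
qed

text \<open>The sorting map turns the partition and the sets of the regularity decomposition into
  intervals, so that all but boundedly many of the cells lie inside a single class.\<close>

lemma regular_cells:
  fixes W :: "real \<times> real \<Rightarrow> real" and qi :: "real \<Rightarrow> nat" and \<delta> w :: real and n k L Nr :: nat
    and a :: "nat \<Rightarrow> real" and cell :: "nat \<Rightarrow> nat \<times> nat"
  assumes W: "W \<in> borel_measurable (unit_space \<Otimes>\<^sub>M unit_space)" "\<And>z. z \<in> space (unit_space \<Otimes>\<^sub>M unit_space) \<Longrightarrow> 0 \<le> W z \<and> W z \<le> 1"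
    and qi: "qi \<in> unit_space \<rightarrow>\<^sub>M count_space UNIV" "\<And>x. x \<in> {0..<1} \<Longrightarrow> qi x < k"
      "\<And>i. i < k \<Longrightarrow> measure unit_space {x \<in> {0..<1}. qi x = i} = a i"
    and n: "n > 0" and L: "L > 0"
    and V: "V \<subseteq> {1..<n}" "\<And>v. v \<in> V \<Longrightarrow> cell v \<in> Cl" "\<And>c. c \<in> Cl \<Longrightarrow> \<exists>p. {v \<in> V. cell v = c} = {p<..p + L}"
      "\<And>v. v \<in> V \<Longrightarrow> (\<Sum>i<fst (cell v). a i) < (real v - 1) / n \<and> real v / n \<le> (\<Sum>i<Suc (fst (cell v)). a i)"
    and Cl: "finite Cl" "\<And>c. c \<in> Cl \<Longrightarrow> fst c < k"
    and \<delta>: "\<delta> > 0" "real Nr * \<delta>\<^sup>2 > 1"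
    and w: "w = real L / n"
  shows "\<exists>\<Omega>. (\<forall>v. \<Omega> v \<in> sets borel \<and> \<Omega> v \<in> sets unit_space \<and> \<Omega> v \<subseteq> {0..<1}) \<and>
    (\<Union>v\<in>{1..n}. \<Omega> v) = {0..<1} \<and> disjoint_family_on \<Omega> {1..n} \<and>
    (\<forall>v\<in>{1..n}. emeasure lborel (\<Omega> v) = ennreal (1 / n) \<and> measure unit_space (\<Omega> v) = 1 / n) \<and>
    (\<forall>v\<in>V. \<Omega> v \<subseteq> {x \<in> {0..<1}. qi x = fst (cell v)}) \<and>
    (\<forall>c\<in>Cl. (\<Union>v\<in>{v\<in>V. cell v = c}. \<Omega> v) \<in> sets unit_space \<and> measure unit_space (\<Union>v\<in>{v\<in>V. cell v = c}. \<Omega> v) = w) \<and>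
    disjoint_family_on (\<lambda>c. \<Union>v\<in>{v\<in>V. cell v = c}. \<Omega> v) Cl \<and>
    (\<forall>S\<in>sets unit_space. \<forall>T\<in>sets unit_space. \<bar>rect_integral unit_space W S T -
       (\<Sum>c\<in>Cl. \<Sum>d\<in>Cl. rect_integral unit_space W (\<Union>v\<in>{v\<in>V. cell v = c}. \<Omega> v) (\<Union>v\<in>{v\<in>V. cell v = d}. \<Omega> v) / w\<^sup>2 *
          measure unit_space (S \<inter> (\<Union>v\<in>{v\<in>V. cell v = c}. \<Omega> v)) * measure unit_space (T \<inter> (\<Union>v\<in>{v\<in>V. cell v = d}. \<Omega> v)))\<bar>
      \<le> 2 * \<delta> + 2 * (1 - w * card Cl) + 2 * real (k * 4 ^ Nr) * w)"
proof -
  interpret U: prob_space unit_space by (rule prob_space_unit)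
  have W1: "\<bar>W z\<bar> \<le> 1" if "z \<in> space (unit_space \<Otimes>\<^sub>M unit_space)" for z using W(2)[OF that] by simp
  have "\<exists>c S T. (\<forall>i<Nr. S i \<in> sets unit_space \<and> T i \<in> sets unit_space) \<and>
     (\<forall>A\<in>sets unit_space. \<forall>B\<in>sets unit_space.
       \<bar>rect_integral unit_space (\<lambda>z. W z - (\<Sum>i<Nr. c i * indicator (S i \<times> T i) z)) A B\<bar> \<le> \<delta>)"
    by (rule U.weak_regularity[OF W(1) W1 \<delta>])
  then obtain cc SS TT where wr: "(\<forall>i<Nr. SS i \<in> sets unit_space \<and> TT i \<in> sets unit_space) \<and>
     (\<forall>A\<in>sets unit_space. \<forall>B\<in>sets unit_space.
       \<bar>rect_integral unit_space (\<lambda>z. W z - (\<Sum>i<Nr. cc i * indicator (SS i \<times> TT i) z)) A B\<bar> \<le> \<delta>)"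
    by (elim exE) (rule that)
  have ST: "SS i \<in> sets unit_space \<and> TT i \<in> sets unit_space" if "i < Nr" for i using conjunct1[OF wr] that by (elim allE impE)
  have cutF: "\<bar>rect_integral unit_space (\<lambda>z. W z - (\<Sum>i<Nr. cc i * indicator (SS i \<times> TT i) z)) A B\<bar> \<le> \<delta>"
    if "A \<in> sets unit_space" "B \<in> sets unit_space" for A B
    by (rule bspec[OF bspec[OF conjunct2[OF wr] that(1)] that(2)])
  define F where "F z = W z - (\<Sum>i<Nr. cc i * indicator (SS i \<times> TT i) z)" for z
  have im: "(indicator (SS i \<times> TT i) :: _ \<Rightarrow> real) \<in> borel_measurable (unit_space \<Otimes>\<^sub>M unit_space)" if "i < Nr" for i
    using ST[OF that] by (intro borel_measurable_indicator pair_measureI) auto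
  have Fm: "F \<in> borel_measurable (unit_space \<Otimes>\<^sub>M unit_space)"
    unfolding F_def by (intro borel_measurable_diff W(1) borel_measurable_sum borel_measurable_times im borel_measurable_const) auto
  have Fb: "\<bar>F z\<bar> \<le> 1 + (\<Sum>i<Nr. \<bar>cc i\<bar>)" if "z \<in> space (unit_space \<Otimes>\<^sub>M unit_space)" for z
  proof -
    have "\<bar>\<Sum>i<Nr. cc i * indicator (SS i \<times> TT i) z\<bar> \<le> (\<Sum>i<Nr. \<bar>cc i\<bar>)"
      by (rule order_trans[OF sum_abs]) (intro sum_mono, auto simp: abs_mult indicator_def)
    then show ?thesis using W1[OF that] unfolding F_def by linarith
  qed
  define B where "B b = (if b < Nr then SS b else TT (b - Nr))" for b
  have Bm: "B b \<in> sets unit_space" if "b < 2 * Nr" for b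
    using that ST[of b] ST[of "b - Nr"] unfolding B_def by (cases "b < Nr") auto
  have "\<exists>code. code \<in> unit_space \<rightarrow>\<^sub>M count_space UNIV \<and> (\<forall>x. code x < (2::nat) ^ (2 * Nr)) \<and>
    (\<forall>x y. code x = code y \<longrightarrow> (\<forall>b<2 * Nr. x \<in> B b \<longleftrightarrow> y \<in> B b))"
    by (rule membership_code[OF Bm])
  then obtain code where cd: "code \<in> unit_space \<rightarrow>\<^sub>M count_space UNIV \<and> (\<forall>x. code x < (2::nat) ^ (2 * Nr)) \<and>
    (\<forall>x y. code x = code y \<longrightarrow> (\<forall>b<2 * Nr. x \<in> B b \<longleftrightarrow> y \<in> B b))"
    by (elim exE) (rule that)
  have code: "code \<in> unit_space \<rightarrow>\<^sub>M count_space UNIV" "code x < (2::nat) ^ (2 * Nr)"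
    "x \<in> B b \<longleftrightarrow> y \<in> B b" if "code x = code y" "b < 2 * Nr" for x y b
    using cd that by blast+
  have code1: "code \<in> unit_space \<rightarrow>\<^sub>M count_space UNIV" and code2: "\<And>x. code x < (2::nat) ^ (2 * Nr)" using cd by blast+
  define P where "P = (4::nat) ^ Nr"
  have Ppos: "P > 0" by (simp add: P_def)
  have codeP: "code x < P" for x using code2[of x] by (simp add: P_def power_mult)
  \<comment> \<open>A two-digit number in base \<open>P\<close> with the class as leading digit:
    sorting makes the classes consecutive and, within each class, the atoms of the regularity
    decomposition.\<close>
  define \<sigma> where "\<sigma> x = qi x * P + code x" for x
  have \<sigma>m: "\<sigma> \<in> unit_space \<rightarrow>\<^sub>M count_space UNIV"
  proof -
    have "(\<lambda>x. qi x * P) \<in> borel_measurable unit_space" by (rule measurable_compose[OF qi(1)]) simp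
    moreover have "(\<lambda>x. code x) \<in> borel_measurable unit_space" by (rule measurable_compose[OF code1]) simp
    ultimately have "\<sigma> \<in> borel_measurable unit_space" unfolding \<sigma>_def by (rule borel_measurable_add)
    then show ?thesis by (rule measurable_nat_borel)
  qed
  have \<sigma>qi: "\<sigma> x < i * P \<longleftrightarrow> qi x < i" for x i
  proof
    assume "\<sigma> x < i * P"
    then have "qi x * P < i * P" unfolding \<sigma>_def by linarith
    then show "qi x < i" by simp
  next
    assume "qi x < i"
    then have "Suc (qi x) * P \<le> i * P" by (intro mult_le_mono1) simp
    then show "\<sigma> x < i * P" unfolding \<sigma>_def using codeP[of x] by simp
  qed
  have \<sigma>R: "\<sigma> x < k * P" if "x \<in> {0..<1}" for x using \<sigma>qi qi(2)[OF that] by simp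
  have \<sigma>eq: "qi x = qi y" "code x = code y" if "\<sigma> x = \<sigma> y" for x y
  proof -
    have "\<sigma> x div P = qi x" "\<sigma> x mod P = code x" for x unfolding \<sigma>_def using codeP[of x] by simp_all
    then show "qi x = qi y" "code x = code y" using that by metis+
  qed
  define \<beta> where "\<beta> b = measure unit_space {x \<in> {0..<1}. \<sigma> x < b}" for b
  obtain H where H: "H \<in> borel_measurable unit_space" "\<And>x. 0 \<le> H x \<and> H x \<le> 1"
    "\<And>S. S \<in> sets borel \<Longrightarrow> emeasure unit_space {x \<in> {0..<1}. H x \<in> S} = emeasure lborel (S \<inter> {0<..<1})"
    "\<And>x. x \<in> {0..<1} \<Longrightarrow> \<beta> (\<sigma> x) \<le> H x \<and> H x \<le> \<beta> (Suc (\<sigma> x))"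
    using sort_map[OF \<sigma>m] unfolding \<beta>_def by blast
  have \<sigma>set: "{x \<in> {0..<1}. Pd (\<sigma> x)} \<in> sets unit_space" for Pd
    using measurable_sets[OF \<sigma>m, of "Collect Pd"] by (simp add: vimage_def Int_def conj_commute)
  have \<beta>mono: "\<beta> b \<le> \<beta> b'" if "b \<le> b'" for b b'
    unfolding \<beta>_def by (rule U.finite_measure_mono[OF _ \<sigma>set]) (use that in auto)
  have \<beta>A: "\<beta> (i * P) = (\<Sum>i'<i. a i')" if "i \<le> k" for i
  proof -
    have qs: "{x \<in> {0..<1}. qi x = i'} \<in> sets unit_space" for i'
      using measurable_sets[OF qi(1), of "{i'}"] by (simp add: vimage_def Int_def conj_commute)
    have "{x \<in> {0..<1}. \<sigma> x < i * P} = (\<Union>i'<i. {x \<in> {0..<1}. qi x = i'})" unfolding \<sigma>qi by auto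
    then have "\<beta> (i * P) = measure unit_space (\<Union>i'<i. {x \<in> {0..<1}. qi x = i'})" unfolding \<beta>_def by simp
    also have "\<dots> = (\<Sum>i'<i. measure unit_space {x \<in> {0..<1}. qi x = i'})"
      by (rule U.finite_measure_finite_Union) (use qs in \<open>auto simp: disjoint_family_on_def\<close>)
    also have "\<dots> = (\<Sum>i'<i. a i')" using qi(3) that by (intro sum.cong) auto
    finally show ?thesis .
  qed
  define \<Omega> where "\<Omega> = sorted_block H n"
  note sb = sorted_block[OF n H(1-3), folded \<Omega>_def]
  have Hv: "(real v - 1) / n \<le> H x" "H x < real v / n" if "v \<in> V" "x \<in> \<Omega> v" for v x
    using that V(1) unfolding \<Omega>_def sorted_block_def vertex_part_def by (auto split: if_splits)
  have x01: "x \<in> {0..<1}" if "x \<in> \<Omega> v" for x v using that sb(2) by blast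
  have \<Omega>q: "qi x = fst (cell v)" if v: "v \<in> V" "x \<in> \<Omega> v" for v x
  proof -
    let ?i = "fst (cell v)"
    have ik: "?i < k" using V(2)[OF v(1)] Cl(2) by blast
    have b1: "\<beta> (?i * P) < H x" using V(4)[OF v(1)] Hv(1)[OF v] \<beta>A[of ?i] ik by simp
    have b2: "H x < \<beta> (Suc ?i * P)" using V(4)[OF v(1)] Hv(2)[OF v] \<beta>A[of "Suc ?i"] ik by (simp del: sum.lessThan_Suc)
    have "\<not> qi x < ?i"
    proof
      assume "qi x < ?i"
      then have "Suc (\<sigma> x) \<le> ?i * P" using \<sigma>qi[of x ?i] by simp
      then have "\<beta> (Suc (\<sigma> x)) \<le> \<beta> (?i * P)" by (rule \<beta>mono)
      then show False using H(4)[OF x01[OF v(2)]] b1 by linarith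
    qed
    moreover have "\<not> Suc ?i \<le> qi x"
    proof
      assume "Suc ?i \<le> qi x"
      then have "Suc ?i * P \<le> \<sigma> x" using \<sigma>qi[of x "Suc ?i"] by linarith
      then have "\<beta> (Suc ?i * P) \<le> \<beta> (\<sigma> x)" by (rule \<beta>mono)
      then show False using H(4)[OF x01[OF v(2)]] b2 by linarith
    qed
    ultimately show ?thesis by linarith
  qed
  have finV: "finite V" using V(1) finite_subset by blast
  define C where "C c = (\<Union>v\<in>{v\<in>V. cell v = c}. \<Omega> v)" for c
  have V1n: "v \<in> {1..n}" if "v \<in> V" for v using V(1) that by auto
  have dV: "disjoint_family_on \<Omega> {v\<in>V. cell v = c}" for c
    using sb(5) V1n unfolding disjoint_family_on_def by blast
  have Cm: "C c \<in> sets unit_space" for c unfolding C_def using finV sb(1) by (intro sets.finite_UN) auto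
  have Cw: "measure unit_space (C c) = w" if "c \<in> Cl" for c
  proof -
    have "measure unit_space (C c) = (\<Sum>v\<in>{v\<in>V. cell v = c}. measure unit_space (\<Omega> v))"
      unfolding C_def by (rule U.finite_measure_finite_Union) (use finV sb(1) dV in auto)
    also have "\<dots> = (\<Sum>v\<in>{v\<in>V. cell v = c}. 1 / n)" using sb(7) V1n by (intro sum.cong) auto
    also have "\<dots> = w" using V(3)[OF that] by (auto simp: w)
    finally show ?thesis .
  qed
  have Cd: "disjoint_family_on C Cl" unfolding disjoint_family_on_def
  proof (intro ballI impI)
    fix c d assume cd: "c \<in> Cl" "d \<in> Cl" "c \<noteq> d"
    show "C c \<inter> C d = {}"
    proof (rule ccontr)
      assume "C c \<inter> C d \<noteq> {}"
      then obtain x where x: "x \<in> C c" "x \<in> C d" by blast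
      obtain u where u: "u \<in> {v \<in> V. cell v = c}" "x \<in> \<Omega> u" using x(1) unfolding C_def by blast
      obtain v where v: "v \<in> {v \<in> V. cell v = d}" "x \<in> \<Omega> v" using x(2) unfolding C_def by blast
      have uv: "u \<in> {1..n}" "v \<in> {1..n}" "u \<noteq> v" using u(1) v(1) V1n cd(3) by blast+
      have "\<Omega> u \<inter> \<Omega> v = {}" using sb(5) uv unfolding disjoint_family_on_def by blast
      then show False using u(2) v(2) by blast
    qed
  qed
  have wpos: "0 < w"
  proof -
    have "0 < real L / real n" using L n by simp
    then show ?thesis using w by simp
  qed
  define Pr where "Pr = {c \<in> Cl. \<forall>x\<in>C c. \<forall>y\<in>C c. \<sigma> x = \<sigma> y}"
  \<comment> \<open>A cell on which \<open>\<sigma>\<close> is not constant contains points on both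
    sides of some threshold \<open>\<beta> b\<close>, weakly speaking.\<close>
  have "\<exists>b<k * P. \<exists>x\<in>C c. \<exists>y\<in>C c. H x \<le> \<beta> b \<and> \<beta> b \<le> H y" if c: "c \<in> Cl - Pr" for c
  proof -
    obtain x y where xy: "x \<in> C c" "y \<in> C c" "\<sigma> x \<noteq> \<sigma> y" using c unfolding Pr_def by blast
    have sp: "z \<in> {0..<1}" if "z \<in> C c" for z using that x01 unfolding C_def by blast
    have *: "H x \<le> \<beta> (\<sigma> y) \<and> \<beta> (\<sigma> y) \<le> H y" if "x \<in> C c" "y \<in> C c" "\<sigma> x < \<sigma> y" for x y
    proof -
      have "\<beta> (Suc (\<sigma> x)) \<le> \<beta> (\<sigma> y)" using that(3) by (intro \<beta>mono) simp
      then show ?thesis using H(4)[OF sp[OF that(1)]] H(4)[OF sp[OF that(2)]] by linarith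
    qed
    show ?thesis
    proof (cases "\<sigma> x < \<sigma> y")
      case True
      then show ?thesis using *[OF xy(1,2)] \<sigma>R[OF sp[OF xy(2)]] xy by blast
    next
      case False
      then have "\<sigma> y < \<sigma> x" using xy(3) by simp
      then show ?thesis using *[OF xy(2,1)] \<sigma>R[OF sp[OF xy(1)]] xy by blast
    qed
  qed
  then obtain bf where bf: "\<And>c. c \<in> Cl - Pr \<Longrightarrow> bf c < k * P \<and> (\<exists>x\<in>C c. \<exists>y\<in>C c. H x \<le> \<beta> (bf c) \<and> \<beta> (bf c) \<le> H y)" by metis
  have rng: "\<exists>p. {v \<in> V. cell v = c} = {p<..p + L} \<and> real p / n \<le> \<beta> (bf c) \<and> \<beta> (bf c) < real (p + L) / n" if c: "c \<in> Cl - Pr" for c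
  proof -
    obtain p where p: "{v \<in> V. cell v = c} = {p<..p + L}" using V(3) c by blast
    obtain x y where xy: "x \<in> C c" "y \<in> C c" "H x \<le> \<beta> (bf c)" "\<beta> (bf c) \<le> H y" using bf[OF c] by blast
    obtain u where u: "u \<in> {v \<in> V. cell v = c}" "x \<in> \<Omega> u" using xy(1) unfolding C_def by blast
    obtain v where v: "v \<in> {v \<in> V. cell v = c}" "y \<in> \<Omega> v" using xy(2) unfolding C_def by blast
    have uV: "u \<in> V" "v \<in> V" using u v by auto
    have pu: "p < u" "v \<le> p + L" using u(1) v(1) unfolding p by auto
    have "real p \<le> real u - 1" using pu(1) by linarith
    then have "real p / n \<le> (real u - 1) / n" by (intro divide_right_mono) auto
    then have 1: "real p / n \<le> \<beta> (bf c)" using Hv(1)[OF uV(1) u(2)] xy(3) by linarith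
    have "real v / n \<le> real (p + L) / n" using pu(2) by (intro divide_right_mono of_nat_mono) auto
    then have 2: "\<beta> (bf c) < real (p + L) / n" using Hv(2)[OF uV(2) v(2)] xy(4) by linarith
    show ?thesis using p 1 2 by blast
  qed
  \<comment> \<open>Distinct cells occupy disjoint runs of vertices, so a threshold crosses at most
    one of them. The impure cells are thus no more numerous than the thresholds, however many cells
    there are.\<close>
  have inj: "inj_on bf (Cl - Pr)"
  proof (rule inj_onI)
    fix c d assume cd: "c \<in> Cl - Pr" "d \<in> Cl - Pr" "bf c = bf d"
    obtain p where p: "{v \<in> V. cell v = c} = {p<..p + L}" "real p / n \<le> \<beta> (bf c)" "\<beta> (bf c) < real (p + L) / n" using rng[OF cd(1)] by blast
    obtain q where q: "{v \<in> V. cell v = d} = {q<..q + L}" "real q / n \<le> \<beta> (bf d)" "\<beta> (bf d) < real (q + L) / n" using rng[OF cd(2)] by blast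
    have "real p / n < real (q + L) / n" using p(2) q(3) unfolding cd(3) by linarith
    then have "p < q + L" using n by (simp add: divide_less_cancel)
    moreover have "real q / n < real (p + L) / n" using q(2) p(3) unfolding cd(3) by linarith
    then have "q < p + L" using n by (simp add: divide_less_cancel)
    ultimately have "max p q + 1 \<in> {p<..p + L}" "max p q + 1 \<in> {q<..q + L}" by auto
    then have "cell (max p q + 1) = c" "cell (max p q + 1) = d" using p(1) q(1) by auto
    then show "c = d" by simp
  qed
  have cR: "card (Cl - Pr) \<le> k * 4 ^ Nr"
  proof -
    have "bf ` (Cl - Pr) \<subseteq> {..<k * P}" using bf by auto
    then have "card (Cl - Pr) \<le> card {..<k * P}" by (intro card_inj_on_le[OF inj]) auto
    then show ?thesis by (simp add: P_def)
  qed
  define aa where "aa c d = (\<Sum>i<Nr. cc i * indicator (SS i \<times> TT i) ((SOME x. x \<in> C c), (SOME y. y \<in> C d)))" for c d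
  have const: "W (x, y) - F (x, y) = aa c d" if "c \<in> Pr" "d \<in> Pr" "x \<in> C c" "y \<in> C d" for c d x y
  proof -
    let ?x = "SOME x. x \<in> C c" and ?y = "SOME y. y \<in> C d"
    have "?x \<in> C c" "?y \<in> C d" using that(3,4) by (auto intro: someI)
    then have "\<sigma> x = \<sigma> ?x" "\<sigma> y = \<sigma> ?y" using that unfolding Pr_def by blast+
    then have cxy: "code x = code ?x" "code y = code ?y" using \<sigma>eq(2) by blast+
    have "x \<in> SS i \<longleftrightarrow> ?x \<in> SS i" "y \<in> TT i \<longleftrightarrow> ?y \<in> TT i" if "i < Nr" for i
      using code(3)[OF cxy(1), of i] code(3)[OF cxy(2), of "Nr + i"] that unfolding B_def by auto
    then have "(\<Sum>i<Nr. cc i * indicator (SS i \<times> TT i) (x, y)) = aa c d"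
      unfolding aa_def by (intro sum.cong refl) (auto simp: indicator_def)
    then show ?thesis unfolding F_def by simp
  qed
  have main: "\<bar>rect_integral unit_space W S T - (\<Sum>c\<in>Cl. \<Sum>d\<in>Cl. rect_integral unit_space W (C c) (C d) / w\<^sup>2 * measure unit_space (S \<inter> C c) * measure unit_space (T \<inter> C d))\<bar>
     \<le> 2 * \<delta> + 2 * (1 - w * card Cl) + 2 * real (k * 4 ^ Nr) * w" if "S \<in> sets unit_space" "T \<in> sets unit_space" for S T
  proof (rule U.cell_average_cut[OF W Fm Fb _ Cl(1) Cd Cm Cw wpos _ cR const refl that])
    show "\<bar>rect_integral unit_space F S T\<bar> \<le> \<delta>" if "S \<in> sets unit_space" "T \<in> sets unit_space" for S T
      using cutF[OF that] unfolding F_def[abs_def] .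
    show "Pr \<subseteq> Cl" unfolding Pr_def by auto
  qed
  have q: "\<Omega> v \<subseteq> {x \<in> {0..<1}. qi x = fst (cell v)}" if "v \<in> V" for v
    using \<Omega>q[OF that] x01 by blast
  show ?thesis
    by (rule exI[of _ \<Omega>], intro conjI allI ballI)
       (use sb q main[unfolded C_def] Cm[unfolded C_def] Cw[unfolded C_def] Cd[unfolded C_def[abs_def]] in \<open>simp_all del: UN_simps\<close>)
qed

section \<open>Graphs close to a nearly regular graphon\<close>

text \<open>Deviations are measured in mean, since finitely many classes can match the degrees only
  approximately when the quotient is infinite. The expected degree into class \<open>j\<close> is
  written as density times size, so null classes are harmless.\<close>

definition near_regular ::
    "'a measure \<Rightarrow> ('a \<times> 'a \<Rightarrow> real) \<Rightarrow> ('a \<Rightarrow> nat) \<Rightarrow> nat \<Rightarrow> (nat \<Rightarrow> real) \<Rightarrow> (nat \<Rightarrow> nat \<Rightarrow> real) \<Rightarrow> real \<Rightarrow> bool" where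
  "near_regular M W q k a s \<eta> \<longleftrightarrow>
     W \<in> borel_measurable (M \<Otimes>\<^sub>M M) \<and>
     (\<forall>x\<in>space M. \<forall>y\<in>space M. W (x, y) = W (y, x) \<and> 0 \<le> W (x, y) \<and> W (x, y) \<le> 1) \<and>
     q \<in> M \<rightarrow>\<^sub>M count_space UNIV \<and> (\<forall>x\<in>space M. q x < k) \<and>
     (\<forall>i<k. measure M {x \<in> space M. q x = i} = a i) \<and>
     (\<Sum>i<k. \<Sum>j<k. \<integral>x. indicator {x \<in> space M. q x = i} x *
        \<bar>(\<integral>y. indicator {x \<in> space M. q x = j} y * W (x, y) \<partial>M) - s i j * a j\<bar> \<partial>M) \<le> \<eta>"

lemma round_down:
  fixes x :: real
  assumes "N > 0" "0 \<le> x" "x \<le> 1"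
  shows "0 \<le> \<lfloor>real N * x\<rfloor> / real N" "\<lfloor>real N * x\<rfloor> / real N \<le> 1" "real N * (\<lfloor>real N * x\<rfloor> / real N) \<in> \<int>"
    "\<bar>\<lfloor>real N * x\<rfloor> / real N - x\<bar> \<le> 1 / real N"
proof -
  have 0: "0 \<le> real N * x" "real N * x \<le> real N" using assms by (auto simp: mult_left_le)
  then show "0 \<le> \<lfloor>real N * x\<rfloor> / real N" by simp
  have "real_of_int \<lfloor>real N * x\<rfloor> \<le> real N" using 0 by linarith
  then show "\<lfloor>real N * x\<rfloor> / real N \<le> 1" using assms(1) by simp
  show "real N * (\<lfloor>real N * x\<rfloor> / real N) \<in> \<int>" using assms(1) by simp
  have "\<bar>real_of_int \<lfloor>real N * x\<rfloor> - real N * x\<bar> \<le> 1" by linarith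
  then have "\<bar>real_of_int \<lfloor>real N * x\<rfloor> - real N * x\<bar> / real N \<le> 1 / real N" by (intro divide_right_mono) auto
  moreover have "\<lfloor>real N * x\<rfloor> / real N - x = (real_of_int \<lfloor>real N * x\<rfloor> - real N * x) / real N"
    using assms(1) by (simp add: field_simps)
  ultimately show "\<bar>\<lfloor>real N * x\<rfloor> / real N - x\<bar> \<le> 1 / real N" by simp
qed

text \<open>The graph depends on \<open>W\<close>, but its degrees between classes are
  \<open>L * t * m\<close>, where \<open>t\<close> is computed from the rounded densities only; this
  is why different graphons receive fractionally isomorphic graphs. The error
  \<open>12 * \<delta>\<close> is made of \<open>6 * \<delta>\<close> for averaging over cells,
  \<open>4 * \<delta>\<close> for rounding and correcting the matrix, and
  \<open>2 * \<delta>\<close> for replacing densities by edges.\<close>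

lemma discretize:
  fixes W :: "real \<times> real \<Rightarrow> real" and qi :: "real \<Rightarrow> nat" and a :: "nat \<Rightarrow> real" and s t :: "nat \<Rightarrow> nat \<Rightarrow> real"
    and m :: "nat \<Rightarrow> nat" and k n L K E T sz h N M Nr :: nat and \<delta> \<eta> lam th w :: real and cell :: "nat \<Rightarrow> nat \<times> nat"
  assumes NR: "near_regular unit_space W qi k a s \<eta>" and a1: "(\<Sum>i<k. a i) = 1"
    and s: "\<And>i j. i < k \<Longrightarrow> j < k \<Longrightarrow> 0 \<le> s i j \<and> s i j \<le> 1 \<and> s i j = s j i"
    and Cl: "Cl = (SIGMA i:{..<k}. {..<m i})" and mM: "\<And>i. i < k \<Longrightarrow> m i \<le> M"
    and V: "V \<subseteq> {1..<n}" "\<And>v. v \<in> V \<Longrightarrow> cell v \<in> Cl" "\<And>c. c \<in> Cl \<Longrightarrow> \<exists>p. {v \<in> V. cell v = c} = {p<..p + L}"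
      "\<And>v. v \<in> V \<Longrightarrow> (\<Sum>i<fst (cell v). a i) < (real v - 1) / n \<and> real v / n \<le> (\<Sum>i<Suc (fst (cell v)). a i)"
    and pos: "n > 0" "h > 0" "N > 0" "K > 0" "sz > 0"
    and E: "E = 4 * h" and T: "T = 4 * h * N * (fact M)\<^sup>2 * (4 * h - 1)" and L: "L = E * K * T ^ (K + 1) * sz"
    and lam: "lam = 1 / real h" and th: "th = 1 / (24 * real h)"
    and t: "\<And>i j. t i j = (1 - lam) * (\<lfloor>real N * s i j\<rfloor> / real N) + lam / 2"
    and w: "w = real L / n"
    and num: "\<delta> > 0" "real Nr * \<delta>\<^sup>2 > 1" "lam \<le> \<delta>" "1 / real N \<le> \<delta>" "1 / sqrt K \<le> \<delta>" "w \<le> \<delta>"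
      "real (k * 4 ^ Nr) * w \<le> \<delta>" "1 - w * card Cl \<le> \<delta>"
      "2 * (\<eta> + (1 - w * card Cl) + 2 / real N) / th\<^sup>2 \<le> \<delta>"
  shows "\<exists>G g g'. (\<forall>e\<in>G. e \<subseteq> V \<and> card e = 2) \<and>
    (\<forall>u\<in>V. \<forall>j<k. real (card {v \<in> V. fst (cell v) = j \<and> {u, v} \<in> G}) = real L * (t (fst (cell u)) j * m j)) \<and>
    mp_iso unit_space unit_space g g' \<and>
    (\<forall>S\<in>sets unit_space. \<forall>S'\<in>sets unit_space.
       \<bar>rect_integral unit_space (pull_back W g) S S' - rect_integral unit_space (kernel (graph_representation n G)) S S'\<bar> \<le> 12 * \<delta>)"
proof -
  interpret U: prob_space unit_space by (rule prob_space_unit)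
  have Wm: "W \<in> borel_measurable (unit_space \<Otimes>\<^sub>M unit_space)" using NR unfolding near_regular_def by blast
  have W01: "0 \<le> W z \<and> W z \<le> 1" if "z \<in> space (unit_space \<Otimes>\<^sub>M unit_space)" for z
    using NR that unfolding near_regular_def by (cases z) (auto simp: space_pair_measure)
  have Wsym: "W (x, y) = W (y, x)" if "x \<in> space unit_space" "y \<in> space unit_space" for x y
    using NR that unfolding near_regular_def by blast
  have W1: "\<bar>W z\<bar> \<le> 1" if "z \<in> space (unit_space \<Otimes>\<^sub>M unit_space)" for z using W01[OF that] by simp
  have qm: "qi \<in> unit_space \<rightarrow>\<^sub>M count_space UNIV" and qk: "\<And>x. x \<in> {0..<1} \<Longrightarrow> qi x < k"
    and qa: "\<And>i. i < k \<Longrightarrow> measure unit_space {x \<in> {0..<1}. qi x = i} = a i"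
    and nr: "(\<Sum>i<k. \<Sum>j<k. \<integral>x. indicator {x \<in> {0..<1}. qi x = i} x *
        \<bar>(\<integral>y. indicator {x \<in> {0..<1}. qi x = j} y * W (x, y) \<partial>unit_space) - s i j * a j\<bar> \<partial>unit_space) \<le> \<eta>"
    using NR unfolding near_regular_def by simp_all
  have Tpos: "T > 0" unfolding T using pos by simp
  have Lpos: "L > 0" unfolding L E using pos Tpos by simp
  have wpos: "w > 0" unfolding w using Lpos pos by simp
  have finCl: "finite Cl" and Clk: "\<And>c. c \<in> Cl \<Longrightarrow> fst c < k" unfolding Cl by auto
  have finV: "finite V" using V(1) finite_subset by blast
  have V1n: "v \<in> {1..n}" if "v \<in> V" for v using V(1) that by auto
  define C where "C \<Omega> c = (\<Union>v\<in>{v\<in>V. cell v = c}. \<Omega> v)" for \<Omega> :: "nat \<Rightarrow> real set" and c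
  define P where "P \<Omega> \<longleftrightarrow> (\<forall>v. \<Omega> v \<in> sets borel \<and> \<Omega> v \<in> sets unit_space \<and> \<Omega> v \<subseteq> {0..<1}) \<and>
    (\<Union>v\<in>{1..n}. \<Omega> v) = {0..<1} \<and> disjoint_family_on \<Omega> {1..n} \<and>
    (\<forall>v\<in>{1..n}. emeasure lborel (\<Omega> v) = ennreal (1 / n) \<and> measure unit_space (\<Omega> v) = 1 / n) \<and>
    (\<forall>v\<in>V. \<Omega> v \<subseteq> {x \<in> {0..<1}. qi x = fst (cell v)}) \<and>
    (\<forall>c\<in>Cl. C \<Omega> c \<in> sets unit_space \<and> measure unit_space (C \<Omega> c) = w) \<and>
    disjoint_family_on (C \<Omega>) Cl \<and>
    (\<forall>S\<in>sets unit_space. \<forall>S'\<in>sets unit_space. \<bar>rect_integral unit_space W S S' -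
       (\<Sum>c\<in>Cl. \<Sum>d\<in>Cl. rect_integral unit_space W (C \<Omega> c) (C \<Omega> d) / w\<^sup>2 * measure unit_space (S \<inter> C \<Omega> c) * measure unit_space (S' \<inter> C \<Omega> d))\<bar>
      \<le> 2 * \<delta> + 2 * (1 - w * card Cl) + 2 * real (k * 4 ^ Nr) * w)" for \<Omega>
  have "\<exists>\<Omega>. P \<Omega>"
    unfolding P_def C_def[abs_def] by (rule regular_cells[OF Wm W01 qm qk qa pos(1) Lpos V finCl Clk num(1,2) w])
  then obtain \<Omega> where "P \<Omega>" ..
  note p1 = this[unfolded P_def]
  note p2 = conjunct2[OF p1] note p3 = conjunct2[OF p2] note p4 = conjunct2[OF p3] note p5 = conjunct2[OF p4]
  note p6 = conjunct2[OF p5] note p7 = conjunct2[OF p6] note p8 = conjunct2[OF p7]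
  have \<Omega>1: "\<Omega> v \<in> sets borel" "\<Omega> v \<in> sets unit_space" "\<Omega> v \<subseteq> {0..<1}" for v using conjunct1[OF p1] by simp_all
  have \<Omega>2a: "\<And>v. v \<in> {1..n} \<Longrightarrow> emeasure lborel (\<Omega> v) = ennreal (1 / n)" "\<And>v. v \<in> {1..n} \<Longrightarrow> measure unit_space (\<Omega> v) = 1 / n"
    using conjunct1[OF p4] by blast+
  note \<Omega>2 = conjunct1[OF p2] conjunct1[OF p3] \<Omega>2a
  have \<Omega>q: "\<Omega> v \<subseteq> {x \<in> {0..<1}. qi x = fst (cell v)}" if "v \<in> V" for v using conjunct1[OF p5] that by (rule bspec)
  have Cm: "C \<Omega> c \<in> sets unit_space" and Cw: "measure unit_space (C \<Omega> c) = w" if "c \<in> Cl" for c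
    using bspec[OF conjunct1[OF p6] that] by auto
  note Cd = conjunct1[OF p7]
  have cut: "\<bar>rect_integral unit_space W S S' -
       (\<Sum>c\<in>Cl. \<Sum>d\<in>Cl. rect_integral unit_space W (C \<Omega> c) (C \<Omega> d) / w\<^sup>2 * measure unit_space (S \<inter> C \<Omega> c) * measure unit_space (S' \<inter> C \<Omega> d))\<bar>
      \<le> 2 * \<delta> + 2 * (1 - w * card Cl) + 2 * real (k * 4 ^ Nr) * w" if "S \<in> sets unit_space" "S' \<in> sets unit_space" for S S'
    by (rule bspec[OF bspec[OF p8 that(1)] that(2)])
  obtain g g' where g: "mp_iso unit_space unit_space g g'" and g\<Omega>: "\<And>v x. v \<in> {1..n} \<Longrightarrow> x \<in> vertex_part n v \<Longrightarrow> g x \<in> \<Omega> v"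
    using mp_iso_glue[OF pos(1) \<Omega>1(1,3) \<Omega>2(1,2) \<Omega>2a(1)] by auto
  define X0 where "X0 c d = rect_integral unit_space W (C \<Omega> c) (C \<Omega> d) / w\<^sup>2" for c d
  have X001: "0 \<le> X0 c d" "X0 c d \<le> 1" if "c \<in> Cl" "d \<in> Cl" for c d
  proof -
    have "0 \<le> rect_integral unit_space W (C \<Omega> c) (C \<Omega> d)"
      by (rule U.rect_integral_unit_range(1)[OF Wm W01 Cm[OF that(1)] Cm[OF that(2)]])
    moreover have "rect_integral unit_space W (C \<Omega> c) (C \<Omega> d) \<le> measure unit_space (C \<Omega> c) * measure unit_space (C \<Omega> d)"
      by (rule U.rect_integral_unit_range(2)[OF Wm W01 Cm[OF that(1)] Cm[OF that(2)]])
    ultimately show "0 \<le> X0 c d" "X0 c d \<le> 1" unfolding X0_def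
      using Cw[OF that(1)] Cw[OF that(2)] wpos by (auto simp: power2_eq_square)
  qed
  have X0sym: "X0 c d = X0 d c" if "c \<in> Cl" "d \<in> Cl" for c d
  proof -
    have "rect_integral unit_space W (C \<Omega> c) (C \<Omega> d) = rect_integral unit_space W (C \<Omega> d) (C \<Omega> c)"
      by (rule U.rect_integral_swap[OF Wm Cm[OF that(1)] Cm[OF that(2)] Wsym])
    then show ?thesis by (simp add: X0_def)
  qed
  \<comment> \<open>Rounding to multiples of \<open>1 / N\<close> provides the common denominator;
    it enters the degree error through both \<open>X\<close> and \<open>s'\<close>, whence the term
    \<open>2 / N\<close>.\<close>
  define X where "X c d = real_of_int \<lfloor>real N * X0 c d\<rfloor> / real N" for c d
  define s' where "s' i j = real_of_int \<lfloor>real N * s i j\<rfloor> / real N" for i j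
  have Xr: "0 \<le> X c d" "X c d \<le> 1" "real N * X c d \<in> \<int>" "\<bar>X c d - X0 c d\<bar> \<le> 1 / real N" if "c \<in> Cl" "d \<in> Cl" for c d
    unfolding X_def by (rule round_down[OF pos(3) X001[OF that]])+
  have s'r: "0 \<le> s' i j" "s' i j \<le> 1" "real N * s' i j \<in> \<int>" "\<bar>s' i j - s i j\<bar> \<le> 1 / real N" if "i < k" "j < k" for i j
    using round_down[OF pos(3), of "s i j"] s[OF that] unfolding s'_def by auto
  define err0 where "err0 = (\<Sum>c\<in>Cl. \<Sum>j<k. \<bar>(\<Sum>l<m j. X0 c (j, l)) - s (fst c) j * m j\<bar>)"
  define err where "err = (\<Sum>c\<in>Cl. \<Sum>j<k. \<bar>(\<Sum>l<m j. X c (j, l)) - s' (fst c) j * m j\<bar>)"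
  have wC: "0 \<le> w * card Cl" "w * card Cl \<le> 1"
  proof -
    have "measure unit_space (\<Union>c\<in>Cl. C \<Omega> c) = (\<Sum>c\<in>Cl. measure unit_space (C \<Omega> c))"
      by (rule U.finite_measure_finite_Union[OF finCl]) (use Cm Cd in auto)
    also have "\<dots> = w * card Cl" using Cw by simp
    finally show "w * card Cl \<le> 1" using U.prob_le_1 by metis
  qed (use wpos in simp)
  have wC2: "w\<^sup>2 * (real (card Cl))\<^sup>2 \<le> 1"
    using power_mono[OF wC(2,1), of 2] by (simp add: power_mult_distrib)
  have e0: "w\<^sup>2 * err0 \<le> \<eta> + (1 - w * card Cl)"
    unfolding err0_def
  proof (rule U.degree_error[OF Wm W01 Cl Cd Cm Cw wpos _ qa _ a1 _ X0_def nr])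
    show "{x \<in> {0..<1}. qi x = i} \<in> sets unit_space" for i
      using measurable_sets[OF qm, of "{i}"] by (simp add: vimage_def Int_def conj_commute)
    show "C \<Omega> c \<subseteq> {x \<in> {0..<1}. qi x = fst c}" for c unfolding C_def using \<Omega>q by blast
    show "0 \<le> s i j \<and> s i j \<le> 1" if "i < k" "j < k" for i j using s[OF that] by blast
  qed
  have mCl: "(\<Sum>j<k. real (m j)) = real (card Cl)" unfolding Cl by simp
  have "err \<le> (\<Sum>c\<in>Cl. \<Sum>j<k. \<bar>(\<Sum>l<m j. X0 c (j, l)) - s (fst c) j * m j\<bar> + 2 / real N * m j)"
    unfolding err_def
  proof (intro sum_mono)
    fix c j assume cj: "c \<in> Cl" "j \<in> {..<k}"
    have "\<bar>(\<Sum>l<m j. X c (j, l)) - (\<Sum>l<m j. X0 c (j, l))\<bar> \<le> (\<Sum>l<m j. \<bar>X c (j, l) - X0 c (j, l)\<bar>)"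
      unfolding sum_subtractf[symmetric] by (rule sum_abs)
    also have "\<dots> \<le> (\<Sum>l<m j. 1 / real N)" 
    proof (rule sum_mono)
      fix l assume "l \<in> {..<m j}"
      then have "(j, l) \<in> Cl" using cj(2) by (simp add: Cl)
      then show "\<bar>X c (j, l) - X0 c (j, l)\<bar> \<le> 1 / real N" by (rule Xr(4)[OF cj(1)])
    qed
    finally have 1: "\<bar>(\<Sum>l<m j. X c (j, l)) - (\<Sum>l<m j. X0 c (j, l))\<bar> \<le> 1 / real N * m j" by simp
    have "\<bar>s' (fst c) j - s (fst c) j\<bar> * m j \<le> 1 / real N * m j"
      using s'r(4)[OF Clk[OF cj(1)], of j] cj(2) by (intro mult_right_mono) auto
    then have 2: "\<bar>s' (fst c) j * m j - s (fst c) j * m j\<bar> \<le> 1 / real N * m j"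
      by (simp add: abs_mult flip: left_diff_distrib)
    show "\<bar>(\<Sum>l<m j. X c (j, l)) - s' (fst c) j * m j\<bar> \<le> \<bar>(\<Sum>l<m j. X0 c (j, l)) - s (fst c) j * m j\<bar> + 2 / real N * m j"
    proof -
      have "2 / real N * m j = 1 / real N * m j + 1 / real N * m j" by (simp add: field_simps)
      then show ?thesis using 1 2 by linarith
    qed
  qed
  also have "\<dots> = err0 + 2 / real N * (real (card Cl))\<^sup>2"
    unfolding err0_def sum.distrib sum_distrib_left[symmetric] mCl by (simp add: power2_eq_square)
  finally have "w\<^sup>2 * err \<le> w\<^sup>2 * (err0 + 2 / real N * (real (card Cl))\<^sup>2)" by (intro mult_left_mono) auto
  also have "\<dots> = w\<^sup>2 * err0 + 2 / real N * (w\<^sup>2 * (real (card Cl))\<^sup>2)" by (simp add: algebra_simps)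
  also have "\<dots> \<le> (\<eta> + (1 - w * card Cl)) + 2 / real N * 1"
    by (rule add_mono[OF e0 mult_left_mono[OF wC2]]) simp
  finally have werr: "w\<^sup>2 * err \<le> \<eta> + (1 - w * card Cl) + 2 / real N" by simp
  have "\<exists>Y. (\<forall>c\<in>Cl. \<forall>d\<in>Cl. Y c d = Y d c \<and> 0 \<le> Y c d \<and> Y c d \<le> 1 - lam / 4 \<and> real (4 * h * N * (fact M)\<^sup>2) * Y c d \<in> \<int>) \<and>
    (\<forall>c\<in>Cl. \<forall>j<k. (\<Sum>l<m j. Y c (j, l)) = t (fst c) j * m j) \<and>
    (\<Sum>c\<in>Cl. \<Sum>d\<in>Cl. \<bar>X c d - Y c d\<bar>) \<le> 2 * lam * (real (card Cl))\<^sup>2 + 2 * err / th\<^sup>2"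
  proof (rule matrix_regularize[OF Cl pos(3,2) mM _ _ err_def lam th])
    show "0 \<le> X c d \<and> X c d \<le> 1 \<and> real N * X c d \<in> \<int> \<and> X c d = X d c" if "c \<in> Cl" "d \<in> Cl" for c d
      using Xr[OF that] X0sym[OF that] by (simp add: X_def)
    show "0 \<le> s' i j \<and> s' i j \<le> 1 \<and> real N * s' i j \<in> \<int> \<and> s' i j = s' j i" if "i < k" "j < k" for i j
      using s'r[OF that] s[OF that] by (simp add: s'_def)
    show "t i j = (1 - lam) * s' i j + lam / 2" for i j unfolding t s'_def ..
  qed
  then obtain Y where y1: "(\<forall>c\<in>Cl. \<forall>d\<in>Cl. Y c d = Y d c \<and> 0 \<le> Y c d \<and> Y c d \<le> 1 - lam / 4 \<and> real (4 * h * N * (fact M)\<^sup>2) * Y c d \<in> \<int>) \<and>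
    (\<forall>c\<in>Cl. \<forall>j<k. (\<Sum>l<m j. Y c (j, l)) = t (fst c) j * m j) \<and>
    (\<Sum>c\<in>Cl. \<Sum>d\<in>Cl. \<bar>X c d - Y c d\<bar>) \<le> 2 * lam * (real (card Cl))\<^sup>2 + 2 * err / th\<^sup>2" ..
  note y2 = conjunct2[OF y1]
  have Y: "Y c d = Y d c \<and> 0 \<le> Y c d \<and> Y c d \<le> 1 - lam / 4 \<and> real (4 * h * N * (fact M)\<^sup>2) * Y c d \<in> \<int>" if "c \<in> Cl" "d \<in> Cl" for c d
    by (rule bspec[OF bspec[OF conjunct1[OF y1] that(1)] that(2)])
  have Yr: "(\<Sum>l<m j. Y c (j, l)) = t (fst c) j * m j" if "c \<in> Cl" "j < k" for c j
    using bspec[OF conjunct1[OF y2] that(1)] that(2) by blast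
  note Yc = conjunct2[OF y2]
  have thp: "th\<^sup>2 > 0" using pos by (simp add: th)
  have lam0: "lam > 0" using pos by (simp add: lam)
  \<comment> \<open>The share of rounding is \<open>\<delta>\<close>, that of the contraction
    \<open>2 * \<delta>\<close>, and that of the degree deviations, amplified by the factor
    \<open>2 / th\<^sup>2\<close>, is again \<open>\<delta>\<close>.\<close>
  have cost: "w\<^sup>2 * (\<Sum>c\<in>Cl. \<Sum>d\<in>Cl. \<bar>X0 c d - Y c d\<bar>) \<le> 4 * \<delta>"
  proof -
    have "(\<Sum>c\<in>Cl. \<Sum>d\<in>Cl. \<bar>X0 c d - Y c d\<bar>) \<le> (\<Sum>c\<in>Cl. \<Sum>d\<in>Cl. 1 / real N + \<bar>X c d - Y c d\<bar>)"
    proof (intro sum_mono)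
      fix c d assume "c \<in> Cl" "d \<in> Cl"
      then have "\<bar>X c d - X0 c d\<bar> \<le> 1 / real N" by (rule Xr(4))
      then show "\<bar>X0 c d - Y c d\<bar> \<le> 1 / real N + \<bar>X c d - Y c d\<bar>" by linarith
    qed
    also have "\<dots> = 1 / real N * (real (card Cl))\<^sup>2 + (\<Sum>c\<in>Cl. \<Sum>d\<in>Cl. \<bar>X c d - Y c d\<bar>)"
      by (simp add: sum.distrib power2_eq_square)
    also have "\<dots> \<le> 1 / real N * (real (card Cl))\<^sup>2 + (2 * lam * (real (card Cl))\<^sup>2 + 2 * err / th\<^sup>2)" using Yc by simp
    finally have "w\<^sup>2 * (\<Sum>c\<in>Cl. \<Sum>d\<in>Cl. \<bar>X0 c d - Y c d\<bar>) \<le> w\<^sup>2 * (1 / real N * (real (card Cl))\<^sup>2 + (2 * lam * (real (card Cl))\<^sup>2 + 2 * err / th\<^sup>2))"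
      by (intro mult_left_mono) auto
    also have "\<dots> = (1 / real N + 2 * lam) * (w\<^sup>2 * (real (card Cl))\<^sup>2) + 2 * (w\<^sup>2 * err) / th\<^sup>2"
      by (simp add: algebra_simps)
    also have "\<dots> \<le> (1 / real N + 2 * lam) * 1 + 2 * (\<eta> + (1 - w * card Cl) + 2 / real N) / th\<^sup>2"
      using wC2 werr thp lam0 by (intro add_mono mult_left_mono divide_right_mono) auto
    also have "\<dots> \<le> 4 * \<delta>"
    proof -
      have "(x + 2 * y) * 1 + q \<le> 4 * \<delta>" if "x \<le> \<delta>" "y \<le> \<delta>" "q \<le> \<delta>" for x y q using that by simp
      from this[OF num(4,3,9)] show ?thesis .
    qed
    finally show ?thesis .
  qed
  have E2: "E \<ge> 2" using E pos by simp
  have cardcell: "card {v \<in> V. cell v = c} = E * K * T ^ (K + 1) * sz" if "c \<in> Cl" for c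
    using V(3)[OF that] L by auto
  have Er: "lam / 4 = 1 / real E" "real (4 * h - 1) = real E - 1" using pos by (auto simp: E lam of_nat_diff)
  have YT: "Y c d = Y d c \<and> 0 \<le> Y c d \<and> Y c d \<le> 1 - 1 / real E \<and> real T * Y c d \<in> \<int> \<and> real T * Y c d * (real E / (real E - 1)) \<in> \<int>"
    if cd: "c \<in> Cl" "d \<in> Cl" for c d
  proof -
    \<comment> \<open>The factor \<open>4 * h - 1 = E - 1\<close> in \<open>T\<close> cancels the
      denominator of \<open>E / (E - 1)\<close>, so the thresholds between and inside cells are both
      integers.\<close>
    define z where "z = real (4 * h * N * (fact M)\<^sup>2) * Y c d"
    have z: "z \<in> \<int>" using Y[OF cd] unfolding z_def by blast
    have Tz: "real T * Y c d = real (4 * h - 1) * z" unfolding T z_def of_nat_mult by (simp only: mult_ac)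
    have "real T * Y c d \<in> \<int>" unfolding Tz using z by (intro Ints_mult) auto
    moreover have "real T * Y c d * (real E / (real E - 1)) = real E * z"
      unfolding Tz Er(2) using E2 by simp
    then have "real T * Y c d * (real E / (real E - 1)) \<in> \<int>" using z by (simp add: Ints_mult)
    ultimately show ?thesis using Y[OF cd] Er(1) by simp
  qed
  have "\<exists>G. (\<forall>e\<in>G. e \<subseteq> V \<and> card e = 2) \<and>
    (\<forall>u\<in>V. \<forall>B\<subseteq>Cl. real (card {v \<in> V. cell v \<in> B \<and> {u, v} \<in> G}) = real (E * K * T ^ (K + 1) * sz) * (\<Sum>d\<in>B. Y (cell u) d)) \<and>
    (\<forall>I\<subseteq>V. \<forall>J\<subseteq>V. \<bar>\<Sum>u\<in>I. \<Sum>v\<in>J. of_bool ({u, v} \<in> G) - Y (cell u) (cell v)\<bar>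
        \<le> (real (card V))\<^sup>2 / sqrt K + real (card Cl) * (real (E * K * T ^ (K + 1) * sz))\<^sup>2)"
    by (rule graph_realization[OF finCl finV E2 pos(4) Tpos V(2) cardcell YT])
  then obtain G where g1: "(\<forall>e\<in>G. e \<subseteq> V \<and> card e = 2) \<and>
    (\<forall>u\<in>V. \<forall>B\<subseteq>Cl. real (card {v \<in> V. cell v \<in> B \<and> {u, v} \<in> G}) = real L * (\<Sum>d\<in>B. Y (cell u) d)) \<and>
    (\<forall>I\<subseteq>V. \<forall>J\<subseteq>V. \<bar>\<Sum>u\<in>I. \<Sum>v\<in>J. of_bool ({u, v} \<in> G) - Y (cell u) (cell v)\<bar>
        \<le> (real (card V))\<^sup>2 / sqrt K + real (card Cl) * (real L)\<^sup>2)" unfolding L[symmetric] ..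
  note G1 = conjunct1[OF g1] note g2 = conjunct2[OF g1]
  have G2: "real (card {v \<in> V. cell v \<in> B \<and> {u, v} \<in> G}) = real L * (\<Sum>d\<in>B. Y (cell u) d)" if "u \<in> V" "B \<subseteq> Cl" for u B
    using bspec[OF conjunct1[OF g2] that(1)] that(2) by blast
  have G3: "\<bar>\<Sum>u\<in>I. \<Sum>v\<in>J. of_bool ({u, v} \<in> G) - Y (cell u) (cell v)\<bar>
        \<le> (real (card V))\<^sup>2 / sqrt K + real (card Cl) * (real L)\<^sup>2" if "I \<subseteq> V" "J \<subseteq> V" for I J
    using conjunct2[OF g2] that by blast
  have deg: "real (card {v \<in> V. fst (cell v) = j \<and> {u, v} \<in> G}) = real L * (t (fst (cell u)) j * m j)" if u: "u \<in> V" and j: "j < k" for u j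
  proof -
    have B: "{j} \<times> {..<m j} \<subseteq> Cl" using j by (auto simp: Cl)
    have "{v \<in> V. fst (cell v) = j \<and> {u, v} \<in> G} = {v \<in> V. cell v \<in> {j} \<times> {..<m j} \<and> {u, v} \<in> G}"
      using V(2) by (fastforce simp: Cl mem_Times_iff)
    then have "real (card {v \<in> V. fst (cell v) = j \<and> {u, v} \<in> G}) = real L * (\<Sum>d\<in>{j} \<times> {..<m j}. Y (cell u) d)"
      using G2[OF u B] by simp
    also have "(\<Sum>d\<in>{j} \<times> {..<m j}. Y (cell u) d) = (\<Sum>l<m j. Y (cell u) (j, l))"
    proof -
      have "{j} \<times> {..<m j} = Pair j ` {..<m j}" by auto
      then show ?thesis by (simp add: sum.reindex inj_on_def)
    qed
    finally show ?thesis using Yr[OF V(2)[OF u] j] by simp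
  qed
  have n1: "real n > 0" using pos by simp
  have fin: "\<bar>rect_integral unit_space (pull_back W g) S S' - rect_integral unit_space (kernel (graph_representation n G)) S S'\<bar> \<le> 12 * \<delta>"
    if S: "S \<in> sets unit_space" "S' \<in> sets unit_space" for S S'
  proof -
    note gg = mp_isoD[OF g]
    define I where "I S = g' -` S \<inter> space unit_space" for S
    have Im: "I A \<in> sets unit_space" if "A \<in> sets unit_space" for A
      unfolding I_def by (rule measurable_sets[OF gg(2) that])
    have gI: "g -` I A \<inter> space unit_space = A" if "A \<in> sets unit_space" for A
    proof -
      have "x \<in> A \<Longrightarrow> x \<in> space unit_space" for x using sets.sets_into_space[OF that] by blast
      then show ?thesis unfolding I_def using gg(3) measurable_space[OF gg(1)] by auto
    qed
    have rW: "rect_integral unit_space (pull_back W g) S S' = rect_integral unit_space W (I S) (I S')"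
      using rect_integral_pull_back[OF prob_space_unit gg(1,5) Wm Im[OF S(1)] Im[OF S(2)]] gI[OF S(1)] gI[OF S(2)] by simp
    have vpm: "vertex_part n v \<in> sets unit_space" if "v \<in> {1..n}" for v
      using vertex_part_unit[OF that] by (auto simp: sets_restrict_space_iff vertex_part_def)
    have meas: "measure unit_space (A \<inter> vertex_part n v) = measure unit_space (I A \<inter> \<Omega> v)" if v: "v \<in> {1..n}" and A: "A \<in> sets unit_space" for v A
    proof -
      have "g -` (I A \<inter> \<Omega> v) \<inter> space unit_space = A \<inter> vertex_part n v"
      proof (intro equalityI subsetI)
        fix x assume x: "x \<in> g -` (I A \<inter> \<Omega> v) \<inter> space unit_space"
        then have xA: "x \<in> A" using gI[OF A] by blast
        obtain u where u: "u \<in> {1..n}" "x \<in> vertex_part n u" using vertex_part_cover[of x n] x pos(1) by auto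
        have "u = v"
        proof (rule ccontr)
          assume "u \<noteq> v"
          then have "\<Omega> u \<inter> \<Omega> v = {}" using \<Omega>2(2) u(1) v unfolding disjoint_family_on_def by blast
          then show False using g\<Omega>[OF u] x by blast
        qed
        then show "x \<in> A \<inter> vertex_part n v" using xA u(2) by blast
      next
        fix x assume x: "x \<in> A \<inter> vertex_part n v"
        then have "x \<in> g -` I A \<inter> space unit_space" using gI[OF A] by blast
        then show "x \<in> g -` (I A \<inter> \<Omega> v) \<inter> space unit_space" using g\<Omega>[OF v] x by blast
      qed
      moreover have "measure (distr unit_space unit_space g) (I A \<inter> \<Omega> v) = measure unit_space (g -` (I A \<inter> \<Omega> v) \<inter> space unit_space)"
        using Im[OF A] \<Omega>1(2)[of v] by (intro measure_distr gg(1)) auto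
      ultimately show ?thesis unfolding gg(5) by simp
    qed
    define \<mu> where "\<mu> v = measure unit_space (I S \<inter> \<Omega> v)" for v
    define \<mu>' where "\<mu>' v = measure unit_space (I S' \<inter> \<Omega> v)" for v
    have \<mu>b: "0 \<le> n * \<mu> v \<and> n * \<mu> v \<le> 1" "0 \<le> n * \<mu>' v \<and> n * \<mu>' v \<le> 1" if "v \<in> {1..n}" for v
    proof -
      have "\<mu> v \<le> 1 / n" "\<mu>' v \<le> 1 / n" unfolding \<mu>_def \<mu>'_def \<Omega>2(4)[OF that, symmetric]
        using \<Omega>1(2) by (auto intro!: U.finite_measure_mono)
      then show "0 \<le> n * \<mu> v \<and> n * \<mu> v \<le> 1" "0 \<le> n * \<mu>' v \<and> n * \<mu>' v \<le> 1" using n1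
        by (auto simp: \<mu>_def \<mu>'_def field_simps)
    qed
    have part: "S \<subseteq> (\<Union>v\<in>{1..n}. vertex_part n v)" "S' \<subseteq> (\<Union>v\<in>{1..n}. vertex_part n v)"
    proof -
      have "A \<subseteq> (\<Union>v\<in>{1..n}. vertex_part n v)" if "A \<in> sets unit_space" for A
      proof
        fix x assume "x \<in> A"
        then have "x \<in> {0..<1}" using sets.sets_into_space[OF that] by auto
        then show "x \<in> (\<Union>v\<in>{1..n}. vertex_part n v)" using vertex_part_cover[OF _ pos(1)] by blast
      qed
      then show "S \<subseteq> (\<Union>v\<in>{1..n}. vertex_part n v)" "S' \<subseteq> (\<Union>v\<in>{1..n}. vertex_part n v)" using S by blast+
    qed
    have dvp: "disjoint_family_on (vertex_part n) {1..n}"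
      unfolding disjoint_family_on_def using vertex_part_disjoint by blast
    have "rect_integral unit_space (kernel (graph_representation n G)) S S' =
       (\<Sum>u\<in>{1..n}. \<Sum>v\<in>{1..n}. of_bool ({u, v} \<in> G) * measure unit_space (S \<inter> vertex_part n u) * measure unit_space (S' \<inter> vertex_part n v))"
      by (rule U.rect_integral_step[OF graph_kernel(1,2)[OF pos(1)] _ dvp vpm S part graph_kernel(3)[OF pos(1)]]) auto
    also have "\<dots> = (\<Sum>u\<in>{1..n}. \<Sum>v\<in>{1..n}. of_bool ({u, v} \<in> G) * \<mu> u * \<mu>' v)"
      unfolding \<mu>_def \<mu>'_def using meas S by (intro sum.cong refl) simp
    also have "\<dots> = (\<Sum>u\<in>V. \<Sum>v\<in>V. of_bool ({u, v} \<in> G) * \<mu> u * \<mu>' v)"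
    proof -
      have z: "of_bool ({u, v} \<in> G) * \<mu> u * \<mu>' v = 0" if "u \<notin> V \<or> v \<notin> V" for u v using G1 that by auto
      have "(\<Sum>u\<in>{1..n}. \<Sum>v\<in>{1..n}. of_bool ({u, v} \<in> G) * \<mu> u * \<mu>' v) = (\<Sum>u\<in>V. \<Sum>v\<in>{1..n}. of_bool ({u, v} \<in> G) * \<mu> u * \<mu>' v)"
        by (rule sum.mono_neutral_right) (use V1n z in \<open>auto intro!: sum.neutral\<close>)
      also have "\<dots> = (\<Sum>u\<in>V. \<Sum>v\<in>V. of_bool ({u, v} \<in> G) * \<mu> u * \<mu>' v)"
        by (intro sum.cong refl sum.mono_neutral_right) (use V1n z in auto)
      finally show ?thesis .
    qed
    finally have rG: "rect_integral unit_space (kernel (graph_representation n G)) S S' = (\<Sum>u\<in>V. \<Sum>v\<in>V. of_bool ({u, v} \<in> G) * \<mu> u * \<mu>' v)" .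
    have mC: "measure unit_space (I A \<inter> C \<Omega> c) = (\<Sum>v\<in>{v\<in>V. cell v = c}. measure unit_space (I A \<inter> \<Omega> v))" if A: "A \<in> sets unit_space" for A c
    proof -
      have "I A \<inter> C \<Omega> c = (\<Union>v\<in>{v\<in>V. cell v = c}. I A \<inter> \<Omega> v)" unfolding C_def by blast
      moreover have "disjoint_family_on (\<lambda>v. I A \<inter> \<Omega> v) {v\<in>V. cell v = c}"
        using \<Omega>2(2) V1n unfolding disjoint_family_on_def by blast
      then have "measure unit_space (\<Union>v\<in>{v\<in>V. cell v = c}. I A \<inter> \<Omega> v) = (\<Sum>v\<in>{v\<in>V. cell v = c}. measure unit_space (I A \<inter> \<Omega> v))"
        using finV Im[OF A] \<Omega>1(2) by (intro U.finite_measure_finite_Union) auto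
      ultimately show ?thesis by simp
    qed
    define \<sigma> where "\<sigma> c = measure unit_space (I S \<inter> C \<Omega> c)" for c
    define \<sigma>' where "\<sigma>' c = measure unit_space (I S' \<inter> C \<Omega> c)" for c
    have \<sigma>b: "0 \<le> \<sigma> c" "\<sigma> c \<le> w" "0 \<le> \<sigma>' c" "\<sigma>' c \<le> w" if "c \<in> Cl" for c
      unfolding \<sigma>_def \<sigma>'_def Cw[OF that, symmetric] using Cm[OF that] by (auto intro!: U.finite_measure_mono)
    have i: "\<bar>rect_integral unit_space W (I S) (I S') - (\<Sum>c\<in>Cl. \<Sum>d\<in>Cl. X0 c d * \<sigma> c * \<sigma>' d)\<bar> \<le> 6 * \<delta>"
    proof -
      have "2 * \<delta> + 2 * (1 - w * card Cl) + 2 * real (k * 4 ^ Nr) * w = 2 * \<delta> + 2 * (1 - w * card Cl) + 2 * (real (k * 4 ^ Nr) * w)" by simp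
      also have "\<dots> \<le> 2 * \<delta> + 2 * \<delta> + 2 * \<delta>" by (intro add_mono mult_left_mono num(7,8)) auto
      finally have "2 * \<delta> + 2 * (1 - w * card Cl) + 2 * real (k * 4 ^ Nr) * w \<le> 6 * \<delta>" by simp
      then show ?thesis unfolding X0_def \<sigma>_def \<sigma>'_def by (rule order_trans[OF cut[OF Im[OF S(1)] Im[OF S(2)]]])
    qed
    have ii: "\<bar>(\<Sum>c\<in>Cl. \<Sum>d\<in>Cl. X0 c d * \<sigma> c * \<sigma>' d) - (\<Sum>c\<in>Cl. \<Sum>d\<in>Cl. Y c d * \<sigma> c * \<sigma>' d)\<bar> \<le> 4 * \<delta>"
    proof -
      have "\<bar>(\<Sum>c\<in>Cl. \<Sum>d\<in>Cl. X0 c d * \<sigma> c * \<sigma>' d) - (\<Sum>c\<in>Cl. \<Sum>d\<in>Cl. Y c d * \<sigma> c * \<sigma>' d)\<bar> = \<bar>\<Sum>c\<in>Cl. \<Sum>d\<in>Cl. (X0 c d - Y c d) * \<sigma> c * \<sigma>' d\<bar>"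
        by (simp add: sum_subtractf left_diff_distrib)
      also have "\<dots> \<le> (\<Sum>c\<in>Cl. \<bar>\<Sum>d\<in>Cl. (X0 c d - Y c d) * \<sigma> c * \<sigma>' d\<bar>)" by (rule sum_abs)
      also have "\<dots> \<le> (\<Sum>c\<in>Cl. \<Sum>d\<in>Cl. \<bar>(X0 c d - Y c d) * \<sigma> c * \<sigma>' d\<bar>)" by (rule sum_mono, rule sum_abs)
      also have "\<dots> \<le> (\<Sum>c\<in>Cl. \<Sum>d\<in>Cl. w\<^sup>2 * \<bar>X0 c d - Y c d\<bar>)"
      proof (intro sum_mono)
        fix c d assume cd: "c \<in> Cl" "d \<in> Cl"
        have "\<sigma> c * \<sigma>' d \<le> w * w" using \<sigma>b[OF cd(1)] \<sigma>b[OF cd(2)] wpos by (intro mult_mono) auto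
        then have "\<bar>X0 c d - Y c d\<bar> * (\<sigma> c * \<sigma>' d) \<le> \<bar>X0 c d - Y c d\<bar> * (w * w)" by (intro mult_left_mono) auto
        then show "\<bar>(X0 c d - Y c d) * \<sigma> c * \<sigma>' d\<bar> \<le> w\<^sup>2 * \<bar>X0 c d - Y c d\<bar>"
          using \<sigma>b[OF cd(1)] \<sigma>b[OF cd(2)] by (simp add: abs_mult power2_eq_square mult_ac)
      qed
      also have "\<dots> \<le> 4 * \<delta>" using cost by (simp only: sum_distrib_left[symmetric])
      finally show ?thesis .
    qed
    have eqY: "(\<Sum>c\<in>Cl. \<Sum>d\<in>Cl. Y c d * \<sigma> c * \<sigma>' d) = (\<Sum>u\<in>V. \<Sum>v\<in>V. Y (cell u) (cell v) * \<mu> u * \<mu>' v)"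
      unfolding \<sigma>_def \<sigma>'_def mC[OF S(1)] mC[OF S(2)] \<mu>_def \<mu>'_def by (rule sum_block_measure[OF finV finCl V(2)])
    have iii: "\<bar>(\<Sum>u\<in>V. \<Sum>v\<in>V. of_bool ({u, v} \<in> G) * \<mu> u * \<mu>' v) - (\<Sum>u\<in>V. \<Sum>v\<in>V. Y (cell u) (cell v) * \<mu> u * \<mu>' v)\<bar> \<le> 2 * \<delta>"
    proof -
      \<comment> \<open>A block has measure \<open>1 / n\<close>, so \<open>n * \<mu> u\<close> is
        the fraction of block \<open>u\<close> inside the test set. Fractional weights reduce to
        whole sets of vertices, for which the graph has been estimated.\<close>
      let ?Z = "\<lambda>u v. of_bool ({u, v} \<in> G) - Y (cell u) (cell v)"
      have "\<bar>\<Sum>u\<in>V. \<Sum>v\<in>V. (n * \<mu> u) * (n * \<mu>' v) * ?Z u v\<bar> \<le> (real (card V))\<^sup>2 / sqrt K + real (card Cl) * (real L)\<^sup>2"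
        by (rule weights_extreme[OF finV \<mu>b(1)[OF V1n] finV \<mu>b(2)[OF V1n] G3])
      also have "(\<Sum>u\<in>V. \<Sum>v\<in>V. (n * \<mu> u) * (n * \<mu>' v) * ?Z u v) = (real n)\<^sup>2 * (\<Sum>u\<in>V. \<Sum>v\<in>V. ?Z u v * \<mu> u * \<mu>' v)"
        by (simp add: sum_distrib_left power2_eq_square mult_ac)
      finally have le: "(real n)\<^sup>2 * \<bar>\<Sum>u\<in>V. \<Sum>v\<in>V. ?Z u v * \<mu> u * \<mu>' v\<bar> \<le> (real (card V))\<^sup>2 / sqrt K + real (card Cl) * (real L)\<^sup>2"
        by (simp add: abs_mult)
      have "card V \<le> card {1..n}" using V1n by (intro card_mono) auto
      then have "(real (card V))\<^sup>2 / sqrt K \<le> (real n)\<^sup>2 / sqrt K" by (intro divide_right_mono power_mono) auto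
      also have "\<dots> = (real n)\<^sup>2 * (1 / sqrt K)" by simp
      also have "\<dots> \<le> (real n)\<^sup>2 * \<delta>" using num(5) by (intro mult_left_mono) auto
      finally have b1: "(real (card V))\<^sup>2 / sqrt K \<le> (real n)\<^sup>2 * \<delta>" .
      have "real L = w * n" using n1 by (simp add: w)
      then have "real (card Cl) * (real L)\<^sup>2 = (real n)\<^sup>2 * ((w * card Cl) * w)" by (simp add: power2_eq_square mult_ac)
      also have "\<dots> \<le> (real n)\<^sup>2 * (1 * \<delta>)" using wC wpos num(6) by (intro mult_left_mono mult_mono) auto
      finally have "(real n)\<^sup>2 * \<bar>\<Sum>u\<in>V. \<Sum>v\<in>V. ?Z u v * \<mu> u * \<mu>' v\<bar> \<le> (real n)\<^sup>2 * (2 * \<delta>)" using le b1 by simp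
      then have "\<bar>\<Sum>u\<in>V. \<Sum>v\<in>V. ?Z u v * \<mu> u * \<mu>' v\<bar> \<le> 2 * \<delta>" using n1 by simp
      moreover have "(\<Sum>u\<in>V. \<Sum>v\<in>V. ?Z u v * \<mu> u * \<mu>' v) = (\<Sum>u\<in>V. \<Sum>v\<in>V. of_bool ({u, v} \<in> G) * \<mu> u * \<mu>' v) - (\<Sum>u\<in>V. \<Sum>v\<in>V. Y (cell u) (cell v) * \<mu> u * \<mu>' v)"
        by (simp add: sum_subtractf left_diff_distrib)
      ultimately show ?thesis by simp
    qed
    show ?thesis unfolding rW rG using i ii iii unfolding eqY by linarith
  qed
  show ?thesis
    by (rule exI[of _ G], rule exI[of _ g], rule exI[of _ g'], intro conjI ballI allI impI)
       (use G1 deg g fin in simp_all)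
qed

section \<open>Numbers and sizes of the cells\<close>

lemma cell_multiplicities:
  fixes a :: "nat \<Rightarrow> real" and m :: "nat \<Rightarrow> nat" and k M :: nat
  assumes a: "\<And>i. 0 \<le> a i" "(\<Sum>i<k. a i) = 1" and m: "\<And>i. m i = nat \<lfloor>real M * a i\<rfloor>" and M: "M > 0"
  shows "i < k \<Longrightarrow> m i \<le> M" "real (m i) \<le> real M * a i" "m i > 0 \<Longrightarrow> 1 / real M \<le> a i"
    "real M - real k \<le> real (\<Sum>i<k. m i)" "(\<Sum>i<k. m i) \<le> M"
proof -
  have b: "real (m i) \<le> real M * a i" "real M * a i \<le> real (m i) + 1" for i
    unfolding m using a(1)[of i] by (simp_all add: of_nat_nat)
  then show "real (m i) \<le> real M * a i" by simp
  show "1 / real M \<le> a i" if "m i > 0"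
  proof -
    have "1 \<le> real (m i)" using that by simp
    then have "1 \<le> real M * a i" using b(1)[of i] by linarith
    then show ?thesis using M by (simp add: divide_le_eq mult.commute)
  qed
  have "real (\<Sum>i<k. m i) \<le> (\<Sum>i<k. real M * a i)" unfolding of_nat_sum by (intro sum_mono b)
  also have "\<dots> = real M" using a(2) by (simp flip: sum_distrib_left)
  finally show S: "(\<Sum>i<k. m i) \<le> M" by (simp only: of_nat_le_iff)
  then show "m i \<le> M" if "i < k" using member_le_sum[of i "{..<k}" m] that by auto
  \<comment> \<open>Rounding down loses at most one cell per class. A class lighter than
    \<open>1 / M\<close> receives no cell at all and counts as uncovered.\<close>
  have "real M = (\<Sum>i<k. real M * a i)" using a(2) by (simp flip: sum_distrib_left)
  also have "\<dots> \<le> (\<Sum>i<k. real (m i) + 1)" by (intro sum_mono b)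
  also have "\<dots> = real (\<Sum>i<k. m i) + real k" by (simp add: sum.distrib)
  finally show "real M - real k \<le> real (\<Sum>i<k. m i)" by simp
qed

text \<open>Space is divided as for \<open>M + 1\<close> cells although at most \<open>M\<close> are
  placed; the spare share pays for the margins of the classes. The size is a multiple of
  \<open>N1\<close> so that labels are evenly distributed, which costs at most \<open>N1\<close>
  vertices per cell.\<close>

lemma cell_size:
  fixes n M N1 sz L :: nat and w :: real
  assumes pos: "N1 > 0" "(M + 1) * N1 \<le> n" and sz: "sz = n div ((M + 1) * N1)" and L: "L = N1 * sz"
    and w: "w = real L / real n"
  shows "sz > 0" "n > 0" "real (M + 1) * real L \<le> real n" "w \<le> 1 / real (M + 1)" "1 / real (M + 1) - real N1 / real n \<le> w"
proof -
  have p: "(M + 1) * N1 > 0" using pos(1) by simp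
  show "sz > 0" unfolding sz using p pos(2) by (simp add: div_greater_zero_iff)
  show n: "n > 0" using p pos(2) by linarith
  have "(M + 1) * N1 * sz \<le> n" unfolding sz by (rule times_div_less_eq_dividend)
  then have "real ((M + 1) * L) \<le> real n" unfolding L by (simp only: of_nat_le_iff mult.assoc)
  then show l: "real (M + 1) * real L \<le> real n" by (simp only: of_nat_mult)
  have "n < (M + 1) * N1 * sz + (M + 1) * N1"
    unfolding sz using div_mult_mod_eq[of n "(M + 1) * N1"] mod_less_divisor[OF p, of n] by (simp only: mult.commute)
  then have "n \<le> (M + 1) * (L + N1)" unfolding L by (simp only: distrib_left mult.assoc) 
  then have "real n \<le> real ((M + 1) * (L + N1))" by (simp only: of_nat_le_iff)
  then have u: "real n \<le> real (M + 1) * (real L + real N1)" by (simp only: of_nat_mult of_nat_add)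
  have Mp: "real (M + 1) > 0" by simp
  show "w \<le> 1 / real (M + 1)" unfolding w using l n Mp by (simp only: divide_simps) (simp add: mult.commute)
  have "1 / real (M + 1) \<le> (real L + real N1) / real n"
    using u n Mp by (simp add: divide_simps mult.commute)
  then show "1 / real (M + 1) - real N1 / real n \<le> w" unfolding w by (simp add: add_divide_distrib)
qed

text \<open>Half of \<open>\<gamma>\<close> is reserved for the cells lost to rounding and for the
  spare one, the other half for the rounding of the cell size.\<close>

lemma uncovered_mass:
  fixes w S M k x \<gamma> :: real
  assumes "1 / (M + 1) - x \<le> w" "M - k \<le> S" "0 \<le> S" "S \<le> M" "0 \<le> x" "(k + 1) / (M + 1) \<le> \<gamma> / 2" "M * x \<le> \<gamma> / 2" "M > 0"
  shows "1 - w * S \<le> \<gamma>"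
proof -
  have "(1 / (M + 1) - x) * S \<le> w * S" using assms by (intro mult_right_mono) auto
  moreover have "x * S \<le> M * x" using mult_left_mono[OF assms(4,5)] by (simp add: mult.commute)
  moreover have "(M - k) / (M + 1) \<le> S / (M + 1)" using assms by (intro divide_right_mono) auto
  moreover have "(M - k) / (M + 1) = 1 - (k + 1) / (M + 1)" using assms by (simp add: field_simps)
  moreover have "(1 / (M + 1) - x) * S = S / (M + 1) - x * S" by (simp add: left_diff_distrib)
  ultimately show ?thesis using assms(6,7) by linarith
qed

text \<open>Shrinking from \<open>M\<close> to \<open>M + 1\<close> shares frees
  \<open>n * ai / (M + 1)\<close> vertices, which is at least 3 since
  \<open>ai \<ge> 1 / M\<close>.\<close>

lemma cells_fit:
  fixes mi L n M ai :: real
  assumes "mi \<le> M * ai" "(M + 1) * L \<le> n" "1 / M \<le> ai" "3 * M * (M + 1) \<le> n" "M > 0" "0 \<le> L"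
  shows "mi * L + 3 \<le> n * ai"
proof -
  have ai: "0 \<le> ai" using assms(3,5) by (meson divide_nonneg_pos order_trans zero_le_one)
  have "L \<le> n / (M + 1)" using assms by (simp add: field_simps)
  then have "mi * L \<le> (M * ai) * (n / (M + 1))"
    using assms ai by (intro order_trans[OF mult_right_mono[OF assms(1,6)]] mult_left_mono) auto
  also have "\<dots> = n * ai - n * ai / (M + 1)" using assms(5) by (simp add: field_simps)
  finally have 1: "mi * L \<le> n * ai - n * ai / (M + 1)" .
  have "3 * M * (M + 1) * (1 / M) \<le> n * ai"
    using assms(3-5) by (intro mult_mono) (auto intro: order_trans[rotated])
  then have "3 * (M + 1) \<le> n * ai" using assms(5) by simp
  then have "3 \<le> n * ai / (M + 1)" using assms(5) by (simp add: field_simps)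
  then show ?thesis using 1 by linarith
qed

lemma cut_norm_le:
  fixes W W' :: "'a \<times> 'a \<Rightarrow> real"
  assumes M: "prob_space M" and W: "W \<in> borel_measurable (M \<Otimes>\<^sub>M M)" "\<And>z. z \<in> space (M \<Otimes>\<^sub>M M) \<Longrightarrow> \<bar>W z\<bar> \<le> 1"
    and W': "W' \<in> borel_measurable (M \<Otimes>\<^sub>M M)" "\<And>z. z \<in> space (M \<Otimes>\<^sub>M M) \<Longrightarrow> \<bar>W' z\<bar> \<le> 1"
    and le: "\<And>S T. S \<in> sets M \<Longrightarrow> T \<in> sets M \<Longrightarrow> \<bar>rect_integral M W S T - rect_integral M W' S T\<bar> \<le> \<epsilon>"
  shows "cut_norm M (\<lambda>z. W z - W' z) \<le> ereal \<epsilon>"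
  unfolding cut_norm_def
proof (rule SUP_least, clarify)
  fix S T assume ST: "S \<in> sets M" "T \<in> sets M"
  interpret prob_space M by (rule M)
  have "rect_integral M (\<lambda>z. W z - W' z) S T = rect_integral M W S T - rect_integral M W' S T"
    by (rule set_integral_diff; rule set_integrable_bounded_pair) (use W W' ST in auto)
  then show "ereal \<bar>rect_integral M (\<lambda>z. W z - W' z) S T\<bar> \<le> ereal \<epsilon>" using le[OF ST] by simp
qed

text \<open>Each of the three terms in the bracket may take one sixth of
  \<open>th\<^sup>2 * \<delta>\<close>; the factor 2 and the division restore
  \<open>\<delta>\<close>.\<close>

lemma degree_sum_bound:
  fixes \<eta> gap x th \<delta> :: real
  assumes "\<eta> = th\<^sup>2 * \<delta> / 6" "gap \<le> th\<^sup>2 * \<delta> / 6" "x \<le> th\<^sup>2 * \<delta> / 12" "th > 0"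
  shows "2 * (\<eta> + gap + 2 * x) / th\<^sup>2 \<le> \<delta>"
proof -
  have "2 * (\<eta> + gap + 2 * x) \<le> \<delta> * th\<^sup>2" using assms(1-3) by (simp add: mult.commute)
  then show ?thesis using assms(4) by (simp add: divide_le_eq)
qed

text \<open>The order of quantifiers is the point: \<open>grp\<close> and \<open>D\<close> are fixed
  before \<open>W\<close>, so any two graphs obtained from it have one common partition with one
  common degree matrix.\<close>

definition equitably_realizes ::
    "real \<Rightarrow> real \<Rightarrow> nat \<Rightarrow> (nat \<Rightarrow> real) \<Rightarrow> (nat \<Rightarrow> nat \<Rightarrow> real) \<Rightarrow> nat \<Rightarrow> (nat \<Rightarrow> nat) \<Rightarrow> (nat \<Rightarrow> nat \<Rightarrow> nat) \<Rightarrow> bool" where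
  "equitably_realizes \<epsilon> \<eta> k a s n grp D \<longleftrightarrow> (\<forall>W qi. near_regular unit_space W qi k a s \<eta> \<longrightarrow>
      (\<exists>G g g'. simple_graph {1..n} G \<and>
         (\<forall>u\<in>{1..n}. \<forall>j. degree_into G u {v \<in> {1..n}. grp v = j} = D (grp u) j) \<and>
         mp_iso unit_space unit_space g g' \<and>
         cut_norm unit_space (\<lambda>z. pull_back W g z - kernel (graph_representation n G) z) \<le> ereal \<epsilon>))"

text \<open>\<open>\<eta>\<close> must depend on \<open>\<epsilon>\<close> only, because
  \<open>k\<close> is known only after a partition for \<open>\<eta>\<close> has been found.
  Accordingly \<open>h\<close>, \<open>Nr\<close>, \<open>N\<close> and \<open>K\<close> are chosen
  from \<open>\<epsilon>\<close>, whereas \<open>M\<close>, \<open>T\<close> and \<open>n0\<close>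
  may use \<open>k\<close>.\<close>

lemma uniform_graphs:
  fixes \<epsilon> :: real
  assumes \<epsilon>: "\<epsilon> > 0"
  shows "\<exists>\<eta>>0. \<forall>k (a :: nat \<Rightarrow> real) s. (\<forall>i. 0 \<le> a i) \<and> (\<Sum>i<k. a i) = 1 \<and>
      (\<forall>i<k. \<forall>j<k. 0 \<le> s i j \<and> s i j \<le> 1 \<and> s i j = s j i) \<longrightarrow>
    (\<exists>n0::nat. \<forall>n\<ge>n0. \<exists>grp D. equitably_realizes \<epsilon> \<eta> k a s n grp D)"
proof -
  have small: "\<exists>N>0. 1 / real N \<le> (x::real)" if x0: "x > 0" for x
  proof -
    obtain N where "1 / real (Suc N) < x" by (rule nat_approx_posE[OF x0])
    then show ?thesis by (intro exI[of _ "Suc N"]) simp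
  qed
  \<comment> \<open>Twelve is the total of the error shares in \<open>discretize\<close>.\<close>
  define \<delta> where "\<delta> = \<epsilon> / 12"
  have \<delta>: "\<delta> > 0" using \<epsilon> by (simp add: \<delta>_def)
  obtain h where h: "h > 0" "1 / real h \<le> \<delta>" using small[OF \<delta>] by auto
  define lam th where "lam = 1 / real h" and "th = 1 / (24 * real h)"
  have th: "th > 0" using h by (simp add: th_def)
  obtain Nr :: nat where "1 / \<delta>\<^sup>2 < real Nr" using reals_Archimedean2 by blast
  then have Nr: "real Nr * \<delta>\<^sup>2 > 1" using \<delta> by (simp add: divide_less_eq)
  \<comment> \<open>\<open>\<gamma>\<close> bounds the uncovered mass. That mass enters the cut norm
    directly and the degree error with the factor \<open>2 / th\<^sup>2\<close>; the two terms of
    the minimum serve these two uses.\<close>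
  define \<gamma> where "\<gamma> = min \<delta> (th\<^sup>2 * \<delta> / 6)"
  have \<gamma>: "\<gamma> > 0" "\<gamma> \<le> \<delta>" "\<gamma> \<le> th\<^sup>2 * \<delta> / 6" using \<delta> th by (auto simp: \<gamma>_def)
  define \<eta> where "\<eta> = th\<^sup>2 * \<delta> / 6"
  have \<eta>: "\<eta> > 0" using \<delta> th by (simp add: \<eta>_def)
  obtain N where N: "N > 0" "1 / real N \<le> min \<delta> (th\<^sup>2 * \<delta> / 12)" using small[of "min \<delta> (th\<^sup>2 * \<delta> / 12)"] \<delta> th by auto
  obtain K where K: "K > 0" "1 / real K \<le> \<delta>\<^sup>2" using small[of "\<delta>\<^sup>2"] \<delta> by auto
  have sK: "1 / sqrt (real K) \<le> \<delta>"
    using real_sqrt_le_mono[OF K(2)] \<delta> by (simp add: real_sqrt_divide)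
  show ?thesis
  proof (intro exI[of _ \<eta>] conjI \<eta> allI impI)
    fix k :: nat and a :: "nat \<Rightarrow> real" and s :: "nat \<Rightarrow> nat \<Rightarrow> real"
    assume as: "(\<forall>i. 0 \<le> a i) \<and> (\<Sum>i<k. a i) = 1 \<and> (\<forall>i<k. \<forall>j<k. 0 \<le> s i j \<and> s i j \<le> 1 \<and> s i j = s j i)"
    have a: "\<And>i. 0 \<le> a i" "(\<Sum>i<k. a i) = 1" using as by blast+
    have s: "\<And>i j. i < k \<Longrightarrow> j < k \<Longrightarrow> 0 \<le> s i j \<and> s i j \<le> 1 \<and> s i j = s j i" using as by blast
    define R where "R = real (k * 4 ^ Nr)"
    have R0: "R \<ge> 0" by (simp add: R_def)
    \<comment> \<open>Cells have mass at most \<open>1 / (M + 1)\<close>: the \<open>R\<close>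
      impure ones together shall weigh at most \<open>\<delta>\<close>, and \<open>k + 1\<close>
      missing ones at most \<open>\<gamma> / 2\<close>.\<close>
    have "min (\<delta> / (R + 1)) (\<gamma> / (2 * (real k + 1))) > 0" using \<delta> \<gamma> R0 by auto
    then obtain M where M: "M > 0" "1 / real M \<le> min (\<delta> / (R + 1)) (\<gamma> / (2 * (real k + 1)))" using small by blast
    define m where "m i = nat \<lfloor>real M * a i\<rfloor>" for i
    note mm = cell_multiplicities[OF a m_def M(1)]
    define E where "E = 4 * h"
    define T where "T = 4 * h * N * (fact M)\<^sup>2 * (4 * h - 1)"
    define N1 where "N1 = E * K * T ^ (K + 1)"
    have N1: "N1 > 0" unfolding N1_def E_def T_def using h N K by simp
    \<comment> \<open>In turn: three spare vertices in each class that has a cell, at least one full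
      set of labels for each of \<open>M + 1\<close> cells, and a rounding loss of at most
      \<open>\<gamma> / 2\<close>.\<close>
    define n0 where "n0 = max (3 * M * (M + 1)) (max ((M + 1) * N1) (nat \<lceil>2 * real M * real N1 / \<gamma>\<rceil>))"
    define Cl where "Cl = (SIGMA i:{..<k}. {..<m i})"
    have cCl: "card Cl = (\<Sum>i<k. m i)" unfolding Cl_def by simp
    define t where "t i j = (1 - lam) * (\<lfloor>real N * s i j\<rfloor> / real N) + lam / 2" for i j
    show "\<exists>n0. \<forall>n\<ge>n0. \<exists>grp D. equitably_realizes \<epsilon> \<eta> k a s n grp D"
    proof (intro exI[of _ n0] allI impI)
      fix n assume n: "n0 \<le> n"
      have n1: "3 * M * (M + 1) \<le> n" "(M + 1) * N1 \<le> n" "2 * real M * real N1 / \<gamma> \<le> real n"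
        using n unfolding n0_def by (simp_all add: nat_le_iff ceiling_le_iff)
      define sz where "sz = n div ((M + 1) * N1)"
      define L where "L = E * K * T ^ (K + 1) * sz"
      have L: "L = N1 * sz" unfolding L_def N1_def ..
      define w where "w = real L / real n"
      note cs = cell_size[OF N1 n1(2) sz_def L w_def]
      have "1 / real (M + 1) \<le> 1 / real M" using M(1) by (intro divide_left_mono) auto
      then have wM: "1 / real (M + 1) \<le> \<delta> / (R + 1)" "1 / real (M + 1) \<le> \<gamma> / (2 * (real k + 1))" using M(2) by auto
      have w0: "w \<ge> 0" by (simp add: w_def)
      have "w \<le> \<delta> / (R + 1)" using cs(4) wM(1) by linarith
      then have "w * (R + 1) \<le> \<delta>" using R0 by (simp add: le_divide_eq)
      then have Rw: "w + R * w \<le> \<delta>" by (simp add: algebra_simps)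
      then have w\<delta>: "w \<le> \<delta>" "R * w \<le> \<delta>" using w0 mult_nonneg_nonneg[OF R0 w0] by linarith+
      have gap: "1 - w * real (card Cl) \<le> \<gamma>"
      proof (rule uncovered_mass[of "real M" "real N1 / real n" _ "real k"])
        show "1 / (real M + 1) - real N1 / real n \<le> w" using cs(5) by (simp add: add.commute)
        show "real M - real k \<le> real (card Cl)" "real (card Cl) \<le> real M" unfolding cCl using mm(4,5) by (simp_all only: of_nat_le_iff)
        have "(real k + 1) * (1 / real (M + 1)) \<le> (real k + 1) * (\<gamma> / (2 * (real k + 1)))"
          by (rule mult_left_mono[OF wM(2)]) simp
        also have "\<dots> = \<gamma> / 2" by (simp add: field_simps)
        finally show "(real k + 1) / (real M + 1) \<le> \<gamma> / 2" by (simp add: add.commute)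
        have "2 * real M * real N1 \<le> real n * \<gamma>" using n1(3) \<gamma>(1) by (simp add: divide_le_eq)
        then show "real M * (real N1 / real n) \<le> \<gamma> / 2" using cs(2) by (simp add: field_simps)
      qed (use M(1) in auto)
      have fit: "real (m i * L) + 3 \<le> real n * a i" if "i < k" "m i > 0" for i
      proof -
        have "real (3 * M * (M + 1)) \<le> real n" using n1(1) by (simp only: of_nat_le_iff)
        then have "real (m i) * real L + 3 \<le> real n * a i"
          by (intro cells_fit[OF mm(2) _ mm(3)[OF that(2)]]) (use cs(3) M(1) in \<open>auto simp: algebra_simps\<close>)
        then show ?thesis by simp
      qed
      have "\<exists>V cell. V \<subseteq> {1..<n} \<and> (\<forall>v\<in>V. cell v \<in> Cl) \<and>
        (\<forall>c\<in>Cl. \<exists>p. {v \<in> V. cell v = c} = {p<..p + L}) \<and>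
        (\<forall>v\<in>V. (\<Sum>i<fst (cell v). a i) < (real v - 1) / n \<and> real v / n \<le> (\<Sum>i<Suc (fst (cell v)). a i))"
        by (rule layout[OF cs(2) a Cl_def fit])
      then obtain V cell where V0: "V \<subseteq> {1..<n} \<and> (\<forall>v\<in>V. cell v \<in> Cl) \<and>
        (\<forall>c\<in>Cl. \<exists>p. {v \<in> V. cell v = c} = {p<..p + L}) \<and>
        (\<forall>v\<in>V. (\<Sum>i<fst (cell v). a i) < (real v - 1) / n \<and> real v / n \<le> (\<Sum>i<Suc (fst (cell v)). a i))"
        by (elim exE)
      note v1 = conjunct2[OF V0] note v2 = conjunct2[OF v1]
      note V = conjunct1[OF V0] bspec[OF conjunct1[OF v1]] bspec[OF conjunct1[OF v2]] bspec[OF conjunct2[OF v2]]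
      have Vk: "fst (cell v) < k" if "v \<in> V" for v using V(2)[OF that] unfolding Cl_def by auto
      \<comment> \<open>The extra label \<open>k\<close> collects the vertices outside all cells.
        They are isolated, so the matrix \<open>D\<close> is zero in its row and column.\<close>
      define grp where "grp v = (if v \<in> V then fst (cell v) else k)" for v
      define D where "D i j = (if i < k \<and> j < k then nat \<lfloor>real L * (t i j * real (m j))\<rfloor> else 0)" for i j
      show "\<exists>grp D. equitably_realizes \<epsilon> \<eta> k a s n grp D"
      unfolding equitably_realizes_def
      proof (intro exI[of _ grp] exI[of _ D] allI impI)
        fix W :: "real \<times> real \<Rightarrow> real" and qi assume NR: "near_regular unit_space W qi k a s \<eta>"
        have N\<delta>: "1 / real N \<le> \<delta>" "1 / real N \<le> th\<^sup>2 * \<delta> / 12" using N(2) by auto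
        have ds: "2 * (\<eta> + (1 - w * card Cl) + 2 / real N) / th\<^sup>2 \<le> \<delta>"
          using degree_sum_bound[OF \<eta>_def order_trans[OF gap \<gamma>(3)] N\<delta>(2) th] by simp
        have "\<exists>G g g'. (\<forall>e\<in>G. e \<subseteq> V \<and> card e = 2) \<and>
          (\<forall>u\<in>V. \<forall>j<k. real (card {v \<in> V. fst (cell v) = j \<and> {u, v} \<in> G}) = real L * (t (fst (cell u)) j * m j)) \<and>
          mp_iso unit_space unit_space g g' \<and>
          (\<forall>S\<in>sets unit_space. \<forall>S'\<in>sets unit_space.
             \<bar>rect_integral unit_space (pull_back W g) S S' - rect_integral unit_space (kernel (graph_representation n G)) S S'\<bar> \<le> 12 * \<delta>)"
          by (rule discretize[OF NR a(2) s Cl_def mm(1) V cs(2) h(1) N(1) K(1) cs(1) E_def T_def L_def lam_def th_def t_def w_def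
             \<delta> Nr h(2)[folded lam_def] N\<delta>(1) sK w\<delta>(1) w\<delta>(2)[unfolded R_def] order_trans[OF gap \<gamma>(2)] ds])
        then obtain G g g' where G0: "(\<forall>e\<in>G. e \<subseteq> V \<and> card e = 2) \<and>
          (\<forall>u\<in>V. \<forall>j<k. real (card {v \<in> V. fst (cell v) = j \<and> {u, v} \<in> G}) = real L * (t (fst (cell u)) j * m j)) \<and>
          mp_iso unit_space unit_space g g' \<and>
          (\<forall>S\<in>sets unit_space. \<forall>S'\<in>sets unit_space.
             \<bar>rect_integral unit_space (pull_back W g) S S' - rect_integral unit_space (kernel (graph_representation n G)) S S'\<bar> \<le> 12 * \<delta>)"
          by (elim exE)
        note g1 = conjunct2[OF G0] note g2 = conjunct2[OF g1]
        note GV = bspec[OF conjunct1[OF G0]] note iso = conjunct1[OF g2]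
        have deg: "real (card {v \<in> V. fst (cell v) = j \<and> {u, v} \<in> G}) = real L * (t (fst (cell u)) j * m j)"
          if "u \<in> V" "j < k" for u j using conjunct1[OF g1] that by blast
        have cut: "\<bar>rect_integral unit_space (pull_back W g) S S' - rect_integral unit_space (kernel (graph_representation n G)) S S'\<bar> \<le> \<epsilon>"
          if "S \<in> sets unit_space" "S' \<in> sets unit_space" for S S'
          using bspec[OF bspec[OF conjunct2[OF g2] that(1)] that(2)] by (simp add: \<delta>_def)
        have Vn: "V \<subseteq> {1..n}" using V(1) by auto
        have GV': "u \<in> V \<and> v \<in> V" if "{u, v} \<in> G" for u v using GV[OF that] by simp
        have sg: "simple_graph {1..n} G" unfolding simple_graph_def using GV Vn by blast
        have dg: "degree_into G u {v \<in> {1..n}. grp v = j} = D (grp u) j" if u: "u \<in> {1..n}" for u j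
        proof (cases "u \<in> V \<and> j < k")
          case True
          have "{v \<in> {v \<in> {1..n}. grp v = j}. {u, v} \<in> G} = {v \<in> V. fst (cell v) = j \<and> {u, v} \<in> G}"
            using True Vn unfolding grp_def by (auto dest: GV')
          then have "real (degree_into G u {v \<in> {1..n}. grp v = j}) = real L * (t (fst (cell u)) j * real (m j))"
            unfolding degree_into_def using deg True by simp
          then have "degree_into G u {v \<in> {1..n}. grp v = j} = nat \<lfloor>real L * (t (fst (cell u)) j * real (m j))\<rfloor>"
            by (metis floor_of_nat nat_int)
          then show ?thesis using True Vk unfolding D_def grp_def by simp
        next
          case False
          then have "{v \<in> {v \<in> {1..n}. grp v = j}. {u, v} \<in> G} = {}"
            using Vk unfolding grp_def by (auto dest: GV')
          then have "degree_into G u {v \<in> {1..n}. grp v = j} = 0" unfolding degree_into_def by (simp only: card.empty)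
          moreover have "D (grp u) j = 0" using False unfolding D_def grp_def by auto
          ultimately show ?thesis by simp
        qed
        have Wm: "W \<in> borel_measurable (unit_space \<Otimes>\<^sub>M unit_space)" using NR unfolding near_regular_def by blast
        have gm: "g \<in> unit_space \<rightarrow>\<^sub>M unit_space" by (rule mp_isoD(1)[OF iso])
        have b: "\<bar>pull_back W g z\<bar> \<le> 1" if z: "z \<in> space (unit_space \<Otimes>\<^sub>M unit_space)" for z
        proof -
          obtain x y where xy: "z = (x, y)" "x \<in> space unit_space" "y \<in> space unit_space"
            using z unfolding space_pair_measure by blast
          have "0 \<le> W (g x, g y) \<and> W (g x, g y) \<le> 1"
            using NR measurable_space[OF gm xy(2)] measurable_space[OF gm xy(3)] unfolding near_regular_def by blast
          then show ?thesis unfolding xy(1) pull_back_def by simp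
        qed
        have "cut_norm unit_space (\<lambda>z. pull_back W g z - kernel (graph_representation n G) z) \<le> ereal \<epsilon>"
          by (rule cut_norm_le[OF prob_space_unit pull_back_measurable[OF Wm gm] b graph_kernel(1)[OF cs(2)] graph_kernel(2)[OF cs(2)] cut])
        then show "\<exists>G g g'. simple_graph {1..n} G \<and>
         (\<forall>u\<in>{1..n}. \<forall>j. degree_into G u {v \<in> {1..n}. grp v = j} = D (grp u) (j::nat)) \<and>
         mp_iso unit_space unit_space g g' \<and>
         cut_norm unit_space (\<lambda>z. pull_back W g z - kernel (graph_representation n G) z) \<le> ereal \<epsilon>"
          using sg dg iso by (intro exI[of _ G] exI[of _ g] exI[of _ g'] conjI ballI allI)
      qed
    qed
  qed
qed

section \<open>Nearly regular partitions and fractional isomorphism\<close>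

lemma space_sets_sub_sigma:
  assumes "sub_sigma_algebra M C"
  shows "space (sigma (space M) C) = space M" "sets (sigma (space M) C) = C" "C \<subseteq> sets M"
proof -
  have sa: "sigma_algebra (space M) C" "C \<subseteq> sets M" using assms by (auto simp: sub_sigma_algebra_def)
  then show "C \<subseteq> sets M" by simp
  have "C \<subseteq> Pow (space M)" using sa(2) sets.sets_into_space by blast
  then show "space (sigma (space M) C) = space M" "sets (sigma (space M) C) = C"
    using sigma_algebra.sigma_sets_eq[OF sa(1)] by (simp_all add: space_measure_of sets_measure_of)
qed

definition step_kernel :: "(real \<times> 'a set \<times> 'a set) list \<Rightarrow> 'a \<times> 'a \<Rightarrow> real" where
  "step_kernel xs z = (\<Sum>(c, A, B)\<leftarrow>xs. c * indicator (A \<times> B) z)"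

lemma step_kernel_append: "step_kernel (xs @ ys) z = step_kernel xs z + step_kernel ys z"
  by (simp add: step_kernel_def)

text \<open>A step kernel that nearly minimises the square distance to \<open>W\<close> is nearly orthogonal to all step
  kernels bounded by one, in particular to the signs of the degree deviations.\<close>

lemma near_regular_partition:
  fixes W :: "'a \<times> 'a \<Rightarrow> real"
  assumes M: "prob_space M" and W: "W \<in> borel_measurable (M \<Otimes>\<^sub>M M)"
      "\<And>x y. x \<in> space M \<Longrightarrow> y \<in> space M \<Longrightarrow> W (x, y) = W (y, x) \<and> 0 \<le> W (x, y) \<and> W (x, y) \<le> 1"
    and C: "sub_sigma_algebra M C"
    and inv: "\<And>B. B \<in> C \<Longrightarrow> (\<lambda>x. \<integral>y. W (x, y) * indicator B y \<partial>M) \<in> borel_measurable (sigma (space M) C)"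
    and \<eta>: "\<eta> > 0"
  shows "\<exists>k q a s. near_regular M W q k a s \<eta> \<and> q \<in> sigma (space M) C \<rightarrow>\<^sub>M count_space UNIV \<and>
     (\<forall>i. 0 \<le> a i) \<and> (\<Sum>i<k. a i) = 1 \<and> (\<forall>i<k. \<forall>j<k. 0 \<le> s i j \<and> s i j \<le> 1 \<and> s i j = s j i)"
proof -
  interpret M: prob_space M by (rule M)
  interpret P: pair_prob_space M M by (rule M.pair_prob_space_self)
  note sC = space_sets_sub_sigma[OF C]
  have W01: "0 \<le> W z \<and> W z \<le> 1" if "z \<in> space (M \<Otimes>\<^sub>M M)" for z
    using W(2) that by (cases z) (auto simp: space_pair_measure)
  have W1: "\<bar>W z\<bar> \<le> 1" if "z \<in> space (M \<Otimes>\<^sub>M M)" for z using W01[OF that] by simp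
  define ok where "ok xs \<longleftrightarrow> (\<forall>(c, A, B)\<in>set xs. A \<in> C \<and> B \<in> C)" for xs :: "(real \<times> 'a set \<times> 'a set) list"
  have Fm: "step_kernel xs \<in> borel_measurable (M \<Otimes>\<^sub>M M)" if "ok xs" for xs
    using that
  proof (induction xs)
    case Nil
    then show ?case by (simp add: step_kernel_def[abs_def])
  next
    case (Cons x xs)
    obtain c A B where x: "x = (c, A, B)" by (cases x)
    have AB: "A \<in> sets M" "B \<in> sets M" using Cons.prems sC(3) unfolding ok_def x by auto
    have "ok xs" using Cons.prems unfolding ok_def by auto
    from Cons.IH[OF this] have "(\<lambda>z. c * indicator (A \<times> B) z + step_kernel xs z) \<in> borel_measurable (M \<Otimes>\<^sub>M M)"
      using AB by (intro borel_measurable_add borel_measurable_times borel_measurable_const borel_measurable_indicator pair_measureI)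
    then show ?case by (simp add: step_kernel_def[abs_def] x)
  qed
  have Fb: "\<bar>step_kernel xs z\<bar> \<le> (\<Sum>(c, A, B)\<leftarrow>xs. \<bar>c\<bar>)" for xs z
  proof (induction xs)
    case (Cons x xs)
    obtain c A B where x: "x = (c, A, B)" by (cases x)
    have "\<bar>c * indicator (A \<times> B) z\<bar> \<le> \<bar>c\<bar>" by (simp add: abs_mult indicator_def)
    then show ?case using Cons by (simp add: step_kernel_def x)
  qed (simp add: step_kernel_def)
  define Q where "Q xs = (\<integral>z. (W z - step_kernel xs z)\<^sup>2 \<partial>(M \<Otimes>\<^sub>M M))" for xs
  define \<tau> where "\<tau> = \<eta> / 2"
  have \<tau>: "\<tau> > 0" using \<eta> by (simp add: \<tau>_def)
  have bdd: "bdd_below (Q ` Collect ok)" unfolding Q_def by (intro bdd_belowI[of _ 0]) auto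
  have ne: "Q ` Collect ok \<noteq> {}" by (auto simp: ok_def intro: exI[of _ "[]"])
  \<comment> \<open>The slack \<open>\<tau>\<^sup>2\<close> matches the step \<open>\<tau>\<close>
    taken along the test kernel: its energy change is at most
    \<open>\<tau>\<^sup>2 - 2 * \<tau> * I\<close> for the inner product \<open>I\<close>, and
    near-minimality then gives \<open>I \<le> \<tau>\<close>.\<close>
  have "Inf (Q ` Collect ok) < Inf (Q ` Collect ok) + \<tau>\<^sup>2" using \<tau> by simp
  then obtain xs where xs: "ok xs" "Q xs < Inf (Q ` Collect ok) + \<tau>\<^sup>2"
    unfolding cInf_less_iff[OF ne bdd] by auto
  have near: "Q xs \<le> Q ys + \<tau>\<^sup>2" if "ok ys" for ys
    using xs(2) cInf_lower[OF _ bdd, of "Q ys"] that by auto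
  define F where "F = step_kernel xs"
  define N where "N = length xs"
  define Bs where "Bs b = (if b < N then fst (snd (xs ! b)) else snd (snd (xs ! (b - N))))" for b
  have "Bs b \<in> sets (sigma (space M) C)" if "b < 2 * N" for b
  proof -
    have "fst (snd (xs ! l)) \<in> C \<and> snd (snd (xs ! l)) \<in> C" if "l < N" for l
      using xs(1) nth_mem[of l xs] that unfolding ok_def N_def by (cases "xs ! l") auto
    then show ?thesis using that unfolding Bs_def sC by auto
  qed
  then have "\<exists>code. code \<in> sigma (space M) C \<rightarrow>\<^sub>M count_space UNIV \<and> (\<forall>x. code x < (2::nat) ^ (2 * N)) \<and>
      (\<forall>x y. code x = code y \<longrightarrow> (\<forall>b<2 * N. x \<in> Bs b \<longleftrightarrow> y \<in> Bs b))"
    by (rule membership_code)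
  then obtain q where q0: "q \<in> sigma (space M) C \<rightarrow>\<^sub>M count_space UNIV \<and> (\<forall>x. q x < (2::nat) ^ (2 * N)) \<and>
      (\<forall>x y. q x = q y \<longrightarrow> (\<forall>b<2 * N. x \<in> Bs b \<longleftrightarrow> y \<in> Bs b))" ..
  \<comment> \<open>One class for each membership pattern of the \<open>2 * N\<close> sides of the
    rectangles; many classes may be empty or null.\<close>
  define k where "k = (2::nat) ^ (2 * N)"
  have qC: "q \<in> sigma (space M) C \<rightarrow>\<^sub>M count_space UNIV" and qk: "\<And>x. q x < k"
    using q0 unfolding k_def by blast+
  have qB: "x \<in> Bs b \<longleftrightarrow> y \<in> Bs b" if "q x = q y" "b < 2 * N" for x y b using q0 that by blast
  have Fq: "F (x, y) = F (x', y')" if "q x = q x'" "q y = q y'" for x y x' y'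
  proof -
    have "x \<in> fst (snd p) \<longleftrightarrow> x' \<in> fst (snd p)" "y \<in> snd (snd p) \<longleftrightarrow> y' \<in> snd (snd p)" if p: "p \<in> set xs" for p
    proof -
      obtain l where l: "l < N" "p = xs ! l" using p unfolding N_def in_set_conv_nth by auto
      show "x \<in> fst (snd p) \<longleftrightarrow> x' \<in> fst (snd p)" using qB[OF \<open>q x = q x'\<close>, of l] l by (simp add: Bs_def)
      show "y \<in> snd (snd p) \<longleftrightarrow> y' \<in> snd (snd p)" using qB[OF \<open>q y = q y'\<close>, of "N + l"] l by (simp add: Bs_def)
    qed
    then have "map (\<lambda>(c, A, B). c * indicator (A \<times> B) (x, y)) xs = map (\<lambda>(c, A, B). c * indicator (A \<times> B) (x', y') :: real) xs"
      by (intro map_cong refl) (auto simp: indicator_def)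
    from arg_cong[OF this, of sum_list] show ?thesis unfolding F_def step_kernel_def .
  qed
  define R where "R i = {x \<in> space M. q x = i}" for i
  have RC: "R i \<in> C" for i
    using measurable_sets[OF qC, of "{i}"] unfolding sC R_def by (simp add: vimage_def Int_def conj_commute)
  have Rm [measurable]: "R i \<in> sets M" for i using RC sC(3) by auto
  define a where "a i = measure M (R i)" for i
  have asum: "(\<Sum>i<k. a i) = 1"
  proof -
    have "measure M (\<Union>i<k. R i) = (\<Sum>i<k. measure M (R i))"
    proof (rule M.finite_measure_finite_Union)
      show "disjoint_family_on R {..<k}" unfolding disjoint_family_on_def R_def by auto
    qed (use Rm in auto)
    moreover have "(\<Union>i<k. R i) = space M" using qk by (auto simp: R_def)
    ultimately show ?thesis by (simp add: a_def M.prob_space)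
  qed
  define s0 where "s0 i j = F (SOME x. x \<in> R i, SOME y. y \<in> R j)" for i j
  have Fs0: "F (x, y) = s0 i j" if "x \<in> R i" "y \<in> R j" for x y i j
  proof -
    have "(SOME x. x \<in> R i) \<in> R i" "(SOME y. y \<in> R j) \<in> R j" using that by (auto intro: someI)
    then show ?thesis unfolding s0_def using that by (intro Fq) (auto simp: R_def)
  qed
  define dg where "dg j x = (\<integral>y. indicator (R j) y * W (x, y) \<partial>M)" for j x
  have dgC: "dg j \<in> borel_measurable (sigma (space M) C)" for j
    using inv[OF RC[of j]] unfolding dg_def by (simp add: mult.commute)
  have subm: "f \<in> borel_measurable M" if "f \<in> borel_measurable (sigma (space M) C)" for f :: "'a \<Rightarrow> real"
    using that sC by (auto simp: measurable_def)
  have dgm [measurable]: "dg j \<in> borel_measurable M" for j by (rule subm[OF dgC])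
  have dgb: "\<bar>dg j x\<bar> \<le> 1" if x: "x \<in> space M" for j x
  proof -
    have [measurable]: "(\<lambda>y. W (x, y)) \<in> borel_measurable M" using measurable_Pair2[OF W(1) x] .
    have "\<bar>dg j x\<bar> \<le> (\<integral>y. \<bar>indicator (R j) y * W (x, y)\<bar> \<partial>M)" unfolding dg_def by (rule integral_abs_bound)
    also have "\<dots> \<le> (\<integral>y. 1 \<partial>M)"
    proof (rule integral_mono)
      show "integrable M (\<lambda>y. \<bar>indicator (R j) y * W (x, y)\<bar>)"
        by (rule M.integrable_const_bound[of _ 1]) (use x W(2) in \<open>auto intro!: AE_I2 simp: indicator_def abs_mult\<close>)
      show "\<bar>indicator (R j) y * W (x, y)\<bar> \<le> 1" if "y \<in> space M" for y
        using W(2)[OF x that] by (auto simp: indicator_def)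
    qed simp
    finally show ?thesis by (simp add: M.prob_space)
  qed
  have int: "integrable M (\<lambda>x. indicator A x * (dg j x - c))" if [measurable]: "A \<in> sets M" for A j c
  proof (rule M.integrable_const_bound[of _ "1 + \<bar>c\<bar>"])
    show "AE x in M. norm (indicator A x * (dg j x - c)) \<le> 1 + \<bar>c\<bar>"
    proof (rule AE_I2)
      fix x assume "x \<in> space M"
      then show "norm (indicator A x * (dg j x - c)) \<le> 1 + \<bar>c\<bar>" using dgb[of x j] by (auto simp: indicator_def)
    qed
  qed measurable
  define D where "D i j x = dg j x - s0 i j * a j" for i j x
  \<comment> \<open>Invariance enters here: degrees into members of \<open>C\<close> are
    \<open>C\<close>-measurable, so the sign sets of the deviations lie in \<open>C\<close> and the
    test kernel built from them is admissible in the minimisation.\<close>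
  define Ap where "Ap i j = {x \<in> R i. D i j x > 0}" for i j
  define An where "An i j = {x \<in> R i. D i j x < 0}" for i j
  have ApC: "Ap i j \<in> C" "An i j \<in> C" for i j
  proof -
    note [measurable] = dgC[of j]
    have "{x \<in> space (sigma (space M) C). D i j x > 0} \<in> sets (sigma (space M) C)" unfolding D_def by measurable
    moreover have "{x \<in> space (sigma (space M) C). D i j x < 0} \<in> sets (sigma (space M) C)" unfolding D_def by measurable
    moreover have "Ap i j = R i \<inter> {x \<in> space M. D i j x > 0}" "An i j = R i \<inter> {x \<in> space M. D i j x < 0}"
      unfolding Ap_def An_def R_def by auto
    moreover have "R i \<in> sets (sigma (space M) C)" using RC sC by simp
    ultimately have "Ap i j \<in> sets (sigma (space M) C)" "An i j \<in> sets (sigma (space M) C)" unfolding sC(1) by (metis sets.Int)+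
    then show "Ap i j \<in> C" "An i j \<in> C" unfolding sC(2) .
  qed
  have Apm [measurable]: "Ap i j \<in> sets M" "An i j \<in> sets M" for i j using ApC sC(3) by auto
  define ps where "ps = List.product [0..<k] [0..<k]"
  define zs where "zs = map (\<lambda>(i, j). (\<tau>, Ap i j, R j)) ps @ map (\<lambda>(i, j). (- \<tau>, An i j, R j)) ps"
  have okz: "ok (xs @ zs)" using xs(1) ApC RC unfolding ok_def zs_def by auto
  define Z where "Z z = (\<Sum>i<k. \<Sum>j<k. indicator (Ap i j \<times> R j) z - indicator (An i j \<times> R j) z :: real)" for z
  have slp: "sum_list (map f ps) = (\<Sum>i<k. \<Sum>j<k. f (i, j))" for f :: "nat \<times> nat \<Rightarrow> real"
  proof -
    have "sum_list (map f ps) = sum f (set ps)"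
      unfolding ps_def by (rule sum_list_distinct_conv_sum_set) (simp add: distinct_product)
    also have "set ps = {..<k} \<times> {..<k}" unfolding ps_def by auto
    finally show ?thesis by (simp add: sum.cartesian_product)
  qed
  have skz: "step_kernel zs z = \<tau> * Z z" for z
  proof -
    have "step_kernel zs z = (\<Sum>i<k. \<Sum>j<k. \<tau> * indicator (Ap i j \<times> R j) z) + (\<Sum>i<k. \<Sum>j<k. - \<tau> * indicator (An i j \<times> R j) z)"
      unfolding zs_def step_kernel_append unfolding step_kernel_def
      by (simp only: map_map o_def split_beta fst_conv snd_conv slp[symmetric]) (simp add: slp)
    then show ?thesis unfolding Z_def by (simp add: sum_distrib_left sum_subtractf right_diff_distrib sum_negf)
  qed
  have Zb: "\<bar>Z (x, y)\<bar> \<le> 1" if "x \<in> space M" "y \<in> space M" for x y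
  proof -
    define c :: real where "c = indicator (Ap (q x) (q y)) x - indicator (An (q x) (q y)) x"
    have "indicator (Ap i j \<times> R j) (x, y) - indicator (An i j \<times> R j) (x, y) = (if i = q x then if j = q y then c else 0 else 0)" for i j
      unfolding c_def using that by (auto simp: Ap_def An_def R_def indicator_def)
    then have "Z (x, y) = (\<Sum>i<k. \<Sum>j<k. if i = q x then if j = q y then c else 0 else 0)" unfolding Z_def by (simp only:)
    also have "\<dots> = (\<Sum>i<k. if i = q x then c else 0)" by (intro sum.cong refl) (simp add: qk)
    also have "\<dots> = c" using qk by simp
    finally have "Z (x, y) = c" .
    then show ?thesis unfolding c_def by (simp add: indicator_def)
  qed
  have Zm: "Z \<in> borel_measurable (M \<Otimes>\<^sub>M M)"
    unfolding Z_def by (intro borel_measurable_sum borel_measurable_diff borel_measurable_indicator pair_measureI Apm Rm)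
  have Fm': "F \<in> borel_measurable (M \<Otimes>\<^sub>M M)" unfolding F_def by (rule Fm[OF xs(1)])
  define b where "b = (\<Sum>(c, A, B)\<leftarrow>xs. \<bar>c\<bar>)"
  have WFb: "\<bar>W z - F z\<bar> \<le> 1 + b" if "z \<in> space (M \<Otimes>\<^sub>M M)" for z
    using W1[OF that] Fb[of xs z] unfolding F_def b_def by linarith
  have WFm: "(\<lambda>z. W z - F z) \<in> borel_measurable (M \<Otimes>\<^sub>M M)" using W(1) Fm' by (rule borel_measurable_diff)
  have Zb': "\<bar>Z z\<bar> \<le> 1" if "z \<in> space (M \<Otimes>\<^sub>M M)" for z using Zb that by (cases z) (auto simp: space_pair_measure)
  have b0: "0 \<le> 1 + b"
  proof -
    obtain x where "x \<in> space M" using M.not_empty by blast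
    then have "(x, x) \<in> space (M \<Otimes>\<^sub>M M)" by (simp add: space_pair_measure)
    from WFb[OF this] show ?thesis by linarith
  qed
  have i1: "integrable (M \<Otimes>\<^sub>M M) (\<lambda>z. (W z - F z)\<^sup>2)"
  proof (rule M.integrable_bounded_pair[of _ "(1 + b)\<^sup>2"])
    show "\<bar>(W z - F z)\<^sup>2\<bar> \<le> (1 + b)\<^sup>2" if "z \<in> space (M \<Otimes>\<^sub>M M)" for z
      using power_mono[OF WFb[OF that] abs_ge_zero, of 2] by simp
  qed (use WFm in measurable)
  have i2: "integrable (M \<Otimes>\<^sub>M M) (\<lambda>z. (W z - F z) * Z z)"
  proof (rule M.integrable_bounded_pair[of _ "(1 + b) * 1"])
    show "\<bar>(W z - F z) * Z z\<bar> \<le> (1 + b) * 1" if "z \<in> space (M \<Otimes>\<^sub>M M)" for z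
      unfolding abs_mult using WFb[OF that] Zb'[OF that] b0 by (intro mult_mono) auto
  qed (use WFm Zm in measurable)
  have i3: "integrable (M \<Otimes>\<^sub>M M) (\<lambda>z. (Z z)\<^sup>2)"
  proof (rule M.integrable_bounded_pair[of _ "1\<^sup>2"])
    show "\<bar>(Z z)\<^sup>2\<bar> \<le> 1\<^sup>2" if "z \<in> space (M \<Otimes>\<^sub>M M)" for z
      using power_mono[OF Zb'[OF that] abs_ge_zero, of 2] by simp
  qed (use Zm in measurable)
  have Z2: "(\<integral>z. (Z z)\<^sup>2 \<partial>(M \<Otimes>\<^sub>M M)) \<le> 1"
  proof -
    have "(\<integral>z. (Z z)\<^sup>2 \<partial>(M \<Otimes>\<^sub>M M)) \<le> (\<integral>z. 1 \<partial>(M \<Otimes>\<^sub>M M))"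
    proof (rule integral_mono[OF i3])
      show "(Z z)\<^sup>2 \<le> 1" if "z \<in> space (M \<Otimes>\<^sub>M M)" for z
        using power_mono[OF Zb'[OF that] abs_ge_zero, of 2] by simp
    qed simp
    then show ?thesis by (simp add: P.prob_space)
  qed
  have orth: "(\<integral>z. (W z - F z) * Z z \<partial>(M \<Otimes>\<^sub>M M)) \<le> \<tau>"
  proof -
    let ?I = "\<integral>z. (W z - F z) * Z z \<partial>(M \<Otimes>\<^sub>M M)"
    have "Q (xs @ zs) = (\<integral>z. (W z - F z)\<^sup>2 - (2 * \<tau>) * ((W z - F z) * Z z) + \<tau>\<^sup>2 * (Z z)\<^sup>2 \<partial>(M \<Otimes>\<^sub>M M))"
      unfolding Q_def step_kernel_append skz F_def[symmetric]
      by (rule Bochner_Integration.integral_cong) (auto simp: power2_eq_square algebra_simps)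
    also have "\<dots> = Q xs - 2 * \<tau> * ?I + \<tau>\<^sup>2 * (\<integral>z. (Z z)\<^sup>2 \<partial>(M \<Otimes>\<^sub>M M))"
      unfolding Q_def F_def[symmetric] using i1 i2 i3 by simp
    also have "\<dots> \<le> Q xs - 2 * \<tau> * ?I + \<tau>\<^sup>2 * 1" using Z2 by (intro add_left_mono mult_left_mono) auto
    finally have "2 * \<tau> * ?I \<le> 2 * \<tau> * \<tau>" using near[OF okz] by (simp add: power2_eq_square)
    then show ?thesis using \<tau> by simp
  qed
  have rD: "rect_integral M (\<lambda>z. W z - F z) A (R j) = (\<integral>x. indicator A x * D i j x \<partial>M)"
    if A: "A \<in> sets M" "A \<subseteq> R i" for A i j
  proof -
    have iW: "set_integrable (M \<Otimes>\<^sub>M M) (A \<times> R j) W"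
      by (rule M.set_integrable_bounded_pair[OF W(1) W1]) (use A in auto)
    have iF: "set_integrable (M \<Otimes>\<^sub>M M) (A \<times> R j) F"
      by (rule M.set_integrable_bounded_pair[OF Fm', of b]) (use A Fb[of xs] in \<open>auto simp: F_def b_def\<close>)
    have "rect_integral M (\<lambda>z. W z - F z) A (R j) = rect_integral M W A (R j) - rect_integral M F A (R j)"
      by (rule set_integral_diff(2)[OF iW iF])
    also have "rect_integral M F A (R j) = s0 i j * measure M A * a j"
      unfolding a_def by (rule M.rect_integral_const) (use A Fs0 in auto)
    also have "rect_integral M W A (R j) = (\<integral>x. indicator A x * dg j x \<partial>M)"
      unfolding dg_def by (rule M.rect_integral_fubini[OF W(1) W1 A(1) Rm])
    also have "(\<integral>x. indicator A x * dg j x \<partial>M) - s0 i j * measure M A * a j = (\<integral>x. indicator A x * D i j x \<partial>M)"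
    proof -
      have "(\<integral>x. indicator A x * D i j x \<partial>M) = (\<integral>x. indicator A x * dg j x - indicator A x * (s0 i j * a j) \<partial>M)"
        unfolding D_def by (simp add: right_diff_distrib)
      also have "\<dots> = (\<integral>x. indicator A x * dg j x \<partial>M) - (\<integral>x. indicator A x * (s0 i j * a j) \<partial>M)"
        by (rule Bochner_Integration.integral_diff) (use int[OF A(1), of j 0] A(1) in \<open>auto intro!: integrable_real_indicator simp: less_top[symmetric]\<close>)
      also have "(\<integral>x. indicator A x * (s0 i j * a j) \<partial>M) = s0 i j * measure M A * a j"
        using A sets.sets_into_space[OF A(1)] by (simp add: Int_absorb2)
      finally show ?thesis by simp
    qed
    finally show ?thesis .
  qed
  define V where "V i j = (\<integral>x. indicator (R i) x * \<bar>D i j x\<bar> \<partial>M)" for i j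
  have intD: "integrable M (\<lambda>x. indicator A x * D i j x)" if "A \<in> sets M" for A i j
    using int[OF that, of j "s0 i j * a j"] by (simp add: D_def)
  have intDa: "integrable M (\<lambda>x. indicator (R i) x * \<bar>D i j x\<bar>)" for i j
    using integrable_abs[OF intD[OF Rm[of i], of i j]] by (simp add: abs_mult)
  have "(\<integral>z. (W z - F z) * Z z \<partial>(M \<Otimes>\<^sub>M M)) = (\<Sum>i<k. \<Sum>j<k. V i j)"
  proof -
    have si: "integrable (M \<Otimes>\<^sub>M M) (\<lambda>z. indicator (A \<times> B) z * (W z - F z))" if "A \<in> sets M" "B \<in> sets M" for A B
      using M.set_integrable_bounded_pair[OF WFm WFb, of "A \<times> B"] that by (simp add: set_integrable_def)
    have "(\<integral>z. (W z - F z) * Z z \<partial>(M \<Otimes>\<^sub>M M)) = (\<integral>z. (\<Sum>i<k. \<Sum>j<k. indicator (Ap i j \<times> R j) z * (W z - F z) - indicator (An i j \<times> R j) z * (W z - F z)) \<partial>(M \<Otimes>\<^sub>M M))"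
      unfolding Z_def by (rule Bochner_Integration.integral_cong[OF refl], subst mult.commute) (simp only: sum_distrib_right left_diff_distrib)
    also have "\<dots> = (\<Sum>i<k. \<Sum>j<k. rect_integral M (\<lambda>z. W z - F z) (Ap i j) (R j) - rect_integral M (\<lambda>z. W z - F z) (An i j) (R j))"
      unfolding set_lebesgue_integral_def real_scaleR_def
      by (simp only: Bochner_Integration.integral_sum Bochner_Integration.integrable_sum Bochner_Integration.integral_diff
          Bochner_Integration.integrable_diff si Apm Rm)
    also have "\<dots> = (\<Sum>i<k. \<Sum>j<k. V i j)"
    proof (intro sum.cong refl)
      fix i j
      have "rect_integral M (\<lambda>z. W z - F z) (Ap i j) (R j) - rect_integral M (\<lambda>z. W z - F z) (An i j) (R j)
          = (\<integral>x. indicator (Ap i j) x * D i j x \<partial>M) - (\<integral>x. indicator (An i j) x * D i j x \<partial>M)"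
        by (subst (1 2) rD) (use Apm[of i j] in \<open>auto simp: Ap_def An_def\<close>)
      also have "\<dots> = (\<integral>x. indicator (Ap i j) x * D i j x - indicator (An i j) x * D i j x \<partial>M)"
        by (rule Bochner_Integration.integral_diff[symmetric]) (intro intD Apm)+
      also have "\<dots> = V i j" unfolding V_def
        by (rule Bochner_Integration.integral_cong) (auto simp: Ap_def An_def indicator_def)
      finally show "rect_integral M (\<lambda>z. W z - F z) (Ap i j) (R j) - rect_integral M (\<lambda>z. W z - F z) (An i j) (R j) = V i j" .
    qed
    finally show ?thesis .
  qed
  then have Vs: "(\<Sum>i<k. \<Sum>j<k. V i j) \<le> \<tau>" using orth by simp
  \<comment> \<open>The values \<open>s0\<close> of the step kernel may be asymmetric or leave the
    unit interval, so they are replaced by the true densities. The mean deviation of a class is at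
    most its mean absolute deviation, so this at most doubles the error, which explains
    \<open>\<tau> = \<eta> / 2\<close>.\<close>
  define s where "s i j = (if a i = 0 \<or> a j = 0 then 0 else rect_integral M W (R i) (R j) / (a i * a j))" for i j
  have a0: "0 \<le> a i" for i by (simp add: a_def)
  have s01: "0 \<le> s i j \<and> s i j \<le> 1 \<and> s i j = s j i" for i j
  proof (cases "a i = 0 \<or> a j = 0")
    case False
    then have ap: "a i > 0" "a j > 0" using a0[of i] a0[of j] by auto
    have "rect_integral M W (R i) (R j) = rect_integral M W (R j) (R i)"
      by (rule M.rect_integral_swap[OF W(1) Rm Rm]) (use W(2) in blast)
    moreover have "0 \<le> rect_integral M W (R i) (R j)" "rect_integral M W (R i) (R j) \<le> a i * a j"
      unfolding a_def by (rule M.rect_integral_unit_range[OF W(1) W01 Rm Rm]; assumption)+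
    ultimately show ?thesis using ap by (simp add: s_def mult.commute)
  qed (auto simp: s_def)
  have dev: "(\<integral>x. indicator (R i) x * \<bar>dg j x - s i j * a j\<bar> \<partial>M) \<le> 2 * V i j" for i j
  proof -
    have ri: "(\<integral>x. indicator (R i) x * D i j x \<partial>M) = rect_integral M W (R i) (R j) - s0 i j * a i * a j"
    proof -
      have "(\<integral>x. indicator (R i) x * D i j x \<partial>M) = (\<integral>x. indicator (R i) x * dg j x - indicator (R i) x * (s0 i j * a j) \<partial>M)"
        unfolding D_def by (simp add: right_diff_distrib)
      also have "\<dots> = (\<integral>x. indicator (R i) x * dg j x \<partial>M) - (\<integral>x. indicator (R i) x * (s0 i j * a j) \<partial>M)"
        by (rule Bochner_Integration.integral_diff) (use int[OF Rm[of i], of j 0] in \<open>auto intro!: integrable_real_indicator simp: less_top[symmetric]\<close>)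
      also have "(\<integral>x. indicator (R i) x * (s0 i j * a j) \<partial>M) = s0 i j * a i * a j"
        using sets.sets_into_space[OF Rm[of i]] by (simp add: Int_absorb2 a_def)
      also have "(\<integral>x. indicator (R i) x * dg j x \<partial>M) = rect_integral M W (R i) (R j)"
        unfolding dg_def by (rule M.rect_integral_fubini[OF W(1) W1 Rm Rm, symmetric])
      finally show ?thesis .
    qed
    have "\<bar>\<integral>x. indicator (R i) x * D i j x \<partial>M\<bar> \<le> V i j"
      unfolding V_def using integral_abs_bound[of M "\<lambda>x. indicator (R i) x * D i j x"] by (simp add: abs_mult)
    moreover have "a i * \<bar>s0 i j * a j - s i j * a j\<bar> \<le> \<bar>rect_integral M W (R i) (R j) - s0 i j * a i * a j\<bar>"
    proof (cases "a i = 0 \<or> a j = 0")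
      case False
      then have "rect_integral M W (R i) (R j) = s i j * a i * a j" by (simp add: s_def)
      then have "rect_integral M W (R i) (R j) - s0 i j * a i * a j = - (a i * (s0 i j * a j - s i j * a j))" by (simp add: algebra_simps)
      then show ?thesis using a0[of i] by (simp add: abs_mult)
    qed auto
    ultimately have c: "a i * \<bar>s0 i j * a j - s i j * a j\<bar> \<le> V i j" using ri by simp
    have "(\<integral>x. indicator (R i) x * \<bar>dg j x - s i j * a j\<bar> \<partial>M) \<le> (\<integral>x. indicator (R i) x * \<bar>D i j x\<bar> + indicator (R i) x * \<bar>s0 i j * a j - s i j * a j\<bar> \<partial>M)"
    proof (rule integral_mono)
      show "integrable M (\<lambda>x. indicator (R i) x * \<bar>dg j x - s i j * a j\<bar>)"
        using integrable_abs[OF int[OF Rm[of i], of j "s i j * a j"]] by (simp add: abs_mult)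
      show "integrable M (\<lambda>x. indicator (R i) x * \<bar>D i j x\<bar> + indicator (R i) x * \<bar>s0 i j * a j - s i j * a j\<bar>)"
        by (intro Bochner_Integration.integrable_add intDa integrable_mult_left integrable_real_indicator Rm) (simp add: less_top[symmetric])
    qed (auto simp: indicator_def D_def)
    also have "\<dots> = V i j + a i * \<bar>s0 i j * a j - s i j * a j\<bar>"
    proof -
      have "integrable M (\<lambda>x. indicator (R i) x * \<bar>s0 i j * a j - s i j * a j\<bar>)"
        by (intro integrable_mult_left integrable_real_indicator Rm) (simp add: less_top[symmetric])
      then show ?thesis unfolding V_def
        using intDa[of i j] sets.sets_into_space[OF Rm[of i]] by (simp add: Int_absorb2 a_def)
    qed
    finally show ?thesis using c by simp
  qed
  have "(\<Sum>i<k. \<Sum>j<k. \<integral>x. indicator (R i) x * \<bar>dg j x - s i j * a j\<bar> \<partial>M) \<le> (\<Sum>i<k. \<Sum>j<k. 2 * V i j)"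
    by (intro sum_mono dev)
  also have "\<dots> = 2 * (\<Sum>i<k. \<Sum>j<k. V i j)" by (simp add: sum_distrib_left)
  also have "\<dots> \<le> \<eta>" using Vs by (simp add: \<tau>_def)
  finally have fin: "(\<Sum>i<k. \<Sum>j<k. \<integral>x. indicator (R i) x * \<bar>dg j x - s i j * a j\<bar> \<partial>M) \<le> \<eta>" .
  have qm: "q \<in> M \<rightarrow>\<^sub>M count_space UNIV" using qC sC by (auto simp: measurable_def)
  have "near_regular M W q k a s \<eta>"
    unfolding near_regular_def using W(1) W(2) qm qk fin unfolding R_def dg_def a_def by auto
  then show ?thesis using qC a0 asum s01
    by (intro exI[of _ k] exI[of _ q] exI[of _ a] exI[of _ s]) simp
qed


section \<open>Degrees read off the quotient\<close>

lemma AE_le_of_integrals_eq: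
  fixes f g :: "'a \<Rightarrow> real"
  assumes C: "sub_sigma_algebra M C" and f: "f \<in> borel_measurable (sigma (space M) C)" "integrable M f"
    and g: "g \<in> borel_measurable (sigma (space M) C)" "integrable M g"
    and eq: "\<And>A. A \<in> C \<Longrightarrow> (\<integral>x. indicator A x * f x \<partial>M) = (\<integral>x. indicator A x * g x \<partial>M)"
  shows "AE x in M. f x \<le> g x"
proof -
  note sC = space_sets_sub_sigma[OF C]
  \<comment> \<open>The set where \<open>f\<close> exceeds \<open>g\<close> lies in \<open>C\<close>
    and can itself be tested: a nonnegative difference with integral zero vanishes.\<close>
  define A where "A = {x \<in> space M. g x < f x}"
  have "{x \<in> space (sigma (space M) C). g x < f x} \<in> sets (sigma (space M) C)"
    by (rule borel_measurable_less[OF g(1) f(1)])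
  then have AC: "A \<in> C" unfolding A_def sC .
  then have Am: "A \<in> sets M" using sC(3) by blast
  have i: "integrable M (\<lambda>x. indicator A x * f x)" "integrable M (\<lambda>x. indicator A x * g x)"
    using integrable_mult_indicator[OF Am f(2)] integrable_mult_indicator[OF Am g(2)] by simp_all
  have "(\<integral>x. indicator A x * f x - indicator A x * g x \<partial>M) = 0"
    using eq[OF AC] by (subst Bochner_Integration.integral_diff[OF i]) simp
  moreover have "AE x in M. 0 \<le> indicator A x * f x - indicator A x * g x"
    by (rule AE_I2) (auto simp: A_def indicator_def)
  ultimately have "AE x in M. indicator A x * f x - indicator A x * g x = 0"
    using integral_nonneg_eq_0_iff_AE[OF Bochner_Integration.integrable_diff[OF i]] by blast
  then show ?thesis
  proof (rule AE_mp, intro AE_I2 impI)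
    fix x assume "x \<in> space M" and "indicator A x * f x - indicator A x * g x = 0"
    then show "f x \<le> g x" by (cases "x \<in> A") (auto simp: A_def)
  qed
qed

text \<open>The part of the relation between a graphon and its quotient that survives without
  conditional expectations: \<open>V\<close> knows the degrees of \<open>W\<close> into preimages of
  sets of \<open>N\<close>. It holds for pull-backs as well and is enough to compare class sizes and
  degree deviations.\<close>

definition degree_model ::
    "'a measure \<Rightarrow> ('a \<times> 'a \<Rightarrow> real) \<Rightarrow> 'b measure \<Rightarrow> ('b \<times> 'b \<Rightarrow> real) \<Rightarrow> ('a \<Rightarrow> 'b) \<Rightarrow> bool" where
  "degree_model M W N V r \<longleftrightarrow> r \<in> M \<rightarrow>\<^sub>M N \<and> distr M N r = N \<and>
     (\<forall>B\<in>sets N. AE x in M. (\<integral>y. indicator B (r y) * W (x, y) \<partial>M) = (\<integral>z. indicator B z * V (r x, z) \<partial>N))"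

lemma integrable_degree:
  fixes W :: "'a \<times> 'a \<Rightarrow> real"
  assumes M: "prob_space M" and W: "W \<in> borel_measurable (M \<Otimes>\<^sub>M M)" "\<And>z. z \<in> space (M \<Otimes>\<^sub>M M) \<Longrightarrow> \<bar>W z\<bar> \<le> 1"
    and B: "B \<in> sets M"
  shows "integrable M (\<lambda>x. \<integral>y. indicator B y * W (x, y) \<partial>M)"
proof -
  interpret M: prob_space M by (rule M)
  interpret P: pair_prob_space M M by (rule M.pair_prob_space_self)
  have "(\<lambda>z. indicator (space M \<times> B) z * W z) \<in> borel_measurable (M \<Otimes>\<^sub>M M)"
    by (intro borel_measurable_times borel_measurable_indicator W(1) pair_measureI B sets.top)
  moreover have "\<bar>indicator (space M \<times> B) z * W z\<bar> \<le> 1" if "z \<in> space (M \<Otimes>\<^sub>M M)" for z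
    using W(2)[OF that] by (auto simp: indicator_def)
  ultimately have "integrable (M \<Otimes>\<^sub>M M) (\<lambda>z. indicator (space M \<times> B) z * W z)"
    by (rule M.integrable_bounded_pair)
  then have "integrable M (\<lambda>x. \<integral>y. indicator (space M \<times> B) (x, y) * W (x, y) \<partial>M)"
    by (rule P.integrable_fst')
  also have "?this \<longleftrightarrow> ?thesis"
    by (intro Bochner_Integration.integrable_cong refl Bochner_Integration.integral_cong) (auto simp: indicator_def)
  finally show ?thesis .
qed

text \<open>Conditional expectation preserves integrals over rectangles with sides in
  \<open>C\<close>, hence the integrals of the degree function over members of \<open>C\<close>.
  Invariance makes that function itself \<open>C\<close>-measurable, so equal integrals become
  equality almost everywhere.\<close>

lemma degree_modelI:
  fixes W :: "'a \<times> 'a \<Rightarrow> real" and V :: "'b \<times> 'b \<Rightarrow> real"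
  assumes M: "prob_space M" and W: "W \<in> borel_measurable (M \<Otimes>\<^sub>M M)" "\<And>z. z \<in> space (M \<Otimes>\<^sub>M M) \<Longrightarrow> \<bar>W z\<bar> \<le> 1"
    and C: "sub_sigma_algebra M C"
    and inv: "\<And>B. B \<in> C \<Longrightarrow> (\<lambda>x. \<integral>y. W (x, y) * indicator B y \<partial>M) \<in> borel_measurable (sigma (space M) C)"
    and N: "prob_space N" and r: "r \<in> M \<rightarrow>\<^sub>M N" "distr M N r = N"
    and V: "V \<in> borel_measurable (N \<Otimes>\<^sub>M N)" "\<And>z. z \<in> space (N \<Otimes>\<^sub>M N) \<Longrightarrow> \<bar>V z\<bar> \<le> 1"
    and rC: "\<And>h :: 'b \<Rightarrow> real. h \<in> borel_measurable N \<Longrightarrow> (\<lambda>x. h (r x)) \<in> borel_measurable (sigma (space M) C)"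
    and ae: "AE z in M \<Otimes>\<^sub>M M. pull_back V r z =
      real_cond_exp (M \<Otimes>\<^sub>M M) (sigma (space M) C \<Otimes>\<^sub>M sigma (space M) C) W z"
  shows "degree_model M W N V r"
  unfolding degree_model_def
proof (intro conjI r ballI)
  fix B assume B: "B \<in> sets N"
  interpret M: prob_space M by (rule M)
  interpret N: prob_space N by (rule N)
  interpret P: pair_prob_space M M by (rule M.pair_prob_space_self)
  note sC = space_sets_sub_sigma[OF C]
  define S where "S = sigma (space M) C \<Otimes>\<^sub>M sigma (space M) C"
  have subalg: "subalgebra (M \<Otimes>\<^sub>M M) S"
    unfolding subalgebra_def S_def
  proof
    show "space (sigma (space M) C \<Otimes>\<^sub>M sigma (space M) C) = space (M \<Otimes>\<^sub>M M)"
      by (simp only: space_pair_measure sC)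
    show "sets (sigma (space M) C \<Otimes>\<^sub>M sigma (space M) C) \<subseteq> sets (M \<Otimes>\<^sub>M M)"
      unfolding sets_pair_measure sC by (rule sigma_sets_mono') (use sC(3) in blast)
  qed
  interpret S: finite_measure_subalgebra "M \<Otimes>\<^sub>M M" S by unfold_locales (rule subalg)
  define Q where "Q = r -` B \<inter> space M"
  have QC: "Q \<in> C"
  proof -
    have "(\<lambda>x. indicator B (r x) :: real) \<in> borel_measurable (sigma (space M) C)"
      by (rule rC) (rule borel_measurable_indicator[OF B])
    then have "(\<lambda>x. indicator B (r x) :: real) -` {1} \<inter> space (sigma (space M) C) \<in> sets (sigma (space M) C)"
      by (rule measurable_sets) simp
    moreover have "(\<lambda>x. indicator B (r x) :: real) -` {1} \<inter> space M = Q" by (auto simp: Q_def indicator_def)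
    ultimately show ?thesis by (simp only: sC)
  qed
  then have Qm: "Q \<in> sets M" using sC(3) by blast
  define f where "f x = (\<integral>y. indicator Q y * W (x, y) \<partial>M)" for x
  define h where "h z' = (\<integral>z. indicator B z * V (z', z) \<partial>N)" for z'
  have fC: "f \<in> borel_measurable (sigma (space M) C)"
    using inv[OF QC] unfolding f_def[abs_def] by (simp only: mult.commute)
  have "(\<lambda>z'. \<integral>z. indicator (space N \<times> B) (z', z) * V (z', z) \<partial>N) \<in> borel_measurable N"
    by (rule N.borel_measurable_lebesgue_integral) (use V(1) B in \<open>simp add: case_prod_beta'\<close>)
  moreover have "(\<integral>z. indicator (space N \<times> B) (z', z) * V (z', z) \<partial>N) = h z'" if "z' \<in> space N" for z'
    unfolding h_def using that by (intro Bochner_Integration.integral_cong) (auto simp: indicator_def)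
  ultimately have hm: "h \<in> borel_measurable N" by (simp cong: measurable_cong)
  have pm: "pull_back V r \<in> borel_measurable (M \<Otimes>\<^sub>M M)" by (rule pull_back_measurable[OF V(1) r(1)])
  have pb: "\<bar>pull_back V r z\<bar> \<le> 1" if z: "z \<in> space (M \<Otimes>\<^sub>M M)" for z
  proof -
    obtain x y where xy: "z = (x, y)" "x \<in> space M" "y \<in> space M"
      using z unfolding space_pair_measure by blast
    have "(r x, r y) \<in> space (N \<Otimes>\<^sub>M N)"
      using measurable_space[OF r(1) xy(2)] measurable_space[OF r(1) xy(3)] by (simp add: space_pair_measure)
    from V(2)[OF this] show ?thesis unfolding xy(1) pull_back_def by simp
  qed
  have hr: "h (r x) = (\<integral>y. indicator Q y * pull_back V r (x, y) \<partial>M)" if x: "x \<in> space M" for x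
  proof -
    have rx: "r x \<in> space N" by (rule measurable_space[OF r(1) x])
    have "(\<lambda>z. indicator B z * V (r x, z)) \<in> borel_measurable N"
      using V(1) B rx by simp
    from integral_distr[OF r(1) this]
    have "h (r x) = (\<integral>y. indicator B (r y) * V (r x, r y) \<partial>M)" unfolding r(2) h_def .
    also have "\<dots> = (\<integral>y. indicator Q y * pull_back V r (x, y) \<partial>M)"
      by (rule Bochner_Integration.integral_cong) (auto simp: Q_def indicator_def pull_back_def)
    finally show ?thesis .
  qed
  have fi: "integrable M f" unfolding f_def[abs_def] by (rule integrable_degree[OF M W Qm])
  have "integrable M (\<lambda>x. h (r x)) \<longleftrightarrow> integrable M (\<lambda>x. \<integral>y. indicator Q y * pull_back V r (x, y) \<partial>M)"
    by (rule Bochner_Integration.integrable_cong) (simp_all add: hr)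
  then have hi: "integrable M (\<lambda>x. h (r x))" using integrable_degree[OF M pm pb Qm] by simp
  have eq: "(\<integral>x. indicator A x * f x \<partial>M) = (\<integral>x. indicator A x * h (r x) \<partial>M)" if A: "A \<in> C" for A
  proof -
    have Am: "A \<in> sets M" using A sC(3) by blast
    have AQ: "A \<times> Q \<in> sets S" unfolding S_def by (rule pair_measureI) (use A QC in \<open>simp_all add: sC\<close>)
    have AQm: "A \<times> Q \<in> sets (M \<Otimes>\<^sub>M M)" by (rule pair_measureI[OF Am Qm])
    have "(\<integral>x. indicator A x * f x \<partial>M) = rect_integral M W A Q"
      unfolding f_def by (rule M.rect_integral_fubini[OF W Am Qm, symmetric])
    also have "\<dots> = rect_integral M (real_cond_exp (M \<Otimes>\<^sub>M M) S W) A Q"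
      by (rule S.real_cond_exp_intA[OF M.integrable_bounded_pair[OF W] AQ])
    also have "\<dots> = rect_integral M (pull_back V r) A Q"
      by (rule set_lebesgue_integral_cong_AE) (use ae AQm pm in \<open>auto simp: S_def\<close>)
    also have "\<dots> = (\<integral>x. indicator A x * (\<integral>y. indicator Q y * pull_back V r (x, y) \<partial>M) \<partial>M)"
      by (rule M.rect_integral_fubini[OF pm pb Am Qm])
    also have "\<dots> = (\<integral>x. indicator A x * h (r x) \<partial>M)"
      by (rule Bochner_Integration.integral_cong) (simp_all add: hr)
    finally show ?thesis .
  qed
  have "AE x in M. f x \<le> h (r x)" by (rule AE_le_of_integrals_eq[OF C fC fi rC[OF hm] hi eq])
  moreover have "AE x in M. h (r x) \<le> f x" by (rule AE_le_of_integrals_eq[OF C rC[OF hm] hi fC fi eq[symmetric]])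
  moreover have "(\<integral>y. indicator B (r y) * W (x, y) \<partial>M) = f x" for x
    unfolding f_def by (rule Bochner_Integration.integral_cong) (auto simp: Q_def indicator_def)
  ultimately show "AE x in M. (\<integral>y. indicator B (r y) * W (x, y) \<partial>M) = (\<integral>z. indicator B z * V (r x, z) \<partial>N)"
    unfolding h_def[symmetric] by (auto intro: order.antisym)
qed

lemma degree_model_pull_back:
  assumes W: "W \<in> borel_measurable (N \<Otimes>\<^sub>M N)" and p: "p \<in> M \<rightarrow>\<^sub>M N" "distr M N p = N"
  shows "degree_model M (pull_back W p) N W p"
  unfolding degree_model_def
proof (intro conjI p ballI AE_I2)
  fix B x assume B: "B \<in> sets N" and x: "x \<in> space M"
  have "p x \<in> space N" by (rule measurable_space[OF p(1) x])
  then have "(\<lambda>z. indicator B z * W (p x, z)) \<in> borel_measurable N" using W B by simp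
  from integral_distr[OF p(1) this]
  show "(\<integral>y. indicator B (p y) * pull_back W p (x, y) \<partial>M) = (\<integral>z. indicator B z * W (p x, z) \<partial>N)"
    unfolding p(2) pull_back_def by simp
qed

text \<open>For classes pulled back from \<open>N\<close>, sizes and deviations are integrals over
  \<open>N\<close> in which \<open>W\<close> no longer occurs. Graphons with a common model
  therefore share them.\<close>

lemma degree_model_values:
  fixes W :: "'a \<times> 'a \<Rightarrow> real" and V :: "'b \<times> 'b \<Rightarrow> real" and q :: "'a \<Rightarrow> nat" and c :: real
  assumes M: "prob_space M" and N: "prob_space N" and dm: "degree_model M W N V r"
    and W: "W \<in> borel_measurable (M \<Otimes>\<^sub>M M)" and V: "V \<in> borel_measurable (N \<Otimes>\<^sub>M N)"
    and \<rho>: "\<rho> \<in> N \<rightarrow>\<^sub>M count_space UNIV" and q: "q \<in> M \<rightarrow>\<^sub>M count_space UNIV"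
    and qr: "AE x in M. q x = \<rho> (r x)"
  shows "measure M {x \<in> space M. q x = i} = measure N {z \<in> space N. \<rho> z = i}"
    and "(\<integral>x. indicator {x \<in> space M. q x = i} x *
        \<bar>(\<integral>y. indicator {x \<in> space M. q x = j} y * W (x, y) \<partial>M) - c\<bar> \<partial>M) =
      (\<integral>x. indicator {x \<in> space N. \<rho> x = i} x *
        \<bar>(\<integral>y. indicator {x \<in> space N. \<rho> x = j} y * V (x, y) \<partial>N) - c\<bar> \<partial>N)"
proof -
  interpret M: prob_space M by (rule M)
  interpret N: prob_space N by (rule N)
  have r: "r \<in> M \<rightarrow>\<^sub>M N" "distr M N r = N" using dm by (auto simp: degree_model_def)
  define B where "B i = {z \<in> space N. \<rho> z = i}" for i
  define Q where "Q i = {x \<in> space M. q x = i}" for i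
  have Bm: "B i \<in> sets N" for i
    using measurable_sets[OF \<rho>, of "{i}"] unfolding B_def by (simp add: vimage_def Int_def conj_commute)
  have Qm: "Q i \<in> sets M" for i
    using measurable_sets[OF q, of "{i}"] unfolding Q_def by (simp add: vimage_def Int_def conj_commute)
  have ind: "AE x in M. (indicator (Q i) x :: real) = indicator (B i) (r x)" for i
    using qr by (rule AE_mp) (use measurable_space[OF r(1)] in \<open>auto simp: Q_def B_def indicator_def\<close>)
  have rBm: "r -` B i \<inter> space M \<in> sets M" for i by (rule measurable_sets[OF r(1) Bm])
  have "measure M (Q i) = measure M (r -` B i \<inter> space M)"
  proof (rule M.finite_measure_eq_AE[OF _ Qm rBm])
    show "AE x in M. x \<in> Q i \<longleftrightarrow> x \<in> r -` B i \<inter> space M"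
      using ind[of i] by (rule AE_mp) (auto simp: Q_def indicator_def split: if_splits)
  qed
  also have "\<dots> = measure N (B i)" using measure_distr[OF r(1) Bm, of i] by (simp add: r(2))
  finally show "measure M {x \<in> space M. q x = i} = measure N {z \<in> space N. \<rho> z = i}" unfolding Q_def B_def .
  define H where "H z = indicator (B i) z * \<bar>(\<integral>z'. indicator (B j) z' * V (z, z') \<partial>N) - c\<bar>" for z
  have vm: "(\<lambda>z'. \<integral>z. indicator (B j) z * V (z', z) \<partial>N) \<in> borel_measurable N"
    by (rule N.borel_measurable_lebesgue_integral) (use V Bm in \<open>simp add: case_prod_beta'\<close>)
  then have Hm: "H \<in> borel_measurable N"
    unfolding H_def[abs_def] using Bm by (intro borel_measurable_times borel_measurable_indicator borel_measurable_abs borel_measurable_diff borel_measurable_const)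
  have wm: "(\<lambda>x. \<integral>y. indicator (Q j) y * W (x, y) \<partial>M) \<in> borel_measurable M"
    by (rule M.borel_measurable_lebesgue_integral) (use W Qm in \<open>simp add: case_prod_beta'\<close>)
  have inner: "(\<integral>y. indicator (Q j) y * W (x, y) \<partial>M) = (\<integral>y. indicator (B j) (r y) * W (x, y) \<partial>M)" if "x \<in> space M" for x
  proof (rule integral_cong_AE)
    show "(\<lambda>y. indicator (Q j) y * W (x, y)) \<in> borel_measurable M" using Qm W that by simp
    have "(\<lambda>y. indicator (B j) (r y) :: real) \<in> borel_measurable M"
      by (rule measurable_compose[OF r(1) borel_measurable_indicator[OF Bm]])
    then show "(\<lambda>y. indicator (B j) (r y) * W (x, y)) \<in> borel_measurable M" using W that by simp
    show "AE y in M. indicator (Q j) y * W (x, y) = indicator (B j) (r y) * W (x, y)"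
      using ind[of j] by (rule AE_mp) simp
  qed
  have "AE x in M. (\<integral>y. indicator (B j) (r y) * W (x, y) \<partial>M) = (\<integral>z. indicator (B j) z * V (r x, z) \<partial>N)"
    using dm Bm unfolding degree_model_def by blast
  then have "AE x in M. indicator (Q i) x * \<bar>(\<integral>y. indicator (Q j) y * W (x, y) \<partial>M) - c\<bar> = H (r x)"
  proof (rule AE_mp)
    show "AE x in M. (\<integral>y. indicator (B j) (r y) * W (x, y) \<partial>M) = (\<integral>z. indicator (B j) z * V (r x, z) \<partial>N) \<longrightarrow>
      indicator (Q i) x * \<bar>(\<integral>y. indicator (Q j) y * W (x, y) \<partial>M) - c\<bar> = H (r x)"
      using ind[of i] by (rule AE_mp) (intro AE_I2 impI, simp add: H_def inner)
  qed
  then have "(\<integral>x. indicator (Q i) x * \<bar>(\<integral>y. indicator (Q j) y * W (x, y) \<partial>M) - c\<bar> \<partial>M) = (\<integral>x. H (r x) \<partial>M)"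
    using wm Qm Hm r(1)
    by (intro integral_cong_AE borel_measurable_times borel_measurable_indicator borel_measurable_abs borel_measurable_diff borel_measurable_const
      measurable_compose[OF r(1) Hm])
  also have "\<dots> = (\<integral>z. H z \<partial>N)" using integral_distr[OF r(1) Hm] by (simp add: r(2))
  finally show "(\<integral>x. indicator {x \<in> space M. q x = i} x *
        \<bar>(\<integral>y. indicator {x \<in> space M. q x = j} y * W (x, y) \<partial>M) - c\<bar> \<partial>M) =
      (\<integral>x. indicator {x \<in> space N. \<rho> x = i} x *
        \<bar>(\<integral>y. indicator {x \<in> space N. \<rho> x = j} y * V (x, y) \<partial>N) - c\<bar> \<partial>N)"
    unfolding H_def Q_def B_def .
qed

text \<open>A graphon models the degrees of its pull-backs, so sizes and deviations are unchanged.
  This brings every graphon, with or without atoms, to the unit interval.\<close>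

lemma near_regular_pull_back:
  assumes M: "prob_space M" and N: "prob_space N" and NR: "near_regular N W q k a s \<eta>"
    and p: "p \<in> M \<rightarrow>\<^sub>M N" "distr M N p = N"
  shows "near_regular M (pull_back W p) (\<lambda>x. q (p x)) k a s \<eta>"
proof -
  have W: "W \<in> borel_measurable (N \<Otimes>\<^sub>M N)"
    "\<And>x y. x \<in> space N \<Longrightarrow> y \<in> space N \<Longrightarrow> W (x, y) = W (y, x) \<and> 0 \<le> W (x, y) \<and> W (x, y) \<le> 1"
    and q: "q \<in> N \<rightarrow>\<^sub>M count_space UNIV" "\<And>x. x \<in> space N \<Longrightarrow> q x < k"
    "\<And>i. i < k \<Longrightarrow> measure N {x \<in> space N. q x = i} = a i"
    and d: "(\<Sum>i<k. \<Sum>j<k. \<integral>x. indicator {x \<in> space N. q x = i} x *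
        \<bar>(\<integral>y. indicator {x \<in> space N. q x = j} y * W (x, y) \<partial>N) - s i j * a j\<bar> \<partial>N) \<le> \<eta>"
    using NR unfolding near_regular_def by blast+
  have pm: "pull_back W p \<in> borel_measurable (M \<Otimes>\<^sub>M M)" by (rule pull_back_measurable[OF W(1) p(1)])
  have qp: "(\<lambda>x. q (p x)) \<in> M \<rightarrow>\<^sub>M count_space UNIV" by (rule measurable_compose[OF p(1) q(1)])
  note vals = degree_model_values[OF M N degree_model_pull_back[OF W(1) p] pm W(1) q(1) qp AE_I2[OF refl]]
  have "measure M {x \<in> space M. q (p x) = i} = a i" if "i < k" for i
    using q(3)[OF that] unfolding vals(1) .
  moreover have "q (p x) < k" if "x \<in> space M" for x
    using q(2) measurable_space[OF p(1) that] by blast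
  moreover have "pull_back W p (x, y) = pull_back W p (y, x) \<and> 0 \<le> pull_back W p (x, y) \<and> pull_back W p (x, y) \<le> 1"
    if "x \<in> space M" "y \<in> space M" for x y
    using W(2)[OF measurable_space[OF p(1) that(1)] measurable_space[OF p(1) that(2)]] by (simp add: pull_back_def)
  ultimately show ?thesis unfolding near_regular_def vals(2) using pm qp d by blast
qed

text \<open>Both graphons are compared with the same \<open>V\<close>. The given classes are a
  function \<open>\<rho>\<close> of the quotient point almost everywhere, and \<open>\<rho>\<close>
  composed with the other quotient map defines classes there with identical numbers.\<close>

lemma near_regular_transfer:
  fixes M :: "'a measure" and M' :: "'c measure" and N :: "'b measure"
  assumes M: "prob_space M" and M': "prob_space M'" and N: "prob_space N"
    and NR: "near_regular M W q k a s \<eta>" and dm: "degree_model M W N V r" and dm': "degree_model M' W' N V r'"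
    and V: "V \<in> borel_measurable (N \<Otimes>\<^sub>M N)"
    and \<rho>: "\<rho> \<in> N \<rightarrow>\<^sub>M count_space UNIV" "\<And>z. \<rho> z < k" and qr: "AE x in M. q x = \<rho> (r x)"
    and W': "W' \<in> borel_measurable (M' \<Otimes>\<^sub>M M')"
      "\<And>x y. x \<in> space M' \<Longrightarrow> y \<in> space M' \<Longrightarrow> W' (x, y) = W' (y, x) \<and> 0 \<le> W' (x, y) \<and> W' (x, y) \<le> 1"
  shows "near_regular M' W' (\<lambda>x. \<rho> (r' x)) k a s \<eta>"
proof -
  have W: "W \<in> borel_measurable (M \<Otimes>\<^sub>M M)" and q: "q \<in> M \<rightarrow>\<^sub>M count_space UNIV"
    and qa: "\<And>i. i < k \<Longrightarrow> measure M {x \<in> space M. q x = i} = a i"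
    and d: "(\<Sum>i<k. \<Sum>j<k. \<integral>x. indicator {x \<in> space M. q x = i} x *
        \<bar>(\<integral>y. indicator {x \<in> space M. q x = j} y * W (x, y) \<partial>M) - s i j * a j\<bar> \<partial>M) \<le> \<eta>"
    using NR unfolding near_regular_def by blast+
  have r': "r' \<in> M' \<rightarrow>\<^sub>M N" using dm' unfolding degree_model_def by blast
  have q': "(\<lambda>x. \<rho> (r' x)) \<in> M' \<rightarrow>\<^sub>M count_space UNIV" by (rule measurable_compose[OF r' \<rho>(1)])
  note v = degree_model_values[OF M N dm W V \<rho>(1) q qr]
  note v' = degree_model_values[OF M' N dm' W'(1) V \<rho>(1) q' AE_I2[OF refl]]
  have "measure M' {x \<in> space M'. \<rho> (r' x) = i} = a i" if "i < k" for i
    using qa[OF that] unfolding v(1) v'(1) .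
  moreover note d[unfolded v(2)]
  ultimately show ?thesis unfolding near_regular_def v'(2)
    using W' q' \<rho>(2) by blast
qed

lemma invariant_algebra_indicator:
  assumes M: "prob_space (base W)" and C: "sub_sigma_algebra (base W) C" and inv: "invariant_algebra W C" and B: "B \<in> C"
  shows "(\<lambda>x. \<integral>y. kernel W (x, y) * indicator B y \<partial>base W) \<in> borel_measurable (sigma (space (base W)) C)"
proof -
  interpret prob_space "base W" by (rule M)
  note sC = space_sets_sub_sigma[OF C]
  have "(indicator B :: _ \<Rightarrow> real) \<in> borel_measurable (sigma (space (base W)) C)"
    by (rule borel_measurable_indicator) (simp add: sC B)
  moreover have "(\<lambda>x. (indicator B x :: real)\<^sup>2) = indicator B" by (auto simp: indicator_def)
  then have "integrable (base W) (\<lambda>x. (indicator B x :: real)\<^sup>2)"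
    using B sC(3) by (auto intro!: integrable_real_indicator simp: less_top[symmetric])
  ultimately have "graphon_operator W (indicator B) \<in> borel_measurable (sigma (space (base W)) C)"
    using inv unfolding invariant_algebra_def by blast
  then show ?thesis unfolding graphon_operator_def .
qed

lemma is_graphonD:
  assumes "is_graphon G"
  shows "prob_space (base G)" "kernel G \<in> borel_measurable (base G \<Otimes>\<^sub>M base G)"
    "\<And>x y. x \<in> space (base G) \<Longrightarrow> y \<in> space (base G) \<Longrightarrow>
      kernel G (x, y) = kernel G (y, x) \<and> 0 \<le> kernel G (x, y) \<and> kernel G (x, y) \<le> 1"
    "\<And>z. z \<in> space (base G \<Otimes>\<^sub>M base G) \<Longrightarrow> \<bar>kernel G z\<bar> \<le> 1"
  using assms unfolding is_graphon_def standard_probability_space_def by (auto simp: space_pair_measure)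

text \<open>Composing the second quotient map with the isomorphism of the quotients gives both
  graphons one common degree model. A \<open>C\<close>-measurable partition is a partition of the
  quotient up to null sets and can be pulled back to the other graphon.\<close>

lemma near_regular_fractionally_isomorphic:
  fixes U0 :: "'a graphon" and U :: "'c graphon"
  assumes U0: "is_graphon U0" and U: "is_graphon U" and fi: "fractionally_isomorphic U0 U"
    and min: "minimum_invariant_subalgebra U0 C"
    and NR: "near_regular (base U0) (kernel U0) q k a s \<eta>"
    and q: "q \<in> sigma (space (base U0)) C \<rightarrow>\<^sub>M count_space UNIV"
  shows "\<exists>q'. near_regular (base U) (kernel U) q' k a s \<eta>"
proof -
  obtain C' D and Q Q' :: "real graphon" where d: "minimum_invariant_subalgebra U0 C'" "quotient_graphon U0 C' Q"
    "minimum_invariant_subalgebra U D" "quotient_graphon U D Q'" "isomorphic_graphons Q Q'"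
    using fi unfolding fractionally_isomorphic_def by blast
  \<comment> \<open>The minimum is unique, so the algebra witnessing fractional isomorphism is the
    one from which the partition was taken.\<close>
  have "C' = C" using d(1) min unfolding minimum_invariant_subalgebra_def by blast
  note d2 = d(2)[unfolded this]
  define N V where "N = base Q" and "V = kernel Q"
  have Q: "is_graphon Q" "is_graphon Q'" using d(2,4) unfolding quotient_graphon_def by blast+
  note gU0 = is_graphonD[OF U0] note gU = is_graphonD[OF U] note gQ = is_graphonD[OF Q(1), folded N_def V_def] note gQ' = is_graphonD[OF Q(2)]
  obtain r where r: "quotient_space (base U0) C N r" "AE z in base U0 \<Otimes>\<^sub>M base U0. pull_back V r z =
      real_cond_exp (base U0 \<Otimes>\<^sub>M base U0) (sigma (space (base U0)) C \<Otimes>\<^sub>M sigma (space (base U0)) C) (kernel U0) z"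
    using d2 unfolding quotient_graphon_def N_def V_def by blast
  obtain r1 where r1: "quotient_space (base U) D (base Q') r1" "AE z in base U \<Otimes>\<^sub>M base U. pull_back (kernel Q') r1 z =
      real_cond_exp (base U \<Otimes>\<^sub>M base U) (sigma (space (base U)) D \<Otimes>\<^sub>M sigma (space (base U)) D) (kernel U) z"
    using d(4) unfolding quotient_graphon_def by blast
  obtain f where f: "measure_preserving_bij (base Q') N f" "AE z in base Q' \<Otimes>\<^sub>M base Q'. pull_back V f z = kernel Q' z"
    using d(5) unfolding isomorphic_graphons_def N_def V_def by blast
  have f': "f \<in> base Q' \<rightarrow>\<^sub>M N" "distr (base Q') N f = N"
    using f(1) unfolding measure_preserving_bij_def measure_preserving_map_def by blast+
  have rr: "r \<in> base U0 \<rightarrow>\<^sub>M N" "distr (base U0) N r = N"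
    and rq: "\<And>h :: 'a \<Rightarrow> real. h \<in> borel_measurable (base U0) \<Longrightarrow> h \<in> borel_measurable (sigma (space (base U0)) C) \<longleftrightarrow>
        (\<exists>g\<in>borel_measurable N. AE x in base U0. h x = g (r x))"
    using r(1) unfolding quotient_space_def measure_preserving_map_def by blast+
  have rr1: "r1 \<in> base U \<rightarrow>\<^sub>M base Q'" "distr (base U) (base Q') r1 = base Q'"
    and rq1: "\<And>h :: 'c \<Rightarrow> real. h \<in> borel_measurable (base U) \<Longrightarrow> h \<in> borel_measurable (sigma (space (base U)) D) \<longleftrightarrow>
        (\<exists>g\<in>borel_measurable (base Q'). AE x in base U. h x = g (r1 x))"
    using r1(1) unfolding quotient_space_def measure_preserving_map_def by blast+
  have C: "sub_sigma_algebra (base U0) C" "invariant_algebra U0 C" and D: "sub_sigma_algebra (base U) D" "invariant_algebra U D"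
    using min d(3) unfolding minimum_invariant_subalgebra_def invariant_complete_subalgebra_def by blast+
  have dm: "degree_model (base U0) (kernel U0) N V r"
  proof (rule degree_modelI[OF gU0(1,2,4) C(1) invariant_algebra_indicator[OF gU0(1) C] gQ(1) rr gQ(2,4) _ r(2)])
    fix h :: "real \<Rightarrow> real" assume h: "h \<in> borel_measurable N"
    show "(\<lambda>x. h (r x)) \<in> borel_measurable (sigma (space (base U0)) C)"
      unfolding rq[OF measurable_compose[OF rr(1) h]] by (rule bexI[of _ h]) (simp_all add: h)
  qed
  define r' where "r' x = f (r1 x)" for x
  have r': "r' \<in> base U \<rightarrow>\<^sub>M N" unfolding r'_def[abs_def] by (rule measurable_compose[OF rr1(1) f'(1)])
  have r'd: "distr (base U) N r' = N"
  proof -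
    have "distr (distr (base U) (base Q') r1) N f = distr (base U) N (f \<circ> r1)" by (rule distr_distr[OF f'(1) rr1(1)])
    then show ?thesis unfolding rr1(2) f'(2) r'_def[abs_def] comp_def by simp
  qed
  have ae': "AE z in base U \<Otimes>\<^sub>M base U. pull_back V r' z =
      real_cond_exp (base U \<Otimes>\<^sub>M base U) (sigma (space (base U)) D \<Otimes>\<^sub>M sigma (space (base U)) D) (kernel U) z"
  proof -
    have m: "(\<lambda>(x, y). (r1 x, r1 y)) \<in> base U \<Otimes>\<^sub>M base U \<rightarrow>\<^sub>M base Q' \<Otimes>\<^sub>M base Q'" using rr1(1) by simp
    have "AE z in distr (base U \<Otimes>\<^sub>M base U) (base Q' \<Otimes>\<^sub>M base Q') (\<lambda>(x, y). (r1 x, r1 y)). pull_back V f z = kernel Q' z"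
      unfolding distr_pair_self[OF gQ'(1) rr1] by (rule f(2))
    from AE_distrD[OF m this] r1(2) show ?thesis
    proof eventually_elim
      case (elim z)
      then show ?case by (cases z) (simp add: pull_back_def r'_def)
    qed
  qed
  have dm': "degree_model (base U) (kernel U) N V r'"
  proof (rule degree_modelI[OF gU(1,2,4) D(1) invariant_algebra_indicator[OF gU(1) D] gQ(1) r' r'd gQ(2,4) _ ae'])
    fix h :: "real \<Rightarrow> real" assume h: "h \<in> borel_measurable N"
    show "(\<lambda>x. h (r' x)) \<in> borel_measurable (sigma (space (base U)) D)"
    proof -
      have m: "(\<lambda>x. h (f (r1 x))) \<in> borel_measurable (base U)" using measurable_compose[OF r' h] unfolding r'_def .
      show ?thesis unfolding r'_def rq1[OF m]
        by (rule bexI[of _ "\<lambda>z. h (f z)"]) (simp_all add: measurable_compose[OF f'(1) h])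
    qed
  qed
  interpret P0: prob_space "base U0" by (rule gU0(1))
  have qk: "\<And>x. x \<in> space (base U0) \<Longrightarrow> q x < k" and qm: "q \<in> base U0 \<rightarrow>\<^sub>M count_space UNIV"
    using NR unfolding near_regular_def by blast+
  have k0: "k > 0" using qk P0.not_empty by (metis ex_in_conv gr_zeroI less_nat_zero_code)
  have rm: "real \<in> count_space UNIV \<rightarrow>\<^sub>M borel" by simp
  have "(\<lambda>x. real (q x)) \<in> borel_measurable (sigma (space (base U0)) C)" by (rule measurable_compose[OF q rm])
  then obtain g where g: "g \<in> borel_measurable N" "AE x in base U0. real (q x) = g (r x)"
    unfolding rq[OF measurable_compose[OF qm rm]] by blast
  \<comment> \<open>\<open>g\<close> is real-valued and describes the classes only almost
    everywhere; the floor and the cap at \<open>k - 1\<close> make every value a class index without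
    changing it where \<open>g\<close> already is one.\<close>
  define \<rho> where "\<rho> z = min (nat \<lfloor>g z\<rfloor>) (k - 1)" for z
  have \<rho>: "\<rho> \<in> N \<rightarrow>\<^sub>M count_space UNIV"
    unfolding \<rho>_def[abs_def]
    by (rule measurable_compose[OF measurable_compose[OF g(1) measurable_real_floor], of "\<lambda>i. min (nat i) (k - 1)"]) simp
  have \<rho>k: "\<rho> z < k" for z using k0 unfolding \<rho>_def by auto
  have "AE x in base U0. q x = \<rho> (r x)"
    using g(2)
  proof (rule AE_mp, intro AE_I2 impI)
    fix x assume x: "x \<in> space (base U0)" "real (q x) = g (r x)"
    then show "q x = \<rho> (r x)" using qk[OF x(1)] unfolding \<rho>_def x(2)[symmetric] by simp
  qed
  then have "near_regular (base U) (kernel U) (\<lambda>x. \<rho> (r' x)) k a s \<eta>"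
    by (rule near_regular_transfer[OF gU0(1) gU(1) gQ(1) NR dm dm' gQ(2) \<rho> \<rho>k _ gU(2,3)])
  then show ?thesis by (rule exI[of _ "\<lambda>x. \<rho> (r' x)"])
qed

section \<open>From common degrees to the family of graphs\<close>

lemma same_degrees_fractionally_isomorphic:
  fixes V :: "'v set" and grp :: "'v \<Rightarrow> 'i" and D :: "'i \<Rightarrow> 'i \<Rightarrow> nat"
  assumes V: "finite V"
    and G: "\<And>u j. u \<in> V \<Longrightarrow> degree_into G u {v \<in> V. grp v = j} = D (grp u) j"
    and G': "\<And>u j. u \<in> V \<Longrightarrow> degree_into G' u {v \<in> V. grp v = j} = D (grp u) j"
  shows "fractionally_isomorphic_graphs V G V G'"
proof -
  \<comment> \<open>Parts of an equitable partition must be nonempty, so only the labels that occur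
    on \<open>V\<close> are enumerated.\<close>
  define k where "k = card (grp ` V)"
  obtain e where e: "bij_betw e {1..k} (grp ` V)"
    using ex_bij_betw_nat_finite_1[of "grp ` V"] V unfolding k_def by auto
  define P where "P i = {v \<in> V. grp v = e i}" for i
  have part: "indexed_partition V k P"
    unfolding indexed_partition_def
  proof (intro conjI ballI)
    show "(\<Union>i\<in>{1..k}. P i) = V"
    proof
      show "V \<subseteq> (\<Union>i\<in>{1..k}. P i)"
      proof
        fix v assume v: "v \<in> V"
        then have "grp v \<in> e ` {1..k}" using e unfolding bij_betw_def by blast
        then obtain i where "i \<in> {1..k}" "grp v = e i" by (elim imageE)
        then show "v \<in> (\<Union>i\<in>{1..k}. P i)" using v unfolding P_def by blast
      qed
    qed (auto simp: P_def)
    show "disjoint_family_on P {1..k}"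
      unfolding disjoint_family_on_def
    proof (intro ballI impI)
      fix i j assume ij: "i \<in> {1..k}" "j \<in> {1..k}" "i \<noteq> j"
      then have "e i \<noteq> e j" using e unfolding bij_betw_def inj_on_def by blast
      then show "P i \<inter> P j = {}" unfolding P_def by auto
    qed
    show "P i \<noteq> {}" if "i \<in> {1..k}" for i
    proof -
      have "e i \<in> grp ` V" using e that unfolding bij_betw_def by blast
      then obtain v where "e i = grp v" "v \<in> V" by (rule imageE)
      then have "v \<in> P i" unfolding P_def by simp
      then show ?thesis by auto
    qed
  qed
  have eq: "equitable_partition V E k P" "equitable_parameters E k P (\<lambda>i. card (P i)) (\<lambda>i j. D (e i) (e j))"
    if "\<And>u j. u \<in> V \<Longrightarrow> degree_into E u {v \<in> V. grp v = j} = D (grp u) j" for E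
  proof -
    have "degree_into E u (P j) = D (e i) (e j)" if "u \<in> P i" for u i j
      using that that[unfolded P_def] \<open>\<And>u j. u \<in> V \<Longrightarrow> degree_into E u {v \<in> V. grp v = j} = D (grp u) j\<close>[of u "e j"]
      unfolding P_def by simp
    then show "equitable_partition V E k P" "equitable_parameters E k P (\<lambda>i. card (P i)) (\<lambda>i j. D (e i) (e j))"
      using part unfolding equitable_partition_def equitable_parameters_def by simp_all
  qed
  show ?thesis unfolding fractionally_isomorphic_graphs_def
    by (intro exI[of _ k] exI[of _ P] exI[of _ "\<lambda>i. card (P i)"] exI[of _ "\<lambda>i j. D (e i) (e j)"] conjI eq G G')
qed

text \<open>The partition is found on a single member \<open>U0\<close> and carried to all others.
  Fractional isomorphism with another member is also what supplies the minimum invariant algebra of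
  \<open>U0\<close>, which is taken as a witness instead of being constructed.\<close>

lemma common_regular_partition:
  fixes \<U> :: "'a graphon set"
  assumes U: "\<And>U. U \<in> \<U> \<Longrightarrow> is_graphon U" and fi: "pairwise fractionally_isomorphic \<U>"
    and ne: "\<U> \<noteq> {}" and \<eta>: "\<eta> > 0"
  shows "\<exists>k a s. (\<forall>i. 0 \<le> a i) \<and> (\<Sum>i<k. a i) = 1 \<and>
      (\<forall>i<k. \<forall>j<k. 0 \<le> s i j \<and> s i j \<le> 1 \<and> s i j = s j i) \<and>
      (\<forall>U\<in>\<U>. \<exists>q. near_regular (base U) (kernel U) q k a s \<eta>)"
proof -
  obtain U0 where U0: "U0 \<in> \<U>" using ne by blast
  note g = is_graphonD[OF U[OF U0]]
  have "\<exists>C. sub_sigma_algebra (base U0) C \<and>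
    (\<forall>B\<in>C. (\<lambda>x. \<integral>y. kernel U0 (x, y) * indicator B y \<partial>base U0) \<in> borel_measurable (sigma (space (base U0)) C)) \<and>
    (\<forall>U\<in>\<U>. U \<noteq> U0 \<longrightarrow> minimum_invariant_subalgebra U0 C)"
  proof (cases "\<exists>U\<in>\<U>. U \<noteq> U0")
    case True
    then obtain U where UU: "U \<in> \<U>" "U \<noteq> U0" by (elim bexE)
    obtain C where C: "minimum_invariant_subalgebra U0 C"
      using pairwiseD[OF fi U0 UU(1) UU(2)[symmetric]] unfolding fractionally_isomorphic_def by (elim exE conjE)
    have sub: "sub_sigma_algebra (base U0) C" and inv: "invariant_algebra U0 C"
      using C unfolding minimum_invariant_subalgebra_def invariant_complete_subalgebra_def by blast+
    show ?thesis using C sub invariant_algebra_indicator[OF g(1) sub inv] by (intro exI[of _ C]) blast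
  next
    \<comment> \<open>In a one-element family the pairwise hypothesis yields no algebra. The full
      sigma-algebra, in which all degree functions are measurable, takes its place, and nothing has
      to be transferred.\<close>
    case False
    have "sub_sigma_algebra (base U0) (sets (base U0))"
      unfolding sub_sigma_algebra_def using sets.sigma_algebra_axioms by blast
    moreover have "(\<lambda>x. \<integral>y. kernel U0 (x, y) * indicator B y \<partial>base U0)
        \<in> borel_measurable (sigma (space (base U0)) (sets (base U0)))" if B: "B \<in> sets (base U0)" for B
    proof -
      have "(\<lambda>x. \<integral>y. kernel U0 (x, y) * indicator B y \<partial>base U0) \<in> borel_measurable (base U0)"
        by (rule sigma_finite_measure.borel_measurable_lebesgue_integral[OF prob_space_imp_sigma_finite[OF g(1)]]) (use g(2) B in \<open>simp add: case_prod_beta'\<close>)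
      moreover have "borel_measurable (sigma (space (base U0)) (sets (base U0))) = (borel_measurable (base U0) :: ('a \<Rightarrow> real) set)"
        by (rule measurable_cong_sets) simp_all
      ultimately show ?thesis by (simp only:)
    qed
    ultimately show ?thesis using False by (intro exI[of _ "sets (base U0)"]) blast
  qed
  then obtain C where C0: "sub_sigma_algebra (base U0) C \<and>
    (\<forall>B\<in>C. (\<lambda>x. \<integral>y. kernel U0 (x, y) * indicator B y \<partial>base U0) \<in> borel_measurable (sigma (space (base U0)) C)) \<and>
    (\<forall>U\<in>\<U>. U \<noteq> U0 \<longrightarrow> minimum_invariant_subalgebra U0 C)" ..
  note C = conjunct1[OF C0] bspec[OF conjunct1[OF conjunct2[OF C0]]] bspec[OF conjunct2[OF conjunct2[OF C0]], rule_format]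
  have "\<exists>k q a s. near_regular (base U0) (kernel U0) q k a s \<eta> \<and> q \<in> sigma (space (base U0)) C \<rightarrow>\<^sub>M count_space UNIV \<and>
     (\<forall>i. 0 \<le> a i) \<and> (\<Sum>i<k. a i) = 1 \<and> (\<forall>i<k. \<forall>j<k. 0 \<le> s i j \<and> s i j \<le> 1 \<and> s i j = s j i)"
    by (rule near_regular_partition[OF g(1-3) C(1,2) \<eta>])
  then obtain k q a s where r: "near_regular (base U0) (kernel U0) q k a s \<eta> \<and> q \<in> sigma (space (base U0)) C \<rightarrow>\<^sub>M count_space UNIV \<and>
     (\<forall>i. 0 \<le> a i) \<and> (\<Sum>i<k. a i) = 1 \<and> (\<forall>i<k. \<forall>j<k. 0 \<le> s i j \<and> s i j \<le> 1 \<and> s i j = s j i)"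
    by (elim exE)
  have "\<exists>q. near_regular (base U) (kernel U) q k a s \<eta>" if UU: "U \<in> \<U>" for U
  proof (cases "U = U0")
    case True
    then show ?thesis using conjunct1[OF r] by (intro exI[of _ q]) simp
  next
    case False
    from near_regular_fractionally_isomorphic[OF U[OF U0] U[OF UU] pairwiseD[OF fi U0 UU False[symmetric]]
      C(3)[OF UU False] conjunct1[OF r] conjunct1[OF conjunct2[OF r]]] show ?thesis .
  qed
  then show ?thesis using r by (intro exI[of _ k] exI[of _ a] exI[of _ s]) simp
qed

theorem theorem1p2:
  fixes \<epsilon> :: real and \<U> :: "'a graphon set"
  assumes "\<epsilon> > 0"
    and "\<And>U. U \<in> \<U> \<Longrightarrow> is_graphon U"
    and "pairwise fractionally_isomorphic \<U>"
  shows "\<exists>n0::nat. \<forall>n\<ge>n0. \<exists>H :: 'a graphon \<Rightarrow> nat set set.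
           (\<forall>U\<in>\<U>. simple_graph {1..n} (H U)) \<and>
           pairwise (\<lambda>U U'. fractionally_isomorphic_graphs {1..n} (H U) {1..n} (H U')) \<U> \<and>
           (\<forall>U\<in>\<U>. cut_distance_to_graph U n (H U) \<le> ereal \<epsilon>)"
proof (cases "\<U> = {}")
  case True
  then show ?thesis by (simp add: pairwise_def)
next
  case False
  obtain \<eta> where \<eta>0: "\<eta> > 0 \<and> (\<forall>k a s. (\<forall>i. 0 \<le> a i) \<and> (\<Sum>i<k. a i) = 1 \<and>
      (\<forall>i<k. \<forall>j<k. 0 \<le> s i j \<and> s i j \<le> 1 \<and> s i j = s j i) \<longrightarrow>
    (\<exists>n0::nat. \<forall>n\<ge>n0. \<exists>grp D. equitably_realizes \<epsilon> \<eta> k a s n grp D))"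
    using uniform_graphs[OF assms(1)] by (elim exE)
  note \<eta> = conjunct1[OF \<eta>0] and uni = conjunct2[OF \<eta>0, rule_format]
  have "\<exists>k a s. (\<forall>i. 0 \<le> a i) \<and> (\<Sum>i<k. a i) = 1 \<and>
      (\<forall>i<k. \<forall>j<k. 0 \<le> s i j \<and> s i j \<le> 1 \<and> s i j = s j i) \<and>
      (\<forall>U\<in>\<U>. \<exists>q. near_regular (base U) (kernel U) q k a s \<eta>)"
    by (rule common_regular_partition[OF assms(2,3) False \<eta>])
  then obtain k a s where r: "(\<forall>i. 0 \<le> a i) \<and> (\<Sum>i<k. a i) = 1 \<and>
      (\<forall>i<k. \<forall>j<k. 0 \<le> s i j \<and> s i j \<le> 1 \<and> s i j = s j i) \<and>
      (\<forall>U\<in>\<U>. \<exists>q. near_regular (base U) (kernel U) q k a s \<eta>)"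
    by (elim exE)
  have as: "(\<forall>i. 0 \<le> a i) \<and> (\<Sum>i<k. a i) = 1 \<and> (\<forall>i<k. \<forall>j<k. 0 \<le> s i j \<and> s i j \<le> 1 \<and> s i j = s j i)"
    using r by (elim conjE) (intro conjI)
  \<comment> \<open>\<open>n0\<close> comes from the shared numbers, and \<open>grp\<close> and
    \<open>D\<close> are obtained before a member of the family is chosen, so the graphs of
    different members agree in them.\<close>
  from uni[OF as] obtain n0 :: nat where n0: "\<forall>n\<ge>n0. \<exists>grp D. equitably_realizes \<epsilon> \<eta> k a s n grp D" ..
  show ?thesis
  proof (intro exI[of _ n0] allI impI)
    fix n assume "n0 \<le> n"
    with n0 have "\<exists>grp D. equitably_realizes \<epsilon> \<eta> k a s n grp D" by (elim allE impE)
    then obtain grp D where gD: "equitably_realizes \<epsilon> \<eta> k a s n grp D" by (elim exE)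
    have "\<exists>G. simple_graph {1..n} G \<and>
        (\<forall>u\<in>{1..n}. \<forall>j. degree_into G u {v \<in> {1..n}. grp v = j} = D (grp u) j) \<and>
        cut_distance_to_graph U n G \<le> ereal \<epsilon>" if UU: "U \<in> \<U>" for U
    proof -
      have pU: "prob_space (base U)" by (rule is_graphonD(1)[OF assms(2)[OF UU]])
      from bspec[OF conjunct2[OF conjunct2[OF conjunct2[OF r]]] UU] obtain q where q: "near_regular (base U) (kernel U) q k a s \<eta>" ..
      \<comment> \<open>The same map \<open>p\<close> pulls the near regular partition back to the
        interval and bounds the cut distance there, so the graph found on the interval is close to
        \<open>U\<close> itself.\<close>
      from cut_distance_to_graph_le[OF assms(2)[OF UU]] obtain p where p0: "measure_preserving_map unit_space (base U) p \<and>
        (\<forall>n E g g'. mp_iso unit_space unit_space g g' \<longrightarrow> cut_distance_to_graph U n E \<le>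
          cut_norm unit_space (\<lambda>z. pull_back (kernel U) (\<lambda>x. p (g x)) z - kernel (graph_representation n E) z))" ..
      have p: "p \<in> unit_space \<rightarrow>\<^sub>M base U" "distr unit_space (base U) p = base U"
        using p0 unfolding measure_preserving_map_def by blast+
      from gD[unfolded equitably_realizes_def, rule_format, OF near_regular_pull_back[OF prob_space_unit pU q p]]
      obtain G g g' where G: "simple_graph {1..n} G"
         "\<forall>u\<in>{1..n}. \<forall>j. degree_into G u {v \<in> {1..n}. grp v = j} = D (grp u) j"
         "mp_iso unit_space unit_space g g'"
         "cut_norm unit_space (\<lambda>z. pull_back (pull_back (kernel U) p) g z - kernel (graph_representation n G) z) \<le> ereal \<epsilon>"
        by (elim exE conjE)
      have "pull_back (pull_back (kernel U) p) g = pull_back (kernel U) (\<lambda>x. p (g x))"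
        by (simp add: pull_back_def fun_eq_iff)
      note cn = G(4)[unfolded this]
      have "cut_distance_to_graph U n G \<le>
          cut_norm unit_space (\<lambda>z. pull_back (kernel U) (\<lambda>x. p (g x)) z - kernel (graph_representation n G) z)"
        using conjunct2[OF p0] G(3) by (elim allE impE)
      also note cn
      finally show ?thesis using G(1,2) by (intro exI[of _ G] conjI)
    qed
    then have "\<forall>U\<in>\<U>. \<exists>G. simple_graph {1..n} G \<and>
        (\<forall>u\<in>{1..n}. \<forall>j. degree_into G u {v \<in> {1..n}. grp v = j} = D (grp u) j) \<and>
        cut_distance_to_graph U n G \<le> ereal \<epsilon>" by (intro ballI)
    from bchoice[OF this] obtain H where H: "\<forall>U\<in>\<U>. simple_graph {1..n} (H U) \<and>
        (\<forall>u\<in>{1..n}. \<forall>j. degree_into (H U) u {v \<in> {1..n}. grp v = j} = D (grp u) j) \<and>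
        cut_distance_to_graph U n (H U) \<le> ereal \<epsilon>" ..
    have deg: "degree_into (H U) u {v \<in> {1..n}. grp v = j} = D (grp u) j" if "U \<in> \<U>" "u \<in> {1..n}" for U u j
      using H that by blast
    show "\<exists>H :: 'a graphon \<Rightarrow> nat set set.
           (\<forall>U\<in>\<U>. simple_graph {1..n} (H U)) \<and>
           pairwise (\<lambda>U U'. fractionally_isomorphic_graphs {1..n} (H U) {1..n} (H U')) \<U> \<and>
           (\<forall>U\<in>\<U>. cut_distance_to_graph U n (H U) \<le> ereal \<epsilon>)"
    proof (intro exI[of _ H] conjI ballI pairwiseI)
      fix U U' assume "U \<in> \<U>" "U' \<in> \<U>"
      then show "fractionally_isomorphic_graphs {1..n} (H U) {1..n} (H U')"
        by (intro same_degrees_fractionally_isomorphic[of _ _ grp D] deg) simp_all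
    qed (use H in blast)+
  qed
qed

end
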